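(* Let $u\in\mathbb{R}^d$. (a) (Model A) Let $d\ge 3$ and assume $\mathbb{E}(\xi(0))=0$. Then there exists at least one shift-covariant random gradient Gibbs measure $\xi\mapsto\mu[\xi]$ for model A with tilt $u$, that is, $$\mathbb{E}\Big(\int\mu[\xi](\mathrm{d}\eta)\,\eta(b)\Big)=\langle u,\,y_b-x_b\rangle\quad\text{for all bonds } b=(x_b,y_b)\in(\mathbb{Z}^d)^*,$$ and moreover $\mathbb{E}\int\mu[\xi](\mathrm{d}\eta)\,(\eta(b))^2<\infty$ for all bonds $b\in(\mathbb{Z}^d)^*$. (b) (Model B) Let $d\ge 1$. Then there exists at least one shift-covariant random gradient Gibbs measure $\omega\mapsto\mu[\omega]$ for model B with tilt $u$, that is, $$\mathbb{E}\Big(\int\mu[\omega](\mathrm{d}\eta)\,\eta(b)\Big)=\langle u,\,y_b-x_b\rangle\quad\text{for all bonds } b=(x_b,y_b)\in(\mathbb{Z}^d)^*,$$ and moreover $\mathbb{E}\int\mu[\omega](\mathrm{d}\eta)\,(\eta(b))^2<\infty$ for all bonds $b\in(\mathbb{Z}^d)^*$.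
   Context: General notation. For finite $\Lambda\subset\mathbb{Z}^d$, $\partial\Lambda=\{x\notin\Lambda:\ \|x-y\|_1=1\text{ for some }y\in\Lambda\}$. Sums over "$x,y$ with $|x-y|=1$" are over ordered pairs of nearest neighbours. The disorder lives on a probability space $(\Omega,\mathcal F,\mathbb P)$ with expectation $\mathbb E$. Model A: $V\in C^2(\mathbb{R})$ is even, with $V(s)\ge As^2-B$ for all $s$ (some $A>0$, $B\in\mathbb{R}$) and $V''(s)\le C_2$ for all $s$ (some $C_2>0$). The disorder $(\xi(x))_{x\in\mathbb{Z}^d}$ is an i.i.d. family of real random variables with finite nonzero second moment. For finite $\Lambda$, boundary condition $\psi\in\mathbb{R}^{\mathbb{Z}^d}$ and fixed $\xi$, $$H^\psi_\Lambda[\xi](\phi)=\tfrac12\sum_{x,y\in\Lambda,|x-y|=1}V(\phi(x)-\phi(y))+\sum_{x\in\Lambda,y\in\partial\Lambda,|x-y|=1}V(\phi(x)-\psi(y))+\tfrac12\sum_{x\in\Lambda}\xi(x)\phi(x),$$ and the finite-volume Gibbs measure is $\nu^\psi_\Lambda[\xi](\mathrm{d}\phi)=\frac{1}{Z^\psi_\Lambda[\xi]}e^{-H^\psi_\Lambda[\xi](\phi)}\prod_{x\in\Lambda}\mathrm{d}\phi(x)\prod_{x\notin\Lambda}\delta_{\psi(x)}(\mathrm{d}\phi(x))$ on $\mathbb{R}^{\mathbb{Z}^d}$, with $Z^\psi_\Lambda[\xi]$ the normalizing constant. Model B: for each bond $(x,y)$ (nearest neighbours) there is a random function $V^\omega_{(x,y)}:\mathbb{R}\to\mathbb{R}$,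 jointly measurable in $(\omega,s)$, these being i.i.d. over bonds; for each $\omega$, $V^\omega_{(x,y)}\in C^2(\mathbb{R})$ is even. $(B^\omega_{(x,y)})$ is an i.i.d. family of real random variables with $\mathbb{E}|B_{(x,y)}|<\infty$, and for $\mathbb P$-a.e. $\omega$, $As^2-B^\omega_{(x,y)}\le V^\omega_{(x,y)}(s)\le C_2s^2$ for all $s$ and all bonds (with fixed $A,C_2>0$). The Hamiltonian is $H^\psi_\Lambda[\omega](\phi)=\frac12\sum_{x,y\in\Lambda,|x-y|=1}V^\omega_{(x,y)}(\phi(x)-\phi(y))+\sum_{x\in\Lambda,y\in\partial\Lambda,|x-y|=1}V^\omega_{(x,y)}(\phi(x)-\psi(y))$, and $\nu^\psi_\Lambda[\omega]$ is defined as in model A. Gradient fields. $(\mathbb{Z}^d)^*$ is the set of directed bonds $b=(x_b,y_b)$ with $\|x_b-y_b\|_1=1$; $-b$ is the reversed bond. For $\phi\in\mathbb{R}^{\mathbb{Z}^d}$, $\nabla\phi(b)=\phi(y_b)-\phi(x_b)$. $\chi$ is the set of $\eta\in\mathbb{R}^{(\mathbb{Z}^d)^*}$ with $\eta(-b)=-\eta(b)$ for all $b$ and $\sum_{b\in\mathcal A}\eta(b)=0$ for every plaquette $\mathcal A$ (closed loop of 4 bonds through 4 distinct points); these are exactly the gradient fields $\nabla\phi$. $C_b(\chi)$ denotes bounded functions on $\chi$ continuous in each bond coordinate. The finite-volume gradient Gibbs measure $\mu^\rho_\Lambda[\cdot]$ ($\rho\in\chi$) is the image of $\nu^\psi_\Lambda[\cdot]$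 under $\phi\mapsto\nabla\phi$, where $\psi$ is any height configuration with $\nabla\psi=\rho$. A probability measure $\mu$ on $\chi$ is a gradient Gibbs measure (for the given disorder) if $\int\mu(\mathrm{d}\rho)\int\mu^\rho_\Lambda(\mathrm{d}\eta)F(\eta)=\int\mu(\mathrm{d}\eta)F(\eta)$ for every finite $\Lambda\subset\mathbb{Z}^d$ and $F\in C_b(\chi)$. Shifts: for $v\in\mathbb{Z}^d$, $(\tau_v\eta)(b)=\eta(b-v)$, $(\tau_v\xi)(y)=\xi(y-v)$, and for model B, $\tau_v\omega$ denotes the disorder with the field of bond potentials shifted by $v$ correspondingly. A shift-covariant random gradient Gibbs measure is a measurable map $\xi\mapsto\mu[\xi]$ (resp. $\omega\mapsto\mu[\omega]$) such that $\mu[\xi]$ is a gradient Gibbs measure for $\mathbb P$-a.e. $\xi$ and $\int\mu[\tau_v\xi](\mathrm{d}\eta)F(\eta)=\int\mu[\xi](\mathrm{d}\eta)F(\tau_v\eta)$ for all $v\in\mathbb{Z}^d$, $F\in C_b(\chi)$ (likewise with $\omega$). *)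

theory Defs
  imports "HOL-Analysis.Analysis" "HOL-Probability.Probability"
begin

type_synonym 'd site = "int ^ 'd"
type_synonym 'd bond = "'d site \<times> 'd site"

definition nn :: "'d::finite site \<Rightarrow> 'd site \<Rightarrow> bool" where
  "nn x y \<longleftrightarrow> (\<Sum>i\<in>UNIV. \<bar>x $ i - y $ i\<bar>) = 1"

definition unitv :: "'d::finite \<Rightarrow> 'd site" where
  "unitv i = (\<chi> j. if j = i then 1 else 0)"

text \<open>measurable spaces of height configurations and of gradient (bond) configurations;
  bond configurations are functions on ordered pairs of sites, required to vanish off bonds\<close>
definition HS :: "('d::finite site \<Rightarrow> real) measure" where
  "HS = PiM UNIV (\<lambda>_. borel)"

definition GS :: "('d::finite bond \<Rightarrow> real) measure" where
  "GS = PiM UNIV (\<lambda>_. borel)"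

definition grad :: "('d::finite site \<Rightarrow> real) \<Rightarrow> ('d bond \<Rightarrow> real)" where
  "grad \<phi> = (\<lambda>(x, y). if nn x y then \<phi> y - \<phi> x else 0)"

definition chi :: "('d::finite bond \<Rightarrow> real) set" where
  "chi = {\<eta>. (\<forall>x y. \<not> nn x y \<longrightarrow> \<eta> (x, y) = 0)
           \<and> (\<forall>x y. \<eta> (y, x) = - \<eta> (x, y))
           \<and> (\<forall>a b c e. distinct [a, b, c, e] \<and> nn a b \<and> nn b c \<and> nn c e \<and> nn e a
                 \<longrightarrow> \<eta> (a, b) + \<eta> (b, c) + \<eta> (c, e) + \<eta> (e, a) = 0)}"

text \<open>test functions C_b(chi): bounded on chi, continuous on chi for the product topology
  (coordinates = bonds), and measurable so that all integrals are meaningful\<close>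
definition Cb :: "(('d::finite bond \<Rightarrow> real) \<Rightarrow> real) set" where
  "Cb = {F. F \<in> borel_measurable GS \<and> (\<exists>K. \<forall>\<eta>\<in>chi. \<bar>F \<eta>\<bar> \<le> K) \<and> continuous_on chi F}"

definition extend :: "'a set \<Rightarrow> ('a \<Rightarrow> real) \<Rightarrow> ('a \<Rightarrow> real) \<Rightarrow> ('a \<Rightarrow> real)" where
  "extend \<Lambda> \<phi> \<psi> = (\<lambda>x. if x \<in> \<Lambda> then \<phi> x else \<psi> x)"

text \<open>H \<Lambda> \<psi> \<phi> is the Hamiltonian with boundary condition \<psi>, evaluated at the full
  configuration \<phi> (which equals \<psi> off \<Lambda>).  The finite-volume Gibbs measure has density
  exp(-H)/Z w.r.t. Lebesgue measure on R^\<Lambda> and equals \<psi> off \<Lambda>.\<close>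
definition fv_gibbs ::
  "('d::finite site set \<Rightarrow> ('d site \<Rightarrow> real) \<Rightarrow> ('d site \<Rightarrow> real) \<Rightarrow> real)
    \<Rightarrow> 'd site set \<Rightarrow> ('d site \<Rightarrow> real) \<Rightarrow> ('d site \<Rightarrow> real) measure" where
  "fv_gibbs H \<Lambda> \<psi> =
     (let w = (\<lambda>\<phi>. exp (- H \<Lambda> \<psi> (extend \<Lambda> \<phi> \<psi>)));
          Z = (\<integral>\<^sup>+\<phi>. ennreal (w \<phi>) \<partial>(PiM \<Lambda> (\<lambda>_. lborel)))
      in distr (density (PiM \<Lambda> (\<lambda>_. lborel)) (\<lambda>\<phi>. ennreal (w \<phi>) / Z)) HS
               (\<lambda>\<phi>. extend \<Lambda> \<phi> \<psi>))"

definition gspec ::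
  "('d::finite site set \<Rightarrow> ('d site \<Rightarrow> real) \<Rightarrow> ('d site \<Rightarrow> real) \<Rightarrow> real)
    \<Rightarrow> 'd site set \<Rightarrow> ('d bond \<Rightarrow> real) \<Rightarrow> ('d bond \<Rightarrow> real) measure" where
  "gspec H \<Lambda> \<rho> = distr (fv_gibbs H \<Lambda> (SOME \<psi>. grad \<psi> = \<rho>)) GS grad"

definition is_ggm ::
  "('d::finite site set \<Rightarrow> ('d site \<Rightarrow> real) \<Rightarrow> ('d site \<Rightarrow> real) \<Rightarrow> real)
    \<Rightarrow> ('d bond \<Rightarrow> real) measure \<Rightarrow> bool" where
  "is_ggm H \<mu> \<longleftrightarrow> prob_space \<mu> \<and> sets \<mu> = sets GS \<and> (AE \<eta> in \<mu>. \<eta> \<in> chi) \<and>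
     (\<forall>\<Lambda> F. finite \<Lambda> \<and> F \<in> Cb \<longrightarrow>
        (\<integral>\<rho>. (\<integral>\<eta>. F \<eta> \<partial>(gspec H \<Lambda> \<rho>)) \<partial>\<mu>) = (\<integral>\<eta>. F \<eta> \<partial>\<mu>))"

definition hamA :: "(real \<Rightarrow> real) \<Rightarrow> ('d::finite site \<Rightarrow> real)
    \<Rightarrow> 'd site set \<Rightarrow> ('d site \<Rightarrow> real) \<Rightarrow> ('d site \<Rightarrow> real) \<Rightarrow> real" where
  "hamA V \<xi> \<Lambda> \<psi> \<phi> =
     (1/2) * (\<Sum>(x, y)\<in>{(x, y). x \<in> \<Lambda> \<and> y \<in> \<Lambda> \<and> nn x y}. V (\<phi> x - \<phi> y))
   + (\<Sum>(x, y)\<in>{(x, y). x \<in> \<Lambda> \<and> y \<notin> \<Lambda> \<and> nn x y}. V (\<phi> x - \<psi> y))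
   + (1/2) * (\<Sum>x\<in>\<Lambda>. \<xi> x * \<phi> x)"

text \<open>Model B: the potential of the (undirected) bond {x, x + e_i} is W x i\<close>
definition bondpot :: "('d::finite site \<Rightarrow> 'd \<Rightarrow> real \<Rightarrow> real) \<Rightarrow> 'd site \<Rightarrow> 'd site \<Rightarrow> real \<Rightarrow> real" where
  "bondpot W x y = (if \<exists>i. y = x + unitv i then W x (SOME i. y = x + unitv i)
                    else W y (SOME i. x = y + unitv i))"

definition hamB :: "('d::finite site \<Rightarrow> 'd \<Rightarrow> real \<Rightarrow> real)
    \<Rightarrow> 'd site set \<Rightarrow> ('d site \<Rightarrow> real) \<Rightarrow> ('d site \<Rightarrow> real) \<Rightarrow> real" where
  "hamB W \<Lambda> \<psi> \<phi> =
     (1/2) * (\<Sum>(x, y)\<in>{(x, y). x \<in> \<Lambda> \<and> y \<in> \<Lambda> \<and> nn x y}. bondpot W x y (\<phi> x - \<phi> y))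
   + (\<Sum>(x, y)\<in>{(x, y). x \<in> \<Lambda> \<and> y \<notin> \<Lambda> \<and> nn x y}. bondpot W x y (\<phi> x - \<psi> y))"

definition shift_site :: "'d::finite site \<Rightarrow> ('d site \<Rightarrow> 'b) \<Rightarrow> ('d site \<Rightarrow> 'b)" where
  "shift_site v f = (\<lambda>y. f (y - v))"

definition shift_grad :: "'d::finite site \<Rightarrow> ('d bond \<Rightarrow> real) \<Rightarrow> ('d bond \<Rightarrow> real)" where
  "shift_grad v \<eta> = (\<lambda>(x, y). \<eta> (x - v, y - v))"

definition C2_fun :: "(real \<Rightarrow> real) \<Rightarrow> bool" where
  "C2_fun f \<longleftrightarrow> (\<forall>s. f differentiable at s) \<and> (\<forall>s. deriv f differentiable at s)
     \<and> continuous_on UNIV (deriv (deriv f))"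

definition tilt :: "real ^ 'd \<Rightarrow> 'd::finite site \<Rightarrow> 'd site \<Rightarrow> real" where
  "tilt u x y = (\<Sum>i\<in>UNIV. u $ i * real_of_int ((y - x) $ i))"

text \<open>DS: measurable space of disorder fields; shiftD: shift on it; X: disorder as a random
  field on (Omega, P); Ham z: Hamiltonian family for disorder field z.\<close>
definition shift_cov_rggm_tilt ::
  "'o measure \<Rightarrow> ('o \<Rightarrow> 'z) \<Rightarrow> 'z measure \<Rightarrow> ('d::finite site \<Rightarrow> 'z \<Rightarrow> 'z)
    \<Rightarrow> ('z \<Rightarrow> 'd site set \<Rightarrow> ('d site \<Rightarrow> real) \<Rightarrow> ('d site \<Rightarrow> real) \<Rightarrow> real)
    \<Rightarrow> real ^ 'd \<Rightarrow> ('z \<Rightarrow> ('d bond \<Rightarrow> real) measure) \<Rightarrow> bool" where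
  "shift_cov_rggm_tilt P X DS shiftD Ham u mu \<longleftrightarrow>
     mu \<in> measurable DS (prob_algebra GS)
   \<and> (AE \<omega> in P. is_ggm (Ham (X \<omega>)) (mu (X \<omega>)))
   \<and> (\<forall>v z F. F \<in> Cb \<longrightarrow> (\<integral>\<eta>. F \<eta> \<partial>(mu (shiftD v z))) = (\<integral>\<eta>. F (shift_grad v \<eta>) \<partial>(mu z)))
   \<and> (\<forall>x y. nn x y \<longrightarrow> (\<integral>\<omega>. (\<integral>\<eta>. \<eta> (x, y) \<partial>(mu (X \<omega>))) \<partial>P) = tilt u x y)
   \<and> (\<forall>x y. nn x y \<longrightarrow> (\<integral>\<^sup>+\<omega>. (\<integral>\<^sup>+\<eta>. ennreal ((\<eta> (x, y))\<^sup>2) \<partial>(mu (X \<omega>))) \<partial>P) < \<infinity>)"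

end

theory Submission
  imports Defs
begin

text \<open>Put the tilted linear boundary condition on a large box, take the finite-volume Gibbs measure and
  average it over the shifts that keep the box around the origin. The partition function is bounded below
  on a unit cube around the boundary condition, and exponential moments of the Dirichlet energy are bounded
  above by Gaussian integrals along the chains of bonds in one direction; together this gives a uniform second
  moment for the annealed gradients. In model A the random linear term is first rewritten as a current acting on
  gradients; in dimension at least three the flow of Polya's urn represents a point charge by a current of
  finite energy, so the current has bounded variance because the disorder is independent and centred.

  To obtain a limit that depends measurably on the disorder, no subsequence may be chosen disorder by disorder.
  Instead the laws, coded as laws on the unit interval by a space-filling curve, are replaced by convex
  combinations of their tails whose distribution functions converge almost surely. Such combinations preserve
  the moment bounds, and both the DLR equation and shift covariance hold up to the proportion of shifts near
  the boundary, hence exactly in the limit. The tilt passes to the limit by uniform integrability.\<close>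

section \<open>Gradient fields on the lattice\<close>

text \<open>The bound on the partition function and the bound on the exponential moment differ, on
  the logarithmic scale, by a quantity whose disorder mean is of the order of the volume; averaging
  over that many shifts leaves a constant per bond. Box and averaging window have radii N^2 and N^2
  + N: the extra N lets the window see the whole box from each site of \<open>cube N\<close>, so the
  tilt is exact before the limit, while N is small against N^2 and boundary shifts become
  negligible. Heights have a meaning only up to a constant, so laws are coded after pinning at the
  origin and only functionals of gradients are tested. Mixing is harmless because, given the
  disorder, each property carried to the limit is linear in the law. Covariance is demanded for
  every disorder, hence the limit is used on a shift-invariant set and replaced elsewhere by the
  tilted plane, whose gradient is itself invariant. In model B the disorder \<sigma>-algebra sees
  countably many values of a potential and the lower bound need not be a function of the potentials;
  both are replaced by measurable functionals of the rational values.\<close>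

lemma unitv_nth: "unitv i $ j = (if j = i then 1 else 0)"
  by (simp add: unitv_def)

lemma nn_iff: "nn x y \<longleftrightarrow> (\<exists>i. y = x + unitv i \<or> x = y + unitv i)"
proof
  assume h: "nn x y"
  define f where "f i = \<bar>x $ i - y $ i\<bar>" for i
  have s: "(\<Sum>i\<in>UNIV. f i) = 1" using h by (simp add: nn_def f_def)
  have f0: "f i \<ge> 0" for i by (simp add: f_def)
  obtain i where i: "f i \<noteq> 0" using s by (metis sum.neutral zero_neq_one)
  have "(\<Sum>k\<in>UNIV. f k) = f i + (\<Sum>k\<in>UNIV - {i}. f k)" by (simp add: sum.remove)
  moreover have "f i \<ge> 1" using i f0[of i] by linarith
  moreover have p: "(\<Sum>k\<in>UNIV - {i}. f k) \<ge> 0" by (simp add: sum_nonneg f0)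
  ultimately have fi: "f i = 1" and "(\<Sum>k\<in>UNIV - {i}. f k) = 0" using s by linarith+
  then have z: "f k = 0" if "k \<noteq> i" for k
    using that by (subst (asm) sum_nonneg_eq_0_iff) (auto simp: f0)
  have z': "x $ k = y $ k" if "k \<noteq> i" for k using z[OF that] by (simp add: f_def)
  from fi have "x $ i = y $ i + 1 \<or> y $ i = x $ i + 1" by (auto simp: f_def)
  then show "\<exists>i. y = x + unitv i \<or> x = y + unitv i"
  proof
    assume "x $ i = y $ i + 1"
    then have "x = y + unitv i" using z' by (auto simp: vec_eq_iff unitv_nth)
    then show ?thesis by blast
  next
    assume "y $ i = x $ i + 1"
    then have "y = x + unitv i" using z' by (auto simp: vec_eq_iff unitv_nth)
    then show ?thesis by blast
  qed
next
  have *: "nn x (x + unitv i)" "nn (x + unitv i) x" for x :: "'a site" and i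
  proof -
    have "(\<Sum>j\<in>UNIV. \<bar>x $ j - (x + unitv i) $ j\<bar>) = (\<Sum>j\<in>UNIV. if j = i then 1 else 0)"
      by (rule sum.cong) (auto simp: unitv_nth)
    moreover have "(\<Sum>j\<in>UNIV. \<bar>(x + unitv i) $ j - x $ j\<bar>) = (\<Sum>j\<in>UNIV. if j = i then 1 else 0)"
      by (rule sum.cong) (auto simp: unitv_nth)
    ultimately show "nn x (x + unitv i)" "nn (x + unitv i) x" by (simp_all add: nn_def)
  qed
  assume "\<exists>i. y = x + unitv i \<or> x = y + unitv i"
  then show "nn x y" using * by blast
qed

lemma nn_unitv [simp]: "nn x (x + unitv i)" "nn (x + unitv i) x"
  by (auto simp: nn_iff)

lemma unitv_inj: "unitv i = unitv j \<longleftrightarrow> i = j"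
  by (auto simp: unitv_def vec_eq_iff)

lemma unitv_neq: "unitv i + unitv j \<noteq> 0"
proof
  assume "unitv i + unitv j = 0"
  then have "(unitv i + unitv j) $ i = 0" by (simp del: vector_add_component)
  then show False by (simp add: unitv_nth split: if_splits)
qed

text \<open>Strong induction on the l1 norm: a nonzero coordinate can be moved one unit towards 0.
  This is the stand-in for choosing a lattice path from the origin.\<close>

lemma site_induct [case_names zero plus minus]:
  fixes x :: "'d::finite site"
  assumes z: "Pr 0" and p: "\<And>x i. Pr x \<Longrightarrow> Pr (x + unitv i)" and m: "\<And>x i. Pr x \<Longrightarrow> Pr (x - unitv i)"
  shows "Pr x"
proof (induction "nat (\<Sum>i\<in>UNIV. \<bar>x $ i\<bar>)" arbitrary: x rule: less_induct)
  case less
  show ?case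
  proof (cases "x = 0")
    case True then show ?thesis using z by simp
  next
    case False
    then obtain i where i: "x $ i \<noteq> 0" by (auto simp: vec_eq_iff)
    define y where "y = (if x $ i > 0 then x - unitv i else x + unitv i)"
    have "(\<Sum>k\<in>UNIV. \<bar>y $ k\<bar>) = \<bar>y $ i\<bar> + (\<Sum>k\<in>UNIV - {i}. \<bar>y $ k\<bar>)" by (simp add: sum.remove)
    also have "(\<Sum>k\<in>UNIV - {i}. \<bar>y $ k\<bar>) = (\<Sum>k\<in>UNIV - {i}. \<bar>x $ k\<bar>)"
      by (rule sum.cong) (auto simp: y_def unitv_nth)
    also have "\<bar>y $ i\<bar> = \<bar>x $ i\<bar> - 1" using i by (auto simp: y_def unitv_nth)
    also have "\<bar>x $ i\<bar> - 1 + (\<Sum>k\<in>UNIV - {i}. \<bar>x $ k\<bar>) = (\<Sum>k\<in>UNIV. \<bar>x $ k\<bar>) - 1"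
      by (simp add: sum.remove)
    finally have "(\<Sum>k\<in>UNIV. \<bar>y $ k\<bar>) = (\<Sum>k\<in>UNIV. \<bar>x $ k\<bar>) - 1" .
    moreover have "(\<Sum>k\<in>UNIV. \<bar>y $ k\<bar>) \<ge> 0" by (simp add: sum_nonneg)
    ultimately have "Pr y" by (intro less) auto
    then have "Pr (y + unitv i)" "Pr (y - unitv i)" using p m by auto
    then show ?thesis by (auto simp: y_def split: if_splits)
  qed
qed

lemma nn_sym: "nn x y \<longleftrightarrow> nn y x"
  by (auto simp: nn_iff)

lemma grad_in_chi: "grad \<phi> \<in> chi"
  by (auto simp: chi_def grad_def nn_sym)

lemma space_HS [simp]: "space HS = UNIV" and space_GS [simp]: "space GS = UNIV"
  by (auto simp: HS_def GS_def space_PiM)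

lemma HS_component [measurable]: "(\<lambda>\<phi>. \<phi> x) \<in> borel_measurable HS"
  unfolding HS_def by (rule measurable_component_singleton) simp

lemma GS_component [measurable]: "(\<lambda>\<eta>. \<eta> b) \<in> borel_measurable GS"
  unfolding GS_def by (rule measurable_component_singleton) simp

lemma measurable_HS_I:
  assumes "\<And>x. (\<lambda>a. f a x) \<in> borel_measurable M" shows "f \<in> measurable M HS"
  unfolding HS_def using assms by (intro measurable_PiM_single') auto

lemma measurable_GS_I:
  assumes "\<And>x. (\<lambda>a. f a x) \<in> borel_measurable M" shows "f \<in> measurable M GS"
  unfolding GS_def using assms by (intro measurable_PiM_single') auto

lemma grad_measurable [measurable]: "grad \<in> measurable HS GS"
proof (rule measurable_GS_I)
  fix b :: "'a bond"
  obtain x y where "b = (x, y)" by force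
  then show "(\<lambda>a. grad a b) \<in> borel_measurable HS" by (cases "nn x y") (auto simp: grad_def)
qed

lemma borel_measurable_pred_eq:
  fixes f g :: "'a \<Rightarrow> real"
  assumes [measurable]: "f \<in> borel_measurable M" "g \<in> borel_measurable M"
  shows "Measurable.pred M (\<lambda>x. f x = g x)"
proof -
  have "(\<lambda>x. f x = g x) = (\<lambda>x. f x \<le> g x \<and> g x \<le> f x)" by auto
  then show ?thesis by simp
qed

text \<open>The lattice is countable, so all conditions together form a countable conjunction of
  conditional equations between coordinates.\<close>

lemma chi_sets: "(chi :: ('d::finite bond \<Rightarrow> real) set) \<in> sets GS"
proof -
  have "chi = {\<eta>\<in>space GS. (\<forall>x y :: 'd site. \<not> nn x y \<longrightarrow> \<eta> (x, y) = 0)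
           \<and> (\<forall>x y. \<eta> (y, x) = - \<eta> (x, y))
           \<and> (\<forall>a b c e. distinct [a, b, c, e] \<and> nn a b \<and> nn b c \<and> nn c e \<and> nn e a
                 \<longrightarrow> \<eta> (a, b) + \<eta> (b, c) + \<eta> (c, e) + \<eta> (e, a) = 0)}"
    by (simp add: chi_def)
  also have "\<dots> \<in> sets GS"
    by (intro predE pred_intros_logic(3) pred_intros_countable(1) pred_intros_imp'(1) borel_measurable_pred_eq) measurable
  finally show ?thesis .
qed

lemma shift_site_measurable [measurable]: "shift_site v \<in> measurable HS HS"
  by (rule measurable_HS_I) (simp add: shift_site_def)

lemma shift_grad_measurable [measurable]: "shift_grad v \<in> measurable GS GS"
  by (rule measurable_GS_I) (auto simp: shift_grad_def split: prod.split)

lemma nn_shift [simp]: "nn (x - v) (y - v) = nn x y" "nn (x + v) (y + v) = nn x y"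
  by (simp_all add: nn_def)

lemma shift_grad_grad: "shift_grad v (grad \<phi>) = grad (shift_site v \<phi>)"
  by (auto simp: shift_grad_def grad_def shift_site_def fun_eq_iff)

lemma grad_minus_const: "grad (\<lambda>x. \<phi> x - c) = grad \<phi>"
  by (auto simp: grad_def fun_eq_iff)

text \<open>Both height fields sum the same increments along a path from the origin.\<close>

lemma grad_eq_imp:
  assumes "grad \<phi> = grad \<psi>" shows "\<phi> x - \<phi> 0 = \<psi> x - \<psi> 0"
proof (induction x rule: site_induct)
  case zero then show ?case by simp
next
  case (plus x i)
  have "grad \<phi> (x, x + unitv i) = grad \<psi> (x, x + unitv i)" using assms by simp
  then show ?case using plus by (simp add: grad_def)
next
  case (minus x i)
  have "grad \<phi> (x - unitv i, x - unitv i + unitv i) = grad \<psi> (x - unitv i, x - unitv i + unitv i)"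
    using assms by simp
  then show ?case using minus
    unfolding grad_def by (simp only: prod.case nn_unitv if_True) simp
qed

text \<open>Summing increments along a path from 0 recovers the heights pinned at 0. A measurable
  map doing this matters because \<open>gspec\<close> picks the heights of a gradient field by
  \<open>SOME\<close>, which by itself gives no measurability.\<close>

lemma grad_left_inverse:
  "\<exists>h :: ('d::finite bond \<Rightarrow> real) \<Rightarrow> 'd site \<Rightarrow> real. h \<in> measurable GS HS \<and> (\<forall>\<phi> x. h (grad \<phi>) x = \<phi> x - \<phi> 0)"
proof -
  have "\<exists>g \<in> borel_measurable GS. \<forall>\<phi>. g (grad \<phi>) = \<phi> x - \<phi> 0" for x :: "'d site"
  proof (induction x rule: site_induct)
    case zero then show ?case by (intro bexI[of _ "\<lambda>_. 0"]) auto
  next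
    case (plus x i)
    then obtain g where "g \<in> borel_measurable GS" "\<forall>\<phi>. g (grad \<phi>) = \<phi> x - \<phi> 0" by blast
    then show ?case by (intro bexI[of _ "\<lambda>\<eta>. g \<eta> + \<eta> (x, x + unitv i)"]) (auto simp: grad_def)
  next
    case (minus x i)
    have n: "nn (x - unitv i) x" by (auto simp: nn_iff intro!: exI[of _ i])
    obtain g where "g \<in> borel_measurable GS" "\<forall>\<phi>. g (grad \<phi>) = \<phi> x - \<phi> 0" using minus by blast
    then show ?case by (intro bexI[of _ "\<lambda>\<eta>. g \<eta> - \<eta> (x - unitv i, x)"]) (auto simp: grad_def n)
  qed
  then obtain g :: "'d site \<Rightarrow> ('d bond \<Rightarrow> real) \<Rightarrow> real"
    where "\<And>x. g x \<in> borel_measurable GS" "\<And>x \<phi>. g x (grad \<phi>) = \<phi> x - \<phi> 0"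
    unfolding Bex_def by metis
  then show ?thesis by (intro exI[of _ "\<lambda>\<eta> x. g x \<eta>"] conjI measurable_HS_I) auto
qed

text \<open>Convergence of heights at each site is convergence of all bond coordinates, and the
  product topology is exactly coordinatewise convergence. Later limits of test functions use this
  sequential form.\<close>

lemma Cb_pointwise_continuous:
  fixes \<phi> :: "nat \<Rightarrow> 'd::finite site \<Rightarrow> real"
  assumes F: "F \<in> Cb" and lim: "\<And>x. (\<lambda>n. \<phi> n x) \<longlonglongrightarrow> \<phi>' x"
  shows "(\<lambda>n. F (grad (\<phi> n))) \<longlonglongrightarrow> F (grad \<phi>')"
proof -
  have c: "continuous_on chi F" using F by (simp add: Cb_def)
  have "(\<lambda>n. grad (\<phi> n)) \<longlonglongrightarrow> grad \<phi>'"
    unfolding limitin_canonical_iff[symmetric] euclidean_product_topology[symmetric] limitin_componentwise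
  proof (intro conjI ballI, goal_cases)
    case (3 b)
    obtain x y where "b = (x, y)" by force
    then show ?case
      using tendsto_diff[OF lim[of y] lim[of x]] by (auto simp: grad_def)
  qed auto
  then show ?thesis
    by (rule continuous_on_tendsto_compose[OF c]) (simp_all add: grad_in_chi)
qed

lemma Cb_bound:
  assumes "F \<in> Cb" obtains K where "K \<ge> 0" "\<And>\<phi>. \<bar>F (grad \<phi>)\<bar> \<le> K"
proof -
  obtain K where K: "\<forall>\<eta>\<in>chi. \<bar>F \<eta>\<bar> \<le> K" using assms by (auto simp: Cb_def)
  have "\<bar>F (grad \<phi>)\<bar> \<le> K" for \<phi> using K grad_in_chi by blast
  moreover have "0 \<le> K" using calculation[of undefined] by linarith
  ultimately show ?thesis using that by blast
qed

section \<open>Coding by one real variable and convex combinations\<close>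

text \<open>The point of the Cantor set with ternary digits \<open>2 * b m\<close>: avoiding the
  digit 1 leaves gaps in which a continuous reading function can interpolate.\<close>

definition ternary :: "(nat \<Rightarrow> real) \<Rightarrow> real" where
  "ternary b = (\<Sum>m. 2 * b m / 3 ^ Suc m)"

lemma ternary_summable:
  assumes "\<And>m. b m \<in> {0, 1}" shows "summable (\<lambda>m. 2 * b m / (3::real) ^ Suc m)"
proof (rule summable_comparison_test'[of "\<lambda>m. (2/3) * (1/3) ^ m" 0])
  show "summable (\<lambda>m. (2/3) * (1/3::real) ^ m)" by (intro summable_mult summable_geometric) auto
  show "norm (2 * b n / 3 ^ Suc n) \<le> 2/3 * (1/3) ^ n" for n
    using assms[of n] by (auto simp: power_one_over divide_simps)
qed

lemma ternary_bounds:
  assumes b: "\<And>m. b m \<in> {0, 1}" shows "0 \<le> ternary b" "ternary b \<le> 1"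
proof -
  have n: "0 \<le> 2 * b m / 3 ^ Suc m" for m using b[of m] by auto
  show "0 \<le> ternary b" unfolding ternary_def by (intro suminf_nonneg ternary_summable b n)
  have "ternary b \<le> (\<Sum>m. (2/3) * (1/3) ^ m)" unfolding ternary_def
  proof (intro suminf_le ternary_summable b)
    show "summable (\<lambda>m. (2/3) * (1/3::real) ^ m)" by (intro summable_mult summable_geometric) auto
    show "2 * b n / 3 ^ Suc n \<le> 2/3 * (1/3) ^ n" for n
      using b[of n] by (auto simp: power_one_over divide_simps)
  qed
  also have "\<dots> = 1" by (subst suminf_mult) (auto simp: suminf_geometric)
  finally show "ternary b \<le> 1" .
qed

lemma ternary_step:
  assumes b: "\<And>m. b m \<in> {0, 1}" shows "3 * ternary b = 2 * b 0 + ternary (\<lambda>m. b (Suc m))"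
proof -
  have "ternary b = (\<Sum>m. 2 * b (Suc m) / 3 ^ Suc (Suc m)) + 2 * b 0 / 3 ^ Suc 0"
    unfolding ternary_def using suminf_split_head[OF ternary_summable[of b]] b by simp
  moreover have "(\<Sum>m. 2 * b (Suc m) / 3 ^ Suc (Suc m)) = ternary (\<lambda>m. b (Suc m)) / 3"
    unfolding ternary_def by (subst suminf_divide[symmetric]) (use ternary_summable[of "\<lambda>m. b (Suc m)"] b in \<open>auto simp: field_simps\<close>)
  ultimately show ?thesis by simp
qed

text \<open>An even function of period 2, equal to 0 on [0, 1/3] and to 1 on [2/3, 1]: on the Cantor
  set it reads the leading ternary digit continuously.\<close>

definition schoenberg :: "real \<Rightarrow> real" where
  "schoenberg t = min 1 (max 0 (1/2 - cos (pi * t)))"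

text \<open>Multiplication by \<open>3 ^ m\<close> shifts the expansion by m digits and adds an even
  integer, because the digits are 0 or 2. The period 2 removes that integer, and the leading digit
  is then that of \<open>b m\<close>.\<close>

lemma schoenberg_ternary:
  assumes b: "\<And>m. b m \<in> {0, 1}" shows "schoenberg (3 ^ m * ternary b) = b m"
proof -
  have "\<And>b. (\<And>m. b m \<in> {0, 1::real}) \<Longrightarrow> cos (pi * (3 ^ m * ternary b)) = cos (pi * ternary (\<lambda>k. b (m + k)))"
  proof (induction m)
    case (Suc m)
    have "3 ^ Suc m * ternary b = 3 ^ m * (3 * ternary b)" by simp
    also have "\<dots> = 2 * (3 ^ m * b 0) + 3 ^ m * ternary (\<lambda>k. b (Suc k))"
      by (subst ternary_step[OF Suc.prems]) (simp add: algebra_simps)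
    finally have e: "pi * (3 ^ Suc m * ternary b) = pi * (3 ^ m * ternary (\<lambda>k. b (Suc k))) + 2 * (3 ^ m * b 0) * pi"
      by (simp add: algebra_simps)
    have "3 ^ m * b 0 \<in> \<int>" using Suc.prems[of 0] by auto
    then obtain z where z: "3 ^ m * b 0 = of_int z" by (auto elim: Ints_cases)
    have "2 * (3 ^ m * b 0) * pi = 2 * pi * of_int z" unfolding z by simp
    then have s: "sin (2 * (3 ^ m * b 0) * pi) = 0" "cos (2 * (3 ^ m * b 0) * pi) = 1"
      by (simp_all only: sin_int_2pin cos_int_2pin)
    have "cos (pi * (3 ^ Suc m * ternary b)) = cos (pi * (3 ^ m * ternary (\<lambda>k. b (Suc k))))"
      unfolding e cos_add s by simp
    also have "\<dots> = cos (pi * ternary (\<lambda>k. b (Suc (m + k))))" by (rule Suc.IH) (rule Suc.prems)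
    finally show ?case by simp
  qed simp
  from this[OF b] have c: "cos (pi * (3 ^ m * ternary b)) = cos (pi * ternary (\<lambda>k. b (m + k)))" .
  let ?b = "\<lambda>k. b (m + k)"
  have st: "3 * ternary ?b = 2 * b m + ternary (\<lambda>k. ?b (Suc k))" using ternary_step[of ?b] b by simp
  have bd: "0 \<le> ternary (\<lambda>k. ?b (Suc k))" "ternary (\<lambda>k. ?b (Suc k)) \<le> 1" using ternary_bounds b by auto
  consider "b m = 0" | "b m = 1" using b[of m] by auto
  then show ?thesis
  proof cases
    case 1
    then have "0 \<le> ternary ?b" "ternary ?b \<le> 1/3" using st bd by auto
    then have "cos (pi * (1/3)) \<le> cos (pi * ternary ?b)" by (intro cos_monotone_0_pi_le) (auto simp: mult_left_le)
    then show ?thesis using 1 by (simp add: schoenberg_def c cos_60)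
  next
    case 2
    then have "2/3 \<le> ternary ?b" "ternary ?b \<le> 1" using st bd by auto
    then have "cos (pi * ternary ?b) \<le> cos (pi * (2/3))" by (intro cos_monotone_0_pi_le) (auto simp: mult_left_le)
    then have "cos (pi * (3 ^ m * ternary b)) \<le> - (1/2)" unfolding c using cos_120 by (simp add: mult.commute)
    then show ?thesis using 2 by (simp add: schoenberg_def)
  qed
qed

text \<open>The n-th partial sum is the floor of \<open>2 ^ n * s\<close> divided by
  \<open>2 ^ n\<close>, hence within \<open>(1/2) ^ n\<close> of \<open>s\<close>; for
  \<open>0 \<le> s < 1\<close> there is no integer part to add.\<close>

lemma binary_expansion_sums:
  fixes s :: real assumes s: "0 \<le> s" "s < 1"
  shows "(\<lambda>k. (1/2) ^ Suc k * of_int (\<lfloor>2 ^ Suc k * s\<rfloor> mod 2)) sums s"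
proof -
  have p: "(\<Sum>k<n. (1/2::real) ^ Suc k * of_int (\<lfloor>2 ^ Suc k * s\<rfloor> mod 2)) = of_int \<lfloor>2 ^ n * s\<rfloor> / 2 ^ n" for n
  proof (induction n)
    case 0
    have "\<lfloor>s\<rfloor> = 0" using s by (simp add: floor_eq_iff)
    then show ?case by simp
  next
    case (Suc n)
    have "\<lfloor>2 ^ n * s\<rfloor> = \<lfloor>2 ^ Suc n * s\<rfloor> div 2"
      using floor_divide_real_eq_div[of 2 "2 ^ Suc n * s"] by simp
    then have "\<lfloor>2 ^ Suc n * s\<rfloor> = 2 * \<lfloor>2 ^ n * s\<rfloor> + \<lfloor>2 ^ Suc n * s\<rfloor> mod 2" by simp
    then have "real_of_int \<lfloor>2 ^ Suc n * s\<rfloor> = 2 * real_of_int \<lfloor>2 ^ n * s\<rfloor> + of_int (\<lfloor>2 ^ Suc n * s\<rfloor> mod 2)"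
      by (metis of_int_add of_int_mult of_int_numeral)
    then show ?case using Suc by (simp add: field_simps power_one_over)
  qed
  have "(\<lambda>n. of_int \<lfloor>2 ^ n * s\<rfloor> / 2 ^ n) \<longlonglongrightarrow> s"
  proof (rule tendsto_sandwich[of "\<lambda>n. s - (1/2) ^ n" _ _ "\<lambda>n. s"])
    have "s - (1/2) ^ n \<le> of_int \<lfloor>2 ^ n * s\<rfloor> / 2 ^ n" for n
    proof -
      have "2 ^ n * s - 1 \<le> of_int \<lfloor>2 ^ n * s\<rfloor>" by linarith
      then have "(2 ^ n * s - 1) / 2 ^ n \<le> of_int \<lfloor>2 ^ n * s\<rfloor> / 2 ^ n" by (intro divide_right_mono) auto
      then show ?thesis by (simp add: diff_divide_distrib power_one_over)
    qed
    then show "\<forall>\<^sub>F n in sequentially. s - (1/2) ^ n \<le> of_int \<lfloor>2 ^ n * s\<rfloor> / 2 ^ n" by simp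
    show "\<forall>\<^sub>F n in sequentially. of_int \<lfloor>2 ^ n * s\<rfloor> / 2 ^ n \<le> s" by (simp add: field_simps)
    have "(\<lambda>n. s - (1/2) ^ n) \<longlonglongrightarrow> s - 0" by (intro tendsto_diff tendsto_const LIMSEQ_power_zero) auto
    then show "(\<lambda>n. s - (1/2) ^ n) \<longlonglongrightarrow> s" by simp
  qed simp
  then show ?thesis unfolding sums_def p .
qed

text \<open>Schoenberg's space-filling curve: the base-3 expansion interleaves the binary digits of all
  coordinates, so laws on a countable product can be coded as laws on the real line.\<close>

lemma space_filling_coding:
  "\<exists>(cd :: (nat \<Rightarrow> real) \<Rightarrow> real) D.
     cd \<in> borel_measurable (PiM UNIV (\<lambda>_. borel)) \<and> (\<forall>s. 0 \<le> cd s \<and> cd s \<le> 1)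
   \<and> (\<forall>i t. isCont (D i) t) \<and> (\<forall>i t. 0 \<le> D i t \<and> D i t \<le> 1)
   \<and> (\<forall>s. (\<forall>i. 0 \<le> s i \<and> s i < 1) \<longrightarrow> (\<forall>i::nat. D i (cd s) = s i))"
proof -
  \<comment> \<open>Position \<open>m\<close> stores a binary digit of coordinate i, the one of
    index k, where \<open>prod_decode m = (i, k)\<close>.\<close>
  define bit :: "(nat \<Rightarrow> real) \<Rightarrow> nat \<Rightarrow> real" where
    "bit s m = of_int (\<lfloor>2 ^ Suc (snd (prod_decode m)) * s (fst (prod_decode m))\<rfloor> mod 2)" for s m
  have bit01: "bit s m \<in> {0, 1}" for s m by (auto simp: bit_def)
  \<comment> \<open>Weighting the digits read for coordinate \<open>i\<close> by powers of 1/2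
    rebuilds it. The series converges uniformly, so \<open>D i\<close> is continuous on the whole
    line, also at points that code nothing; limits of laws may charge such points.\<close>
  define D where "D i t = (\<Sum>k. (1/2) ^ Suc k * schoenberg (3 ^ prod_encode (i, k) * t))" for i :: nat and t :: real
  define cd where "cd s = ternary (bit s)" for s
  have sb: "0 \<le> schoenberg t" "schoenberg t \<le> 1" for t by (auto simp: schoenberg_def)
  have geo: "(\<lambda>k. (1/2::real) ^ Suc k) sums 1" using power_half_series .
  have le: "norm ((1/2) ^ Suc k * schoenberg t) \<le> (1/2) ^ Suc k" for k t
    using sb[of t] by (simp add: mult_left_le)
  have sm: "summable (\<lambda>k. (1/2) ^ Suc k * schoenberg (3 ^ prod_encode (i, k) * t))" for i t
    by (rule summable_comparison_test'[of "\<lambda>k. (1/2) ^ Suc k" 0])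
       (use geo sums_summable in blast, rule le)
  have "cd \<in> borel_measurable (PiM UNIV (\<lambda>_. borel))"
    unfolding cd_def ternary_def bit_def by measurable
  moreover have "\<forall>s. 0 \<le> cd s \<and> cd s \<le> 1" using ternary_bounds bit01 by (auto simp: cd_def)
  moreover have "isCont (D i) t" for i t
  proof -
    have "uniform_limit UNIV (\<lambda>n t. \<Sum>k<n. (1/2) ^ Suc k * schoenberg (3 ^ prod_encode (i, k) * t)) (D i) sequentially"
      unfolding D_def
      by (rule Weierstrass_m_test[of _ _ "\<lambda>k. (1/2) ^ Suc k"]) (use le geo sums_summable in blast)+
    then have "continuous_on UNIV (D i)"
      by (rule uniform_limit_theorem[rotated]) (auto intro!: continuous_intros always_eventually simp: schoenberg_def)
    then show ?thesis by (simp add: continuous_on_eq_continuous_at)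
  qed
  moreover have "0 \<le> D i t \<and> D i t \<le> 1" for i t
  proof
    show "0 \<le> D i t" unfolding D_def by (intro suminf_nonneg sm) (simp add: sb)
    have "D i t \<le> (\<Sum>k. (1/2) ^ Suc k)" unfolding D_def
      by (intro suminf_le sm sums_summable[OF geo]) (use sb in \<open>simp add: mult_left_le\<close>)
    then show "D i t \<le> 1" using geo sums_unique by fastforce
  qed
  moreover have "D i (cd s) = s i" if "\<forall>i. 0 \<le> s i \<and> s i < 1" for s i
  proof -
    have "D i (cd s) = (\<Sum>k. (1/2) ^ Suc k * of_int (\<lfloor>2 ^ Suc k * s i\<rfloor> mod 2))"
      unfolding D_def cd_def by (subst schoenberg_ternary) (auto simp: bit_def)
    also have "\<dots> = s i" using binary_expansion_sums[of "s i"] that sums_unique by metis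
    finally show ?thesis .
  qed
  ultimately show ?thesis by blast
qed

text \<open>Mazur's lemma for bounded sequences: near-minimisers of the \<open>L\<^sup>2\<close> norm among tail mixtures are
  Cauchy by the parallelogram identity.\<close>

lemma forward_convex_combinations:
  fixes f :: "nat \<Rightarrow> 'a \<Rightarrow> real"
  assumes M: "prob_space M" and f[measurable]: "\<And>n. f n \<in> borel_measurable M"
    and f01: "\<And>n x. 0 \<le> f n x \<and> f n x \<le> 1"
  shows "\<exists>c :: nat \<Rightarrow> nat pmf. (\<forall>n. set_pmf (c n) \<subseteq> {n..}) \<and>
           (AE x in M. convergent (\<lambda>n. \<integral>k. f k x \<partial>measure_pmf (c n)))"
proof -
  interpret prob_space M by fact
  define g where "g p x = (\<integral>k. f k x \<partial>measure_pmf p)" for p x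
  have fm: "(\<lambda>(x, k). f k x) \<in> borel_measurable (M \<Otimes>\<^sub>M measure_pmf p)" for p :: "nat pmf"
    unfolding case_prod_beta by (rule measurable_compose_countable[where f="\<lambda>k z. f k (fst z)" and g=snd]) auto
  have gm[measurable]: "g p \<in> borel_measurable M" for p
    unfolding g_def using fm by (rule sigma_finite_measure.borel_measurable_lebesgue_integral[rotated])
      (rule prob_space_imp_sigma_finite, rule prob_space_measure_pmf)
  have fi: "integrable (measure_pmf p) (\<lambda>k. f k x)" for p x
    by (rule measure_pmf.integrable_const_bound[of _ 1]) (auto simp: f01)
  have g01: "0 \<le> g p x" "g p x \<le> 1" for p x
    unfolding g_def using f01 fi by (auto intro!: integral_nonneg_AE measure_pmf.integral_le_const)
  have gabs: "\<bar>g p x\<bar> \<le> 1" for p x using g01[of p x] by simp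
  \<comment> \<open>A fair coin between two mixtures realises the midpoint, to which the
    parallelogram identity is applied.\<close>
  define mix where "mix p p' = bind_pmf (bernoulli_pmf (1/2)) (\<lambda>b. if b then p else p')" for p p' :: "nat pmf"
  have gmix: "g (mix p p') x = (g p x + g p' x) / 2" for p p' x
  proof -
    have "g (mix p p') x = (\<integral>b. g (if b then p else p') x \<partial>measure_pmf (bernoulli_pmf (1/2)))"
      unfolding g_def mix_def measure_pmf_bind
      by (subst integral_bind[where K="count_space UNIV" and B=1 and B'=1]) (auto simp: f01 space_subprob_algebra intro!: prob_space_imp_subprob_space prob_space_measure_pmf)
    then show ?thesis by simp
  qed
  define e where "e p = (\<integral>x. (g p x)\<^sup>2 \<partial>M)" for p
  have sqi: "integrable M (\<lambda>x. g p x * g p' x)" for p p'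
    by (rule integrable_const_bound[of _ 1]) (auto simp: abs_mult gabs mult_le_one)
  have e0: "0 \<le> e p" for p by (simp add: e_def)
  have e1: "e p \<le> 1" for p unfolding e_def
    using sqi[of p p] gabs[of p] by (intro integral_le_const) (auto simp: power2_eq_square abs_square_le_1[unfolded power2_eq_square])
  \<comment> \<open>\<open>S n\<close> is closed under \<open>mix\<close> and shrinks as n grows, so
    the infimum \<open>m n\<close> of the energy over it increases; being at most 1, it has a limit
    \<open>L\<close>.\<close>
  define S where "S n = {p :: nat pmf. set_pmf p \<subseteq> {n..}}" for n
  have Sne: "return_pmf n \<in> S n" for n by (auto simp: S_def)
  define m where "m n = Inf (e ` S n)" for n
  have bdd: "bdd_below (e ` S n)" for n using e0 by (auto intro: bdd_belowI[of _ 0])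
  have mle: "m n \<le> e p" if "p \<in> S n" for n p unfolding m_def using that bdd by (auto intro: cInf_lower)
  have incm: "incseq m" unfolding m_def
    by (intro incseq_SucI cInf_superset_mono bdd image_mono)
      (auto simp: S_def intro!: exI[of _ "return_pmf (Suc _)"])
  have m1: "m n \<le> 1" for n using mle[OF Sne] e1 order_trans by blast
  obtain L where L: "m \<longlonglongrightarrow> L" and mL: "\<And>n. m n \<le> L" using incseq_convergent[OF incm] m1 by metis
  have "\<exists>p\<in>S n. e p < m n + (1/2) ^ n" for n
  proof -
    have "Inf (e ` S n) < m n + (1/2) ^ n" by (simp add: m_def)
    then show ?thesis using cInf_lessD[of "e ` S n"] Sne by blast
  qed
  then obtain p where pS: "\<And>n. p n \<in> S n" and pe: "\<And>n. e (p n) < m n + (1/2) ^ n" by metis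
  \<comment> \<open>The midpoint of \<open>p n\<close> and \<open>p k\<close> still lies in
    \<open>S n\<close>, so its energy is at least \<open>m n\<close>. The energies of both ends
    exceed \<open>m n\<close> by little, which forces the ends to be close.\<close>
  have diff: "(\<integral>x. (g (p n) x - g (p k) x)\<^sup>2 \<partial>M) \<le> 2 * (L - m n) + 4 * (1/2) ^ n" if "n \<le> k" for n k
  proof -
    have "p k \<in> S n" using pS[of k] that by (auto simp: S_def)
    then have "mix (p n) (p k) \<in> S n" using pS[of n] by (auto simp: S_def mix_def split: if_splits)
    then have "m n \<le> e (mix (p n) (p k))" by (rule mle)
    also have "\<dots> = (e (p n) + 2 * (\<integral>x. g (p n) x * g (p k) x \<partial>M) + e (p k)) / 4"
    proof -
      have "e (mix (p n) (p k)) = (\<integral>x. (g (p n) x * g (p n) x + 2 * (g (p n) x * g (p k) x) + g (p k) x * g (p k) x) / 4 \<partial>M)"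
        unfolding e_def gmix by (rule Bochner_Integration.integral_cong) (auto simp: field_simps power2_eq_square)
      also have "\<dots> = (e (p n) + 2 * (\<integral>x. g (p n) x * g (p k) x \<partial>M) + e (p k)) / 4"
        unfolding e_def power2_eq_square by (simp add: sqi)
      finally show ?thesis .
    qed
    finally have a: "4 * m n \<le> e (p n) + 2 * (\<integral>x. g (p n) x * g (p k) x \<partial>M) + e (p k)" by simp
    have "(\<integral>x. (g (p n) x - g (p k) x)\<^sup>2 \<partial>M) =
        (\<integral>x. g (p n) x * g (p n) x - 2 * (g (p n) x * g (p k) x) + g (p k) x * g (p k) x \<partial>M)"
      by (rule Bochner_Integration.integral_cong) (auto simp: algebra_simps power2_eq_square)
    also have "\<dots> = e (p n) - 2 * (\<integral>x. g (p n) x * g (p k) x \<partial>M) + e (p k)"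
      unfolding e_def power2_eq_square by (simp add: sqi)
    also have "\<dots> \<le> 2 * e (p n) + 2 * e (p k) - 4 * m n" using a by simp
    also have "\<dots> \<le> 2 * (m n + (1/2) ^ n) + 2 * (L + (1/2) ^ n) - 4 * m n"
    proof -
      have "(1/2::real) ^ k \<le> (1/2) ^ n" using that by (intro power_decreasing) auto
      then show ?thesis using pe[of n] pe[of k] mL[of k] by argo
    qed
    finally show ?thesis by (simp add: algebra_simps)
  qed
  have "(\<lambda>n. 2 * (L - m n) + 4 * (1/2) ^ n) \<longlonglongrightarrow> 2 * (L - L) + 4 * 0"
    by (intro tendsto_intros L LIMSEQ_power_zero) auto
  then have dl: "(\<lambda>n. 2 * (L - m n) + 4 * (1/2) ^ n) \<longlonglongrightarrow> 0" by simp
  have "\<exists>N. \<forall>n\<ge>N. 2 * (L - m n) + 4 * (1/2) ^ n < (1/4) ^ j" for j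
    using order_tendstoD(2)[OF dl, of "(1/4) ^ j"] by (auto simp: eventually_sequentially)
  then obtain N where N: "\<And>j n. N j \<le> n \<Longrightarrow> 2 * (L - m n) + 4 * (1/2) ^ n < (1/4) ^ j" by metis
  \<comment> \<open>Adding up the thresholds makes the index monotone and at least
    \<open>N j\<close>; the summand \<open>j\<close> keeps the support of \<open>c j\<close> in the
    tail.\<close>
  define r where "r j = (\<Sum>i\<le>j. N i) + j" for j
  have rN: "N j \<le> r j" and rj: "j \<le> r j" and rr: "r j \<le> r (Suc j)" for j
    by (auto simp: r_def intro: trans_le_add1 member_le_sum)
  define c where "c j = p (r j)" for j
  have cs: "set_pmf (c j) \<subseteq> {j..}" for j using pS[of "r j"] rj[of j] by (auto simp: S_def c_def)
  define h where "h j x = \<bar>g (c (Suc j)) x - g (c j) x\<bar>" for j x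
  have h01: "0 \<le> h j x" "h j x \<le> 1" for j x
    using g01[of "c (Suc j)" x] g01[of "c j" x] by (auto simp: h_def abs_le_iff)
  have hm[measurable]: "h j \<in> borel_measurable M" for j unfolding h_def by measurable
  have hint: "integrable M (h j)" for j
    by (rule integrable_const_bound[of _ 1]) (auto simp: h01)
  have hle: "(\<integral>x. h j x \<partial>M) \<le> (1/2) ^ j" for j
  proof -
    have sq: "integrable M (\<lambda>x. (h j x)\<^sup>2)"
      by (rule integrable_const_bound[of _ 1]) (auto simp: h01 abs_square_le_1 intro!: power_le_one)
    \<comment> \<open>Young's inequality with weight \<open>2 ^ j\<close> turns a squared distance
      of \<open>(1/4) ^ j\<close> into a mean distance of \<open>(1/2) ^ j\<close>. These are
      summable, so the increments are absolutely summable almost surely.\<close>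
    have "(\<integral>x. h j x \<partial>M) \<le> (\<integral>x. (1/2) * (1/2) ^ j + (1/2) * (2 ^ j * (h j x)\<^sup>2) \<partial>M)"
    proof (rule integral_mono)
      fix x
      have "0 \<le> (1 - 2 ^ j * h j x)\<^sup>2" by simp
      then have "2 * (2 ^ j * h j x) \<le> 1 + (2 ^ j * h j x)\<^sup>2" by (simp add: power2_diff)
      then have "2 * h j x \<le> (1/2) ^ j + 2 ^ j * (h j x)\<^sup>2"
        by (simp add: field_simps power_one_over power2_eq_square)
      then show "h j x \<le> (1/2) * (1/2) ^ j + (1/2) * (2 ^ j * (h j x)\<^sup>2)" by simp
    qed (use hint sq in auto)
    also have "\<dots> = (1/2) * (1/2) ^ j + (1/2) * (2 ^ j * (\<integral>x. (h j x)\<^sup>2 \<partial>M))"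
      using sq by (simp add: prob_space)
    also have "(\<integral>x. (h j x)\<^sup>2 \<partial>M) = (\<integral>x. (g (p (r j)) x - g (p (r (Suc j))) x)\<^sup>2 \<partial>M)"
      by (rule Bochner_Integration.integral_cong) (auto simp: h_def c_def power2_commute)
    also have "(1/2) * (1/2) ^ j + (1/2) * (2 ^ j * (\<integral>x. (g (p (r j)) x - g (p (r (Suc j))) x)\<^sup>2 \<partial>M))
        \<le> (1/2) * (1/2) ^ j + (1/2) * (2 ^ j * (1/4) ^ j)"
      using diff[OF rr[of j]] N[OF rN[of j]] by (intro add_left_mono mult_left_mono) auto
    also have "\<dots> = (1/2) ^ j" by (simp add: power_mult_distrib[symmetric])
    finally show ?thesis .
  qed
  have "(\<integral>\<^sup>+x. (\<Sum>j. ennreal (h j x)) \<partial>M) = (\<Sum>j. \<integral>\<^sup>+x. ennreal (h j x) \<partial>M)"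
    by (rule nn_integral_suminf) (simp add: h_def)
  also have "\<dots> \<le> (\<Sum>j. ennreal ((1/2) ^ j))"
    by (intro suminf_le summableI) (simp add: nn_integral_eq_integral[OF hint] h01 hle ennreal_leI)
  also have "\<dots> < \<infinity>" by (subst suminf_ennreal2) auto
  finally have "AE x in M. (\<Sum>j. ennreal (h j x)) \<noteq> \<infinity>"
    by (intro nn_integral_PInf_AE) (auto simp: h_def)
  then have "AE x in M. convergent (\<lambda>n. g (c n) x)"
  proof eventually_elim
    fix x assume "(\<Sum>j. ennreal (h j x)) \<noteq> \<infinity>"
    then have "summable (\<lambda>j. h j x)" by (intro summable_suminf_not_top) (auto simp: h_def)
    then have s: "summable (\<lambda>j. g (c (Suc j)) x - g (c j) x)"
      unfolding h_def by (rule summable_rabs_cancel)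
    then obtain l where "(\<lambda>n. \<Sum>j<n. g (c (Suc j)) x - g (c j) x) \<longlonglongrightarrow> l"
      by (auto simp: summable_def sums_def)
    then have "(\<lambda>n. (\<Sum>j<n. g (c (Suc j)) x - g (c j) x) + g (c 0) x) \<longlonglongrightarrow> l + g (c 0) x"
      by (intro tendsto_add tendsto_const)
    then have "(\<lambda>n. g (c n) x) \<longlonglongrightarrow> l + g (c 0) x"
      unfolding sum_lessThan_telescope[of "\<lambda>n. g (c n) x"] by simp
    then show "convergent (\<lambda>n. g (c n) x)" by (auto simp: convergent_def)
  qed
  then show ?thesis using cs unfolding g_def by blast
qed

section \<open>Hamiltonians as sums over bonds\<close>

text \<open>Each undirected bond with an endpoint in \<Lambda> occurs once, as its lower end and its
  direction; bonds leaving \<Lambda> are included.\<close>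

definition bnd :: "'d::finite site set \<Rightarrow> ('d site \<times> 'd) set" where
  "bnd \<Lambda> = {(x, i). x \<in> \<Lambda> \<or> x + unitv i \<in> \<Lambda>}"

definition gd :: "('d::finite site \<Rightarrow> real) \<Rightarrow> 'd site \<times> 'd \<Rightarrow> real" where
  "gd \<phi> b = \<phi> (fst b + unitv (snd b)) - \<phi> (fst b)"

text \<open>Boundary terms have the same form as interior ones, since the boundary condition enters
  only as the values of \<phi> off \<Lambda>.\<close>

definition energy :: "('d::finite site \<Rightarrow> 'd \<Rightarrow> real \<Rightarrow> real) \<Rightarrow> ('d site \<Rightarrow> real) \<Rightarrow> 'd site set \<Rightarrow> ('d site \<Rightarrow> real) \<Rightarrow> real" where
  "energy U h \<Lambda> \<phi> = (\<Sum>b\<in>bnd \<Lambda>. U (fst b) (snd b) (gd \<phi> b)) + 1/2 * (\<Sum>x\<in>\<Lambda>. h x * \<phi> x)"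

text \<open>Common form of both models: one potential for all bonds with \<open>h\<close> the random
  field gives model A, and \<open>h = 0\<close> gives model B. It is built on \<open>hamB\<close>,
  so the agreement with \<open>hamA\<close> and \<open>hamB\<close> holds for all arguments, even
  when \<phi> and \<psi> disagree off \<Lambda>.\<close>

definition hamf :: "('d::finite site \<Rightarrow> 'd \<Rightarrow> real \<Rightarrow> real) \<Rightarrow> ('d site \<Rightarrow> real) \<Rightarrow> 'd site set \<Rightarrow> ('d site \<Rightarrow> real) \<Rightarrow> ('d site \<Rightarrow> real) \<Rightarrow> real" where
  "hamf U h \<Lambda> \<psi> \<phi> = hamB U \<Lambda> \<psi> \<phi> + 1/2 * (\<Sum>x\<in>\<Lambda>. h x * \<phi> x)"

lemma bnd_subset: "bnd \<Lambda> \<subseteq> \<Lambda> \<times> UNIV \<union> (\<lambda>(x, i). (x - unitv i, i)) ` (\<Lambda> \<times> UNIV)"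
proof
  fix b assume "b \<in> bnd \<Lambda>"
  then obtain x i where b: "b = (x, i)" and c: "x \<in> \<Lambda> \<or> x + unitv i \<in> \<Lambda>" by (auto simp: bnd_def)
  show "b \<in> \<Lambda> \<times> UNIV \<union> (\<lambda>(x, i). (x - unitv i, i)) ` (\<Lambda> \<times> UNIV)"
    using c unfolding b by (auto intro!: image_eqI[of _ _ "(x + unitv i, i)"])
qed

lemma finite_bnd [simp]: "finite \<Lambda> \<Longrightarrow> finite (bnd \<Lambda>)"
  by (rule finite_subset[OF bnd_subset]) auto

lemma card_bnd:
  fixes \<Lambda> :: "'d::finite site set"
  assumes "finite \<Lambda>" shows "card (bnd \<Lambda>) \<le> 2 * CARD('d) * card \<Lambda>"
proof -
  have "card (bnd \<Lambda>) \<le> card (\<Lambda> \<times> (UNIV::'d set) \<union> (\<lambda>(x, i). (x - unitv i, i)) ` (\<Lambda> \<times> UNIV))"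
    using assms by (intro card_mono bnd_subset) auto
  also have "\<dots> \<le> card (\<Lambda> \<times> (UNIV::'d set)) + card ((\<lambda>(x, i). (x - unitv i, i)) ` (\<Lambda> \<times> (UNIV::'d set)))"
    by (rule card_Un_le)
  also have "card ((\<lambda>(x, i). (x - unitv i, i)) ` (\<Lambda> \<times> (UNIV::'d set))) \<le> card (\<Lambda> \<times> (UNIV::'d set))"
    using assms by (intro card_image_le) auto
  finally show ?thesis by (simp add: card_cartesian_product algebra_simps)
qed

lemma bnd_mono: "\<Lambda> \<subseteq> \<Delta> \<Longrightarrow> bnd \<Lambda> \<subseteq> bnd \<Delta>"
  by (auto simp: bnd_def)

lemma bondpot_unitv [simp]:
  "bondpot U x (x + unitv i) = U x i" "bondpot U (x + unitv i) x = U x i"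
proof -
  show "bondpot U x (x + unitv i) = U x i" by (auto simp: bondpot_def unitv_inj)
  have "x \<noteq> x + unitv i + unitv j" for j using unitv_neq[of i j] by (simp add: add.assoc)
  then show "bondpot U (x + unitv i) x = U x i" by (auto simp: bondpot_def unitv_inj)
qed

text \<open>Ordered neighbour pairs are split by orientation; the two families are disjoint since
  \<open>unitv i + unitv j\<close> is never 0.\<close>

lemma sum_nn:
  fixes f :: "'d::finite site \<Rightarrow> 'd site \<Rightarrow> real"
  assumes fin: "finite {(x, y). Pr x y \<and> nn x y}"
  shows "(\<Sum>(x, y)\<in>{(x, y). Pr x y \<and> nn x y}. f x y) =
    (\<Sum>(x, i)\<in>{(x, i). Pr x (x + unitv i)}. f x (x + unitv i)) + (\<Sum>(x, i)\<in>{(x, i). Pr (x + unitv i) x}. f (x + unitv i) x)"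
proof -
  let ?A = "(\<lambda>(x, i). (x, x + unitv i)) ` {(x, i). Pr x (x + unitv i)}"
  let ?B = "(\<lambda>(x, i). (x + unitv i, x)) ` {(x, i). Pr (x + unitv i) x}"
  have un: "{(x, y). Pr x y \<and> nn x y} = ?A \<union> ?B"
  proof (intro set_eqI iffI)
    fix p assume "p \<in> {(x, y). Pr x y \<and> nn x y}"
    then obtain x y where p: "p = (x, y)" "Pr x y" "nn x y" by auto
    then obtain i where "y = x + unitv i \<or> x = y + unitv i" by (auto simp: nn_iff)
    then show "p \<in> ?A \<union> ?B"
    proof
      assume "y = x + unitv i" then show ?thesis using p by (intro UnI1 image_eqI[of _ _ "(x, i)"]) auto
    next
      assume "x = y + unitv i" then show ?thesis using p by (intro UnI2 image_eqI[of _ _ "(y, i)"]) auto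
    qed
  qed auto
  have disj: "?A \<inter> ?B = {}"
  proof -
    have "x + unitv i + unitv j \<noteq> x" for x :: "'d site" and i j using unitv_neq[of i j] by (simp add: add.assoc)
    then show ?thesis by (force simp: )
  qed
  have "finite ?A" "finite ?B" using fin unfolding un by auto
  then have "(\<Sum>(x, y)\<in>{(x, y). Pr x y \<and> nn x y}. f x y) = (\<Sum>(x, y)\<in>?A. f x y) + (\<Sum>(x, y)\<in>?B. f x y)"
    unfolding un using disj by (rule sum.union_disjoint)
  also have "(\<Sum>(x, y)\<in>?A. f x y) = (\<Sum>(x, i)\<in>{(x, i). Pr x (x + unitv i)}. f x (x + unitv i))"
    by (subst sum.reindex) (auto simp: inj_on_def unitv_inj intro!: sum.cong)
  also have "(\<Sum>(x, y)\<in>?B. f x y) = (\<Sum>(x, i)\<in>{(x, i). Pr (x + unitv i) x}. f (x + unitv i) x)"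
    by (subst sum.reindex) (auto simp: inj_on_def unitv_inj intro!: sum.cong)
  finally show ?thesis .
qed

lemma finite_nn: assumes "finite \<Lambda>" shows "finite {(x, y). x \<in> \<Lambda> \<and> Pr x y \<and> nn x (y :: 'd::finite site)}"
proof -
  have "{(x, y). x \<in> \<Lambda> \<and> Pr x y \<and> nn x y} \<subseteq> (\<lambda>(x, i). (x, x + unitv i)) ` (\<Lambda> \<times> UNIV) \<union> (\<lambda>(x, i). (x, x - unitv i)) ` (\<Lambda> \<times> UNIV)"
  proof
    fix p assume "p \<in> {(x, y). x \<in> \<Lambda> \<and> Pr x y \<and> nn x y}"
    then obtain x y where p: "p = (x, y)" "x \<in> \<Lambda>" "nn x y" by auto
    then obtain i where "y = x + unitv i \<or> x = y + unitv i" by (auto simp: nn_iff)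
    then have "y = x + unitv i \<or> y = x - unitv i" by auto
    then show "p \<in> (\<lambda>(x, i). (x, x + unitv i)) ` (\<Lambda> \<times> UNIV) \<union> (\<lambda>(x, i). (x, x - unitv i)) ` (\<Lambda> \<times> UNIV)"
    proof
      assume "y = x + unitv i" then show ?thesis using p by (intro UnI1 image_eqI[of _ _ "(x, i)"]) auto
    next
      assume "y = x - unitv i" then show ?thesis using p by (intro UnI2 image_eqI[of _ _ "(x, i)"]) auto
    qed
  qed
  then show ?thesis using assms by (auto intro: finite_subset)
qed

text \<open>Evenness makes the two orientations of an interior bond equal, which absorbs the factor
  1/2. A boundary bond occurs in one orientation only, and the two cases are whether its inner end
  is the lower or the upper one.\<close>

lemma hamf_eq_energy:
  fixes \<Lambda> :: "'d::finite site set"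
  assumes fin: "finite \<Lambda>" and even: "\<And>x i s. U x i (- s) = U x i s" and bd: "\<And>x. x \<notin> \<Lambda> \<Longrightarrow> \<phi> x = \<psi> x"
  shows "hamf U h \<Lambda> \<psi> \<phi> = energy U h \<Lambda> \<phi>"
proof -
  have ev: "U x i (a - b) = U x i (b - a)" for x i a b using even[of x i "b - a"] by simp
  have "finite {(x, y). (x \<in> \<Lambda> \<and> y \<in> \<Lambda>) \<and> nn x y}" "finite {(x, y). (x \<in> \<Lambda> \<and> y \<notin> \<Lambda>) \<and> nn x y}"
    using finite_nn[OF fin, of "\<lambda>x y. y \<in> \<Lambda>"] finite_nn[OF fin, of "\<lambda>x y. y \<notin> \<Lambda>"] by (simp_all add: conj_assoc)
  note s = sum_nn[OF this(1), of "\<lambda>x y. bondpot U x y (\<phi> x - \<phi> y)"] sum_nn[OF this(2), of "\<lambda>x y. bondpot U x y (\<phi> x - \<psi> y)"]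
  let ?u = "\<lambda>(x, i). U x i (\<phi> (x + unitv i) - \<phi> x)"
  let ?I = "{(x, i::'d). x \<in> \<Lambda> \<and> x + unitv i \<in> \<Lambda>}"
  let ?O1 = "{(x, i::'d). x \<in> \<Lambda> \<and> x + unitv i \<notin> \<Lambda>}"
  let ?O2 = "{(x, i::'d). x + unitv i \<in> \<Lambda> \<and> x \<notin> \<Lambda>}"
  have f: "finite ?I" "finite ?O1" "finite ?O2" by (auto intro: finite_subset[OF _ finite_bnd[OF fin]] simp: bnd_def)
  have I: "(\<Sum>(x, y)\<in>{(x, y). x \<in> \<Lambda> \<and> y \<in> \<Lambda> \<and> nn x y}. bondpot U x y (\<phi> x - \<phi> y)) = 2 * sum ?u ?I"
    using s(1) by (simp add: conj_assoc ev[of _ _ "\<phi> _" "\<phi> (_ + _)"]) (simp add: conj_commute)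
  have O: "(\<Sum>(x, y)\<in>{(x, y). x \<in> \<Lambda> \<and> y \<notin> \<Lambda> \<and> nn x y}. bondpot U x y (\<phi> x - \<psi> y)) = sum ?u ?O1 + sum ?u ?O2"
  proof -
    have "(\<Sum>(x, i)\<in>?O1. U x i (\<phi> x - \<psi> (x + unitv i))) = sum ?u ?O1"
      by (rule sum.cong) (auto simp: bd ev[of _ _ "\<phi> _" "\<psi> _"])
    moreover have "(\<Sum>(x, i)\<in>?O2. U x i (\<phi> (x + unitv i) - \<psi> x)) = sum ?u ?O2"
      by (rule sum.cong) (auto simp: bd)
    ultimately show ?thesis using s(2) by (simp add: conj_assoc)
  qed
  have "bnd \<Lambda> = ?I \<union> (?O1 \<union> ?O2)" by (auto simp: bnd_def)
  then have "sum ?u (bnd \<Lambda>) = sum ?u (?I \<union> (?O1 \<union> ?O2))" by simp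
  also have "\<dots> = sum ?u ?I + sum ?u (?O1 \<union> ?O2)" using f by (intro sum.union_disjoint) auto
  also have "sum ?u (?O1 \<union> ?O2) = sum ?u ?O1 + sum ?u ?O2" using f by (intro sum.union_disjoint) auto
  finally have "sum ?u (bnd \<Lambda>) = sum ?u ?I + (sum ?u ?O1 + sum ?u ?O2)" .
  then show ?thesis unfolding hamf_def hamB_def energy_def I O by (simp add: gd_def case_prod_beta')
qed

lemma extend_measurable [measurable (raw)]:
  assumes [measurable]: "f \<in> measurable M (PiM \<Lambda> (\<lambda>_. lborel))" "g \<in> measurable M HS"
  shows "(\<lambda>a. extend \<Lambda> (f a) (g a)) \<in> measurable M HS"
proof (rule measurable_HS_I)
  fix x
  show "(\<lambda>a. extend \<Lambda> (f a) (g a) x) \<in> borel_measurable M"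
  proof (cases "x \<in> \<Lambda>")
    case True
    have "(\<lambda>p. p x) \<in> measurable (PiM \<Lambda> (\<lambda>_. lborel)) lborel" using True by (rule measurable_component_singleton)
    then have "(\<lambda>p. p x) \<in> borel_measurable (PiM \<Lambda> (\<lambda>_. lborel :: real measure))" by simp
    then show ?thesis using True by (simp add: extend_def)
  qed (simp add: extend_def)
qed

lemma gd_measurable [measurable]: "(\<lambda>\<phi>. gd \<phi> b) \<in> borel_measurable HS"
  by (simp add: gd_def)

lemma energy_joint_measurable:
  assumes U: "\<And>x i. (\<lambda>(z, s). U z x i s) \<in> borel_measurable (Q \<Otimes>\<^sub>M borel)"
    and h: "\<And>x. (\<lambda>z. h z x) \<in> borel_measurable Q"
  shows "(\<lambda>(z, \<phi>). energy (U z) (h z) \<Lambda> \<phi>) \<in> borel_measurable (Q \<Otimes>\<^sub>M HS)"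
proof -
  have U': "(\<lambda>p. U (f p) x i (g p)) \<in> borel_measurable M"
    if [measurable]: "f \<in> measurable M Q" "g \<in> borel_measurable M" for f g x i and M :: "'c measure"
    using measurable_compose[OF measurable_Pair[OF that] U] by simp
  note [measurable] = h U'
  show ?thesis unfolding energy_def case_prod_beta' by measurable
qed

section \<open>Gaussian integrals along chains of bonds\<close>

lemma nn_integral_gaussian_shift:
  fixes a :: real assumes a: "a > 0"
  shows "(\<integral>\<^sup>+y. ennreal (exp (- a * (w - y)\<^sup>2)) \<partial>lborel) = ennreal (sqrt (pi / a))"
proof -
  define \<sigma> where "\<sigma> = sqrt (1 / (2 * a))"
  have s: "\<sigma> > 0" "\<sigma>\<^sup>2 = 1 / (2 * a)" using a by (auto simp: \<sigma>_def)
  interpret N: prob_space "density lborel (\<lambda>x. ennreal (normal_density w \<sigma> x))" by (rule prob_space_normal_density[OF s(1)])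
  have c: "sqrt (2 * pi * \<sigma>\<^sup>2) = sqrt (pi / a)" by (simp add: s(2))
  have "(\<integral>\<^sup>+y. ennreal (exp (- a * (w - y)\<^sup>2)) \<partial>lborel) = (\<integral>\<^sup>+y. ennreal (sqrt (pi / a)) * ennreal (normal_density w \<sigma> y) \<partial>lborel)"
  proof (rule nn_integral_cong)
    fix y
    have "exp (- a * (w - y)\<^sup>2) = sqrt (pi / a) * normal_density w \<sigma> y"
      unfolding normal_density_def c using a by (simp add: s(2) power2_commute field_simps)
    then show "ennreal (exp (- a * (w - y)\<^sup>2)) = ennreal (sqrt (pi / a)) * ennreal (normal_density w \<sigma> y)"
      using a by (simp add: ennreal_mult)
  qed
  also have "\<dots> = ennreal (sqrt (pi / a)) * emeasure (density lborel (\<lambda>x. ennreal (normal_density w \<sigma> x))) UNIV"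
    by (simp add: nn_integral_cmult emeasure_density)
  also have "\<dots> = ennreal (sqrt (pi / a))" using N.emeasure_space_1 by simp
  finally show ?thesis .
qed

text \<open>Only the bonds in direction \<open>i\<close> are kept: they form disjoint chains leaving \<open>\<Lambda>\<close>, which can be
  integrated out one site at a time starting from the sites with smallest \<open>i\<close>-th coordinate.\<close>

lemma gaussian_chain_integral:
  fixes \<psi> :: "'d::finite site \<Rightarrow> real"
  assumes a: "a > 0" and fin: "finite \<Lambda>"
  shows "(\<integral>\<^sup>+\<phi>. ennreal (exp (- a * (\<Sum>x\<in>\<Lambda>. (gd (extend \<Lambda> \<phi> \<psi>) (x, i))\<^sup>2))) \<partial>(PiM \<Lambda> (\<lambda>_. lborel)))
     = ennreal (sqrt (pi / a)) ^ card \<Lambda>"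
  using fin
proof (induction "card \<Lambda>" arbitrary: \<Lambda>)
  case 0
  then have "\<Lambda> = {}" by simp
  then show ?case by (simp add: PiM_empty nn_integral_count_space_finite)
next
  case (Suc n)
  interpret product_sigma_finite "\<lambda>_::'d site. lborel :: real measure" by standard
  have ne: "\<Lambda> \<noteq> {}" "finite \<Lambda>" using Suc by auto
  \<comment> \<open>A site \<open>x\<close> with smallest \<open>i\<close>-th coordinate is the
    upper end of no bond starting in \<Lambda>. Its height therefore occurs in one term only and
    integrates to a constant, whatever the height of its upper neighbour.\<close>
  define m where "m = Min ((\<lambda>x. x $ i) ` \<Lambda>)"
  have "m \<in> (\<lambda>x. x $ i) ` \<Lambda>" unfolding m_def using ne by (intro Min_in) auto
  then obtain x where x: "x \<in> \<Lambda>" "x $ i = m" by auto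
  have mn: "m \<le> y $ i" if "y \<in> \<Lambda>" for y unfolding m_def using ne that by (intro Min_le) auto
  define I where "I = \<Lambda> - {x}"
  have I: "\<Lambda> = insert x I" "x \<notin> I" "finite I" "card I = n" using x ne Suc.hyps(2) by (auto simp: I_def)
  have nx: "y + unitv i \<noteq> x" if "y \<in> \<Lambda>" for y
  proof
    assume "y + unitv i = x"
    then have "(y + unitv i) $ i = m" using x by simp
    then show False using mn[OF that] by (simp add: unitv_nth)
  qed
  have gdI: "gd (extend \<Lambda> (\<phi>(x := y)) \<psi>) (z, i) = gd (extend I \<phi> \<psi>) (z, i)" if "z \<in> I" for \<phi> y z
    using that nx[of z] I by (auto simp: gd_def extend_def)
  have gdx: "gd (extend \<Lambda> (\<phi>(x := y)) \<psi>) (x, i) = extend I \<phi> \<psi> (x + unitv i) - y" for \<phi> y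
    using nx[OF x(1)] x(1) I by (auto simp: gd_def extend_def)
  have "(\<integral>\<^sup>+\<phi>. ennreal (exp (- a * (\<Sum>x\<in>\<Lambda>. (gd (extend \<Lambda> \<phi> \<psi>) (x, i))\<^sup>2))) \<partial>(PiM \<Lambda> (\<lambda>_. lborel)))
    = (\<integral>\<^sup>+\<phi>. \<integral>\<^sup>+y. ennreal (exp (- a * (\<Sum>z\<in>\<Lambda>. (gd (extend \<Lambda> (\<phi>(x := y)) \<psi>) (z, i))\<^sup>2))) \<partial>lborel \<partial>(PiM I (\<lambda>_. lborel)))"
    unfolding I(1) by (rule product_nn_integral_insert) (use I in auto)
  also have "\<dots> = (\<integral>\<^sup>+\<phi>. \<integral>\<^sup>+y. ennreal (exp (- a * (extend I \<phi> \<psi> (x + unitv i) - y)\<^sup>2)) * ennreal (exp (- a * (\<Sum>z\<in>I. (gd (extend I \<phi> \<psi>) (z, i))\<^sup>2))) \<partial>lborel \<partial>(PiM I (\<lambda>_. lborel)))"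
  proof (intro nn_integral_cong)
    fix \<phi> y
    have "(\<Sum>z\<in>\<Lambda>. (gd (extend \<Lambda> (\<phi>(x := y)) \<psi>) (z, i))\<^sup>2) = (extend I \<phi> \<psi> (x + unitv i) - y)\<^sup>2 + (\<Sum>z\<in>I. (gd (extend I \<phi> \<psi>) (z, i))\<^sup>2)"
      using I gdI gdx by (simp cong: sum.cong)
    then show "ennreal (exp (- a * (\<Sum>z\<in>\<Lambda>. (gd (extend \<Lambda> (\<phi>(x := y)) \<psi>) (z, i))\<^sup>2))) = ennreal (exp (- a * (extend I \<phi> \<psi> (x + unitv i) - y)\<^sup>2)) * ennreal (exp (- a * (\<Sum>z\<in>I. (gd (extend I \<phi> \<psi>) (z, i))\<^sup>2)))"
      by (simp add: ennreal_mult[symmetric] exp_add[symmetric] distrib_left)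
  qed
  also have "\<dots> = (\<integral>\<^sup>+\<phi>. ennreal (sqrt (pi / a)) * ennreal (exp (- a * (\<Sum>z\<in>I. (gd (extend I \<phi> \<psi>) (z, i))\<^sup>2))) \<partial>(PiM I (\<lambda>_. lborel)))"
    using nn_integral_gaussian_shift[OF a] by (simp add: nn_integral_multc)
  also have "\<dots> = ennreal (sqrt (pi / a)) * ennreal (sqrt (pi / a)) ^ card I"
    using Suc.hyps(1)[OF I(4)[symmetric] I(3)] by (subst nn_integral_cmult) simp_all
  also have "\<dots> = ennreal (sqrt (pi / a)) ^ card \<Lambda>" using I by simp
  finally show ?case .
qed

section \<open>Partition functions and finite-volume Gibbs measures\<close>

definition wt where "wt U h \<Lambda> \<phi> = exp (- energy U h \<Lambda> \<phi>)"

definition pfn :: "('d::finite site \<Rightarrow> 'd \<Rightarrow> real \<Rightarrow> real) \<Rightarrow> ('d site \<Rightarrow> real) \<Rightarrow> 'd site set \<Rightarrow> ('d site \<Rightarrow> real) \<Rightarrow> ennreal" where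
  "pfn U h \<Lambda> \<psi> = (\<integral>\<^sup>+\<phi>. ennreal (wt U h \<Lambda> (extend \<Lambda> \<phi> \<psi>)) \<partial>(PiM \<Lambda> (\<lambda>_. lborel)))"

abbreviation gib where "gib U h \<equiv> fv_gibbs (hamf U h)"

definition dir_energy :: "'d::finite site set \<Rightarrow> ('d site \<Rightarrow> real) \<Rightarrow> real" where
  "dir_energy \<Lambda> \<phi> = (\<Sum>b\<in>bnd \<Lambda>. (gd \<phi> b)\<^sup>2)"

lemma wt_pos [simp]: "wt U h \<Lambda> \<phi> > 0" by (simp add: wt_def)

lemma wt_nonneg [simp]: "wt U h \<Lambda> \<phi> \<ge> 0" by (simp add: wt_def)

text \<open>\<open>current\<close> is a summation by parts: the field is the divergence of a current
  \<open>j\<close>, which may depend on \<Lambda>. Written in gradients, the linear term can be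
  absorbed by the quadratic growth of \<open>U\<close>, which has no direct hold on the
  heights.\<close>

locale potential =
  fixes U :: "'d::finite site \<Rightarrow> 'd \<Rightarrow> real \<Rightarrow> real" and h :: "'d site \<Rightarrow> real" and A :: real
    and Bf :: "'d site \<Rightarrow> 'd \<Rightarrow> real" and j :: "'d site set \<Rightarrow> 'd site \<times> 'd \<Rightarrow> real"
  assumes cont: "\<And>x i. continuous_on UNIV (U x i)"
    and even: "\<And>x i s. U x i (- s) = U x i s"
    and A: "A > 0"
    and lower: "\<And>x i s. A * s\<^sup>2 - Bf x i \<le> U x i s"
    and current: "\<And>\<Lambda> f. finite \<Lambda> \<Longrightarrow> (\<And>x. x \<notin> \<Lambda> \<Longrightarrow> f x = 0) \<Longrightarrow>
      (\<Sum>x\<in>\<Lambda>. h x * f x) = (\<Sum>b\<in>bnd \<Lambda>. j \<Lambda> b * gd f b)"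
begin

definition low :: "'d site set \<Rightarrow> ('d site \<Rightarrow> real) \<Rightarrow> real" where
  "low \<Lambda> \<psi> = 1/2 * (\<Sum>x\<in>\<Lambda>. h x * \<psi> x) - A/4 * dir_energy \<Lambda> \<psi> - (\<Sum>b\<in>bnd \<Lambda>. Bf (fst b) (snd b)) - 1/(2*A) * (\<Sum>b\<in>bnd \<Lambda>. (j \<Lambda> b)\<^sup>2)"

lemma U_measurable [measurable]: "U x i \<in> borel_measurable borel"
  using cont by (rule borel_measurable_continuous_onI)

lemma energy_measurable [measurable]: "energy U h \<Lambda> \<in> borel_measurable HS"
  unfolding energy_def by measurable

lemma wt_measurable [measurable]: "wt U h \<Lambda> \<in> borel_measurable HS"
  unfolding wt_def by measurable

text \<open>The current acts on the deviation \<open>f\<close> from \<psi>, which vanishes off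
  \<Lambda>. A quarter of the quadratic growth pays for it: the square is completed bond by bond,
  and \<open>(gd f b)\<^sup>2\<close> is split between \<phi> and \<psi>. Three quarters are left
  for \<phi>.\<close>

lemma energy_lower:
  assumes fin: "finite \<Lambda>" and bd: "\<And>x. x \<notin> \<Lambda> \<Longrightarrow> \<phi> x = \<psi> x"
  shows "energy U h \<Lambda> \<phi> \<ge> 3 * A/4 * dir_energy \<Lambda> \<phi> + low \<Lambda> \<psi>"
proof -
  define f where "f x = \<phi> x - \<psi> x" for x
  have gf: "gd f b = gd \<phi> b - gd \<psi> b" for b by (simp add: gd_def f_def)
  have cur: "(\<Sum>x\<in>\<Lambda>. h x * f x) = (\<Sum>b\<in>bnd \<Lambda>. j \<Lambda> b * gd f b)"
    using fin bd by (intro current) (auto simp: f_def)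
  have "(\<Sum>x\<in>\<Lambda>. h x * \<phi> x) = (\<Sum>x\<in>\<Lambda>. h x * \<psi> x) + (\<Sum>x\<in>\<Lambda>. h x * f x)"
    by (simp add: f_def sum.distrib[symmetric] algebra_simps)
  then have e: "energy U h \<Lambda> \<phi> = 1/2 * (\<Sum>x\<in>\<Lambda>. h x * \<psi> x) + (\<Sum>b\<in>bnd \<Lambda>. U (fst b) (snd b) (gd \<phi> b) + 1/2 * (j \<Lambda> b * gd f b))"
    unfolding energy_def cur by (simp add: sum.distrib sum_distrib_left algebra_simps)
  have "3 * A/4 * (gd \<phi> b)\<^sup>2 - A/4 * (gd \<psi> b)\<^sup>2 - Bf (fst b) (snd b) - 1/(2*A) * (j \<Lambda> b)\<^sup>2
      \<le> U (fst b) (snd b) (gd \<phi> b) + 1/2 * (j \<Lambda> b * gd f b)" for b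
  proof -
    \<comment> \<open>The weights make the cross term exactly the field term
      \<open>1/2 * (j \<Lambda> b * gd f b)\<close>.\<close>
    have "0 \<le> (A * gd f b / 2 + j \<Lambda> b)\<^sup>2 / (2 * A)" using A by simp
    also have "\<dots> = A/8 * (gd f b)\<^sup>2 + 1/2 * (j \<Lambda> b * gd f b) + 1/(2*A) * (j \<Lambda> b)\<^sup>2"
      using A by (simp add: power2_eq_square field_simps)
    finally have 1: "0 \<le> A/8 * (gd f b)\<^sup>2 + 1/2 * (j \<Lambda> b * gd f b) + 1/(2*A) * (j \<Lambda> b)\<^sup>2" .
    have "0 \<le> (gd \<phi> b + gd \<psi> b)\<^sup>2" by simp
    then have "(gd f b)\<^sup>2 \<le> 2 * (gd \<phi> b)\<^sup>2 + 2 * (gd \<psi> b)\<^sup>2" unfolding gf by (simp add: power2_eq_square algebra_simps)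
    then have "A/8 * (gd f b)\<^sup>2 \<le> A/8 * (2 * (gd \<phi> b)\<^sup>2 + 2 * (gd \<psi> b)\<^sup>2)" using A by (intro mult_left_mono) auto
    then have 2: "A/8 * (gd f b)\<^sup>2 \<le> A/4 * (gd \<phi> b)\<^sup>2 + A/4 * (gd \<psi> b)\<^sup>2" by (simp add: algebra_simps)
    have 3: "A * (gd \<phi> b)\<^sup>2 - Bf (fst b) (snd b) \<le> U (fst b) (snd b) (gd \<phi> b)" by (rule lower)
    have 4: "3 * A/4 * (gd \<phi> b)\<^sup>2 = A * (gd \<phi> b)\<^sup>2 - A/4 * (gd \<phi> b)\<^sup>2" by (simp add: algebra_simps)
    show ?thesis using 1 2 3 unfolding 4 by argo
  qed
  then have "(\<Sum>b\<in>bnd \<Lambda>. 3 * A/4 * (gd \<phi> b)\<^sup>2 - A/4 * (gd \<psi> b)\<^sup>2 - Bf (fst b) (snd b) - 1/(2*A) * (j \<Lambda> b)\<^sup>2)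
     \<le> (\<Sum>b\<in>bnd \<Lambda>. U (fst b) (snd b) (gd \<phi> b) + 1/2 * (j \<Lambda> b * gd f b))" by (intro sum_mono) auto
  moreover have "(\<Sum>b\<in>bnd \<Lambda>. 3 * A/4 * (gd \<phi> b)\<^sup>2 - A/4 * (gd \<psi> b)\<^sup>2 - Bf (fst b) (snd b) - 1/(2*A) * (j \<Lambda> b)\<^sup>2)
    = 3 * A/4 * dir_energy \<Lambda> \<phi> - A/4 * dir_energy \<Lambda> \<psi> - (\<Sum>b\<in>bnd \<Lambda>. Bf (fst b) (snd b)) - 1/(2*A) * (\<Sum>b\<in>bnd \<Lambda>. (j \<Lambda> b)\<^sup>2)"
    unfolding dir_energy_def by (simp add: sum_subtractf sum_distrib_left)
  ultimately show ?thesis unfolding e low_def by linarith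
qed

lemma dir_energy_chain: "finite \<Lambda> \<Longrightarrow> (\<Sum>x\<in>\<Lambda>. (gd \<phi> (x, i))\<^sup>2) \<le> dir_energy \<Lambda> \<phi>"
proof -
  assume fin: "finite \<Lambda>"
  have "(\<Sum>x\<in>\<Lambda>. (gd \<phi> (x, i))\<^sup>2) = (\<Sum>b\<in>(\<lambda>x. (x, i)) ` \<Lambda>. (gd \<phi> b)\<^sup>2)"
    by (subst sum.reindex) (auto simp: inj_on_def)
  also have "\<dots> \<le> dir_energy \<Lambda> \<phi>" unfolding dir_energy_def using fin by (intro sum_mono2 finite_bnd) (auto simp: bnd_def)
  finally show ?thesis .
qed

lemma dir_energy_measurable [measurable]: "dir_energy \<Lambda> \<in> borel_measurable HS"
  unfolding dir_energy_def by measurable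

text \<open>Of the \<open>3 * A/4\<close> in \<open>energy_lower\<close>, \<open>A/2\<close>
  compensates the exponential and \<open>A/4\<close> remains. Keeping only the chains in one
  arbitrary direction leaves a Gaussian integral with variance parameter \<open>A/4\<close>, whence
  \<open>4 * pi / A\<close>.\<close>

lemma exp_energy_integral:
  assumes fin: "finite \<Lambda>"
  shows "(\<integral>\<^sup>+\<phi>. ennreal (exp (A/2 * dir_energy \<Lambda> (extend \<Lambda> \<phi> \<psi>)) * wt U h \<Lambda> (extend \<Lambda> \<phi> \<psi>)) \<partial>(PiM \<Lambda> (\<lambda>_. lborel)))
      \<le> ennreal (exp (- low \<Lambda> \<psi>)) * ennreal (sqrt (4 * pi / A)) ^ card \<Lambda>"
proof -
  fix i :: 'd
  have "(\<integral>\<^sup>+\<phi>. ennreal (exp (A/2 * dir_energy \<Lambda> (extend \<Lambda> \<phi> \<psi>)) * wt U h \<Lambda> (extend \<Lambda> \<phi> \<psi>)) \<partial>(PiM \<Lambda> (\<lambda>_. lborel)))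
    \<le> (\<integral>\<^sup>+\<phi>. ennreal (exp (- low \<Lambda> \<psi>)) * ennreal (exp (- (A/4) * (\<Sum>x\<in>\<Lambda>. (gd (extend \<Lambda> \<phi> \<psi>) (x, i))\<^sup>2))) \<partial>(PiM \<Lambda> (\<lambda>_. lborel)))"
  proof (intro nn_integral_mono)
    fix \<phi>
    let ?e = "extend \<Lambda> \<phi> \<psi>"
    have "energy U h \<Lambda> ?e \<ge> 3 * A/4 * dir_energy \<Lambda> ?e + low \<Lambda> \<psi>" by (rule energy_lower[OF fin]) (simp add: extend_def)
    moreover have "A/4 * (\<Sum>x\<in>\<Lambda>. (gd ?e (x, i))\<^sup>2) \<le> A/4 * dir_energy \<Lambda> ?e" using dir_energy_chain[OF fin] A by (intro mult_left_mono) auto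
    moreover have "3 * A/4 * dir_energy \<Lambda> ?e = A/2 * dir_energy \<Lambda> ?e + A/4 * dir_energy \<Lambda> ?e" by (simp add: algebra_simps)
    ultimately have "A/2 * dir_energy \<Lambda> ?e + - energy U h \<Lambda> ?e \<le> - low \<Lambda> \<psi> + - (A/4) * (\<Sum>x\<in>\<Lambda>. (gd ?e (x, i))\<^sup>2)" by linarith
    then have "exp (A/2 * dir_energy \<Lambda> ?e) * wt U h \<Lambda> ?e \<le> exp (- low \<Lambda> \<psi>) * exp (- (A/4) * (\<Sum>x\<in>\<Lambda>. (gd ?e (x, i))\<^sup>2))"
      unfolding wt_def exp_add[symmetric] by simp
    then show "ennreal (exp (A/2 * dir_energy \<Lambda> ?e) * wt U h \<Lambda> ?e)
        \<le> ennreal (exp (- low \<Lambda> \<psi>)) * ennreal (exp (- (A/4) * (\<Sum>x\<in>\<Lambda>. (gd ?e (x, i))\<^sup>2)))"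
      by (subst ennreal_mult[symmetric]) (auto intro: ennreal_leI)
  qed
  also have "\<dots> = ennreal (exp (- low \<Lambda> \<psi>)) * ennreal (sqrt (pi / (A/4))) ^ card \<Lambda>"
    using gaussian_chain_integral[of "A/4" \<Lambda> \<psi> i] A fin by (subst nn_integral_cmult) auto
  finally show ?thesis by (simp add: mult.commute)
qed

lemma pfn_finite: assumes fin: "finite \<Lambda>" shows "pfn U h \<Lambda> \<psi> < \<infinity>"
proof -
  have "pfn U h \<Lambda> \<psi> \<le> (\<integral>\<^sup>+\<phi>. ennreal (exp (A/2 * dir_energy \<Lambda> (extend \<Lambda> \<phi> \<psi>)) * wt U h \<Lambda> (extend \<Lambda> \<phi> \<psi>)) \<partial>(PiM \<Lambda> (\<lambda>_. lborel)))"
    unfolding pfn_def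
  proof (intro nn_integral_mono ennreal_leI)
    fix \<phi>
    have "1 \<le> exp (A/2 * dir_energy \<Lambda> (extend \<Lambda> \<phi> \<psi>))" using A by (simp add: dir_energy_def sum_nonneg)
    then show "wt U h \<Lambda> (extend \<Lambda> \<phi> \<psi>) \<le> exp (A/2 * dir_energy \<Lambda> (extend \<Lambda> \<phi> \<psi>)) * wt U h \<Lambda> (extend \<Lambda> \<phi> \<psi>)"
      by (metis mult_le_cancel_right1 not_less wt_nonneg)
  qed
  also have "\<dots> \<le> ennreal (exp (- low \<Lambda> \<psi>)) * ennreal (sqrt (4 * pi / A)) ^ card \<Lambda>" by (rule exp_energy_integral[OF fin])
  also have "\<dots> < \<infinity>" by (simp add: ennreal_mult_less_top power_less_top_ennreal)
  finally show ?thesis .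
qed

lemma pfn_lower:
  assumes fin: "finite \<Lambda>" and le: "\<And>\<phi>. (\<And>x. x \<in> \<Lambda> \<Longrightarrow> \<psi> x \<le> \<phi> x \<and> \<phi> x \<le> \<psi> x + 1) \<Longrightarrow> (\<And>x. x \<notin> \<Lambda> \<Longrightarrow> \<phi> x = \<psi> x) \<Longrightarrow> energy U h \<Lambda> \<phi> \<le> E"
  shows "pfn U h \<Lambda> \<psi> \<ge> ennreal (exp (- E))"
proof -
  interpret finite_product_sigma_finite "\<lambda>_::'d site. lborel :: real measure" \<Lambda> by standard (rule fin)
  let ?X = "PiE \<Lambda> (\<lambda>x. {\<psi> x..\<psi> x + 1})"
  have "emeasure (PiM \<Lambda> (\<lambda>_. lborel)) ?X = (\<Prod>x\<in>\<Lambda>. emeasure lborel {\<psi> x..\<psi> x + 1})" by (rule measure_times) simp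
  then have X: "emeasure (PiM \<Lambda> (\<lambda>_. lborel)) ?X = 1" by simp
  have "?X \<in> sets (PiM \<Lambda> (\<lambda>_. lborel))" using fin by (intro sets_PiM_I_finite) auto
  then have "ennreal (exp (- E)) = (\<integral>\<^sup>+\<phi>. ennreal (exp (- E)) * indicator ?X \<phi> \<partial>(PiM \<Lambda> (\<lambda>_. lborel)))"
    using X by (simp add: nn_integral_cmult_indicator)
  also have "\<dots> \<le> pfn U h \<Lambda> \<psi>" unfolding pfn_def
  proof (intro nn_integral_mono)
    fix \<phi>
    show "ennreal (exp (- E)) * indicator ?X \<phi> \<le> ennreal (wt U h \<Lambda> (extend \<Lambda> \<phi> \<psi>))"
    proof (cases "\<phi> \<in> ?X")
      case True
      then have "energy U h \<Lambda> (extend \<Lambda> \<phi> \<psi>) \<le> E" by (intro le) (auto simp: extend_def PiE_iff)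
      then show ?thesis using True by (simp add: wt_def ennreal_leI)
    qed simp
  qed
  finally show ?thesis .
qed

lemma pfn_pos: assumes fin: "finite \<Lambda>" shows "pfn U h \<Lambda> \<psi> > 0"
proof (rule ccontr)
  interpret finite_product_sigma_finite "\<lambda>_::'d site. lborel :: real measure" \<Lambda> by standard (rule fin)
  assume "\<not> pfn U h \<Lambda> \<psi> > 0"
  then have "pfn U h \<Lambda> \<psi> = 0" by simp
  then have "AE \<phi> in PiM \<Lambda> (\<lambda>_. lborel). ennreal (wt U h \<Lambda> (extend \<Lambda> \<phi> \<psi>)) = 0"
    unfolding pfn_def by (subst (asm) nn_integral_0_iff_AE) auto
  then have "AE \<phi> in PiM \<Lambda> (\<lambda>_. lborel :: real measure). False"
    by eventually_elim (use wt_pos[of U h \<Lambda>] in \<open>auto simp: ennreal_eq_0_iff not_le[symmetric] simp del: wt_pos\<close>)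
  then have z: "emeasure (PiM \<Lambda> (\<lambda>_. lborel :: real measure)) (space (PiM \<Lambda> (\<lambda>_. lborel))) = 0"
    by (subst (asm) AE_iff_measurable[OF sets.top]) auto
  have "emeasure (PiM \<Lambda> (\<lambda>_. lborel)) (PiE \<Lambda> (\<lambda>x. {0::real..1})) = (\<Prod>x\<in>\<Lambda>. emeasure lborel {0::real..1})" by (rule measure_times) simp
  moreover have "emeasure (PiM \<Lambda> (\<lambda>_. lborel)) (PiE \<Lambda> (\<lambda>x. {0::real..1})) \<le> emeasure (PiM \<Lambda> (\<lambda>_. lborel :: real measure)) (space (PiM \<Lambda> (\<lambda>_. lborel)))"
    by (rule emeasure_space)
  ultimately show False using z by simp
qed

lemma gib_eq:
  assumes fin: "finite \<Lambda>"
  shows "gib U h \<Lambda> \<psi> = distr (density (PiM \<Lambda> (\<lambda>_. lborel)) (\<lambda>\<phi>. ennreal (wt U h \<Lambda> (extend \<Lambda> \<phi> \<psi>)) / pfn U h \<Lambda> \<psi>)) HS (\<lambda>\<phi>. extend \<Lambda> \<phi> \<psi>)"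
proof -
  have "exp (- hamf U h \<Lambda> \<psi> (extend \<Lambda> \<phi> \<psi>)) = wt U h \<Lambda> (extend \<Lambda> \<phi> \<psi>)" for \<phi>
    unfolding wt_def by (subst hamf_eq_energy) (auto simp: extend_def fin even)
  then show ?thesis unfolding fv_gibbs_def pfn_def Let_def by simp
qed

lemma sets_gib [simp, measurable_cong]: "sets (gib U h \<Lambda> \<psi>) = sets HS"
  by (simp add: fv_gibbs_def Let_def)

lemma space_gib [simp]: "space (gib U h \<Lambda> \<psi>) = UNIV"
  by (simp add: fv_gibbs_def Let_def)

lemma nn_integral_gib:
  assumes fin: "finite \<Lambda>" and [measurable]: "G \<in> borel_measurable HS"
  shows "(\<integral>\<^sup>+\<phi>. G \<phi> \<partial>gib U h \<Lambda> \<psi>) =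
    (\<integral>\<^sup>+\<phi>. ennreal (wt U h \<Lambda> (extend \<Lambda> \<phi> \<psi>)) * G (extend \<Lambda> \<phi> \<psi>) \<partial>(PiM \<Lambda> (\<lambda>_. lborel))) / pfn U h \<Lambda> \<psi>"
proof -
  have [measurable]: "(\<lambda>\<phi>. extend \<Lambda> \<phi> \<psi>) \<in> measurable (PiM \<Lambda> (\<lambda>_. lborel)) HS" by measurable
  have "(\<integral>\<^sup>+\<phi>. G \<phi> \<partial>gib U h \<Lambda> \<psi>) = (\<integral>\<^sup>+\<phi>. ennreal (wt U h \<Lambda> (extend \<Lambda> \<phi> \<psi>)) / pfn U h \<Lambda> \<psi> * G (extend \<Lambda> \<phi> \<psi>) \<partial>(PiM \<Lambda> (\<lambda>_. lborel)))"
    unfolding gib_eq[OF fin] by (simp add: nn_integral_distr nn_integral_density)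
  also have "\<dots> = (\<integral>\<^sup>+\<phi>. (ennreal (wt U h \<Lambda> (extend \<Lambda> \<phi> \<psi>)) * G (extend \<Lambda> \<phi> \<psi>)) / pfn U h \<Lambda> \<psi> \<partial>(PiM \<Lambda> (\<lambda>_. lborel)))"
    by (simp add: ennreal_times_divide mult.commute)
  finally show ?thesis by (simp add: nn_integral_divide)
qed

lemma prob_space_gib: assumes fin: "finite \<Lambda>" shows "prob_space (gib U h \<Lambda> \<psi>)"
proof
  have "emeasure (gib U h \<Lambda> \<psi>) (space (gib U h \<Lambda> \<psi>)) = (\<integral>\<^sup>+\<phi>. 1 \<partial>gib U h \<Lambda> \<psi>)" by simp
  also have "\<dots> = pfn U h \<Lambda> \<psi> / pfn U h \<Lambda> \<psi>" by (subst nn_integral_gib[OF fin]) (simp_all add: pfn_def)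
  also have "\<dots> = 1" using pfn_finite[OF fin, of \<psi>] pfn_pos[OF fin, of \<psi>] by (simp add: ennreal_divide_self)
  finally show "emeasure (gib U h \<Lambda> \<psi>) (space (gib U h \<Lambda> \<psi>)) = 1" .
qed

end

section \<open>Kernel property and consistency of nested boxes\<close>

lemma extend_extend: "extend \<Lambda> \<phi> (extend \<Lambda> \<phi>' \<psi>) = extend \<Lambda> \<phi> \<psi>"
  by (auto simp: extend_def)

context potential begin

lemma pfn_measurable [measurable]: "pfn U h \<Lambda> \<in> borel_measurable HS" if "finite \<Lambda>"
proof -
  interpret finite_product_sigma_finite "\<lambda>_::'d site. lborel :: real measure" \<Lambda> by standard (rule that)
  have "(\<lambda>\<psi>. \<integral>\<^sup>+\<phi>. ennreal (wt U h \<Lambda> (extend \<Lambda> \<phi> \<psi>)) \<partial>(PiM \<Lambda> (\<lambda>_. lborel))) \<in> borel_measurable HS"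
    by measurable
  then show ?thesis by (simp add: pfn_def[abs_def])
qed

lemma nn_integral_gib_measurable:
  assumes fin: "finite \<Lambda>" and [measurable]: "G \<in> borel_measurable HS"
  shows "(\<lambda>\<psi>. \<integral>\<^sup>+\<phi>. G \<phi> \<partial>gib U h \<Lambda> \<psi>) \<in> borel_measurable HS"
proof -
  interpret finite_product_sigma_finite "\<lambda>_::'d site. lborel :: real measure" \<Lambda> by standard (rule fin)
  show ?thesis unfolding nn_integral_gib[OF assms] using fin by measurable
qed

lemma gib_kernel:
  assumes fin: "finite \<Lambda>"
  shows "gib U h \<Lambda> \<in> measurable HS (prob_algebra HS)"
proof (rule measurable_prob_algebraI)
  show "prob_space (gib U h \<Lambda> \<psi>)" for \<psi> by (rule prob_space_gib[OF fin])
  show "gib U h \<Lambda> \<in> measurable HS (subprob_algebra HS)"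
  proof (rule measurable_subprob_algebra)
    show "subprob_space (gib U h \<Lambda> \<psi>)" for \<psi> by (intro prob_space_imp_subprob_space prob_space_gib fin)
    show "(\<lambda>\<psi>. emeasure (gib U h \<Lambda> \<psi>) X) \<in> borel_measurable HS" if "X \<in> sets HS" for X
      using nn_integral_gib_measurable[OF fin, of "indicator X"] that by simp
  qed simp
qed

lemma energy_split:
  assumes fin: "finite \<Delta>" and sub: "\<Lambda> \<subseteq> \<Delta>"
  shows "energy U h \<Delta> \<phi> = energy U h \<Lambda> \<phi> + ((\<Sum>b\<in>bnd \<Delta> - bnd \<Lambda>. U (fst b) (snd b) (gd \<phi> b)) + 1/2 * (\<Sum>x\<in>\<Delta> - \<Lambda>. h x * \<phi> x))"
  using sum.subset_diff[OF bnd_mono[OF sub] finite_bnd[OF fin], of "\<lambda>b. U (fst b) (snd b) (gd \<phi> b)"]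
    sum.subset_diff[OF sub fin, of "\<lambda>x. h x * \<phi> x"] by (simp add: energy_def algebra_simps)

text \<open>The weight of the large box is that of the small one times a factor
  \<open>exp (- r)\<close> blind to the heights in \<Lambda>. Integrating those heights first, the
  inner average times \<open>pfn U h \<Lambda>\<close> gives back the unnormalised integral of
  \<open>G\<close>.\<close>

lemma gib_consistent_nn:
  assumes fin: "finite \<Delta>" and sub: "\<Lambda> \<subseteq> \<Delta>" and [measurable]: "G \<in> borel_measurable HS"
  shows "(\<integral>\<^sup>+\<phi>. (\<integral>\<^sup>+\<phi>'. G \<phi>' \<partial>gib U h \<Lambda> \<phi>) \<partial>gib U h \<Delta> \<psi>) = (\<integral>\<^sup>+\<phi>. G \<phi> \<partial>gib U h \<Delta> \<psi>)"
proof -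
  interpret product_sigma_finite "\<lambda>_::'d site. lborel :: real measure" by standard
  have finL: "finite \<Lambda>" using sub fin finite_subset by blast
  interpret L: finite_product_sigma_finite "\<lambda>_::'d site. lborel :: real measure" \<Lambda> by standard (rule finL)
  define I where "I = \<Delta> - \<Lambda>"
  have I: "I \<inter> \<Lambda> = {}" "finite I" "I \<union> \<Lambda> = \<Delta>" using fin sub by (auto simp: I_def)
  define r where "r \<phi> = (\<Sum>b\<in>bnd \<Delta> - bnd \<Lambda>. U (fst b) (snd b) (gd \<phi> b)) + 1/2 * (\<Sum>x\<in>\<Delta> - \<Lambda>. h x * \<phi> x)" for \<phi>
  have rm [measurable]: "r \<in> borel_measurable HS" unfolding r_def by measurable
  have r_ext: "r (extend \<Lambda> y \<phi>) = r \<phi>" for y \<phi>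
    unfolding r_def by (intro arg_cong2[where f=plus] arg_cong2[where f=times] refl sum.cong)
      (auto simp: gd_def extend_def bnd_def)
  have wt: "wt U h \<Delta> \<phi> = exp (- r \<phi>) * wt U h \<Lambda> \<phi>" for \<phi>
    unfolding wt_def energy_split[OF fin sub] r_def by (simp add: exp_add[symmetric])
  define Q where "Q \<phi> = (\<integral>\<^sup>+\<phi>'. G \<phi>' \<partial>gib U h \<Lambda> \<phi>)" for \<phi>
  have Qm [measurable]: "Q \<in> borel_measurable HS" unfolding Q_def by (rule nn_integral_gib_measurable[OF finL]) measurable
  have mrg: "extend \<Delta> (merge I \<Lambda> (x, y)) \<psi> = extend \<Lambda> y (extend I x \<psi>)" for x y
    using I by (auto simp: extend_def merge_def fun_eq_iff)
  have fold: "(\<integral>\<^sup>+\<phi>. ennreal (wt U h \<Delta> (extend \<Delta> \<phi> \<psi>)) * K (extend \<Delta> \<phi> \<psi>) \<partial>(PiM \<Delta> (\<lambda>_. lborel)))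
     = (\<integral>\<^sup>+x. ennreal (exp (- r (extend I x \<psi>))) * (\<integral>\<^sup>+y. ennreal (wt U h \<Lambda> (extend \<Lambda> y (extend I x \<psi>))) * K (extend \<Lambda> y (extend I x \<psi>)) \<partial>(PiM \<Lambda> (\<lambda>_. lborel))) \<partial>(PiM I (\<lambda>_. lborel)))"
    if [measurable]: "K \<in> borel_measurable HS" for K
  proof -
    have "(\<integral>\<^sup>+\<phi>. ennreal (wt U h \<Delta> (extend \<Delta> \<phi> \<psi>)) * K (extend \<Delta> \<phi> \<psi>) \<partial>(PiM \<Delta> (\<lambda>_. lborel)))
      = (\<integral>\<^sup>+x. \<integral>\<^sup>+y. ennreal (wt U h \<Delta> (extend \<Delta> (merge I \<Lambda> (x, y)) \<psi>)) * K (extend \<Delta> (merge I \<Lambda> (x, y)) \<psi>) \<partial>(PiM \<Lambda> (\<lambda>_. lborel)) \<partial>(PiM I (\<lambda>_. lborel)))"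
      unfolding I(3)[symmetric] by (rule product_nn_integral_fold) (use I finL in auto)
    also have "\<dots> = (\<integral>\<^sup>+x. \<integral>\<^sup>+y. ennreal (exp (- r (extend I x \<psi>))) * (ennreal (wt U h \<Lambda> (extend \<Lambda> y (extend I x \<psi>))) * K (extend \<Lambda> y (extend I x \<psi>))) \<partial>(PiM \<Lambda> (\<lambda>_. lborel)) \<partial>(PiM I (\<lambda>_. lborel)))"
      unfolding mrg wt r_ext by (simp add: ennreal_mult mult.assoc)
    also have "\<dots> = (\<integral>\<^sup>+x. ennreal (exp (- r (extend I x \<psi>))) * (\<integral>\<^sup>+y. ennreal (wt U h \<Lambda> (extend \<Lambda> y (extend I x \<psi>))) * K (extend \<Lambda> y (extend I x \<psi>)) \<partial>(PiM \<Lambda> (\<lambda>_. lborel))) \<partial>(PiM I (\<lambda>_. lborel)))"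
      by (intro nn_integral_cong nn_integral_cmult) measurable
    finally show ?thesis .
  qed
  \<comment> \<open>The inner average sees its argument only off \<Lambda>, so it leaves the
    integral over \<Lambda> as a constant.\<close>
  have Qext: "Q (extend \<Lambda> y \<phi>) = Q \<phi>" for y \<phi>
    unfolding Q_def by (subst (1 2) nn_integral_gib[OF finL]) (simp_all add: extend_extend pfn_def)
  have inner: "(\<integral>\<^sup>+y. ennreal (wt U h \<Lambda> (extend \<Lambda> y \<phi>)) * Q (extend \<Lambda> y \<phi>) \<partial>(PiM \<Lambda> (\<lambda>_. lborel)))
      = (\<integral>\<^sup>+y. ennreal (wt U h \<Lambda> (extend \<Lambda> y \<phi>)) * G (extend \<Lambda> y \<phi>) \<partial>(PiM \<Lambda> (\<lambda>_. lborel)))" for \<phi>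
  proof -
    have "(\<integral>\<^sup>+y. ennreal (wt U h \<Lambda> (extend \<Lambda> y \<phi>)) * Q (extend \<Lambda> y \<phi>) \<partial>(PiM \<Lambda> (\<lambda>_. lborel))) = pfn U h \<Lambda> \<phi> * Q \<phi>"
      unfolding Qext pfn_def by (rule nn_integral_multc) measurable
    also have "\<dots> = (\<integral>\<^sup>+y. ennreal (wt U h \<Lambda> (extend \<Lambda> y \<phi>)) * G (extend \<Lambda> y \<phi>) \<partial>(PiM \<Lambda> (\<lambda>_. lborel)))"
    proof -
      \<comment> \<open>Cancellation in \<open>ennreal\<close> requires the partition function to be
        neither 0 nor infinite.\<close>
      have "p * (t / p) = t" if "0 < p" "p < \<infinity>" for p t :: ennreal
        using that ennreal_mult_divide_eq[of p t] by (auto simp: ennreal_times_divide mult.commute)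
      then show ?thesis unfolding Q_def nn_integral_gib[OF finL assms(3)]
        using pfn_finite[OF finL, of \<phi>] pfn_pos[OF finL, of \<phi>] by blast
    qed
    finally show ?thesis .
  qed
  have "(\<integral>\<^sup>+\<phi>. Q \<phi> \<partial>gib U h \<Delta> \<psi>) = (\<integral>\<^sup>+\<phi>. G \<phi> \<partial>gib U h \<Delta> \<psi>)"
    unfolding nn_integral_gib[OF fin Qm] nn_integral_gib[OF fin assms(3)] fold[OF Qm] fold[OF assms(3)] inner ..
  then show ?thesis by (simp add: Q_def)
qed

lemma gib_consistent:
  fixes G :: "('d site \<Rightarrow> real) \<Rightarrow> real"
  assumes fin: "finite \<Delta>" and sub: "\<Lambda> \<subseteq> \<Delta>" and G [measurable]: "G \<in> borel_measurable HS" and bd: "\<And>\<phi>. \<bar>G \<phi>\<bar> \<le> K"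
  shows "(\<integral>\<phi>. (\<integral>\<phi>'. G \<phi>' \<partial>gib U h \<Lambda> \<phi>) \<partial>gib U h \<Delta> \<psi>) = (\<integral>\<phi>. G \<phi> \<partial>gib U h \<Delta> \<psi>)"
proof -
  have finL: "finite \<Lambda>" using sub fin finite_subset by blast
  have k: "gib U h \<Lambda> \<in> measurable (gib U h \<Delta> \<psi>) (subprob_algebra HS)"
    using measurable_prob_algebraD[OF gib_kernel[OF finL]] by simp
  interpret D: prob_space "gib U h \<Delta> \<psi>" by (rule prob_space_gib[OF fin])
  have "gib U h \<Delta> \<psi> \<bind> gib U h \<Lambda> = gib U h \<Delta> \<psi>"
  proof (rule measure_eqI)
    show "sets (gib U h \<Delta> \<psi> \<bind> gib U h \<Lambda>) = sets (gib U h \<Delta> \<psi>)"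
      by (subst sets_bind[where N=HS]) auto
    fix X assume "X \<in> sets (gib U h \<Delta> \<psi> \<bind> gib U h \<Lambda>)"
    then have X: "X \<in> sets HS" by (subst (asm) sets_bind[where N=HS]) auto
    have "emeasure (gib U h \<Delta> \<psi> \<bind> gib U h \<Lambda>) X = (\<integral>\<^sup>+\<phi>. emeasure (gib U h \<Lambda> \<phi>) X \<partial>gib U h \<Delta> \<psi>)"
      by (rule emeasure_bind[OF _ k X]) simp
    then show "emeasure (gib U h \<Delta> \<psi> \<bind> gib U h \<Lambda>) X = emeasure (gib U h \<Delta> \<psi>) X"
      using gib_consistent_nn[OF fin sub, of "indicator X" \<psi>] X by simp
  qed
  then have "(\<integral>\<phi>. G \<phi> \<partial>gib U h \<Delta> \<psi>) = (\<integral>\<phi>. G \<phi> \<partial>(gib U h \<Delta> \<psi> \<bind> gib U h \<Lambda>))" by simp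
  also have "\<dots> = (\<integral>\<phi>. (\<integral>\<phi>'. G \<phi>' \<partial>gib U h \<Lambda> \<phi>) \<partial>gib U h \<Delta> \<psi>)"
    by (rule integral_bind[OF G bd k, of 1])
      (auto intro!: D.finite_measure_axioms prob_space.emeasure_space_1 simp: prob_space.emeasure_le_1 prob_space_gib finL)
  finally show ?thesis by simp
qed

lemma integral_gib:
  fixes G :: "('d site \<Rightarrow> real) \<Rightarrow> real"
  assumes fin: "finite \<Lambda>" and [measurable]: "G \<in> borel_measurable HS" and bd: "\<And>\<phi>. \<bar>G \<phi>\<bar> \<le> K"
  shows "(\<integral>\<phi>. G \<phi> \<partial>gib U h \<Lambda> \<psi>) =
    (\<integral>\<phi>. wt U h \<Lambda> (extend \<Lambda> \<phi> \<psi>) * G (extend \<Lambda> \<phi> \<psi>) \<partial>(PiM \<Lambda> (\<lambda>_. lborel))) / enn2real (pfn U h \<Lambda> \<psi>)"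
proof -
  let ?Z = "enn2real (pfn U h \<Lambda> \<psi>)"
  have Z: "pfn U h \<Lambda> \<psi> = ennreal ?Z" "0 < ?Z"
    using pfn_finite[OF fin, of \<psi>] pfn_pos[OF fin, of \<psi>] by (simp_all add: enn2real_positive_iff)
  have [measurable]: "(\<lambda>\<phi>. extend \<Lambda> \<phi> \<psi>) \<in> measurable (PiM \<Lambda> (\<lambda>_. lborel)) HS" by measurable
  have "ennreal (wt U h \<Lambda> (extend \<Lambda> \<phi> \<psi>)) / pfn U h \<Lambda> \<psi> = ennreal (wt U h \<Lambda> (extend \<Lambda> \<phi> \<psi>) / ?Z)" for \<phi>
    using Z(2) by (subst Z(1)) (simp add: divide_ennreal)
  then have "(\<integral>\<phi>. G \<phi> \<partial>gib U h \<Lambda> \<psi>) = (\<integral>\<phi>. (wt U h \<Lambda> (extend \<Lambda> \<phi> \<psi>) / ?Z) *\<^sub>R G (extend \<Lambda> \<phi> \<psi>) \<partial>(PiM \<Lambda> (\<lambda>_. lborel)))"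
    unfolding gib_eq[OF fin] using Z(2) by (simp add: integral_distr integral_density)
  also have "\<dots> = (\<integral>\<phi>. wt U h \<Lambda> (extend \<Lambda> \<phi> \<psi>) * G (extend \<Lambda> \<phi> \<psi>) / ?Z \<partial>(PiM \<Lambda> (\<lambda>_. lborel)))"
    by (simp add: mult.commute)
  finally show ?thesis by simp
qed

lemma integrable_wt:
  assumes fin: "finite \<Lambda>" shows "integrable (PiM \<Lambda> (\<lambda>_. lborel)) (\<lambda>\<phi>. wt U h \<Lambda> (extend \<Lambda> \<phi> \<psi>))"
    and "(\<integral>\<phi>. wt U h \<Lambda> (extend \<Lambda> \<phi> \<psi>) \<partial>(PiM \<Lambda> (\<lambda>_. lborel))) = enn2real (pfn U h \<Lambda> \<psi>)"
  using pfn_finite[OF fin, of \<psi>] unfolding pfn_def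
  by (auto intro!: integrableI_nonneg simp: integral_eq_nn_integral)

end

text \<open>Relabelling of sites and vertical translation are handled at once: the first serves
  shift covariance, the second the fact that a gradient field fixes heights only up to a constant.
  Rectangles are mapped to rectangles, and each side keeps its length.\<close>

lemma PiM_lborel_shift:
  fixes \<Lambda> :: "'d::finite site set" and c :: real
  assumes fin: "finite \<Lambda>"
  shows "PiM \<Lambda> (\<lambda>_. lborel) = distr (PiM ((\<lambda>x. x - v) ` \<Lambda>) (\<lambda>_. lborel)) (PiM \<Lambda> (\<lambda>_. lborel)) (\<lambda>\<phi>. \<lambda>x\<in>\<Lambda>. \<phi> (x - v) + c)"
proof (rule sym, rule product_sigma_finite.PiM_eqI)
  let ?L = "(\<lambda>x. x - v) ` \<Lambda>"
  interpret finite_product_sigma_finite "\<lambda>_::'d site. lborel :: real measure" ?L by standard (use fin in auto)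
  show "product_sigma_finite (\<lambda>_::'d site. lborel :: real measure)" by standard
  fix X :: "'d site \<Rightarrow> real set" assume X: "\<And>x. x \<in> \<Lambda> \<Longrightarrow> X x \<in> sets lborel"
  let ?f = "\<lambda>\<phi>. \<lambda>x\<in>\<Lambda>. \<phi> (x - v) + c"
  have comp: "(\<lambda>\<phi>. \<phi> (x - v)) \<in> measurable (PiM ?L (\<lambda>_. lborel)) (lborel :: real measure)" if "x \<in> \<Lambda>" for x
    using that by (intro measurable_component_singleton) auto
  have m: "?f \<in> measurable (PiM ?L (\<lambda>_. lborel)) (PiM \<Lambda> (\<lambda>_. lborel))"
    using comp by (intro measurable_restrict) simp
  have "?f -` (PiE \<Lambda> X) \<inter> space (PiM ?L (\<lambda>_. lborel)) = PiE ?L (\<lambda>y. (\<lambda>s. s + c) -` X (y + v))"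
    by (auto simp: space_PiM PiE_iff extensional_def)
  then have "emeasure (distr (PiM ?L (\<lambda>_. lborel)) (PiM \<Lambda> (\<lambda>_. lborel)) ?f) (PiE \<Lambda> X) = emeasure (PiM ?L (\<lambda>_. lborel)) (PiE ?L (\<lambda>y. (\<lambda>s. s + c) -` X (y + v)))"
    using X fin by (subst emeasure_distr[OF m]) (auto intro!: sets_PiM_I_finite)
  also have "\<dots> = (\<Prod>y\<in>?L. emeasure lborel ((\<lambda>s. s + c) -` X (y + v)))"
  proof (rule measure_times)
    fix y assume "y \<in> ?L"
    then have "X (y + v) \<in> sets borel" using X by auto
    then show "(\<lambda>s. s + c) -` X (y + v) \<in> sets lborel"
      using measurable_sets_borel[of "\<lambda>s. s + c" borel "X (y + v)"] by simp
  qed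
  also have "\<dots> = (\<Prod>x\<in>\<Lambda>. emeasure lborel ((\<lambda>s. s + c) -` X x))"
    by (subst prod.reindex) (auto simp: inj_on_def)
  also have "\<dots> = (\<Prod>x\<in>\<Lambda>. emeasure lborel (X x))"
  proof (rule prod.cong)
    fix x assume "x \<in> \<Lambda>"
    then have "X x \<in> sets borel" using X by simp
    then have "emeasure (distr lborel borel (\<lambda>s. s + c)) (X x) = emeasure lborel ((\<lambda>s. s + c) -` X x)"
      by (subst emeasure_distr) auto
    then show "emeasure lborel ((\<lambda>s. s + c) -` X x) = emeasure lborel (X x)"
      using lborel_distr_plus[of c] by (simp add: add.commute[of _ c])
  qed simp
  finally show "emeasure (distr (PiM ?L (\<lambda>_. lborel)) (PiM \<Lambda> (\<lambda>_. lborel)) ?f) (PiE \<Lambda> X) = (\<Prod>x\<in>\<Lambda>. emeasure lborel (X x))" .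
qed (use fin in auto)

text \<open>Bond terms are blind to the constant \<open>c\<close>. Only the field notices it,
  through a term free of \<phi> that the normalisation will cancel.\<close>

lemma energy_shift:
  assumes U: "\<And>x i. U x i = U' (x - v) i" and h: "\<And>x. h x = h' (x - v)"
  shows "energy U h \<Lambda> (\<lambda>x. \<phi> (x - v) + c) = energy U' h' ((\<lambda>x. x - v) ` \<Lambda>) \<phi> + c/2 * (\<Sum>x\<in>\<Lambda>. h x)"
proof -
  have bs: "bnd ((\<lambda>x. x - v) ` \<Lambda>) = (\<lambda>(x, i). (x - v, i)) ` bnd \<Lambda>"
  proof (intro set_eqI iffI)
    fix b assume "b \<in> bnd ((\<lambda>x. x - v) ` \<Lambda>)"
    then obtain y i where b: "b = (y, i)" "y \<in> (\<lambda>x. x - v) ` \<Lambda> \<or> y + unitv i \<in> (\<lambda>x. x - v) ` \<Lambda>" by (auto simp: bnd_def)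
    have eq: "y \<in> (\<lambda>x. x - v) ` \<Lambda> \<longleftrightarrow> y + v \<in> \<Lambda>" for y by (auto intro!: image_eqI[of _ _ "y + v"])
    have "(y + v, i) \<in> bnd \<Lambda>" using b(2) unfolding eq by (auto simp: bnd_def algebra_simps)
    then show "b \<in> (\<lambda>(x, i). (x - v, i)) ` bnd \<Lambda>" using b(1) by (intro image_eqI[of _ _ "(y + v, i)"]) auto
  next
    fix b assume "b \<in> (\<lambda>(x, i). (x - v, i)) ` bnd \<Lambda>"
    then obtain x i where "b = (x - v, i)" "x \<in> \<Lambda> \<or> x + unitv i \<in> \<Lambda>" by (auto simp: bnd_def)
    moreover have "x - v + unitv i = (x + unitv i) - v" by simp
    ultimately show "b \<in> bnd ((\<lambda>x. x - v) ` \<Lambda>)" unfolding bnd_def by auto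
  qed
  have inj: "inj_on (\<lambda>(x, i). (x - v, i)) (bnd \<Lambda>)" by (auto simp: inj_on_def)
  have 1: "(\<Sum>b\<in>bnd ((\<lambda>x. x - v) ` \<Lambda>). U' (fst b) (snd b) (gd \<phi> b)) = (\<Sum>b\<in>bnd \<Lambda>. U (fst b) (snd b) (gd (\<lambda>x. \<phi> (x - v) + c) b))"
    unfolding bs by (subst sum.reindex[OF inj]) (auto simp: U gd_def algebra_simps intro!: sum.cong)
  have 2: "(\<Sum>x\<in>(\<lambda>x. x - v) ` \<Lambda>. h' x * \<phi> x) = (\<Sum>x\<in>\<Lambda>. h x * \<phi> (x - v))"
    by (subst sum.reindex) (auto simp: h inj_on_def)
  show ?thesis unfolding energy_def 1 2 by (simp add: distrib_left sum.distrib sum_distrib_left sum_distrib_right mult.commute)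
qed

lemma ennreal_inverse_antimono: "a \<le> b \<Longrightarrow> inverse b \<le> inverse (a::ennreal)"
proof (cases a; cases b)
  fix r t :: real assume h: "a \<le> b" "0 \<le> r" "a = ennreal r" "0 \<le> t" "b = ennreal t"
  show "inverse b \<le> inverse a"
  proof (cases "r = 0")
    case False
    then show ?thesis using h by (auto simp: inverse_ennreal intro!: ennreal_leI)
  qed (simp add: h)
qed (auto simp: top_unique)

lemma UNIV_HS [simp]: "UNIV \<in> sets HS"
  using sets.top[of HS] by simp

lemma ennreal_mult_divide_cancel_left:
  fixes a b k :: ennreal
  assumes "0 < b" "b < \<infinity>" "0 < k" "k < \<infinity>"
  shows "(k * a) / (k * b) = a / b"
proof -
  have "a = a / b * b" using assms ennreal_mult_divide_eq[of b a] by (auto simp: ennreal_times_divide mult.commute)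
  then have "k * a = (a / b) * (k * b)" by (metis mult.assoc mult.commute)
  moreover have "k * b \<noteq> 0" "k * b \<noteq> top" using assms by (auto simp: ennreal_mult_eq_top_iff)
  ultimately show ?thesis using ennreal_mult_divide_eq[of "k * b" "a / b"] by simp
qed

text \<open>The unnormalised weight and the partition function are both multiplied by the same
  constant \<open>k\<close>. The case \<open>c = 0\<close> gives lattice shifts; the case
  \<open>v = 0\<close> gives independence of the heights chosen for a gradient field.\<close>

lemma gib_shift:
  fixes U U' :: "'d::finite site \<Rightarrow> 'd \<Rightarrow> real \<Rightarrow> real" and c :: real
  assumes p: "potential U h A Bf j" and p': "potential U' h' A Bf' j'" and fin: "finite \<Lambda>"
    and U: "\<And>x i. U x i = U' (x - v) i" and h: "\<And>x. h x = h' (x - v)"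
  shows "gib U h \<Lambda> (\<lambda>x. \<psi> (x - v) + c) = distr (gib U' h' ((\<lambda>x. x - v) ` \<Lambda>) \<psi>) HS (\<lambda>\<phi> x. \<phi> (x - v) + c)"
proof -
  interpret p: potential U h A Bf j by fact
  interpret p': potential U' h' A Bf' j' by fact
  let ?L = "(\<lambda>x. x - v) ` \<Lambda>"
  define T where "T \<phi> x = \<phi> (x - v) + c" for \<phi> :: "'d site \<Rightarrow> real" and x
  have [measurable]: "T \<in> measurable HS HS" by (rule measurable_HS_I) (simp add: T_def)
  define k where "k = exp (- (c/2 * (\<Sum>x\<in>\<Lambda>. h x)))"
  have wt: "wt U h \<Lambda> (T \<phi>) = k * wt U' h' ?L \<phi>" for \<phi>
    unfolding wt_def T_def energy_shift[of U U' v h h', OF U h] k_def by (simp add: exp_add[symmetric])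
  have ext: "extend \<Lambda> (\<lambda>x\<in>\<Lambda>. \<phi> (x - v) + c) (T \<psi>) = T (extend ?L \<phi> \<psi>)" for \<phi>
    by (auto simp: extend_def T_def fun_eq_iff)
  have fL: "finite ?L" using fin by simp
  have f [measurable]: "(\<lambda>\<phi>. \<lambda>x\<in>\<Lambda>. \<phi> (x - v) + c) \<in> measurable (PiM ?L (\<lambda>_. lborel)) (PiM \<Lambda> (\<lambda>_. lborel :: real measure))"
  proof (rule measurable_restrict)
    fix x assume "x \<in> \<Lambda>"
    then have "(\<lambda>\<phi>. \<phi> (x - v)) \<in> measurable (PiM ?L (\<lambda>_. lborel)) (lborel :: real measure)"
      by (intro measurable_component_singleton) auto
    then show "(\<lambda>\<phi>. \<phi> (x - v) + c) \<in> measurable (PiM ?L (\<lambda>_. lborel)) (lborel :: real measure)" by simp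
  qed
  have key: "(\<integral>\<^sup>+\<phi>. ennreal (wt U h \<Lambda> (extend \<Lambda> \<phi> (T \<psi>))) * G (extend \<Lambda> \<phi> (T \<psi>)) \<partial>(PiM \<Lambda> (\<lambda>_. lborel)))
      = ennreal k * (\<integral>\<^sup>+\<phi>. ennreal (wt U' h' ?L (extend ?L \<phi> \<psi>)) * G (T (extend ?L \<phi> \<psi>)) \<partial>(PiM ?L (\<lambda>_. lborel)))"
    if [measurable]: "G \<in> borel_measurable HS" for G
  proof -
    have "(\<integral>\<^sup>+\<phi>. ennreal (wt U h \<Lambda> (extend \<Lambda> \<phi> (T \<psi>))) * G (extend \<Lambda> \<phi> (T \<psi>)) \<partial>(PiM \<Lambda> (\<lambda>_. lborel)))
      = (\<integral>\<^sup>+\<phi>. ennreal (wt U h \<Lambda> (extend \<Lambda> (\<lambda>x\<in>\<Lambda>. \<phi> (x - v) + c) (T \<psi>))) * G (extend \<Lambda> (\<lambda>x\<in>\<Lambda>. \<phi> (x - v) + c) (T \<psi>)) \<partial>(PiM ?L (\<lambda>_. lborel)))"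
      by (subst PiM_lborel_shift[OF fin, of v c]) (simp add: nn_integral_distr)
    also have "\<dots> = (\<integral>\<^sup>+\<phi>. ennreal k * (ennreal (wt U' h' ?L (extend ?L \<phi> \<psi>)) * G (T (extend ?L \<phi> \<psi>))) \<partial>(PiM ?L (\<lambda>_. lborel)))"
      unfolding ext wt by (simp add: ennreal_mult k_def mult.assoc)
    also have "\<dots> = ennreal k * (\<integral>\<^sup>+\<phi>. ennreal (wt U' h' ?L (extend ?L \<phi> \<psi>)) * G (T (extend ?L \<phi> \<psi>)) \<partial>(PiM ?L (\<lambda>_. lborel)))"
      by (rule nn_integral_cmult) measurable
    finally show ?thesis .
  qed
  have Z: "pfn U h \<Lambda> (T \<psi>) = ennreal k * pfn U' h' ?L \<psi>"
    using key[of "\<lambda>_. 1"] by (simp add: pfn_def)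
  have "gib U h \<Lambda> (T \<psi>) = distr (gib U' h' ?L \<psi>) HS T"
  proof (rule measure_eqI)
    fix X assume "X \<in> sets (gib U h \<Lambda> (T \<psi>))"
    then have X [measurable]: "X \<in> sets HS" by simp
    have X1: "(indicator X :: _ \<Rightarrow> ennreal) \<in> borel_measurable HS"
      and X2: "(\<lambda>\<phi>. indicator X (T \<phi>) :: ennreal) \<in> borel_measurable HS" by measurable
    have "emeasure (gib U h \<Lambda> (T \<psi>)) X = (\<integral>\<^sup>+\<phi>. indicator X \<phi> \<partial>gib U h \<Lambda> (T \<psi>))" by simp
    also have "\<dots> = (\<integral>\<^sup>+\<phi>. indicator X (T \<phi>) \<partial>gib U' h' ?L \<psi>)"
      using p'.pfn_finite[OF fL, of \<psi>] p'.pfn_pos[OF fL, of \<psi>]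
      by (subst p.nn_integral_gib[OF fin X1], subst p'.nn_integral_gib[OF fL X2], subst key[OF X1])
        (simp add: Z ennreal_mult_divide_cancel_left k_def)
    also have "\<dots> = (\<integral>\<^sup>+\<phi>. indicator X \<phi> \<partial>distr (gib U' h' ?L \<psi>) HS T)"
      by (rule nn_integral_distr[symmetric]) measurable
    also have "\<dots> = emeasure (distr (gib U' h' ?L \<psi>) HS T) X" by simp
    finally show "emeasure (gib U h \<Lambda> (T \<psi>)) X = emeasure (distr (gib U' h' ?L \<psi>) HS T) X" .
  qed simp
  then show ?thesis by (simp add: T_def[abs_def])
qed

text \<open>Numerator and partition function are integrals over the heights of functions jointly
  measurable in disorder and heights.\<close>

lemma gib_z_kernel:
  fixes \<Lambda> :: "'d::finite site set"
  assumes p: "\<And>z. z \<in> space Q \<Longrightarrow> potential (U z) (h z) A (Bf z) (j z)" and fin: "finite \<Lambda>"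
    and U: "\<And>x i. (\<lambda>(z, s). U z x i s) \<in> borel_measurable (Q \<Otimes>\<^sub>M borel)"
    and h: "\<And>x. (\<lambda>z. h z x) \<in> borel_measurable Q"
  shows "(\<lambda>z. gib (U z) (h z) \<Lambda> \<psi>) \<in> measurable Q (prob_algebra HS)"
proof (rule measurable_prob_algebraI)
  interpret finite_product_sigma_finite "\<lambda>_::'d site. lborel :: real measure" \<Lambda> by standard (rule fin)
  show pr: "prob_space (gib (U z) (h z) \<Lambda> \<psi>)" if "z \<in> space Q" for z
    using potential.prob_space_gib[OF p[OF that] fin] .
  have "(\<lambda>(z, \<phi>). wt (U z) (h z) \<Lambda> \<phi>) \<in> borel_measurable (Q \<Otimes>\<^sub>M HS)"
    using energy_joint_measurable[where \<Lambda>=\<Lambda>, OF U h] unfolding wt_def case_prod_beta' by measurable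
  moreover have "(\<lambda>p. (fst p, extend \<Lambda> (snd p) \<psi>)) \<in> measurable (Q \<Otimes>\<^sub>M PiM \<Lambda> (\<lambda>_. lborel)) (Q \<Otimes>\<^sub>M HS)"
    by measurable
  ultimately have w: "(\<lambda>p. wt (U (fst p)) (h (fst p)) \<Lambda> (extend \<Lambda> (snd p) \<psi>)) \<in> borel_measurable (Q \<Otimes>\<^sub>M PiM \<Lambda> (\<lambda>_. lborel))"
    by (rule measurable_compose[rotated, THEN measurable_cong[THEN iffD1, rotated]]) simp
  have nn: "(\<lambda>z. \<integral>\<^sup>+\<phi>. ennreal (wt (U z) (h z) \<Lambda> (extend \<Lambda> \<phi> \<psi>)) * indicator X (extend \<Lambda> \<phi> \<psi>) \<partial>(PiM \<Lambda> (\<lambda>_. lborel))) \<in> borel_measurable Q"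
    if [measurable]: "X \<in> sets HS" for X
  proof -
    note [measurable] = w
    show ?thesis by (rule borel_measurable_nn_integral) (unfold case_prod_beta', measurable)
  qed
  show "(\<lambda>z. gib (U z) (h z) \<Lambda> \<psi>) \<in> measurable Q (subprob_algebra HS)"
  proof (rule measurable_subprob_algebra)
    show "subprob_space (gib (U z) (h z) \<Lambda> \<psi>)" if "z \<in> space Q" for z
      by (intro prob_space_imp_subprob_space pr that)
    fix X :: "('d site \<Rightarrow> real) set" assume X: "X \<in> sets HS"
    have "(\<lambda>z. pfn (U z) (h z) \<Lambda> \<psi>) \<in> borel_measurable Q"
      unfolding pfn_def using nn[of UNIV] by simp
    then have "(\<lambda>z. (\<integral>\<^sup>+\<phi>. ennreal (wt (U z) (h z) \<Lambda> (extend \<Lambda> \<phi> \<psi>)) * indicator X (extend \<Lambda> \<phi> \<psi>) \<partial>(PiM \<Lambda> (\<lambda>_. lborel))) / pfn (U z) (h z) \<Lambda> \<psi>) \<in> borel_measurable Q"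
      using nn[OF X] by measurable
    moreover have "emeasure (gib (U z) (h z) \<Lambda> \<psi>) X = (\<integral>\<^sup>+\<phi>. ennreal (wt (U z) (h z) \<Lambda> (extend \<Lambda> \<phi> \<psi>)) * indicator X (extend \<Lambda> \<phi> \<psi>) \<partial>(PiM \<Lambda> (\<lambda>_. lborel))) / pfn (U z) (h z) \<Lambda> \<psi>"
      if "z \<in> space Q" for z
      using potential.nn_integral_gib[OF p[OF that] fin, of "indicator X" \<psi>] X
        potential.sets_gib[OF p[OF that]] by simp
    ultimately show "(\<lambda>z. emeasure (gib (U z) (h z) \<Lambda> \<psi>) X) \<in> borel_measurable Q"
      by (subst measurable_cong) auto
  qed (use potential.sets_gib[OF p] in auto)
qed

section \<open>Continuity in the boundary condition and the energy estimate\<close>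

context potential begin

text \<open>Dominated convergence: a Gaussian weight on the chains for the limiting boundary
  condition dominates uniformly in n, because the boundary conditions converge on the finitely many
  sites that matter.\<close>

lemma integral_wt_tendsto:
  fixes G :: "('d site \<Rightarrow> real) \<Rightarrow> real"
  assumes fin: "finite \<Lambda>" and [measurable]: "G \<in> borel_measurable HS" and bd: "\<And>\<phi>. \<bar>G \<phi>\<bar> \<le> K"
    and Gc: "\<And>(\<phi> :: nat \<Rightarrow> _) \<phi>'. (\<And>x. (\<lambda>n. \<phi> n x) \<longlonglongrightarrow> \<phi>' x) \<Longrightarrow> (\<lambda>n. G (\<phi> n)) \<longlonglongrightarrow> G \<phi>'"
    and lim: "\<And>x. (\<lambda>n::nat. \<psi> n x) \<longlonglongrightarrow> \<psi>' x"
  shows "(\<lambda>n. \<integral>\<phi>. wt U h \<Lambda> (extend \<Lambda> \<phi> (\<psi> n)) * G (extend \<Lambda> \<phi> (\<psi> n)) \<partial>(PiM \<Lambda> (\<lambda>_. lborel)))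
     \<longlonglongrightarrow> (\<integral>\<phi>. wt U h \<Lambda> (extend \<Lambda> \<phi> \<psi>') * G (extend \<Lambda> \<phi> \<psi>') \<partial>(PiM \<Lambda> (\<lambda>_. lborel)))"
proof -
  fix i :: 'd
  have K0: "0 \<le> K" using bd[of undefined] by linarith
  have gdl: "(\<lambda>n. gd (\<phi> n) b) \<longlonglongrightarrow> gd \<phi>' b" if "\<And>x. (\<lambda>n. \<phi> n x) \<longlonglongrightarrow> \<phi>' x" for b \<phi>' and \<phi> :: "nat \<Rightarrow> _"
    unfolding gd_def by (intro tendsto_diff that)
  have enl: "(\<lambda>n. energy U h \<Lambda> (\<phi> n)) \<longlonglongrightarrow> energy U h \<Lambda> \<phi>'" if *: "\<And>x. (\<lambda>n. \<phi> n x) \<longlonglongrightarrow> \<phi>' x" for \<phi>' and \<phi> :: "nat \<Rightarrow> _"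
    unfolding energy_def using cont
    by (intro tendsto_intros * isCont_tendsto_compose[OF _ gdl[OF *]]) (auto simp: continuous_on_eq_continuous_at)
  \<comment> \<open>Everything in the lower bound that depends on n but not on \<phi>; it converges,
    hence is bounded by some \<open>m\<close>.\<close>
  define q where "q n = low \<Lambda> (\<psi> n) - 3*A/4 * (\<Sum>x\<in>\<Lambda>. (\<psi> n (x + unitv i) - \<psi>' (x + unitv i))\<^sup>2)" for n
  have "q \<longlonglongrightarrow> low \<Lambda> \<psi>' - 3*A/4 * (\<Sum>x\<in>\<Lambda>. (\<psi>' (x + unitv i) - \<psi>' (x + unitv i))\<^sup>2)"
    unfolding q_def low_def dir_energy_def by (intro tendsto_intros lim gdl) auto
  then have "Bseq q" using convergent_imp_Bseq convergentI by blast
  then obtain m where m: "\<And>n. \<bar>q n\<bar> \<le> m" by (auto simp: Bseq_def)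
  define g where "g \<phi> = (\<Sum>x\<in>\<Lambda>. (gd (extend \<Lambda> \<phi> \<psi>') (x, i))\<^sup>2)" for \<phi>
  have dom: "wt U h \<Lambda> (extend \<Lambda> \<phi> (\<psi> n)) \<le> exp m * exp (- (3*A/8) * g \<phi>)" for n \<phi>
  proof -
    let ?e = "extend \<Lambda> \<phi> (\<psi> n)" and ?f = "extend \<Lambda> \<phi> \<psi>'"
    \<comment> \<open>Changing the boundary condition moves at most the upper end of such a bond, by
      an amount independent of \<phi>. This costs half of the quadratic term, hence
      \<open>3*A/8\<close> below.\<close>
    have "1/2 * (gd ?f (x, i))\<^sup>2 - (\<psi> n (x + unitv i) - \<psi>' (x + unitv i))\<^sup>2 \<le> (gd ?e (x, i))\<^sup>2" if "x \<in> \<Lambda>" for x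
    proof -
      define d where "d = gd ?f (x, i) - gd ?e (x, i)"
      have "d\<^sup>2 \<le> (\<psi> n (x + unitv i) - \<psi>' (x + unitv i))\<^sup>2"
        using that by (auto simp: d_def gd_def extend_def power2_commute)
      moreover have "(gd ?f (x, i))\<^sup>2 \<le> 2 * (gd ?e (x, i))\<^sup>2 + 2 * d\<^sup>2"
        using zero_le_power2[of "gd ?e (x, i) - d"] unfolding d_def by (simp add: power2_eq_square algebra_simps)
      ultimately show ?thesis by linarith
    qed
    then have "(\<Sum>x\<in>\<Lambda>. 1/2 * (gd ?f (x, i))\<^sup>2 - (\<psi> n (x + unitv i) - \<psi>' (x + unitv i))\<^sup>2) \<le> (\<Sum>x\<in>\<Lambda>. (gd ?e (x, i))\<^sup>2)"
      by (intro sum_mono)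
    also have "\<dots> \<le> dir_energy \<Lambda> ?e" by (rule dir_energy_chain[OF fin])
    finally have "1/2 * g \<phi> - (\<Sum>x\<in>\<Lambda>. (\<psi> n (x + unitv i) - \<psi>' (x + unitv i))\<^sup>2) \<le> dir_energy \<Lambda> ?e"
      by (simp add: sum_subtractf sum_distrib_left g_def)
    then have "3*A/4 * (1/2 * g \<phi> - (\<Sum>x\<in>\<Lambda>. (\<psi> n (x + unitv i) - \<psi>' (x + unitv i))\<^sup>2)) \<le> 3*A/4 * dir_energy \<Lambda> ?e"
      using A by (intro mult_left_mono) auto
    moreover have "energy U h \<Lambda> ?e \<ge> 3 * A/4 * dir_energy \<Lambda> ?e + low \<Lambda> (\<psi> n)" by (rule energy_lower[OF fin]) (simp add: extend_def)
    ultimately have "energy U h \<Lambda> ?e \<ge> 3*A/8 * g \<phi> + q n" by (simp add: q_def algebra_simps)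
    then have "- energy U h \<Lambda> ?e \<le> m + - (3*A/8) * g \<phi>" using m[of n] by simp
    then show ?thesis unfolding wt_def exp_add[symmetric] by simp
  qed
  have [measurable]: "g \<in> borel_measurable (PiM \<Lambda> (\<lambda>_. lborel))" unfolding g_def by measurable
  have gi: "integrable (PiM \<Lambda> (\<lambda>_. lborel)) (\<lambda>\<phi>. exp (- (3*A/8) * g \<phi>))"
    using gaussian_chain_integral[of "3*A/8" \<Lambda> \<psi>' i] A fin
    by (intro integrableI_nonneg) (auto simp: g_def[symmetric] power_less_top_ennreal)
  show ?thesis
  proof (rule integral_dominated_convergence)
    show "integrable (PiM \<Lambda> (\<lambda>_. lborel)) (\<lambda>\<phi>. K * (exp m * exp (- (3*A/8) * g \<phi>)))" using gi by auto
    have el: "(\<lambda>n. extend \<Lambda> \<phi> (\<psi> n) x) \<longlonglongrightarrow> extend \<Lambda> \<phi> \<psi>' x" for \<phi> x using lim by (simp add: extend_def)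
    show "AE \<phi> in PiM \<Lambda> (\<lambda>_. lborel). (\<lambda>n. wt U h \<Lambda> (extend \<Lambda> \<phi> (\<psi> n)) * G (extend \<Lambda> \<phi> (\<psi> n))) \<longlonglongrightarrow> wt U h \<Lambda> (extend \<Lambda> \<phi> \<psi>') * G (extend \<Lambda> \<phi> \<psi>')"
      unfolding wt_def by (intro AE_I2 tendsto_intros enl Gc el)
    show "AE \<phi> in PiM \<Lambda> (\<lambda>_. lborel). norm (wt U h \<Lambda> (extend \<Lambda> \<phi> (\<psi> n)) * G (extend \<Lambda> \<phi> (\<psi> n))) \<le> K * (exp m * exp (- (3*A/8) * g \<phi>))" for n
    proof (rule AE_I2)
      fix \<phi>
      have "\<bar>G (extend \<Lambda> \<phi> (\<psi> n))\<bar> * wt U h \<Lambda> (extend \<Lambda> \<phi> (\<psi> n)) \<le> K * (exp m * exp (- (3*A/8) * g \<phi>))"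
        by (intro mult_mono dom bd K0) auto
      then show "norm (wt U h \<Lambda> (extend \<Lambda> \<phi> (\<psi> n)) * G (extend \<Lambda> \<phi> (\<psi> n))) \<le> K * (exp m * exp (- (3*A/8) * g \<phi>))"
        by (simp add: abs_mult mult.commute)
    qed
  qed measurable
qed

text \<open>Numerator and partition function converge separately, and the limiting partition
  function is positive. This Feller property lets Gibbs kernels preserve test functions.\<close>

lemma integral_gib_tendsto:
  fixes G :: "('d site \<Rightarrow> real) \<Rightarrow> real"
  assumes fin: "finite \<Lambda>" and G: "G \<in> borel_measurable HS" and bd: "\<And>\<phi>. \<bar>G \<phi>\<bar> \<le> K"
    and Gc: "\<And>(\<phi> :: nat \<Rightarrow> _) \<phi>'. (\<And>x. (\<lambda>n. \<phi> n x) \<longlonglongrightarrow> \<phi>' x) \<Longrightarrow> (\<lambda>n. G (\<phi> n)) \<longlonglongrightarrow> G \<phi>'"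
    and lim: "\<And>x. (\<lambda>n::nat. \<psi> n x) \<longlonglongrightarrow> \<psi>' x"
  shows "(\<lambda>n. \<integral>\<phi>. G \<phi> \<partial>gib U h \<Lambda> (\<psi> n)) \<longlonglongrightarrow> (\<integral>\<phi>. G \<phi> \<partial>gib U h \<Lambda> \<psi>')"
proof -
  have "(\<lambda>n. \<integral>\<phi>. wt U h \<Lambda> (extend \<Lambda> \<phi> (\<psi> n)) * 1 \<partial>(PiM \<Lambda> (\<lambda>_. lborel)))
     \<longlonglongrightarrow> (\<integral>\<phi>. wt U h \<Lambda> (extend \<Lambda> \<phi> \<psi>') * 1 \<partial>(PiM \<Lambda> (\<lambda>_. lborel)))"
    by (rule integral_wt_tendsto[OF fin, of "\<lambda>_. 1" 1]) (auto intro: lim)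
  then have "(\<lambda>n. enn2real (pfn U h \<Lambda> (\<psi> n))) \<longlonglongrightarrow> enn2real (pfn U h \<Lambda> \<psi>')"
    by (simp add: integrable_wt[OF fin])
  moreover have "enn2real (pfn U h \<Lambda> \<psi>') \<noteq> 0"
    using pfn_finite[OF fin, of \<psi>'] pfn_pos[OF fin, of \<psi>'] by (auto simp: enn2real_eq_0_iff)
  ultimately show ?thesis
    unfolding integral_gib[OF fin G bd] by (intro tendsto_divide integral_wt_tendsto[OF fin G bd Gc lim])
qed

text \<open>Bounds the logarithm of the exponential moment of
  \<open>A/2 * dir_energy \<Lambda>\<close>: the energy on the unit cube at \<psi>, minus
  \<open>low\<close>, plus the Gaussian constants. The terms \<open>h x * \<psi> x\<close> have
  cancelled. Absolute values and the \<open>max 1\<close> keep every summand nonnegative for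
  \<open>C \<ge> 0\<close>, so the disorder mean can be taken term by term.\<close>

definition energy_bd :: "real \<Rightarrow> 'd site set \<Rightarrow> ('d site \<Rightarrow> real) \<Rightarrow> real" where
  "energy_bd C \<Lambda> \<psi> = 1/2 * (\<Sum>x\<in>\<Lambda>. \<bar>h x\<bar>) + (\<Sum>b\<in>bnd \<Lambda>. C * (3 + 2 * (gd \<psi> b)\<^sup>2)) + A/4 * dir_energy \<Lambda> \<psi>
     + (\<Sum>b\<in>bnd \<Lambda>. \<bar>Bf (fst b) (snd b)\<bar>) + 1/(2*A) * (\<Sum>b\<in>bnd \<Lambda>. (j \<Lambda> b)\<^sup>2) + real (card \<Lambda>) * ln (max 1 (sqrt (4 * pi / A)))"

lemma energy_bd_nonneg: "C \<ge> 0 \<Longrightarrow> 0 \<le> energy_bd C \<Lambda> \<psi>"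
  unfolding energy_bd_def dir_energy_def using A by (intro add_nonneg_nonneg mult_nonneg_nonneg sum_nonneg) auto

text \<open>The partition function is bounded below by integrating over a unit cube around \<open>\<psi>\<close>, while the exponential moment of
  the Dirichlet energy is bounded above by a Gaussian integral.\<close>

lemma energy_moment:
  assumes fin: "finite \<Lambda>" and C: "C \<ge> 0" and upper: "\<And>x i s. U x i s \<le> C * (1 + s\<^sup>2)"
  shows "(\<integral>\<^sup>+\<phi>. ennreal (A/2 * dir_energy \<Lambda> \<phi>) \<partial>gib U h \<Lambda> \<psi>) \<le> ennreal (energy_bd C \<Lambda> \<psi>) + 1"
proof -
  interpret G: prob_space "gib U h \<Lambda> \<psi>" by (rule prob_space_gib[OF fin])
  define E where "E = 1/2 * (\<Sum>x\<in>\<Lambda>. h x * \<psi> x) + 1/2 * (\<Sum>x\<in>\<Lambda>. \<bar>h x\<bar>) + (\<Sum>b\<in>bnd \<Lambda>. C * (3 + 2 * (gd \<psi> b)\<^sup>2))"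
  define M where "M = energy_bd C \<Lambda> \<psi>"
  define s where "s = max 1 (sqrt (4 * pi / A))"
  have Z: "ennreal (exp (- E)) \<le> pfn U h \<Lambda> \<psi>"
  proof (rule pfn_lower[OF fin])
    fix \<phi> assume in1: "\<And>x. x \<in> \<Lambda> \<Longrightarrow> \<psi> x \<le> \<phi> x \<and> \<phi> x \<le> \<psi> x + 1" and out: "\<And>x. x \<notin> \<Lambda> \<Longrightarrow> \<phi> x = \<psi> x"
    have r: "0 \<le> \<phi> x - \<psi> x \<and> \<phi> x - \<psi> x \<le> 1" for x using in1[of x] out[of x] by (cases "x \<in> \<Lambda>") auto
    have "h x * \<phi> x \<le> h x * \<psi> x + \<bar>h x\<bar>" for x
    proof -
      have "h x * (\<phi> x - \<psi> x) \<le> \<bar>h x\<bar> * 1" using r[of x] by (intro mult_mono) auto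
      then show ?thesis by (simp add: algebra_simps)
    qed
    then have 1: "(\<Sum>x\<in>\<Lambda>. h x * \<phi> x) \<le> (\<Sum>x\<in>\<Lambda>. h x * \<psi> x) + (\<Sum>x\<in>\<Lambda>. \<bar>h x\<bar>)"
      unfolding sum.distrib[symmetric] by (intro sum_mono) auto
    \<comment> \<open>Both heights lie within [0, 1] above \<psi>, so the gradient moves by at most
      1, and \<open>1 + a\<^sup>2 \<le> 3 + 2 * g\<^sup>2\<close> whenever
      \<open>\<bar>a - g\<bar> \<le> 1\<close>.\<close>
    have "U (fst b) (snd b) (gd \<phi> b) \<le> C * (3 + 2 * (gd \<psi> b)\<^sup>2)" for b
    proof -
      have "\<bar>gd \<phi> b - gd \<psi> b\<bar> \<le> 1" using r[of "fst b"] r[of "fst b + unitv (snd b)"] unfolding gd_def by linarith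
      then have "(gd \<phi> b - gd \<psi> b)\<^sup>2 \<le> 1" by (simp add: abs_square_le_1)
      moreover have "(gd \<phi> b)\<^sup>2 \<le> 2 * (gd \<psi> b)\<^sup>2 + 2 * (gd \<phi> b - gd \<psi> b)\<^sup>2"
        using zero_le_power2[of "gd \<phi> b - 2 * gd \<psi> b"] by (simp add: power2_eq_square algebra_simps)
      ultimately have "1 + (gd \<phi> b)\<^sup>2 \<le> 3 + 2 * (gd \<psi> b)\<^sup>2" by linarith
      then have "C * (1 + (gd \<phi> b)\<^sup>2) \<le> C * (3 + 2 * (gd \<psi> b)\<^sup>2)" using C by (intro mult_left_mono) auto
      then show ?thesis using upper[of "fst b" "snd b" "gd \<phi> b"] by linarith
    qed
    then have "(\<Sum>b\<in>bnd \<Lambda>. U (fst b) (snd b) (gd \<phi> b)) \<le> (\<Sum>b\<in>bnd \<Lambda>. C * (3 + 2 * (gd \<psi> b)\<^sup>2))" by (intro sum_mono) auto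
    then show "energy U h \<Lambda> \<phi> \<le> E" using 1 by (simp add: energy_def E_def)
  qed
  have M: "E - low \<Lambda> \<psi> + real (card \<Lambda>) * ln s \<le> M"
  proof -
    have "(\<Sum>b\<in>bnd \<Lambda>. Bf (fst b) (snd b)) \<le> (\<Sum>b\<in>bnd \<Lambda>. \<bar>Bf (fst b) (snd b)\<bar>)" by (intro sum_mono) auto
    then show ?thesis by (simp add: E_def low_def M_def energy_bd_def s_def)
  qed
  have "(\<integral>\<^sup>+\<phi>. ennreal (exp (A/2 * dir_energy \<Lambda> \<phi>)) \<partial>gib U h \<Lambda> \<psi>) =
     (\<integral>\<^sup>+\<phi>. ennreal (exp (A/2 * dir_energy \<Lambda> (extend \<Lambda> \<phi> \<psi>)) * wt U h \<Lambda> (extend \<Lambda> \<phi> \<psi>)) \<partial>(PiM \<Lambda> (\<lambda>_. lborel))) / pfn U h \<Lambda> \<psi>"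
    by (subst nn_integral_gib[OF fin]) (auto simp: ennreal_mult mult.commute)
  also have "\<dots> \<le> (ennreal (exp (- low \<Lambda> \<psi>)) * ennreal (sqrt (4 * pi / A)) ^ card \<Lambda>) / ennreal (exp (- E))"
    unfolding divide_ennreal_def by (intro mult_mono exp_energy_integral[OF fin] ennreal_inverse_antimono Z) auto
  also have "\<dots> = ennreal (exp (- low \<Lambda> \<psi>) * sqrt (4 * pi / A) ^ card \<Lambda> / exp (- E))"
    using A by (simp add: ennreal_power ennreal_mult[symmetric] divide_ennreal)
  also have "\<dots> \<le> ennreal (exp M)"
  proof (rule ennreal_leI)
    have "sqrt (4 * pi / A) ^ card \<Lambda> \<le> s ^ card \<Lambda>" using A by (intro power_mono) (auto simp: s_def)
    also have "\<dots> = exp (real (card \<Lambda>) * ln s)" by (subst exp_of_nat_mult) (auto simp: s_def)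
    finally have "exp (- low \<Lambda> \<psi>) * sqrt (4 * pi / A) ^ card \<Lambda> / exp (- E) \<le> exp (- low \<Lambda> \<psi>) * exp (real (card \<Lambda>) * ln s) / exp (- E)"
      by (intro divide_right_mono mult_left_mono) auto
    also have "\<dots> = exp (E - low \<Lambda> \<psi> + real (card \<Lambda>) * ln s)" by (simp add: exp_diff exp_add exp_minus field_simps)
    also have "\<dots> \<le> exp M" using M by simp
    finally show "exp (- low \<Lambda> \<psi>) * sqrt (4 * pi / A) ^ card \<Lambda> / exp (- E) \<le> exp M" .
  qed
  finally have exp_mom: "(\<integral>\<^sup>+\<phi>. ennreal (exp (A/2 * dir_energy \<Lambda> \<phi>)) \<partial>gib U h \<Lambda> \<psi>) \<le> ennreal (exp M)" .
  have M0: "0 \<le> M" unfolding M_def by (rule energy_bd_nonneg[OF C])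
  have "(\<integral>\<^sup>+\<phi>. ennreal (A/2 * dir_energy \<Lambda> \<phi>) \<partial>gib U h \<Lambda> \<psi>) \<le> (\<integral>\<^sup>+\<phi>. ennreal M + ennreal (exp (- M)) * ennreal (exp (A/2 * dir_energy \<Lambda> \<phi>)) \<partial>gib U h \<Lambda> \<psi>)"
  proof (intro nn_integral_mono)
    fix \<phi>
    \<comment> \<open>The bound \<open>t \<le> M + exp (t - M)\<close> passes from the exponential
      moment to the mean at the price of an additive 1.\<close>
    have "A/2 * dir_energy \<Lambda> \<phi> - M \<le> exp (A/2 * dir_energy \<Lambda> \<phi> - M)" using exp_ge_add_one_self[of "A/2 * dir_energy \<Lambda> \<phi> - M"] by linarith
    moreover have "exp (A/2 * dir_energy \<Lambda> \<phi> - M) = exp (- M) * exp (A/2 * dir_energy \<Lambda> \<phi>)" by (simp add: exp_add[symmetric])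
    ultimately have "A/2 * dir_energy \<Lambda> \<phi> \<le> M + exp (- M) * exp (A/2 * dir_energy \<Lambda> \<phi>)" by linarith
    then show "ennreal (A/2 * dir_energy \<Lambda> \<phi>) \<le> ennreal M + ennreal (exp (- M)) * ennreal (exp (A/2 * dir_energy \<Lambda> \<phi>))"
      using M0 by (simp add: ennreal_mult[symmetric] ennreal_plus[symmetric] del: ennreal_plus)
  qed
  also have "\<dots> = ennreal M + ennreal (exp (- M)) * (\<integral>\<^sup>+\<phi>. ennreal (exp (A/2 * dir_energy \<Lambda> \<phi>)) \<partial>gib U h \<Lambda> \<psi>)"
    using G.emeasure_space_1 by (subst nn_integral_add) (auto simp: nn_integral_cmult)
  also have "\<dots> \<le> ennreal M + ennreal (exp (- M)) * ennreal (exp M)"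
    by (intro add_left_mono mult_left_mono exp_mom) auto
  also have "\<dots> = ennreal M + 1" by (simp add: ennreal_mult[symmetric] exp_add[symmetric])
  finally show ?thesis by (simp add: M_def)
qed

end

section \<open>Weak limits of random measures along convex combinations\<close>

text \<open>The jumps of a distribution function are countable, an interval is not.\<close>

lemma real_distribution_isCont_between:
  assumes "real_distribution M" "x < y" shows "\<exists>a. x < a \<and> a < y \<and> isCont (cdf M) a"
proof -
  interpret real_distribution M by fact
  have "countable {a. \<not> isCont (cdf M) a}"
    by (rule mono_ctble_discont) (auto simp: mono_def cdf_nondecreasing)
  then have "\<not> {x<..<y} \<subseteq> {a. \<not> isCont (cdf M) a}"
    using assms(2) uncountable_open_interval countable_subset by blast
  then show ?thesis by auto
qed

text \<open>Between \<open>x\<close> and a larger \<open>y\<close> lie a continuity point of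
  \<open>N\<close>, then a rational, then a continuity point of \<open>M\<close>. Convergence of the
  full sequence at the rational compares the two subsequential limits; right continuity lets
  \<open>y\<close> tend to \<open>x\<close>.\<close>

lemma weak_conv_cdf_le:
  assumes R: "\<And>n. real_distribution (R n)" and N: "real_distribution N" and M: "real_distribution M"
    and s: "strict_mono (s :: nat \<Rightarrow> nat)" "weak_conv_m (R \<circ> s) N" and r: "strict_mono (r :: nat \<Rightarrow> nat)" "weak_conv_m (R \<circ> r) M"
    and q: "\<And>q. q \<in> \<rat> \<Longrightarrow> convergent (\<lambda>n. cdf (R n) q)"
  shows "cdf N x \<le> cdf M x"
proof -
  interpret M: real_distribution M by fact
  interpret N: real_distribution N by fact
  have mono: "cdf (R n) a \<le> cdf (R n) b" if "a \<le> b" for n a b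
  proof -
    interpret real_distribution "R n" by (rule R)
    show ?thesis using that by (rule cdf_nondecreasing)
  qed
  have le: "cdf N x \<le> cdf M y" if xy: "x < y" for y
  proof -
    obtain a where a: "x < a" "a < y" "isCont (cdf N) a" using real_distribution_isCont_between[OF N xy] by blast
    obtain p where p: "p \<in> \<rat>" "a < p" "p < y" using Rats_dense_in_real[OF a(2)] by blast
    obtain b where b: "p < b" "b < y" "isCont (cdf M) b" using real_distribution_isCont_between[OF M p(3)] by blast
    obtain L where L: "(\<lambda>n. cdf (R n) p) \<longlonglongrightarrow> L" using q[OF p(1)] by (auto simp: convergent_def)
    have "(\<lambda>n. cdf (R (s n)) a) \<longlonglongrightarrow> cdf N a" using s(2) a(3) by (auto simp: weak_conv_m_def weak_conv_def)
    moreover have "(\<lambda>n. cdf (R (s n)) p) \<longlonglongrightarrow> L" using LIMSEQ_subseq_LIMSEQ[OF L s(1)] by (simp add: o_def)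
    ultimately have 1: "cdf N a \<le> L" using p mono by (intro LIMSEQ_le) (auto intro!: exI[of _ 0])
    have "(\<lambda>n. cdf (R (r n)) b) \<longlonglongrightarrow> cdf M b" using r(2) b(3) by (auto simp: weak_conv_m_def weak_conv_def)
    moreover have "(\<lambda>n. cdf (R (r n)) p) \<longlonglongrightarrow> L" using LIMSEQ_subseq_LIMSEQ[OF L r(1)] by (simp add: o_def)
    ultimately have 2: "L \<le> cdf M b" using b mono by (intro LIMSEQ_le) (auto intro!: exI[of _ 0])
    have "cdf N x \<le> cdf N a" using a by (intro N.cdf_nondecreasing) auto
    also note 1 also note 2
    also have "cdf M b \<le> cdf M y" using b by (intro M.cdf_nondecreasing) auto
    finally show ?thesis .
  qed
  have "((\<lambda>y. cdf M y) \<longlongrightarrow> cdf M x) (at_right x)" using M.cdf_is_right_cont[of x] by (simp add: continuous_within)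
  moreover have "eventually (\<lambda>y. cdf N x \<le> cdf M y) (at_right x)"
    using le by (auto simp: eventually_at_right_field intro!: exI[of _ "x + 1"])
  ultimately show ?thesis by (intro tendsto_lowerbound) auto
qed

text \<open>Support in [0, 1] gives tightness, and convergence at the rationals forces all
  subsequential limits to agree. The interval opens at -1 because \<open>tight\<close> works with
  left-open intervals and 0 may carry mass.\<close>

lemma weak_limit_exists:
  assumes R: "\<And>n. real_distribution (R n)" and supp: "\<And>n. measure (R n) {0..1} = 1"
    and q: "\<And>q. q \<in> \<rat> \<Longrightarrow> convergent (\<lambda>n. cdf (R n) q)"
  shows "\<exists>M. real_distribution M \<and> weak_conv_m R M"
proof -
  have ge: "measure (R n) {-1<..1} \<ge> 1" for n
  proof -
    interpret real_distribution "R n" by (rule R)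
    have "{0..1} \<subseteq> {-1<..1::real}" by auto
    then have "prob {0..1} \<le> prob {-1<..1}" by (rule finite_measure_mono) auto
    then show ?thesis using supp[of n] by simp
  qed
  have t: "tight R" unfolding tight_def
  proof (intro conjI allI impI R)
    fix \<epsilon> :: real assume "\<epsilon> > 0"
    then have "1 - \<epsilon> < measure (R n) {-1<..1}" for n using ge[of n] by linarith
    then have "(-1::real) < 1 \<and> (\<forall>n. 1 - \<epsilon> < measure (R n) {-1<..1})" by simp
    then show "\<exists>a b. a < b \<and> (\<forall>n. 1 - \<epsilon> < measure (R n) {a<..b})" by blast
  qed
  obtain r M where r: "strict_mono (r :: nat \<Rightarrow> nat)" and M: "real_distribution M" and c: "weak_conv_m (R \<circ> r) M"
    using tight_imp_convergent_subsubsequence[OF t strict_mono_id] by (auto simp: o_def)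
  have "weak_conv_m R M"
  proof (rule tight_subseq_weak_converge[OF R M t])
    fix s N assume s: "strict_mono (s :: nat \<Rightarrow> nat)" and N: "real_distribution N" and sN: "weak_conv_m (R \<circ> s) N"
    have "cdf N = cdf M"
      using weak_conv_cdf_le[OF R N M s sN r c q] weak_conv_cdf_le[OF R M N r c s sN q] by (intro ext antisym) auto
    then show "weak_conv_m (R \<circ> s) M" using sN by (simp add: weak_conv_m_def)
  qed
  then show ?thesis using M by blast
qed

text \<open>A homeomorphism of the line onto (0, 1) with inverse \<open>unsquash\<close>. The
  endpoints 0 and 1, met only in limits, stand for heights escaping to infinity.\<close>

definition squash :: "real \<Rightarrow> real" where "squash r = (1 + r / (1 + \<bar>r\<bar>)) / 2"
definition unsquash :: "real \<Rightarrow> real" where "unsquash t = (2 * t - 1) / (1 - \<bar>2 * t - 1\<bar>)"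

lemma squash_eq: "2 * squash r - 1 = r / (1 + \<bar>r\<bar>)"
proof -
  have "2 * ((1 + t) / 2) - 1 = t" for t :: real by argo
  then show ?thesis unfolding squash_def .
qed

lemma abs_squash: "\<bar>2 * squash r - 1\<bar> = \<bar>r\<bar> / (1 + \<bar>r\<bar>)"
  unfolding squash_eq by (simp add: abs_divide)

lemma squash_bounds: "0 < squash r" "squash r < 1"
proof -
  have "\<bar>2 * squash r - 1\<bar> < 1" unfolding abs_squash by (simp add: divide_less_eq)
  then show "0 < squash r" "squash r < 1" by linarith+
qed

lemma unsquash_squash: "unsquash (squash r) = r"
proof -
  have "1 - \<bar>r\<bar> / (1 + \<bar>r\<bar>) = 1 / (1 + \<bar>r\<bar>)" by (simp add: field_simps)
  then show ?thesis unfolding unsquash_def abs_squash squash_eq by simp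
qed

lemma isCont_unsquash: "0 < t \<Longrightarrow> t < 1 \<Longrightarrow> isCont unsquash t"
  unfolding unsquash_def by (intro continuous_intros) auto

text \<open>Random laws \<open>K n z\<close> whose tightness is known only after averaging over the
  disorder, a coding \<open>cd\<close> with continuous decoders \<open>D\<close>, and tail mixtures
  \<open>c\<close>. The coding reduces weak convergence of laws on height fields to distribution
  functions on the line.\<close>

locale tight_kernels = prob_space Q for Q :: "'z measure" +
  fixes K :: "nat \<Rightarrow> 'z \<Rightarrow> ('d::finite site \<Rightarrow> real) measure"
    and cd :: "(nat \<Rightarrow> real) \<Rightarrow> real" and D :: "nat \<Rightarrow> real \<Rightarrow> real" and c :: "nat \<Rightarrow> nat pmf"
  assumes K: "\<And>n. K n \<in> measurable Q (prob_algebra HS)"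
    and moment: "\<And>x. \<exists>C. \<forall>n. (\<integral>\<^sup>+z. \<integral>\<^sup>+\<phi>. ennreal ((\<phi> x - \<phi> 0)\<^sup>2) \<partial>K n z \<partial>Q) \<le> ennreal C"
    and cd: "cd \<in> borel_measurable (PiM UNIV (\<lambda>_. borel))" "\<And>s. 0 \<le> cd s" "\<And>s. cd s \<le> 1"
    and D: "\<And>i t. isCont (D i) t" "\<And>i t. 0 \<le> D i t" "\<And>i t. D i t \<le> 1"
    and Dcd: "\<And>s i. (\<And>i. 0 \<le> s i \<and> s i < 1) \<Longrightarrow> D i (cd s) = s i"
    and c: "\<And>n. set_pmf (c n) \<subseteq> {n..}"
begin

text \<open>Pinning at the origin comes first, since only height differences have controlled
  moments.\<close>

definition code :: "('d site \<Rightarrow> real) \<Rightarrow> real" where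
  "code \<phi> = cd (\<lambda>i. squash (\<phi> (from_nat i) - \<phi> 0))"

definition dec :: "real \<Rightarrow> 'd site \<Rightarrow> real" where
  "dec t x = unsquash (D (to_nat x) t)"

lemma D_code: "D (to_nat x) (code \<phi>) = squash (\<phi> x - \<phi> 0)"
  unfolding code_def using squash_bounds by (subst Dcd) (auto intro: less_imp_le)

lemma dec_code: "dec (code \<phi>) = (\<lambda>x. \<phi> x - \<phi> 0)"
  by (simp add: dec_def D_code unsquash_squash fun_eq_iff)

lemma squash_measurable [measurable]: "squash \<in> borel_measurable borel"
  unfolding squash_def by measurable

lemma unsquash_measurable [measurable]: "unsquash \<in> borel_measurable borel"
  unfolding unsquash_def by measurable

lemma D_measurable [measurable]: "D i \<in> borel_measurable borel"
  using D(1) by (intro borel_measurable_continuous_onI continuous_at_imp_continuous_on) auto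

lemma code_measurable [measurable]: "code \<in> borel_measurable HS"
  unfolding code_def by (rule measurable_compose[OF _ cd(1)]) (auto intro!: measurable_PiM_single')

lemma dec_measurable [measurable]: "dec \<in> measurable borel HS"
  by (rule measurable_HS_I) (simp add: dec_def)

lemma K_prob: "z \<in> space Q \<Longrightarrow> prob_space (K n z)" and K_sets: "z \<in> space Q \<Longrightarrow> sets (K n z) = sets HS"
  using measurable_space[OF K] by (auto simp: space_prob_algebra)

lemma K_sub [measurable]: "K n \<in> measurable Q (subprob_algebra HS)"
  by (rule measurable_prob_algebraD[OF K])

definition R :: "nat \<Rightarrow> 'z \<Rightarrow> real measure" where
  "R n z = distr (measure_pmf (c n) \<bind> (\<lambda>k. K k z)) borel code"

lemma mix_sub: "z \<in> space Q \<Longrightarrow> (\<lambda>k. K k z) \<in> measurable (measure_pmf p) (subprob_algebra HS)"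
  using K_prob K_sets by (auto simp: space_subprob_algebra intro!: prob_space_imp_subprob_space)

lemma mix_prob: "z \<in> space Q \<Longrightarrow> prob_space (measure_pmf p \<bind> (\<lambda>k. K k z))"
  by (intro measure_pmf.prob_space_bind[OF _ mix_sub] AE_I2 K_prob)

lemma mix_sets: "z \<in> space Q \<Longrightarrow> sets (measure_pmf p \<bind> (\<lambda>k. K k z)) = sets HS"
  by (rule sets_bind) (auto simp: K_sets)

lemma R_dist: "z \<in> space Q \<Longrightarrow> real_distribution (R n z)"
  unfolding real_distribution_def real_distribution_axioms_def R_def
  by (auto intro!: prob_space.prob_space_distr mix_prob simp: mix_sets cong: measurable_cong_sets)

lemma integral_R:
  fixes g :: "real \<Rightarrow> real"
  assumes z: "z \<in> space Q" and [measurable]: "g \<in> borel_measurable borel" and bd: "\<And>t. \<bar>g t\<bar> \<le> B"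
  shows "(\<integral>t. g t \<partial>R n z) = (\<integral>k. (\<integral>\<phi>. g (code \<phi>) \<partial>K k z) \<partial>measure_pmf (c n))"
proof -
  have "(\<integral>t. g t \<partial>R n z) = (\<integral>\<phi>. g (code \<phi>) \<partial>(measure_pmf (c n) \<bind> (\<lambda>k. K k z)))"
    unfolding R_def by (rule integral_distr) (auto simp: mix_sets[OF z] cong: measurable_cong_sets)
  also have "\<dots> = (\<integral>k. (\<integral>\<phi>. g (code \<phi>) \<partial>K k z) \<partial>measure_pmf (c n))"
    by (rule integral_bind[OF _ _ mix_sub[OF z], where B=B and B'=1])
      (auto simp: bd measure_pmf.finite_measure_axioms prob_space.emeasure_space_1[OF K_prob[OF z]])
  finally show ?thesis .
qed

lemma Kint_bound:
  fixes G :: "_ \<Rightarrow> real"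
  assumes z: "z \<in> space Q" and [measurable]: "G \<in> borel_measurable HS" and bd: "\<And>\<phi>. \<bar>G \<phi>\<bar> \<le> B"
  shows "\<bar>\<integral>\<phi>. G \<phi> \<partial>K k z\<bar> \<le> B"
proof -
  interpret K: prob_space "K k z" by (rule K_prob[OF z])
  have "integrable (K k z) G"
    by (rule K.integrable_const_bound[of _ B]) (use bd K_sets[OF z] in \<open>auto cong: measurable_cong_sets\<close>)
  then have "\<bar>\<integral>\<phi>. G \<phi> \<partial>K k z\<bar> \<le> (\<integral>\<phi>. \<bar>G \<phi>\<bar> \<partial>K k z)" by (intro integral_abs_bound)
  also have "\<dots> \<le> B" using \<open>integrable (K k z) G\<close> bd by (intro K.integral_le_const) auto
  finally show ?thesis .
qed

lemma pair_measurable: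
  fixes f :: "nat \<Rightarrow> 'z \<Rightarrow> real"
  assumes [measurable]: "\<And>k. f k \<in> borel_measurable Q"
  shows "(\<lambda>(z, k). f k z) \<in> borel_measurable (Q \<Otimes>\<^sub>M measure_pmf p)"
  unfolding case_prod_beta by (rule measurable_compose_countable[where f="\<lambda>k z. f k (fst z)" and g=snd]) auto

lemma pmf_mix_measurable:
  fixes f :: "nat \<Rightarrow> 'z \<Rightarrow> real"
  assumes "\<And>k. f k \<in> borel_measurable Q"
  shows "(\<lambda>z. \<integral>k. f k z \<partial>measure_pmf p) \<in> borel_measurable Q"
  using pair_measurable[OF assms] by (rule sigma_finite_measure.borel_measurable_lebesgue_integral[rotated])
    (rule prob_space_imp_sigma_finite, rule prob_space_measure_pmf)

lemma R_measurable:
  fixes g :: "real \<Rightarrow> real"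
  assumes [measurable]: "g \<in> borel_measurable borel" and bd: "\<And>t. \<bar>g t\<bar> \<le> B"
  shows "(\<lambda>z. \<integral>t. g t \<partial>R n z) \<in> borel_measurable Q"
proof -
  have "(\<lambda>z. \<integral>k. (\<integral>\<phi>. g (code \<phi>) \<partial>K k z) \<partial>measure_pmf (c n)) \<in> borel_measurable Q"
    by (rule pmf_mix_measurable) measurable
  then show ?thesis by (subst measurable_cong[OF integral_R[OF _ assms]]) auto
qed

text \<open>Fubini takes the mixture outside the disorder average, and \<open>c n\<close> charges
  only indices from \<open>n\<close> on.\<close>

lemma annealed_R_le:
  fixes g :: "real \<Rightarrow> real"
  assumes [measurable]: "g \<in> borel_measurable borel" and bd: "\<And>t. \<bar>g t\<bar> \<le> B"
    and le: "\<And>k. k \<ge> n \<Longrightarrow> (\<integral>z. (\<integral>\<phi>. g (code \<phi>) \<partial>K k z) \<partial>Q) \<le> b"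
  shows "(\<integral>z. (\<integral>t. g t \<partial>R n z) \<partial>Q) \<le> b"
proof -
  let ?p = "measure_pmf (c n)"
  define f where "f k z = (\<integral>\<phi>. g (code \<phi>) \<partial>K k z)" for k z
  have fm [measurable]: "f k \<in> borel_measurable Q" for k unfolding f_def by measurable
  have fb: "\<bar>f k z\<bar> \<le> B" if "z \<in> space Q" for k z unfolding f_def by (rule Kint_bound[OF that _ bd]) measurable
  interpret pp: pair_prob_space Q ?p ..
  have "integrable (Q \<Otimes>\<^sub>M ?p) (\<lambda>(z, k). f k z)"
    by (rule pp.P.integrable_const_bound[of _ B]) (auto simp: space_pair_measure fb intro!: pair_measurable AE_I2)
  then have "(\<integral>z. (\<integral>k. f k z \<partial>?p) \<partial>Q) = (\<integral>k. (\<integral>z. f k z \<partial>Q) \<partial>?p)"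
    using pp.Fubini_integral[of "\<lambda>z k. f k z"] by simp
  also have "\<dots> \<le> b"
  proof (rule measure_pmf.integral_le_const)
    have "\<bar>\<integral>z. f k z \<partial>Q\<bar> \<le> B" for k
    proof -
      have i: "integrable Q (f k)" by (rule integrable_const_bound[of _ B]) (auto simp: fb intro!: AE_I2)
      then have "\<bar>\<integral>z. f k z \<partial>Q\<bar> \<le> (\<integral>z. \<bar>f k z\<bar> \<partial>Q)" by (intro integral_abs_bound)
      also have "\<dots> \<le> B" using i fb by (intro integral_le_const) (auto intro!: AE_I2)
      finally show ?thesis .
    qed
    then show "integrable ?p (\<lambda>k. \<integral>z. f k z \<partial>Q)" by (intro measure_pmf.integrable_const_bound[of _ B]) auto
    show "AE k in ?p. (\<integral>z. f k z \<partial>Q) \<le> b" using c[of n] le by (auto simp: AE_measure_pmf_iff f_def)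
  qed
  finally have "(\<integral>z. (\<integral>k. f k z \<partial>?p) \<partial>Q) \<le> b" .
  moreover have "(\<integral>z. (\<integral>t. g t \<partial>R n z) \<partial>Q) = (\<integral>z. (\<integral>k. f k z \<partial>?p) \<partial>Q)"
    by (rule Bochner_Integration.integral_cong) (auto simp: integral_R[OF _ assms(1) bd] f_def)
  ultimately show ?thesis by simp
qed

text \<open>Rational points suffice for weak convergence of laws on [0, 1], and being countably many
  they keep this set measurable.\<close>

definition good1 :: "'z set" where
  "good1 = {z \<in> space Q. \<forall>r::rat. convergent (\<lambda>n. cdf (R n z) (of_rat r))}"

lemma cdf_R: "z \<in> space Q \<Longrightarrow> cdf (R n z) q = (\<integral>k. (\<integral>\<phi>. indicator {..q} (code \<phi>) \<partial>K k z) \<partial>measure_pmf (c n))"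
proof -
  assume z: "z \<in> space Q"
  interpret Rn: real_distribution "R n z" by (rule R_dist[OF z])
  have "cdf (R n z) q = (\<integral>t. indicator {..q} t \<partial>R n z)" by (simp add: cdf_def)
  then show ?thesis by (subst (asm) integral_R[OF z, of _ 1]) (auto simp: indicator_def)
qed

lemma good1_sets [measurable]: "good1 \<in> sets Q"
proof -
  have [measurable]: "(\<lambda>z. cdf (R n z) (of_rat r)) \<in> borel_measurable Q" for n and r :: rat
    by (subst measurable_cong[OF cdf_R]) (auto intro!: pmf_mix_measurable)
  show ?thesis unfolding good1_def Cauchy_convergent_iff[symmetric] by measurable
qed

lemma good1_limit: "z \<in> good1 \<Longrightarrow> \<exists>M. real_distribution M \<and> weak_conv_m (\<lambda>n. R n z) M"
proof (rule weak_limit_exists)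
  assume z: "z \<in> good1"
  then have zs: "z \<in> space Q" by (simp add: good1_def)
  show "real_distribution (R n z)" for n by (rule R_dist[OF zs])
  show "measure (R n z) {0..1} = 1" for n
  proof -
    interpret Rn: real_distribution "R n z" by (rule R_dist[OF zs])
    have "measure (R n z) {0..1} = (\<integral>t. indicator {0..1} t \<partial>R n z)" by simp
    also have "\<dots> = (\<integral>k. (\<integral>\<phi>. indicator {0..1} (code \<phi>) \<partial>K k z) \<partial>measure_pmf (c n))"
      by (rule integral_R[OF zs, of _ 1]) (auto simp: indicator_def)
    also have "\<dots> = (\<integral>k. 1 \<partial>measure_pmf (c n))"
      using cd by (intro Bochner_Integration.integral_cong) (auto simp: code_def prob_space.prob_space[OF K_prob[OF zs]])
    finally show ?thesis by simp
  qed
  show "convergent (\<lambda>n. cdf (R n z) q)" if "q \<in> \<rat>" for q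
    using that z by (auto simp: good1_def elim!: Rats_cases)
qed

text \<open>Weak limits are unique, so on \<open>good1\<close> the \<open>SOME\<close> makes no real
  choice; this is why the limit can depend measurably on the disorder.\<close>

definition m0 :: "'z \<Rightarrow> real measure" where
  "m0 z = (if z \<in> good1 then SOME M. real_distribution M \<and> weak_conv_m (\<lambda>n. R n z) M else return borel 0)"

lemma m0_good: "z \<in> good1 \<Longrightarrow> real_distribution (m0 z) \<and> weak_conv_m (\<lambda>n. R n z) (m0 z)"
  using someI_ex[OF good1_limit] by (simp add: m0_def)

lemma m0_dist: "real_distribution (m0 z)"
  using m0_good by (cases "z \<in> good1")
    (auto simp: m0_def real_distribution_def real_distribution_axioms_def intro!: prob_space_return)

lemma m0_conv:
  fixes g :: "real \<Rightarrow> real"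
  assumes z: "z \<in> good1" and "g \<in> borel_measurable borel" "\<And>t. \<bar>g t\<bar> \<le> B" "emeasure (m0 z) {t. \<not> isCont g t} = 0"
  shows "(\<lambda>n. \<integral>t. g t \<partial>R n z) \<longlonglongrightarrow> (\<integral>t. g t \<partial>m0 z)"
proof (rule weak_conv_imp_bdd_ae_continuous_conv)
  show "real_distribution (R n z)" for n using z by (intro R_dist) (simp add: good1_def)
qed (use assms m0_good[OF z] in auto)

text \<open>Integrals of bounded continuous functions against \<open>m0 z\<close> are limits of
  measurable functions of \<open>z\<close>. Continuous steps falling from 1 at \<open>a\<close> to 0
  at \<open>b k\<close> lie between two values of the distribution function, which right continuity
  brings together.\<close>

lemma m0_kernel: "m0 \<in> measurable Q (prob_algebra borel)"
proof (rule measurable_prob_algebra_generated[of _ UNIV "range atMost"])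
  show "sets borel = sigma_sets UNIV (range (atMost :: real \<Rightarrow> _))" by (simp add: borel_eq_atMost)
  show "Int_stable (range (atMost :: real \<Rightarrow> _))" by (auto simp: Int_stable_def intro!: exI[of _ "min _ _"])
  show "prob_space (m0 z)" "sets (m0 z) = sets borel" for z
    using m0_dist[of z] by (auto simp: real_distribution_def real_distribution_axioms_def)
  fix A :: "real set" assume "A \<in> range atMost"
  then obtain a where A: "A = {..a}" by auto
  define b where "b k = a + 1 / (1 + real k)" for k :: nat
  have ab: "a < b k" for k by (simp add: b_def)
  have cts: "isCont (cts_step a (b k)) t" for k t
    using cts_step_uniformly_continuous[OF ab[of k]] by (rule isUCont_isCont)
  have ctb: "\<bar>cts_step a (b k) t\<bar> \<le> 1" for k t using ab[of k] by (auto simp: cts_step_def)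
  have ctm: "cts_step a (b k) \<in> borel_measurable borel" for k
    using cts by (intro borel_measurable_continuous_onI continuous_at_imp_continuous_on) auto
  have m: "(\<lambda>z. \<integral>t. cts_step a (b k) t \<partial>R n z) \<in> borel_measurable Q" for n k by (rule R_measurable[OF ctm ctb])
  have m2: "(\<lambda>z. if z \<in> good1 then \<integral>t. cts_step a (b k) t \<partial>m0 z else \<integral>t. cts_step a (b k) t \<partial>return borel 0) \<in> borel_measurable Q" (is "?F k \<in> _") for k
  proof (rule borel_measurable_LIMSEQ_real)
    show "(\<lambda>n. if z \<in> good1 then \<integral>t. cts_step a (b k) t \<partial>R n z else \<integral>t. cts_step a (b k) t \<partial>return borel 0) \<longlonglongrightarrow> ?F k z" for z
      using m0_conv[OF _ ctm ctb, of z k] cts by auto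
    show "(\<lambda>z. if z \<in> good1 then \<integral>t. cts_step a (b k) t \<partial>R n z else \<integral>t. cts_step a (b k) t \<partial>return borel 0) \<in> borel_measurable Q" for n
      using m by measurable
  qed
  have "?F k = (\<lambda>z. \<integral>t. cts_step a (b k) t \<partial>m0 z)" for k by (auto simp: m0_def)
  then have m3: "(\<lambda>z. \<integral>t. cts_step a (b k) t \<partial>m0 z) \<in> borel_measurable Q" for k using m2[of k] by simp
  have "(\<lambda>z. cdf (m0 z) a) \<in> borel_measurable Q"
  proof (rule borel_measurable_LIMSEQ_real[OF _ m3])
    fix z
    interpret M: real_distribution "m0 z" by (rule m0_dist)
    have bl: "b \<longlonglongrightarrow> a" unfolding b_def by real_asymp
    have "(cdf (m0 z) \<longlongrightarrow> cdf (m0 z) a) (at_right a)" using M.cdf_is_right_cont[of a] by (simp add: continuous_within)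
    moreover have "filterlim b (at_right a) sequentially"
      using bl ab less_imp_neq[OF ab, symmetric] by (auto simp: filterlim_at intro!: always_eventually)
    ultimately have "(\<lambda>k. cdf (m0 z) (b k)) \<longlonglongrightarrow> cdf (m0 z) a" by (rule filterlim_compose)
    then show "(\<lambda>k. \<integral>t. cts_step a (b k) t \<partial>m0 z) \<longlonglongrightarrow> cdf (m0 z) a"
      by (rule tendsto_sandwich[OF _ _ tendsto_const, rotated 2]) (auto simp: M.cdf_cts_step[OF ab])
  qed
  moreover have "emeasure (m0 z) A = ennreal (cdf (m0 z) a)" for z
  proof -
    interpret M: real_distribution "m0 z" by (rule m0_dist)
    show ?thesis unfolding A cdf_def by (simp add: M.emeasure_eq_measure)
  qed
  ultimately show "(\<lambda>z. emeasure (m0 z) A) \<in> borel_measurable Q" by simp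
qed auto

lemma m0_sub [measurable]: "m0 \<in> measurable Q (subprob_algebra borel)"
  by (rule measurable_prob_algebraD[OF m0_kernel])

text \<open>Dominated convergence in the disorder. Discontinuities of \<open>g\<close> on a null set
  of the limit are allowed, as functions composed with \<open>dec\<close> require.\<close>

lemma annealed_limit_le:
  fixes g :: "real \<Rightarrow> real"
  assumes g [measurable]: "g \<in> borel_measurable borel" and bd: "\<And>t. \<bar>g t\<bar> \<le> B"
    and ae: "AE z in Q. z \<in> good1 \<and> emeasure (m0 z) {t. \<not> isCont g t} = 0"
    and le: "\<And>k. k \<ge> N \<Longrightarrow> (\<integral>z. (\<integral>\<phi>. g (code \<phi>) \<partial>K k z) \<partial>Q) \<le> b"
  shows "(\<integral>z. (\<integral>t. g t \<partial>m0 z) \<partial>Q) \<le> b"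
proof (rule LIMSEQ_le_const2)
  show "(\<lambda>n. \<integral>z. (\<integral>t. g t \<partial>R n z) \<partial>Q) \<longlonglongrightarrow> (\<integral>z. (\<integral>t. g t \<partial>m0 z) \<partial>Q)"
  proof (rule integral_dominated_convergence)
    show "AE z in Q. (\<lambda>n. \<integral>t. g t \<partial>R n z) \<longlonglongrightarrow> (\<integral>t. g t \<partial>m0 z)"
      using ae by eventually_elim (rule m0_conv[OF _ g bd], auto)
    show "AE z in Q. norm (\<integral>t. g t \<partial>R n z) \<le> B" for n
    proof (rule AE_I2)
      fix z assume z: "z \<in> space Q"
      interpret Rn: real_distribution "R n z" by (rule R_dist[OF z])
      have i: "integrable (R n z) g" by (rule Rn.integrable_const_bound[of _ B]) (auto simp: bd)
      then have "norm (\<integral>t. g t \<partial>R n z) \<le> (\<integral>t. \<bar>g t\<bar> \<partial>R n z)" by (simp add: integral_abs_bound)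
      also have "\<dots> \<le> B" using i bd by (intro Rn.integral_le_const) auto
      finally show "norm (\<integral>t. g t \<partial>R n z) \<le> B" .
    qed
    show "(\<lambda>z. \<integral>t. g t \<partial>R n z) \<in> borel_measurable Q" for n by (rule R_measurable[OF g bd])
  qed auto
  show "\<exists>n0. \<forall>n\<ge>n0. (\<integral>z. (\<integral>t. g t \<partial>R n z) \<partial>Q) \<le> b"
    by (intro exI[of _ N] allI impI annealed_R_le[OF g bd] le) auto
qed

text \<open>Codes of an infinite height difference at \<open>x\<close>; away from them the decoding
  at \<open>x\<close> is continuous.\<close>

definition bad :: "'d site \<Rightarrow> real set" where
  "bad x = {t. D (to_nat x) t = 0 \<or> D (to_nat x) t = 1}"

lemma bad_sets [measurable]: "bad x \<in> sets borel"
proof -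
  have "{t \<in> space borel. D (to_nat x) t = 0 \<or> D (to_nat x) t = 1} \<in> sets borel" by measurable
  then show ?thesis by (simp add: bad_def)
qed

definition good2 :: "'z set" where
  "good2 = {z \<in> good1. \<forall>x :: 'd site. emeasure (m0 z) (bad x) = 0}"

lemma good2_sets [measurable]: "good2 \<in> sets Q"
proof -
  have "good2 = {z \<in> space Q. z \<in> good1 \<and> (\<forall>x :: 'd site. emeasure (m0 z) (bad x) = 0)}"
    by (auto simp: good2_def good1_def)
  also have "\<dots> \<in> sets Q" by measurable
  finally show ?thesis .
qed

text \<open>No mass escapes to infinity: the indicator of \<open>bad x\<close> is dominated by continuous cut-offs whose
  annealed means are at most \<open>\<epsilon> (2 + C)\<close>.\<close>

lemma bad_null:
  assumes ae: "AE z in Q. z \<in> good1"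
  shows "AE z in Q. emeasure (m0 z) (bad x) = 0"
proof -
  obtain C' where C': "\<And>n. (\<integral>\<^sup>+z. \<integral>\<^sup>+\<phi>. ennreal ((\<phi> x - \<phi> 0)\<^sup>2) \<partial>K n z \<partial>Q) \<le> ennreal C'" using moment by blast
  define C where "C = max 0 C'"
  have C0: "C \<ge> 0" by (simp add: C_def)
  have C: "(\<integral>\<^sup>+z. \<integral>\<^sup>+\<phi>. ennreal ((\<phi> x - \<phi> 0)\<^sup>2) \<partial>K n z \<partial>Q) \<le> ennreal C" for n
    by (rule order.trans[OF C']) (simp add: C_def)
  have le: "(\<integral>z. measure (m0 z) (bad x) \<partial>Q) \<le> \<epsilon> * (2 + C)" if e: "\<epsilon> > 0" for \<epsilon>
  proof -
    \<comment> \<open>A continuous cut-off equal to 1 on \<open>bad x\<close>. At the code of an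
      actual height field it is positive only if \<open>1 + \<bar>\<phi> x - \<phi> 0\<bar>\<close>
      exceeds \<open>1 / \<epsilon>\<close>.\<close>
    define g where "g t = max 0 (1 - (1 - \<bar>2 * D (to_nat x) t - 1\<bar>) / \<epsilon>)" for t
    have gc: "isCont g t" for t unfolding g_def using D(1) e by (intro continuous_intros) auto
    have y1: "\<bar>2 * D (to_nat x) t - 1\<bar> \<le> 1" for t using D(2,3)[of "to_nat x" t] by (simp add: abs_le_iff)
    have g01: "0 \<le> g t" "g t \<le> 1" for t using y1[of t] e by (auto simp: g_def)
    have gm [measurable]: "g \<in> borel_measurable borel" unfolding g_def by measurable
    have gbad: "indicator (bad x) t \<le> g t" for t using g01[of t] by (auto simp: indicator_def bad_def g_def)
    have gcode: "g (code \<phi>) \<le> \<epsilon> * (2 + (\<phi> x - \<phi> 0)\<^sup>2)" for \<phi>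
    proof -
      define r where "r = \<phi> x - \<phi> 0"
      have "1 - \<bar>2 * D (to_nat x) (code \<phi>) - 1\<bar> = 1 / (1 + \<bar>r\<bar>)"
        unfolding D_code abs_squash r_def[symmetric] by (simp add: field_simps)
      then have gr: "g (code \<phi>) = max 0 (1 - 1 / (1 + \<bar>r\<bar>) / \<epsilon>)" by (simp add: g_def)
      \<comment> \<open>With \<open>w = \<epsilon> * (1 + \<bar>r\<bar>)\<close> this is
        \<open>1 - 1 / w \<le> w\<close>, true for every positive \<open>w\<close>. Linear growth in
        \<open>r\<close> is then controlled by the second moment, with the small factor \<epsilon>
        in front.\<close>
      have "1 - 1 / (1 + \<bar>r\<bar>) / \<epsilon> \<le> \<epsilon> * (1 + \<bar>r\<bar>)"
      proof -
        define w where "w = \<epsilon> * (1 + \<bar>r\<bar>)"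
        have w: "w > 0" using e by (simp add: w_def add_pos_nonneg)
        have "1 - 1 / w \<le> w"
        proof (cases "w \<ge> 1")
          case False then have "1 \<le> 1 / w" using w by simp
          then show ?thesis using w by linarith
        qed (use w in \<open>smt (verit) divide_pos_pos\<close>)
        then show ?thesis by (simp add: w_def mult.commute)
      qed
      also have "\<epsilon> * (1 + \<bar>r\<bar>) \<le> \<epsilon> * (2 + r\<^sup>2)"
      proof (intro mult_left_mono)
        have "0 \<le> (\<bar>r\<bar> - 1)\<^sup>2 + \<bar>r\<bar>" by simp
        then have "2 * \<bar>r\<bar> \<le> r\<^sup>2 + 1 + \<bar>r\<bar>" by (simp add: power2_eq_square algebra_simps)
        then show "1 + \<bar>r\<bar> \<le> 2 + r\<^sup>2" by linarith
      qed (use e in simp)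
      finally show ?thesis unfolding gr r_def[symmetric] using e by (simp add: add_nonneg_nonneg)
    qed
    have "(\<integral>z. (\<integral>t. g t \<partial>m0 z) \<partial>Q) \<le> \<epsilon> * (2 + C)"
    proof (rule annealed_limit_le[OF gm])
      show "\<bar>g t\<bar> \<le> 1" for t using g01[of t] by simp
      show "AE z in Q. z \<in> good1 \<and> emeasure (m0 z) {t. \<not> isCont g t} = 0" using ae gc by simp
      fix k
      have "(\<integral>z. (\<integral>\<phi>. g (code \<phi>) \<partial>K k z) \<partial>Q) = enn2real (\<integral>\<^sup>+z. \<integral>\<^sup>+\<phi>. ennreal (g (code \<phi>)) \<partial>K k z \<partial>Q)"
      proof -
        have "(\<integral>\<^sup>+z. \<integral>\<^sup>+\<phi>. ennreal (g (code \<phi>)) \<partial>K k z \<partial>Q) = (\<integral>\<^sup>+z. ennreal (\<integral>\<phi>. g (code \<phi>) \<partial>K k z) \<partial>Q)"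
        proof (rule nn_integral_cong)
          fix z assume z: "z \<in> space Q"
          interpret Kz: prob_space "K k z" by (rule K_prob[OF z])
          show "(\<integral>\<^sup>+\<phi>. ennreal (g (code \<phi>)) \<partial>K k z) = ennreal (\<integral>\<phi>. g (code \<phi>) \<partial>K k z)"
            by (intro nn_integral_eq_integral Kz.integrable_const_bound[of _ 1])
              (use g01 K_sets[OF z] in \<open>auto cong: measurable_cong_sets\<close>)
        qed
        then show ?thesis by (subst integral_eq_nn_integral) (auto simp: g01)
      qed
      also have "(\<integral>\<^sup>+z. \<integral>\<^sup>+\<phi>. ennreal (g (code \<phi>)) \<partial>K k z \<partial>Q) \<le> ennreal (\<epsilon> * (2 + C))"
      proof -
        have "(\<integral>\<^sup>+z. \<integral>\<^sup>+\<phi>. ennreal (g (code \<phi>)) \<partial>K k z \<partial>Q) \<le> (\<integral>\<^sup>+z. ennreal (2 * \<epsilon>) + ennreal \<epsilon> * (\<integral>\<^sup>+\<phi>. ennreal ((\<phi> x - \<phi> 0)\<^sup>2) \<partial>K k z) \<partial>Q)"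
        proof (rule nn_integral_mono)
          fix z assume z: "z \<in> space Q"
          interpret Kz: prob_space "K k z" by (rule K_prob[OF z])
          have [measurable]: "(\<lambda>\<phi>. (\<phi> x - \<phi> 0)\<^sup>2) \<in> borel_measurable (K k z)"
            by (subst measurable_cong_sets[OF K_sets[OF z] refl]) measurable
          have "(\<integral>\<^sup>+\<phi>. ennreal (g (code \<phi>)) \<partial>K k z) \<le> (\<integral>\<^sup>+\<phi>. ennreal (2 * \<epsilon>) + ennreal \<epsilon> * ennreal ((\<phi> x - \<phi> 0)\<^sup>2) \<partial>K k z)"
          proof (rule nn_integral_mono)
            fix \<phi>
            have "ennreal (g (code \<phi>)) \<le> ennreal (2 * \<epsilon> + \<epsilon> * (\<phi> x - \<phi> 0)\<^sup>2)"
              using gcode[of \<phi>] by (intro ennreal_leI) (simp add: algebra_simps)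
            then show "ennreal (g (code \<phi>)) \<le> ennreal (2 * \<epsilon>) + ennreal \<epsilon> * ennreal ((\<phi> x - \<phi> 0)\<^sup>2)"
              using e by (simp add: ennreal_mult)
          qed
          also have "\<dots> = ennreal (2 * \<epsilon>) + ennreal \<epsilon> * (\<integral>\<^sup>+\<phi>. ennreal ((\<phi> x - \<phi> 0)\<^sup>2) \<partial>K k z)"
            using Kz.emeasure_space_1 by (subst nn_integral_add) (auto simp: nn_integral_cmult)
          finally show "(\<integral>\<^sup>+\<phi>. ennreal (g (code \<phi>)) \<partial>K k z) \<le> ennreal (2 * \<epsilon>) + ennreal \<epsilon> * (\<integral>\<^sup>+\<phi>. ennreal ((\<phi> x - \<phi> 0)\<^sup>2) \<partial>K k z)" .
        qed
        also have "\<dots> = ennreal (2 * \<epsilon>) + ennreal \<epsilon> * (\<integral>\<^sup>+z. \<integral>\<^sup>+\<phi>. ennreal ((\<phi> x - \<phi> 0)\<^sup>2) \<partial>K k z \<partial>Q)"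
        proof -
          have [measurable]: "(\<lambda>z. \<integral>\<^sup>+\<phi>. ennreal ((\<phi> x - \<phi> 0)\<^sup>2) \<partial>K k z) \<in> borel_measurable Q"
            by (rule measurable_compose[OF K_sub nn_integral_measurable_subprob_algebra]) measurable
          show ?thesis using emeasure_space_1 by (subst nn_integral_add) (auto simp: nn_integral_cmult)
        qed
        also have "\<dots> \<le> ennreal (2 * \<epsilon>) + ennreal \<epsilon> * ennreal C"
          using C[of k] by (intro add_left_mono mult_left_mono ennreal_leI) auto
        also have "\<dots> = ennreal (\<epsilon> * (2 + C))"
          using e C0 by (simp add: ennreal_mult[symmetric] ennreal_plus[symmetric] algebra_simps del: ennreal_plus)
        finally show ?thesis .
      qed
      then have "enn2real (\<integral>\<^sup>+z. \<integral>\<^sup>+\<phi>. ennreal (g (code \<phi>)) \<partial>K k z \<partial>Q) \<le> \<epsilon> * (2 + C)"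
        using e C0 by (intro enn2real_leI) auto
      finally show "(\<integral>z. (\<integral>\<phi>. g (code \<phi>) \<partial>K k z) \<partial>Q) \<le> \<epsilon> * (2 + C)" .
    qed
    moreover have "(\<integral>z. measure (m0 z) (bad x) \<partial>Q) \<le> (\<integral>z. (\<integral>t. g t \<partial>m0 z) \<partial>Q)"
    proof (rule integral_mono_AE)
      have 1: "measure (m0 z) (bad x) \<le> (\<integral>t. g t \<partial>m0 z)" and 2: "(\<integral>t. g t \<partial>m0 z) \<le> 1" for z
      proof -
        interpret M: real_distribution "m0 z" by (rule m0_dist)
        have i: "integrable (m0 z) g" by (rule M.integrable_const_bound[of _ 1]) (auto simp: g01)
        have "measure (m0 z) (bad x) = (\<integral>t. indicator (bad x) t \<partial>m0 z)" by simp
        also have "\<dots> \<le> (\<integral>t. g t \<partial>m0 z)" by (rule integral_mono[OF _ i gbad]) (simp add: M.emeasure_eq_measure)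
        finally show "measure (m0 z) (bad x) \<le> (\<integral>t. g t \<partial>m0 z)" .
        show "(\<integral>t. g t \<partial>m0 z) \<le> 1" using i g01 by (intro M.integral_le_const) auto
      qed
      show "AE z in Q. measure (m0 z) (bad x) \<le> (\<integral>t. g t \<partial>m0 z)" using 1 by simp
      have 3: "0 \<le> (\<integral>t. g t \<partial>m0 z)" for z using 1[of z] measure_nonneg order_trans by blast
      show "integrable Q (\<lambda>z. \<integral>t. g t \<partial>m0 z)" using 2 3 by (intro integrable_const_bound[of _ 1]) (auto simp: abs_le_iff)
      show "integrable Q (\<lambda>z. measure (m0 z) (bad x))"
        using 1 2 order_trans by (intro integrable_const_bound[of _ 1]) fastforce+
    qed
    ultimately show ?thesis by simp
  qed
  have int: "integrable Q (\<lambda>z. measure (m0 z) (bad x))"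
  proof (rule integrable_const_bound[of _ 1])
    show "AE z in Q. norm (measure (m0 z) (bad x)) \<le> 1"
    proof (rule AE_I2)
      fix z interpret M: real_distribution "m0 z" by (rule m0_dist)
      show "norm (measure (m0 z) (bad x)) \<le> 1" using M.prob_le_1 by simp
    qed
  qed measurable
  have "(\<integral>z. measure (m0 z) (bad x) \<partial>Q) \<le> 0"
  proof (rule field_le_epsilon)
    fix e :: real assume "e > 0"
    then show "(\<integral>z. measure (m0 z) (bad x) \<partial>Q) \<le> 0 + e"
      using le[of "e / (2 + C)"] C0 by (simp add: add_pos_nonneg)
  qed
  then have "(\<integral>z. measure (m0 z) (bad x) \<partial>Q) = 0" by (simp add: antisym)
  then have "AE z in Q. measure (m0 z) (bad x) = 0"
    using int by (subst (asm) integral_nonneg_eq_0_iff_AE) auto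
  then show ?thesis
  proof eventually_elim
    fix z assume h: "measure (m0 z) (bad x) = 0"
    interpret M: real_distribution "m0 z" by (rule m0_dist)
    from h show "emeasure (m0 z) (bad x) = 0" by (simp add: M.emeasure_eq_measure)
  qed
qed

lemma AE_good2:
  assumes ae: "AE z in Q. z \<in> good1" shows "AE z in Q. z \<in> good2"
proof -
  have "AE z in Q. \<forall>x :: 'd site. emeasure (m0 z) (bad x) = 0"
    unfolding AE_all_countable using bad_null[OF ae] by blast
  then show ?thesis using ae by eventually_elim (simp add: good2_def)
qed

definition m where "m z = distr (m0 z) HS dec"

lemma dec_m0: "dec \<in> measurable (m0 z) HS"
proof -
  interpret M: real_distribution "m0 z" by (rule m0_dist)
  show ?thesis using dec_measurable by (simp add: measurable_cong_sets[OF M.events_eq_borel refl])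
qed

lemma m_kernel: "m \<in> measurable Q (prob_algebra HS)"
  unfolding m_def by (rule measurable_compose[OF m0_kernel measurable_distr_prob_space]) measurable

text \<open>Off all \<open>bad x\<close> the decoders take values in the open unit interval, where
  \<open>unsquash\<close> is continuous.\<close>

lemma isCont_dec:
  fixes G :: "('d site \<Rightarrow> real) \<Rightarrow> real"
  assumes Gc: "\<And>(\<phi> :: nat \<Rightarrow> _) \<phi>'. (\<And>x. (\<lambda>n. \<phi> n x) \<longlonglongrightarrow> \<phi>' x) \<Longrightarrow> (\<lambda>n. G (\<phi> n)) \<longlonglongrightarrow> G \<phi>'"
    and t: "\<And>x. t \<notin> bad x"
  shows "isCont (\<lambda>t. G (dec t)) t"
  unfolding continuous_at_sequentially
proof (intro allI impI)
  fix u :: "nat \<Rightarrow> real" assume u: "u \<longlonglongrightarrow> t"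
  have "(\<lambda>n. dec (u n) x) \<longlonglongrightarrow> dec t x" for x
  proof -
    have "0 < D (to_nat x) t" "D (to_nat x) t < 1" using t[of x] D(2,3)[of "to_nat x" t] by (auto simp: bad_def less_le)
    then have "isCont unsquash (D (to_nat x) t)" by (rule isCont_unsquash)
    then show ?thesis unfolding dec_def using D(1) u by (intro isCont_tendsto_compose[of _ unsquash] isCont_tendsto_compose[of _ "D (to_nat x)"])
  qed
  then show "((\<lambda>t. G (dec t)) \<circ> u) \<longlonglongrightarrow> G (dec t)" unfolding o_def by (rule Gc)
qed

lemma discont_null:
  fixes G :: "('d site \<Rightarrow> real) \<Rightarrow> real"
  assumes Gc: "\<And>(\<phi> :: nat \<Rightarrow> _) \<phi>'. (\<And>x. (\<lambda>n. \<phi> n x) \<longlonglongrightarrow> \<phi>' x) \<Longrightarrow> (\<lambda>n. G (\<phi> n)) \<longlonglongrightarrow> G \<phi>'"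
    and z: "z \<in> good2"
  shows "emeasure (m0 z) {t. \<not> isCont (\<lambda>t. G (dec t)) t} = 0"
proof -
  interpret M: real_distribution "m0 z" by (rule m0_dist)
  have "(\<Union>x. bad x) \<in> null_sets (m0 z)"
    using z by (intro null_sets_UN) (auto simp: good2_def null_sets_def)
  then have "emeasure (m0 z) (\<Union>x. bad x) = 0" by auto
  moreover have "{t. \<not> isCont (\<lambda>t. G (dec t)) t} \<subseteq> (\<Union>x. bad x)" using isCont_dec[where G=G, OF Gc] by auto
  moreover have "(\<Union>x. bad x) \<in> sets (m0 z)" by measurable
  ultimately show ?thesis by (metis emeasure_mono le_zero_eq)
qed

text \<open>The limit on the line is carried back to height fields: decoding undoes the code up to
  the pinning, which \<open>inv\<close> makes invisible.\<close>

lemma m_conv: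
  fixes G :: "('d site \<Rightarrow> real) \<Rightarrow> real"
  assumes z: "z \<in> good2" and [measurable]: "G \<in> borel_measurable HS" and bd: "\<And>\<phi>. \<bar>G \<phi>\<bar> \<le> B"
    and Gc: "\<And>(\<phi> :: nat \<Rightarrow> _) \<phi>'. (\<And>x. (\<lambda>n. \<phi> n x) \<longlonglongrightarrow> \<phi>' x) \<Longrightarrow> (\<lambda>n. G (\<phi> n)) \<longlonglongrightarrow> G \<phi>'"
    and inv: "\<And>\<phi>. G (\<lambda>x. \<phi> x - \<phi> 0) = G \<phi>"
  shows "(\<lambda>n. \<integral>k. (\<integral>\<phi>. G \<phi> \<partial>K k z) \<partial>measure_pmf (c n)) \<longlonglongrightarrow> (\<integral>\<phi>. G \<phi> \<partial>m z)"
proof -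
  have zs: "z \<in> space Q" "z \<in> good1" using z by (auto simp: good2_def good1_def)
  interpret M: real_distribution "m0 z" by (rule m0_dist)
  have "(\<lambda>n. \<integral>t. G (dec t) \<partial>R n z) \<longlonglongrightarrow> (\<integral>t. G (dec t) \<partial>m0 z)"
    by (rule m0_conv[OF zs(2) _ _ discont_null[where G=G, OF Gc z]]) (auto intro: bd)
  moreover have "(\<integral>t. G (dec t) \<partial>R n z) = (\<integral>k. (\<integral>\<phi>. G \<phi> \<partial>K k z) \<partial>measure_pmf (c n))" for n
    by (subst integral_R[OF zs(1), of _ B]) (auto simp: bd dec_code inv)
  moreover have "(\<integral>t. G (dec t) \<partial>m0 z) = (\<integral>\<phi>. G \<phi> \<partial>m z)" unfolding m_def by (rule integral_distr[OF dec_m0 assms(2), symmetric])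
  ultimately show ?thesis by simp
qed

lemma m_annealed:
  fixes G :: "('d site \<Rightarrow> real) \<Rightarrow> real"
  assumes ae: "AE z in Q. z \<in> good1" and [measurable]: "G \<in> borel_measurable HS" and bd: "\<And>\<phi>. \<bar>G \<phi>\<bar> \<le> B"
    and Gc: "\<And>(\<phi> :: nat \<Rightarrow> _) \<phi>'. (\<And>x. (\<lambda>n. \<phi> n x) \<longlonglongrightarrow> \<phi>' x) \<Longrightarrow> (\<lambda>n. G (\<phi> n)) \<longlonglongrightarrow> G \<phi>'"
    and inv: "\<And>\<phi>. G (\<lambda>x. \<phi> x - \<phi> 0) = G \<phi>"
    and le: "\<And>k. k \<ge> N \<Longrightarrow> (\<integral>z. (\<integral>\<phi>. G \<phi> \<partial>K k z) \<partial>Q) \<le> b"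
  shows "(\<integral>z. (\<integral>\<phi>. G \<phi> \<partial>m z) \<partial>Q) \<le> b"
proof -
  have "(\<integral>z. (\<integral>t. G (dec t) \<partial>m0 z) \<partial>Q) \<le> b"
  proof (rule annealed_limit_le[of _ B N])
    show "AE z in Q. z \<in> good1 \<and> emeasure (m0 z) {t. \<not> isCont (\<lambda>t. G (dec t)) t} = 0"
      using AE_good2[OF ae] by eventually_elim (use discont_null[where G=G, OF Gc] in \<open>auto simp: good2_def\<close>)
    show "(\<integral>z. (\<integral>\<phi>. G (dec (code \<phi>)) \<partial>K k z) \<partial>Q) \<le> b" if "N \<le> k" for k
      using le[OF that] by (simp add: dec_code inv)
  qed (auto simp: bd)
  moreover have "(\<integral>t. G (dec t) \<partial>m0 z) = (\<integral>\<phi>. G \<phi> \<partial>m z)" for z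
  proof -
    interpret M: real_distribution "m0 z" by (rule m0_dist)
    show ?thesis unfolding m_def by (rule integral_distr[OF dec_m0 assms(2), symmetric])
  qed
  ultimately show ?thesis by simp
qed

end

text \<open>Functionals of the gradient in disguise: the last clause makes them insensitive to
  pinning at 0. Sequential sitewise continuity is a condition that Gibbs kernels preserve by
  dominated convergence.\<close>

definition test_fun :: "real \<Rightarrow> (('d::finite site \<Rightarrow> real) \<Rightarrow> real) \<Rightarrow> bool" where
  "test_fun B G \<longleftrightarrow> G \<in> borel_measurable HS \<and> (\<forall>\<phi>. \<bar>G \<phi>\<bar> \<le> B)
     \<and> (\<forall>(\<phi> :: nat \<Rightarrow> _) \<phi>'. (\<forall>x. (\<lambda>n. \<phi> n x) \<longlonglongrightarrow> \<phi>' x) \<longrightarrow> (\<lambda>n. G (\<phi> n)) \<longlonglongrightarrow> G \<phi>')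
     \<and> (\<forall>\<phi>. G (\<lambda>x. \<phi> x - \<phi> 0) = G \<phi>)"

text \<open>One sequence of mixtures, fixed before the disorder is seen, serves all disorders
  outside a null set, so the limit \<open>m\<close> is measurable. The final clause carries annealed
  upper bounds, valid from some index on, to the limit.\<close>

lemma random_weak_limit:
  fixes Q :: "'z measure" and K :: "nat \<Rightarrow> 'z \<Rightarrow> ('d::finite site \<Rightarrow> real) measure"
  assumes Q: "prob_space Q" and K: "\<And>n. K n \<in> measurable Q (prob_algebra HS)"
    and moment: "\<And>x. \<exists>C. \<forall>n. (\<integral>\<^sup>+z. \<integral>\<^sup>+\<phi>. ennreal ((\<phi> x - \<phi> 0)\<^sup>2) \<partial>K n z \<partial>Q) \<le> ennreal C"
  obtains c :: "nat \<Rightarrow> nat pmf" and good :: "'z set" and m :: "'z \<Rightarrow> ('d site \<Rightarrow> real) measure"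
  where "\<And>n. set_pmf (c n) \<subseteq> {n..}" "good \<in> sets Q" "AE z in Q. z \<in> good" "m \<in> measurable Q (prob_algebra HS)"
    "\<And>z G B. z \<in> good \<Longrightarrow> test_fun B G \<Longrightarrow>
      (\<lambda>n. \<integral>k. (\<integral>\<phi>. G \<phi> \<partial>K k z) \<partial>measure_pmf (c n)) \<longlonglongrightarrow> (\<integral>\<phi>. G \<phi> \<partial>m z)"
    "\<And>G B N b. test_fun B G \<Longrightarrow> (\<And>k. k \<ge> N \<Longrightarrow> (\<integral>z. (\<integral>\<phi>. G \<phi> \<partial>K k z) \<partial>Q) \<le> b) \<Longrightarrow>
      (\<integral>z. (\<integral>\<phi>. G \<phi> \<partial>m z) \<partial>Q) \<le> b"
proof -
  interpret Q: prob_space Q by fact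
  obtain cd :: "(nat \<Rightarrow> real) \<Rightarrow> real" and D :: "nat \<Rightarrow> real \<Rightarrow> real" where cd: "cd \<in> borel_measurable (PiM UNIV (\<lambda>_. borel))" "\<forall>s. 0 \<le> cd s \<and> cd s \<le> 1"
    "\<forall>i t. isCont (D i) t" "\<forall>i t. 0 \<le> D i t \<and> D i t \<le> 1"
    "\<forall>s. (\<forall>i. 0 \<le> s i \<and> s i < 1) \<longrightarrow> (\<forall>i::nat. D i (cd s) = s i)"
    using space_filling_coding by blast
  have tk: "tight_kernels Q K cd D c" if "\<And>n. set_pmf (c n) \<subseteq> {n..}" for c
    using cd K moment that Q by (auto simp: tight_kernels_def tight_kernels_axioms_def)
  \<comment> \<open>A provisional choice of mixtures: \<open>code\<close> is needed to state the
    functions from which \<open>c\<close> is then found, and \<open>code\<close> itself does not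
    depend on the mixtures.\<close>
  interpret T0: tight_kernels Q K cd D return_pmf by (rule tk) auto
  define q :: "nat \<Rightarrow> real" where "q k = of_rat (from_nat k)" for k
  \<comment> \<open>The rational threshold is made a second random variable with a geometric law, so
    one use of \<open>forward_convex_combinations\<close> on the product space gives the same
    \<open>c\<close> for all rationals. Clamping makes the bounds 0 and 1 hold at every
    point.\<close>
  define f :: "nat \<Rightarrow> 'z \<times> nat \<Rightarrow> real" where "f n p = max 0 (min 1 (\<integral>\<phi>. indicator {..q (snd p)} (T0.code \<phi>) \<partial>K n (fst p)))" for n p
  let ?g = "measure_pmf (geometric_pmf (1/2))"
  interpret pp: pair_prob_space Q ?g ..
  have fm: "f n \<in> borel_measurable (Q \<Otimes>\<^sub>M ?g)" for n
  proof -
    have "(\<lambda>p. \<integral>\<phi>. indicat_real {..q (snd p)} (T0.code \<phi>) \<partial>K n (fst p)) \<in> borel_measurable (Q \<Otimes>\<^sub>M ?g)"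
      using T0.pair_measurable[of "\<lambda>k z. \<integral>\<phi>. indicator {..q k} (T0.code \<phi>) \<partial>K n z" "geometric_pmf (1/2)"]
      by (simp add: case_prod_beta')
    then show ?thesis unfolding f_def by measurable
  qed
  have f01: "0 \<le> f n p \<and> f n p \<le> 1" for n p by (simp add: f_def)
  obtain c where c: "\<And>n. set_pmf (c n) \<subseteq> {n..}"
    and conv: "AE p in Q \<Otimes>\<^sub>M ?g. convergent (\<lambda>n. \<integral>k. f k p \<partial>measure_pmf (c n))"
    using forward_convex_combinations[where f=f, OF pp.P.prob_space_axioms fm f01] by blast
  interpret T: tight_kernels Q K cd D c by (rule tk) (rule c)
  have "AE z in Q. AE k in ?g. convergent (\<lambda>n. \<integral>l. f l (z, k) \<partial>measure_pmf (c n))"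
    using pp.AE_pair[OF conv] .
  \<comment> \<open>The geometric law charges every natural number, so almost every \<open>k\<close>
    means every \<open>k\<close>.\<close>
  then have "AE z in Q. \<forall>k. convergent (\<lambda>n. \<integral>l. f l (z, k) \<partial>measure_pmf (c n))"
    by (simp add: AE_measure_pmf_iff set_pmf_geometric)
  then have ae: "AE z in Q. z \<in> T.good1"
  proof (rule AE_mp, intro AE_I2 impI)
    fix z assume z: "z \<in> space Q" and cv: "\<forall>k. convergent (\<lambda>n. \<integral>l. f l (z, k) \<partial>measure_pmf (c n))"
    have "convergent (\<lambda>n. cdf (T.R n z) (of_rat r))" for r
    proof -
      have "f l (z, to_nat r) = (\<integral>\<phi>. indicator {..of_rat r} (T0.code \<phi>) \<partial>K l z)" for l
      proof -
        have "\<bar>\<integral>\<phi>. indicator {..of_rat r :: real} (T0.code \<phi>) \<partial>K l z\<bar> \<le> (1::real)"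
          by (rule T0.Kint_bound[OF z]) (auto simp: indicator_def)
        moreover have "(0::real) \<le> (\<integral>\<phi>. indicator {..of_rat r :: real} (T0.code \<phi>) \<partial>K l z)"
          by (rule integral_nonneg_AE) simp
        ultimately show ?thesis by (simp add: f_def q_def)
      qed
      then show ?thesis using cv[rule_format, of "to_nat r"] by (simp add: T.cdf_R[OF z])
    qed
    then show "z \<in> T.good1" using z by (simp add: T.good1_def)
  qed
  show ?thesis
  proof (rule that[OF c T.good2_sets T.AE_good2[OF ae] T.m_kernel])
    fix G :: "('d site \<Rightarrow> real) \<Rightarrow> real" and B assume G: "test_fun B G"
    then have g: "G \<in> borel_measurable HS" "\<And>\<phi>. \<bar>G \<phi>\<bar> \<le> B" "\<And>\<phi>. G (\<lambda>x. \<phi> x - \<phi> 0) = G \<phi>"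
      by (auto simp: test_fun_def)
    have gc: "(\<lambda>n. G (\<phi> n)) \<longlonglongrightarrow> G \<phi>'" if "\<And>x. (\<lambda>n. \<phi> n x) \<longlonglongrightarrow> \<phi>' x" for \<phi>' and \<phi> :: "nat \<Rightarrow> _"
      using G that by (simp add: test_fun_def)
    show "(\<lambda>n. \<integral>k. (\<integral>\<phi>. G \<phi> \<partial>K k z) \<partial>measure_pmf (c n)) \<longlonglongrightarrow> (\<integral>\<phi>. G \<phi> \<partial>T.m z)" if z: "z \<in> T.good2" for z
    proof (rule T.m_conv[where G=G and B=B])
      show "(\<lambda>n. G (\<phi> n)) \<longlonglongrightarrow> G \<phi>'" if "\<And>x. (\<lambda>n. \<phi> n x) \<longlonglongrightarrow> \<phi>' x" for \<phi>' and \<phi> :: "nat \<Rightarrow> _"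
        using that by (rule gc)
    qed (fact z g)+
    show "(\<integral>z. (\<integral>\<phi>. G \<phi> \<partial>T.m z) \<partial>Q) \<le> b"
      if le: "\<And>k. k \<ge> N \<Longrightarrow> (\<integral>z. (\<integral>\<phi>. G \<phi> \<partial>K k z) \<partial>Q) \<le> b" for N b
    proof (rule T.m_annealed[where G=G and B=B and N=N])
      show "(\<lambda>n. G (\<phi> n)) \<longlonglongrightarrow> G \<phi>'" if "\<And>x. (\<lambda>n. \<phi> n x) \<longlonglongrightarrow> \<phi>' x" for \<phi>' and \<phi> :: "nat \<Rightarrow> _"
        using that by (rule gc)
      show "(\<integral>z. (\<integral>\<phi>. G \<phi> \<partial>K k z) \<partial>Q) \<le> b" if "k \<ge> N" for k using that by (rule le)
    qed (fact ae g)+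
  qed
qed

section \<open>Shift-averaged Dirichlet Gibbs measures\<close>

definition cube :: "nat \<Rightarrow> 'd::finite site set" where
  "cube r = {x. \<forall>i. \<bar>x $ i\<bar> \<le> int r}"

lemma cube_eq: "cube r = (\<lambda>f. \<chi> i. f i) ` (PiE UNIV (\<lambda>_. {- int r..int r}))"
proof (intro set_eqI iffI)
  fix x :: "'a site" assume "x \<in> cube r"
  then have "x = (\<chi> i. x $ i)" "(\<lambda>i. x $ i) \<in> PiE UNIV (\<lambda>_. {- int r..int r})"
    by (auto simp: cube_def abs_le_iff vec_eq_iff minus_le_iff)
  then show "x \<in> (\<lambda>f. \<chi> i. f i) ` (PiE UNIV (\<lambda>_. {- int r..int r}))" by blast
qed (auto simp: cube_def abs_le_iff PiE_iff minus_le_iff)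

lemma card_cube: "card (cube r :: 'd::finite site set) = (2 * r + 1) ^ CARD('d)"
proof -
  have "inj_on (\<lambda>f. \<chi> i. f i) (PiE UNIV (\<lambda>_::'d. {- int r..int r}))" by (auto simp: inj_on_def vec_eq_iff)
  then have "card (cube r :: 'd site set) = card (PiE UNIV (\<lambda>_::'d. {- int r..int r}))"
    unfolding cube_eq by (rule card_image)
  also have "\<dots> = (2 * r + 1) ^ CARD('d)" by (simp add: card_PiE nat_add_distrib nat_mult_distrib)
  finally show ?thesis .
qed

lemma finite_cube [simp]: "finite (cube r)"
  unfolding cube_eq by (intro finite_imageI finite_PiE) auto

lemma zero_in_cube [simp]: "0 \<in> cube r" by (simp add: cube_def)

lemma cube_nonempty [simp]: "cube r \<noteq> {}" using zero_in_cube by blast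

lemma cube_mono: "r \<le> s \<Longrightarrow> cube r \<subseteq> cube s"
  by (auto simp: cube_def intro: order_trans)

lemma cube_diff: "x \<in> cube r \<Longrightarrow> y \<in> cube s \<Longrightarrow> x - y \<in> cube (r + s)"
  unfolding cube_def using abs_triangle_ineq4 by (auto intro!: order_trans[OF abs_triangle_ineq4] add_mono)

lemma cube_add: "x \<in> cube r \<Longrightarrow> y \<in> cube s \<Longrightarrow> x + y \<in> cube (r + s)"
  unfolding cube_def by (auto intro!: order_trans[OF abs_triangle_ineq] add_mono)

lemma finite_subset_cube:
  assumes "finite (\<Lambda> :: 'd::finite site set)" obtains r where "\<Lambda> \<subseteq> cube r"
proof -
  have "\<exists>r. x \<in> cube r" for x :: "'d site"
  proof (intro exI)
    have "\<bar>x $ i\<bar> \<le> (\<Sum>i\<in>UNIV. \<bar>x $ i\<bar>)" for i by (rule member_le_sum) auto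
    then show "x \<in> cube (nat (\<Sum>i\<in>UNIV. \<bar>x $ i\<bar>))" by (simp add: cube_def sum_nonneg)
  qed
  then obtain f where f: "\<And>x :: 'd site. x \<in> cube (f x)" by metis
  have "\<Lambda> \<subseteq> cube (\<Sum>x\<in>\<Lambda>. f x)"
  proof
    fix x assume "x \<in> \<Lambda>"
    then have "f x \<le> (\<Sum>x\<in>\<Lambda>. f x)" using assms by (intro member_le_sum) auto
    then show "x \<in> cube (\<Sum>x\<in>\<Lambda>. f x)" using f cube_mono by blast
  qed
  then show ?thesis using that by blast
qed

text \<open>Both radii are \<open>N * N\<close> up to terms of order N, so the layer between the
  cubes is negligible in volume.\<close>

lemma cube_ratio:
  "(\<lambda>N. real (card (cube (N * N - r) :: 'd::finite site set)) / real (card (cube (N * N + N) :: 'd site set))) \<longlonglongrightarrow> 1"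
proof -
  have "(\<lambda>N. (2 * real (N * N - r) + 1) / (2 * real (N * N + N) + 1)) \<longlonglongrightarrow> 1"
  proof (rule Lim_transform_eventually)
    show "(\<lambda>N. (2 * (real N * real N - real r) + 1) / (2 * (real N * real N + real N) + 1)) \<longlonglongrightarrow> 1" by real_asymp
    show "\<forall>\<^sub>F N in sequentially. (2 * (real N * real N - real r) + 1) / (2 * (real N * real N + real N) + 1) = (2 * real (N * N - r) + 1) / (2 * real (N * N + N) + 1)"
    proof (rule eventually_sequentiallyI[of "r + 1"])
      fix N assume "r + 1 \<le> N"
      then have "r \<le> N * N" by (metis add_leD1 le_square le_trans)
      then show "(2 * (real N * real N - real r) + 1) / (2 * (real N * real N + real N) + 1) = (2 * real (N * N - r) + 1) / (2 * real (N * N + N) + 1)"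
        by (simp add: of_nat_diff)
    qed
  qed
  from tendsto_power[OF this, of "CARD('d)"] show ?thesis
    by (simp add: card_cube power_divide add.commute)
qed

lemma sum_diff_le:
  fixes a :: "'a \<Rightarrow> real"
  assumes "finite S" "finite T" "card S = card T" "W \<subseteq> S" "W \<subseteq> T" and a: "\<And>x. \<bar>a x\<bar> \<le> B"
  shows "\<bar>sum a S - sum a T\<bar> \<le> 2 * B * (real (card S) - real (card W))"
proof -
  have fW: "finite W" using assms finite_subset by blast
  have "\<bar>sum a (S - W)\<bar> \<le> real (card (S - W)) * B" "\<bar>sum a (T - W)\<bar> \<le> real (card (T - W)) * B"
    using sum_norm_bound[of "S - W" a B] sum_norm_bound[of "T - W" a B] a by auto
  moreover have "sum a S = sum a (S - W) + sum a W" "sum a T = sum a (T - W) + sum a W"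
    using assms by (auto intro: sum.subset_diff)
  moreover have "real (card (S - W)) = real (card S) - real (card W)" "real (card (T - W)) = real (card S) - real (card W)"
    using assms fW by (auto simp: card_Diff_subset card_mono of_nat_diff)
  ultimately show ?thesis by (auto simp: algebra_simps)
qed

lemma (in potential) AE_gib_boundary:
  assumes fin: "finite \<Lambda>" shows "AE \<phi> in gib U h \<Lambda> \<psi>. \<forall>x. x \<notin> \<Lambda> \<longrightarrow> \<phi> x = \<psi> x"
proof -
  have e: "(\<lambda>\<phi>. extend \<Lambda> \<phi> \<psi>) \<in> measurable (density (PiM \<Lambda> (\<lambda>_. lborel)) (\<lambda>\<phi>. ennreal (wt U h \<Lambda> (extend \<Lambda> \<phi> \<psi>)) / pfn U h \<Lambda> \<psi>)) HS"
    by measurable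
  have "Measurable.pred HS (\<lambda>\<phi>. \<forall>x. x \<notin> \<Lambda> \<longrightarrow> \<phi> x = \<psi> x)"
    by (intro pred_intros_countable(1) pred_intros_imp'(1) borel_measurable_pred_eq) measurable
  then have s: "{\<phi> \<in> space HS. \<forall>x. x \<notin> \<Lambda> \<longrightarrow> \<phi> x = \<psi> x} \<in> sets HS" by (rule predE)
  show ?thesis unfolding gib_eq[OF fin]
    by (subst AE_distr_iff[OF e s]) (auto simp: extend_def)
qed

lemma prob_integral_abs_le:
  fixes F :: "'a \<Rightarrow> real"
  assumes "prob_space M" "F \<in> borel_measurable M" "\<And>x. \<bar>F x\<bar> \<le> B"
  shows "\<bar>\<integral>x. F x \<partial>M\<bar> \<le> B"
proof -
  interpret M: prob_space M by fact
  have i: "integrable M F" by (rule M.integrable_const_bound[of _ B]) (auto simp: assms)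
  have "\<bar>\<integral>x. F x \<partial>M\<bar> \<le> (\<integral>x. \<bar>F x\<bar> \<partial>M)" by (rule integral_abs_bound)
  also have "\<dots> \<le> B" using i assms by (intro M.integral_le_const) auto
  finally show ?thesis .
qed

text \<open>What both models supply: a stationary disorder law, shifts acting as a group, potentials
  and fields covariant under them, and one constant \<open>E0\<close> bounding first moments of
  fields and lower bounds and second moments of currents, uniformly in \<Lambda> and in the bond.
  The annealed energy per site is then bounded.\<close>

locale grad_model = prob_space Q for Q :: "'z measure" +
  fixes sh :: "'d::finite site \<Rightarrow> 'z \<Rightarrow> 'z" and U :: "'z \<Rightarrow> 'd site \<Rightarrow> 'd \<Rightarrow> real \<Rightarrow> real"
    and h :: "'z \<Rightarrow> 'd site \<Rightarrow> real" and A C E0 :: real and Bf :: "'z \<Rightarrow> 'd site \<Rightarrow> 'd \<Rightarrow> real"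
    and j :: "'z \<Rightarrow> 'd site set \<Rightarrow> 'd site \<times> 'd \<Rightarrow> real" and u :: "real ^ 'd"
  assumes space_Q [simp]: "space Q = UNIV"
    and pot: "\<And>z. potential (U z) (h z) A (Bf z) (j z)"
    and C: "C \<ge> 0" and upper: "\<And>z x i s. U z x i s \<le> C * (1 + s\<^sup>2)"
    and sh_measurable [measurable]: "\<And>v. sh v \<in> measurable Q Q"
    and sh_distr: "\<And>v. distr Q Q (sh v) = Q"
    and sh_zero: "\<And>z. sh 0 z = z"
    and sh_sh: "\<And>v w z. sh v (sh w z) = sh (v + w) z"
    and U_sh: "\<And>v z x i. U (sh v z) x i = U z (x - v) i"
    and h_sh: "\<And>v z x. h (sh v z) x = h z (x - v)"
    and U_measurable: "\<And>x i. (\<lambda>(z, s). U z x i s) \<in> borel_measurable (Q \<Otimes>\<^sub>M borel)"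
    and h_measurable: "\<And>x. (\<lambda>z. h z x) \<in> borel_measurable Q"
    and h_moment: "\<And>x. integrable Q (\<lambda>z. h z x)" "\<And>x. (\<integral>z. \<bar>h z x\<bar> \<partial>Q) \<le> E0"
    and B_moment: "\<And>x i. integrable Q (\<lambda>z. Bf z x i)" "\<And>x i. (\<integral>z. \<bar>Bf z x i\<bar> \<partial>Q) \<le> E0"
    and j_moment: "\<And>\<Lambda> b. finite \<Lambda> \<Longrightarrow> integrable Q (\<lambda>z. (j z \<Lambda> b)\<^sup>2)"
      "\<And>\<Lambda> b. finite \<Lambda> \<Longrightarrow> (\<integral>z. (j z \<Lambda> b)\<^sup>2 \<partial>Q) \<le> E0"
begin

definition plane :: "'d site \<Rightarrow> real" where
  "plane x = (\<Sum>i\<in>UNIV. u $ i * real_of_int (x $ i))"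

lemma plane_add: "plane (x + y) = plane x + plane y"
  by (simp add: plane_def distrib_left sum.distrib)

lemma gd_plane: "gd plane b = u $ snd b"
proof -
  have "plane (unitv i) = (\<Sum>k\<in>UNIV. if k = i then u $ k else 0)" for i
    unfolding plane_def by (rule sum.cong) (auto simp: unitv_nth)
  then show ?thesis by (simp add: gd_def plane_add)
qed

definition box_gib :: "nat \<Rightarrow> 'z \<Rightarrow> ('d site \<Rightarrow> real) measure" where
  "box_gib N z = gib (U z) (h z) (cube (N * N)) plane"

text \<open>The radius exceeds that of the box by \<open>N\<close>: for each \<open>x\<close> in
  \<open>cube N\<close> the sites \<open>x - v\<close> run through the whole box.\<close>

definition Av :: "nat \<Rightarrow> 'd site set" where "Av N = cube (N * N + N)"

text \<open>The finite-volume measure in the box translated by \<open>v\<close>, for the same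
  disorder \<open>z\<close>: the disorder is moved back and the resulting heights forward. The
  boundary plane is translated along, which changes it by a constant only.\<close>

definition box_gib_at :: "nat \<Rightarrow> 'd site \<Rightarrow> 'z \<Rightarrow> ('d site \<Rightarrow> real) measure" where
  "box_gib_at N v z = distr (box_gib N (sh (- v) z)) HS (shift_site v)"

definition K :: "nat \<Rightarrow> 'z \<Rightarrow> ('d site \<Rightarrow> real) measure" where
  "K N z = measure_pmf (pmf_of_set (Av N)) \<bind> (\<lambda>v. box_gib_at N v z)"

lemma Av_fin [simp]: "finite (Av N)" "Av N \<noteq> {}" "card (Av N) > 0"
  by (auto simp: Av_def card_cube)

lemma box_gib_kernel: "box_gib N \<in> measurable Q (prob_algebra HS)"
  unfolding box_gib_def by (rule gib_z_kernel[OF pot _ U_measurable h_measurable]) simp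

lemma box_gib_prob: "prob_space (box_gib N z)" and box_gib_sets [simp, measurable_cong]: "sets (box_gib N z) = sets HS"
  using measurable_space[OF box_gib_kernel[of N], of z] by (auto simp: space_prob_algebra)

lemma box_gib_sub [measurable]: "box_gib N \<in> measurable Q (subprob_algebra HS)"
  by (rule measurable_prob_algebraD[OF box_gib_kernel])

lemma box_gib_at_kernel: "box_gib_at N v \<in> measurable Q (prob_algebra HS)"
  unfolding box_gib_at_def
  by (rule measurable_compose[OF measurable_compose[OF sh_measurable box_gib_kernel] measurable_distr_prob_space]) measurable

lemma box_gib_at_prob: "prob_space (box_gib_at N v z)" and box_gib_at_sets [simp, measurable_cong]: "sets (box_gib_at N v z) = sets HS"
  using measurable_space[OF box_gib_at_kernel[of N v], of z] by (auto simp: space_prob_algebra)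

lemma box_gib_at_mix: "(\<lambda>v. box_gib_at N v z) \<in> measurable (measure_pmf p) (subprob_algebra HS)"
  by (auto simp: space_subprob_algebra intro!: prob_space_imp_subprob_space box_gib_at_prob)

lemma nn_integral_K_box_gib_at:
  assumes "G \<in> borel_measurable HS"
  shows "(\<integral>\<^sup>+\<phi>. G \<phi> \<partial>K N z) = (\<Sum>v\<in>Av N. (\<integral>\<^sup>+\<phi>. G \<phi> \<partial>box_gib_at N v z)) / of_nat (card (Av N))"
proof -
  have "(\<integral>\<^sup>+\<phi>. G \<phi> \<partial>K N z) = (\<integral>\<^sup>+v. (\<integral>\<^sup>+\<phi>. G \<phi> \<partial>box_gib_at N v z) \<partial>measure_pmf (pmf_of_set (Av N)))"
    unfolding K_def by (rule nn_integral_bind[OF assms box_gib_at_mix])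
  then show ?thesis by (simp add: nn_integral_pmf_of_set ennreal_of_nat_eq_real_of_nat)
qed

lemma nn_integral_K:
  assumes [measurable]: "G \<in> borel_measurable HS"
  shows "(\<integral>\<^sup>+\<phi>. G \<phi> \<partial>K N z) = (\<Sum>v\<in>Av N. \<integral>\<^sup>+\<phi>. G (shift_site v \<phi>) \<partial>box_gib N (sh (- v) z)) / of_nat (card (Av N))"
  unfolding nn_integral_K_box_gib_at[OF assms] by (simp add: box_gib_at_def nn_integral_distr)

lemma integral_K:
  fixes G :: "_ \<Rightarrow> real"
  assumes [measurable]: "G \<in> borel_measurable HS" and bd: "\<And>\<phi>. \<bar>G \<phi>\<bar> \<le> B"
  shows "(\<integral>\<phi>. G \<phi> \<partial>K N z) = (\<Sum>v\<in>Av N. \<integral>\<phi>. G (shift_site v \<phi>) \<partial>box_gib N (sh (- v) z)) / real (card (Av N))"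
proof -
  have "(\<integral>\<phi>. G \<phi> \<partial>K N z) = (\<integral>v. (\<integral>\<phi>. G \<phi> \<partial>box_gib_at N v z) \<partial>measure_pmf (pmf_of_set (Av N)))"
    unfolding K_def by (rule integral_bind[OF _ bd box_gib_at_mix, where B'=1])
      (auto simp: measure_pmf.finite_measure_axioms prob_space.emeasure_space_1[OF box_gib_at_prob])
  also have "\<dots> = (\<Sum>v\<in>Av N. (\<integral>\<phi>. G \<phi> \<partial>box_gib_at N v z)) / real (card (Av N))"
    by (simp add: integral_pmf_of_set)
  finally show ?thesis by (simp add: box_gib_at_def integral_distr)
qed

lemma K_kernel: "K N \<in> measurable Q (prob_algebra HS)"
proof (rule measurable_prob_algebraI)
  show pr: "prob_space (K N z)" for z
    unfolding K_def by (intro measure_pmf.prob_space_bind[OF _ box_gib_at_mix] AE_I2 box_gib_at_prob)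
  show "K N \<in> measurable Q (subprob_algebra HS)"
  proof (rule measurable_subprob_algebra)
    show "subprob_space (K N z)" for z by (intro prob_space_imp_subprob_space pr)
    show s: "sets (K N z) = sets HS" for z unfolding K_def by (rule sets_bind) auto
    fix X :: "('d site \<Rightarrow> real) set" assume X [measurable]: "X \<in> sets HS"
    have "emeasure (K N z) X = (\<Sum>v\<in>Av N. emeasure (box_gib_at N v z) X) / of_nat (card (Av N))" for z
      using nn_integral_K_box_gib_at[of "indicator X" N z] by (simp add: s)
    moreover have "(\<lambda>z. emeasure (box_gib_at N v z) X) \<in> borel_measurable Q" for v
      using measurable_emeasure_kernel[OF measurable_prob_algebraD[OF box_gib_at_kernel] X] by simp
    ultimately show "(\<lambda>z. emeasure (K N z) X) \<in> borel_measurable Q" by simp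
  qed
qed

lemma K_prob: "prob_space (K N z)" and K_sets [simp, measurable_cong]: "sets (K N z) = sets HS"
  using measurable_space[OF K_kernel[of N], of z] by (auto simp: space_prob_algebra)

lemma nn_stationary:
  assumes "f \<in> borel_measurable Q" shows "(\<integral>\<^sup>+z. f (sh v z) \<partial>Q) = (\<integral>\<^sup>+z. f z \<partial>Q)"
  using nn_integral_distr[OF sh_measurable[of v], of f] assms by (simp add: sh_distr)

lemma stationary:
  fixes f :: "'z \<Rightarrow> real"
  assumes "f \<in> borel_measurable Q" shows "(\<integral>z. f (sh v z) \<partial>Q) = (\<integral>z. f z \<partial>Q)"
  using integral_distr[OF sh_measurable[of v], of f] assms by (simp add: sh_distr)

definition BN :: "nat \<Rightarrow> ('d site \<Rightarrow> real) measure" where "BN N = Q \<bind> box_gib N"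

lemma BN_sets [simp, measurable_cong]: "sets (BN N) = sets HS"
  unfolding BN_def by (rule sets_bind) auto

lemma BN_prob: "prob_space (BN N)"
  unfolding BN_def by (intro prob_space_bind[OF _ box_gib_sub] AE_I2 box_gib_prob)

text \<open>Stationarity removes the shift of the disorder, so only translates of the single law
  \<open>BN N\<close> are left.\<close>

lemma annealed_nn:
  assumes [measurable]: "G \<in> borel_measurable HS"
  shows "(\<integral>\<^sup>+z. \<integral>\<^sup>+\<phi>. G \<phi> \<partial>K N z \<partial>Q) = (\<Sum>v\<in>Av N. \<integral>\<^sup>+\<phi>. G (shift_site v \<phi>) \<partial>BN N) / of_nat (card (Av N))"
proof -
  have m: "(\<lambda>z. \<integral>\<^sup>+\<phi>. G (shift_site v \<phi>) \<partial>box_gib N z) \<in> borel_measurable Q" for v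
    by (rule measurable_compose[OF box_gib_sub nn_integral_measurable_subprob_algebra]) measurable
  have m': "(\<lambda>z. \<integral>\<^sup>+\<phi>. G (shift_site v \<phi>) \<partial>box_gib N (sh (- v) z)) \<in> borel_measurable Q" for v
    by (rule measurable_compose[OF sh_measurable m])
  have "(\<integral>\<^sup>+z. \<integral>\<^sup>+\<phi>. G \<phi> \<partial>K N z \<partial>Q) = (\<Sum>v\<in>Av N. \<integral>\<^sup>+z. \<integral>\<^sup>+\<phi>. G (shift_site v \<phi>) \<partial>box_gib N (sh (- v) z) \<partial>Q) / of_nat (card (Av N))"
    using m' by (simp add: nn_integral_K nn_integral_divide nn_integral_sum)
  also have "(\<lambda>v. \<integral>\<^sup>+z. \<integral>\<^sup>+\<phi>. G (shift_site v \<phi>) \<partial>box_gib N (sh (- v) z) \<partial>Q) = (\<lambda>v. \<integral>\<^sup>+\<phi>. G (shift_site v \<phi>) \<partial>BN N)"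
  proof
    fix v
    have "(\<integral>\<^sup>+\<phi>. G (shift_site v \<phi>) \<partial>BN N) = (\<integral>\<^sup>+z. \<integral>\<^sup>+\<phi>. G (shift_site v \<phi>) \<partial>box_gib N z \<partial>Q)"
      unfolding BN_def by (rule nn_integral_bind[OF _ box_gib_sub]) measurable
    then show "(\<integral>\<^sup>+z. \<integral>\<^sup>+\<phi>. G (shift_site v \<phi>) \<partial>box_gib N (sh (- v) z) \<partial>Q) = (\<integral>\<^sup>+\<phi>. G (shift_site v \<phi>) \<partial>BN N)"
      using nn_stationary[OF m] by simp
  qed
  finally show ?thesis .
qed

lemma annealed:
  fixes G :: "_ \<Rightarrow> real"
  assumes [measurable]: "G \<in> borel_measurable HS" and bd: "\<And>\<phi>. \<bar>G \<phi>\<bar> \<le> B"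
  shows "(\<integral>z. (\<integral>\<phi>. G \<phi> \<partial>K N z) \<partial>Q) = (\<Sum>v\<in>Av N. \<integral>\<phi>. G (shift_site v \<phi>) \<partial>BN N) / real (card (Av N))"
proof -
  have m: "(\<lambda>z. \<integral>\<phi>. G (shift_site v \<phi>) \<partial>box_gib N z) \<in> borel_measurable Q" for v
    by (rule measurable_compose[OF box_gib_sub integral_measurable_subprob_algebra]) measurable
  have m': "(\<lambda>z. \<integral>\<phi>. G (shift_site v \<phi>) \<partial>box_gib N (sh (- v) z)) \<in> borel_measurable Q" for v
    by (rule measurable_compose[OF sh_measurable m])
  have b: "\<bar>\<integral>\<phi>. G (shift_site v \<phi>) \<partial>box_gib N z\<bar> \<le> B" for v z
    by (rule prob_integral_abs_le[OF box_gib_prob]) (auto simp: bd)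
  have i: "integrable Q (\<lambda>z. \<integral>\<phi>. G (shift_site v \<phi>) \<partial>box_gib N (sh (- v) z))" for v
    by (rule integrable_const_bound[of _ B]) (auto simp: b m')
  have "(\<integral>z. (\<integral>\<phi>. G \<phi> \<partial>K N z) \<partial>Q) = (\<Sum>v\<in>Av N. \<integral>z. (\<integral>\<phi>. G (shift_site v \<phi>) \<partial>box_gib N (sh (- v) z)) \<partial>Q) / real (card (Av N))"
    using i by (simp add: integral_K[OF assms])
  also have "(\<lambda>v. \<integral>z. (\<integral>\<phi>. G (shift_site v \<phi>) \<partial>box_gib N (sh (- v) z)) \<partial>Q) = (\<lambda>v. \<integral>\<phi>. G (shift_site v \<phi>) \<partial>BN N)"
  proof
    fix v
    have "(\<integral>\<phi>. G (shift_site v \<phi>) \<partial>BN N) = (\<integral>z. (\<integral>\<phi>. G (shift_site v \<phi>) \<partial>box_gib N z) \<partial>Q)"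
      unfolding BN_def by (rule integral_bind[OF _ _ box_gib_sub, where B=B and B'=1])
        (auto simp: bd finite_measure_axioms prob_space.emeasure_space_1[OF box_gib_prob])
    then show "(\<integral>z. (\<integral>\<phi>. G (shift_site v \<phi>) \<partial>box_gib N (sh (- v) z)) \<partial>Q) = (\<integral>\<phi>. G (shift_site v \<phi>) \<partial>BN N)"
      using stationary[OF m] by simp
  qed
  finally show ?thesis .
qed

text \<open>Only the shifts near the boundary of the averaging cube contribute an error.\<close>

lemma K_dlr:
  fixes G :: "_ \<Rightarrow> real"
  assumes fin: "finite \<Lambda>" and r: "\<Lambda> \<subseteq> cube r" "r \<le> N * N" and G [measurable]: "G \<in> borel_measurable HS" and bd: "\<And>\<phi>. \<bar>G \<phi>\<bar> \<le> B"
  shows "\<bar>(\<integral>\<phi>. (\<integral>\<phi>'. G \<phi>' \<partial>gib (U z) (h z) \<Lambda> \<phi>) \<partial>K N z) - (\<integral>\<phi>. G \<phi> \<partial>K N z)\<bar>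
    \<le> 2 * B * (1 - real (card (cube (N * N - r) :: 'd site set)) / real (card (Av N)))"
proof -
  interpret p: potential "U z" "h z" A "Bf z" "j z" by (rule pot)
  define \<Gamma> where "\<Gamma> \<phi> = (\<integral>\<phi>'. G \<phi>' \<partial>gib (U z) (h z) \<Lambda> \<phi>)" for \<phi>
  have B0: "0 \<le> B" using bd[of undefined] by linarith
  have Gm [measurable]: "\<Gamma> \<in> borel_measurable HS" unfolding \<Gamma>_def
    by (rule measurable_compose[OF measurable_prob_algebraD[OF p.gib_kernel[OF fin]] integral_measurable_subprob_algebra]) measurable
  have Gb: "\<bar>\<Gamma> \<phi>\<bar> \<le> B" for \<phi> unfolding \<Gamma>_def
    by (rule prob_integral_abs_le[OF p.prob_space_gib[OF fin]]) (auto simp: bd)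
  define d where "d v = (\<integral>\<phi>. \<Gamma> (shift_site v \<phi>) \<partial>box_gib N (sh (- v) z)) - (\<integral>\<phi>. G (shift_site v \<phi>) \<partial>box_gib N (sh (- v) z))" for v
  \<comment> \<open>For these \<open>v\<close> the translate of \<Lambda> by \<open>- v\<close> lies
    inside the box, so consistency makes the DLR equation exact. The other shifts are bounded
    trivially by \<open>2 * B\<close>.\<close>
  have d0: "d v = 0" if v: "v \<in> cube (N * N - r)" for v
  proof -
    let ?z = "sh (- v) z"
    interpret p': potential "U ?z" "h ?z" A "Bf ?z" "j ?z" by (rule pot)
    have sub: "(\<lambda>x. x - v) ` \<Lambda> \<subseteq> cube (N * N)"
    proof
      fix y assume "y \<in> (\<lambda>x. x - v) ` \<Lambda>"
      then obtain x where "x \<in> cube r" "y = x - v" using r by auto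
      then have "y \<in> cube (r + (N * N - r))" using cube_diff v by blast
      then show "y \<in> cube (N * N)" using r(2) by simp
    qed
    have "\<Gamma> (shift_site v \<phi>) = (\<integral>\<phi>'. G (shift_site v \<phi>') \<partial>gib (U ?z) (h ?z) ((\<lambda>x. x - v) ` \<Lambda>) \<phi>)" for \<phi>
    proof -
      have e: "gib (U z) (h z) \<Lambda> (shift_site v \<phi>) = distr (gib (U ?z) (h ?z) ((\<lambda>x. x - v) ` \<Lambda>) \<phi>) HS (shift_site v)"
        using gib_shift[OF p.potential_axioms p'.potential_axioms fin, of v \<phi> 0] U_sh[of "- v" z] h_sh[of "- v" z]
        by (simp add: shift_site_def[abs_def])
      show ?thesis unfolding \<Gamma>_def e by (rule integral_distr) auto
    qed
    then show ?thesis unfolding d_def box_gib_def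
      by (subst p'.gib_consistent[OF _ sub, symmetric, where K=B]) (auto simp: bd)
  qed
  have db: "\<bar>d v\<bar> \<le> 2 * B" for v
  proof -
    have "\<bar>\<integral>\<phi>. \<Gamma> (shift_site v \<phi>) \<partial>box_gib N (sh (- v) z)\<bar> \<le> B" "\<bar>\<integral>\<phi>. G (shift_site v \<phi>) \<partial>box_gib N (sh (- v) z)\<bar> \<le> B"
      by (rule prob_integral_abs_le[OF box_gib_prob]; simp add: Gb bd)+
    then show ?thesis by (simp add: d_def abs_le_iff)
  qed
  have sub: "cube (N * N - r) \<subseteq> Av N" unfolding Av_def by (rule cube_mono) simp
  have "(\<integral>\<phi>. \<Gamma> \<phi> \<partial>K N z) - (\<integral>\<phi>. G \<phi> \<partial>K N z) = (\<Sum>v\<in>Av N. d v) / real (card (Av N))"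
    by (simp add: integral_K[OF Gm Gb] integral_K[OF G bd] d_def sum_subtractf diff_divide_distrib)
  also have "(\<Sum>v\<in>Av N. d v) = (\<Sum>v\<in>Av N - cube (N * N - r). d v)"
    by (rule sum.mono_neutral_right) (auto simp: d0)
  also have "\<bar>(\<Sum>v\<in>Av N - cube (N * N - r). d v) / real (card (Av N))\<bar> \<le> (2 * B * (real (card (Av N)) - real (card (cube (N * N - r) :: 'd site set)))) / real (card (Av N))"
  proof -
    have "\<bar>\<Sum>v\<in>Av N - cube (N * N - r). d v\<bar> \<le> real (card (Av N - cube (N * N - r))) * (2 * B)"
      using sum_norm_bound[of "Av N - cube (N * N - r)" d "2 * B"] db by simp
    also have "real (card (Av N - cube (N * N - r))) = real (card (Av N)) - real (card (cube (N * N - r) :: 'd site set))"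
      using sub by (simp add: card_Diff_subset card_mono of_nat_diff)
    finally show ?thesis by (simp add: abs_divide divide_right_mono mult.commute)
  qed
  also have "\<dots> = 2 * B * (1 - real (card (cube (N * N - r) :: 'd site set)) / real (card (Av N)))"
    by (simp add: diff_divide_distrib[symmetric] right_diff_distrib diff_divide_distrib)
  finally show ?thesis by (simp add: \<Gamma>_def)
qed

text \<open>Shifting the disorder by \<open>w\<close> merely translates the averaging window; the
  window and its translate share \<open>cube (N * N - r)\<close>.\<close>

lemma K_covariant:
  fixes G :: "_ \<Rightarrow> real"
  assumes r: "w \<in> cube r" "r \<le> N * N" and G [measurable]: "G \<in> borel_measurable HS" and bd: "\<And>\<phi>. \<bar>G \<phi>\<bar> \<le> B"
  shows "\<bar>(\<integral>\<phi>. G \<phi> \<partial>K N (sh w z)) - (\<integral>\<phi>. G (shift_site w \<phi>) \<partial>K N z)\<bar>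
    \<le> 2 * B * (1 - real (card (cube (N * N - r) :: 'd site set)) / real (card (Av N)))"
proof -
  define a where "a v = (\<integral>\<phi>. G (shift_site (v + w) \<phi>) \<partial>box_gib N (sh (- v) z))" for v
  have ab: "\<bar>a v\<bar> \<le> B" for v
    unfolding a_def by (rule prob_integral_abs_le[OF box_gib_prob]) (auto simp: bd)
  have 1: "(\<integral>\<phi>. G \<phi> \<partial>K N (sh w z)) = (\<Sum>v\<in>(\<lambda>v. v - w) ` Av N. a v) / real (card (Av N))"
    unfolding integral_K[OF G bd] by (subst sum.reindex) (auto simp: inj_on_def a_def sh_sh add.commute)
  have ss: "shift_site w (shift_site v \<phi>) = shift_site (v + w) \<phi>" for v and \<phi> :: "'d site \<Rightarrow> real"
    by (auto simp: shift_site_def fun_eq_iff algebra_simps)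
  have 2: "(\<integral>\<phi>. G (shift_site w \<phi>) \<partial>K N z) = (\<Sum>v\<in>Av N. a v) / real (card (Av N))"
    by (subst integral_K[where B=B]) (auto simp: bd a_def ss)
  have "\<bar>sum a ((\<lambda>v. v - w) ` Av N) - sum a (Av N)\<bar> \<le> 2 * B * (real (card ((\<lambda>v. v - w) ` Av N)) - real (card (cube (N * N - r) :: 'd site set)))"
  proof (rule sum_diff_le[OF _ _ _ _ _ ab])
    show "card ((\<lambda>v. v - w) ` Av N) = card (Av N)" by (rule card_image) (auto simp: inj_on_def)
    show "cube (N * N - r) \<subseteq> Av N" unfolding Av_def by (rule cube_mono) simp
    show "cube (N * N - r) \<subseteq> (\<lambda>v. v - w) ` Av N"
    proof
      fix v :: "'d site" assume "v \<in> cube (N * N - r)"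
      then have "v + w \<in> cube (N * N - r + r)" using r(1) by (rule cube_add)
      then have "v + w \<in> Av N" using r(2) cube_mono[of "N * N" "N * N + N"] by (auto simp: Av_def)
      then show "v \<in> (\<lambda>v. v - w) ` Av N" by (intro image_eqI[of _ _ "v + w"]) auto
    qed
  qed auto
  also have "card ((\<lambda>v. v - w) ` Av N) = card (Av N)" by (rule card_image) (auto simp: inj_on_def)
  finally have 3: "\<bar>sum a ((\<lambda>v. v - w) ` Av N) - sum a (Av N)\<bar> \<le> 2 * B * (real (card (Av N)) - real (card (cube (N * N - r) :: 'd site set)))" .
  have "\<bar>(\<integral>\<phi>. G \<phi> \<partial>K N (sh w z)) - (\<integral>\<phi>. G (shift_site w \<phi>) \<partial>K N z)\<bar> = \<bar>sum a ((\<lambda>v. v - w) ` Av N) - sum a (Av N)\<bar> / real (card (Av N))"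
    unfolding 1 2 by (simp add: abs_divide diff_divide_distrib[symmetric])
  also have "\<dots> \<le> 2 * B * (real (card (Av N)) - real (card (cube (N * N - r) :: 'd site set))) / real (card (Av N))"
    by (intro divide_right_mono 3) simp
  also have "\<dots> = 2 * B * (1 - real (card (cube (N * N - r) :: 'd site set)) / real (card (Av N)))"
    by (simp add: right_diff_distrib diff_divide_distrib)
  finally show ?thesis .
qed

end

section \<open>Energy bounds and the tilt\<close>

context grad_model begin

lemma AE_BN_boundary: "AE \<phi> in BN N. \<forall>x. x \<notin> cube (N * N) \<longrightarrow> \<phi> x = plane x"
proof -
  have m: "Measurable.pred HS (\<lambda>\<phi>. \<forall>x. x \<notin> cube (N * N) \<longrightarrow> \<phi> x = plane x)"
    by (intro pred_intros_countable(1) pred_intros_imp'(1) borel_measurable_pred_eq) measurable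
  show ?thesis unfolding BN_def AE_bind[OF box_gib_sub m] unfolding box_gib_def
    by (intro AE_I2 potential.AE_gib_boundary[OF pot]) simp
qed

definition tilt_sq where "tilt_sq = (\<Sum>i\<in>UNIV. (u $ i)\<^sup>2)"

lemma tilt_sq_nonneg: "0 \<le> tilt_sq" by (simp add: tilt_sq_def sum_nonneg)

lemma u_le_tilt_sq: "(u $ i)\<^sup>2 \<le> tilt_sq"
  unfolding tilt_sq_def by (rule member_le_sum) auto

lemma E0_nonneg: "0 \<le> E0"
proof -
  have "0 \<le> (\<integral>z. \<bar>h z 0\<bar> \<partial>Q)" by (rule integral_nonneg_AE) simp
  also have "\<dots> \<le> E0" by (rule h_moment)
  finally show ?thesis .
qed

lemma A_pos: "A > 0" using potential.A[OF pot] .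

lemma dir_energy_meas [measurable]: "dir_energy \<Lambda> \<in> borel_measurable HS"
  by (rule potential.dir_energy_measurable[OF pot])

text \<open>Each sum runs over \<Lambda> or over \<open>bnd \<Lambda>\<close>, with at most
  \<open>2 * CARD('d)\<close> bonds per site, and each term has a mean bounded by a
  constant.\<close>

lemma expectation_energy_bd:
  assumes fin: "finite (\<Lambda> :: 'd site set)"
  shows "integrable Q (\<lambda>z. potential.energy_bd (h z) A (Bf z) (j z) C \<Lambda> plane)" (is ?int)
    and "(\<integral>z. potential.energy_bd (h z) A (Bf z) (j z) C \<Lambda> plane \<partial>Q) \<le>
      real (card \<Lambda>) * (E0 + 2 * real CARD('d) * (C * (3 + 2 * tilt_sq) + A/4 * tilt_sq + E0 + 1/(2*A) * E0) + ln (max 1 (sqrt (4 * pi / A))))" (is ?le)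
proof -
  define n where "n = real (card (bnd \<Lambda>))"
  define L where "L = ln (max 1 (sqrt (4 * pi / A)))"
  have nle: "n \<le> 2 * real CARD('d) * real (card \<Lambda>)"
    unfolding n_def using card_bnd[OF fin] by (metis of_nat_le_iff of_nat_mult of_nat_numeral)
  have e: "potential.energy_bd (h z) A (Bf z) (j z) C \<Lambda> plane = 1/2 * (\<Sum>x\<in>\<Lambda>. \<bar>h z x\<bar>) + (\<Sum>b\<in>bnd \<Lambda>. C * (3 + 2 * (gd plane b)\<^sup>2)) + A/4 * dir_energy \<Lambda> plane
     + (\<Sum>b\<in>bnd \<Lambda>. \<bar>Bf z (fst b) (snd b)\<bar>) + 1/(2*A) * (\<Sum>b\<in>bnd \<Lambda>. (j z \<Lambda> b)\<^sup>2) + real (card \<Lambda>) * L" for z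
    unfolding potential.energy_bd_def[OF pot] L_def ..
  have i: "integrable Q (\<lambda>z. \<bar>h z x\<bar>)" "integrable Q (\<lambda>z. \<bar>Bf z y i\<bar>)" "integrable Q (\<lambda>z. (j z \<Lambda> b)\<^sup>2)" for x y i b
    using h_moment B_moment j_moment[OF fin] by auto
  show ?int unfolding e using i by simp
  have "(\<integral>z. potential.energy_bd (h z) A (Bf z) (j z) C \<Lambda> plane \<partial>Q) = 1/2 * (\<Sum>x\<in>\<Lambda>. \<integral>z. \<bar>h z x\<bar> \<partial>Q) + (\<Sum>b\<in>bnd \<Lambda>. C * (3 + 2 * (gd plane b)\<^sup>2)) + A/4 * dir_energy \<Lambda> plane
     + (\<Sum>b\<in>bnd \<Lambda>. \<integral>z. \<bar>Bf z (fst b) (snd b)\<bar> \<partial>Q) + 1/(2*A) * (\<Sum>b\<in>bnd \<Lambda>. \<integral>z. (j z \<Lambda> b)\<^sup>2 \<partial>Q) + real (card \<Lambda>) * L"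
    unfolding e using i prob_space by simp
  also have "\<dots> \<le> 1/2 * (\<Sum>x\<in>\<Lambda>. E0) + (\<Sum>b\<in>bnd \<Lambda>. C * (3 + 2 * tilt_sq)) + A/4 * (\<Sum>b\<in>bnd \<Lambda>. tilt_sq)
     + (\<Sum>b\<in>bnd \<Lambda>. E0) + 1/(2*A) * (\<Sum>b\<in>bnd \<Lambda>. E0) + real (card \<Lambda>) * L"
    unfolding dir_energy_def using A_pos C
    by (intro add_mono mult_left_mono sum_mono h_moment B_moment j_moment[OF fin]) (auto simp: gd_plane u_le_tilt_sq)
  also have "\<dots> = real (card \<Lambda>) * (E0/2) + n * (C * (3 + 2 * tilt_sq) + A/4 * tilt_sq + E0 + 1/(2*A) * E0) + real (card \<Lambda>) * L"
    by (simp add: n_def algebra_simps)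
  also have "\<dots> \<le> real (card \<Lambda>) * E0 + (2 * real CARD('d) * real (card \<Lambda>)) * (C * (3 + 2 * tilt_sq) + A/4 * tilt_sq + E0 + 1/(2*A) * E0) + real (card \<Lambda>) * L"
    using A_pos C tilt_sq_nonneg E0_nonneg nle
    by (intro add_mono mult_right_mono mult_left_mono add_nonneg_nonneg mult_nonneg_nonneg) auto
  also have "\<dots> = real (card \<Lambda>) * (E0 + 2 * real CARD('d) * (C * (3 + 2 * tilt_sq) + A/4 * tilt_sq + E0 + 1/(2*A) * E0) + L)"
    by (simp add: algebra_simps)
  finally show ?le unfolding L_def .
qed

lemma energy_BN: "\<exists>c\<ge>0. \<forall>N. (\<integral>\<^sup>+\<phi>. ennreal (dir_energy (cube (N * N)) \<phi>) \<partial>BN N) \<le> ennreal (c * real (card (cube (N * N) :: 'd site set)))"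
proof -
  define c0 where "c0 = E0 + 2 * real CARD('d) * (C * (3 + 2 * tilt_sq) + A/4 * tilt_sq + E0 + 1/(2*A) * E0) + ln (max 1 (sqrt (4 * pi / A)))"
  have c0: "c0 \<ge> 0" unfolding c0_def using A_pos C tilt_sq_nonneg E0_nonneg by (intro add_nonneg_nonneg mult_nonneg_nonneg) auto
  have "(\<integral>\<^sup>+\<phi>. ennreal (dir_energy (cube (N * N)) \<phi>) \<partial>BN N) \<le> ennreal (2/A * (c0 + 1) * real (card (cube (N * N) :: 'd site set)))" for N
  proof -
    let ?L = "cube (N * N) :: 'd site set"
    let ?e = "\<lambda>z. potential.energy_bd (h z) A (Bf z) (j z) C ?L plane"
    have 1: "(\<integral>\<^sup>+\<phi>. ennreal (A/2 * dir_energy ?L \<phi>) \<partial>BN N) = (\<integral>\<^sup>+z. \<integral>\<^sup>+\<phi>. ennreal (A/2 * dir_energy ?L \<phi>) \<partial>box_gib N z \<partial>Q)"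
      unfolding BN_def by (rule nn_integral_bind[OF _ box_gib_sub]) measurable
    also have "\<dots> \<le> (\<integral>\<^sup>+z. ennreal (?e z) + 1 \<partial>Q)"
      unfolding box_gib_def by (intro nn_integral_mono potential.energy_moment[OF pot] C upper) auto
    also have "\<dots> = ennreal (\<integral>z. ?e z \<partial>Q) + 1"
      using expectation_energy_bd(1)[of ?L] potential.energy_bd_nonneg[OF pot C] emeasure_space_1
      by (subst nn_integral_add) (auto simp: nn_integral_eq_integral)
    also have "\<dots> \<le> ennreal (real (card ?L) * c0) + ennreal (real (card ?L))"
    proof (intro add_mono ennreal_leI)
      show "(\<integral>z. ?e z \<partial>Q) \<le> real (card ?L) * c0" using expectation_energy_bd(2)[of ?L] by (simp add: c0_def)
      have "1 \<le> real (card ?L)" by (simp add: card_cube)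
      then show "1 \<le> ennreal (real (card ?L))" using ennreal_leI by fastforce
    qed
    also have "\<dots> = ennreal (real (card ?L) * (c0 + 1))" using c0 by (simp add: ennreal_plus[symmetric] distrib_left del: ennreal_plus)
    finally have 2: "(\<integral>\<^sup>+\<phi>. ennreal (A/2 * dir_energy ?L \<phi>) \<partial>BN N) \<le> ennreal (real (card ?L) * (c0 + 1))" .
    have "(\<integral>\<^sup>+\<phi>. ennreal (dir_energy ?L \<phi>) \<partial>BN N) = (\<integral>\<^sup>+\<phi>. ennreal (2/A) * ennreal (A/2 * dir_energy ?L \<phi>) \<partial>BN N)"
      using A_pos by (intro nn_integral_cong) (simp add: ennreal_mult[symmetric] dir_energy_def sum_nonneg)
    also have "\<dots> = ennreal (2/A) * (\<integral>\<^sup>+\<phi>. ennreal (A/2 * dir_energy ?L \<phi>) \<partial>BN N)" by (rule nn_integral_cmult) measurable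
    also have "\<dots> \<le> ennreal (2/A) * ennreal (real (card ?L) * (c0 + 1))" by (intro mult_left_mono 2) auto
    also have "\<dots> = ennreal (2/A * (c0 + 1) * real (card ?L))"
      using A_pos c0 by (simp add: ennreal_mult[symmetric] mult_ac)
    finally show ?thesis .
  qed
  then show ?thesis using A_pos c0 by (intro exI[of _ "2/A * (c0 + 1)"]) auto
qed

lemma gd_shift: "gd (shift_site v \<phi>) (x, i) = gd \<phi> (x - v, i)"
  by (simp add: gd_def shift_site_def algebra_simps)

text \<open>Distinct shifts give distinct bonds. Those touching the box contribute at most its
  Dirichlet energy; at the others the field is the plane, whose gradient is
  \<open>u $ i\<close>.\<close>

lemma sum_shift_gd_le:
  assumes out: "\<And>x. x \<notin> cube (N * N) \<Longrightarrow> \<phi> x = plane x"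
  shows "(\<Sum>v\<in>Av N. (gd \<phi> (x - v, i))\<^sup>2) \<le> dir_energy (cube (N * N)) \<phi> + real (card (Av N)) * tilt_sq"
proof -
  let ?B = "bnd (cube (N * N)) :: ('d site \<times> 'd) set"
  let ?S = "{v \<in> Av N. (x - v, i) \<in> ?B}"
  have "(gd \<phi> (x - v, i))\<^sup>2 \<le> tilt_sq" if "v \<in> Av N - ?S" for v
  proof -
    have "x - v \<notin> cube (N * N)" "x - v + unitv i \<notin> cube (N * N)" using that by (auto simp: bnd_def)
    then have "gd \<phi> (x - v, i) = gd plane (x - v, i)" unfolding gd_def by (simp add: out)
    then show ?thesis using u_le_tilt_sq[of i] by (simp add: gd_plane)
  qed
  then have "(\<Sum>v\<in>Av N - ?S. (gd \<phi> (x - v, i))\<^sup>2) \<le> real (card (Av N - ?S)) * tilt_sq"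
    by (rule sum_bounded_above)
  also have "\<dots> \<le> real (card (Av N)) * tilt_sq" using tilt_sq_nonneg by (intro mult_right_mono) (auto intro: card_mono)
  finally have 1: "(\<Sum>v\<in>Av N - ?S. (gd \<phi> (x - v, i))\<^sup>2) \<le> real (card (Av N)) * tilt_sq" .
  have "(\<Sum>v\<in>?S. (gd \<phi> (x - v, i))\<^sup>2) = (\<Sum>b\<in>(\<lambda>v. (x - v, i)) ` ?S. (gd \<phi> b)\<^sup>2)"
    by (subst sum.reindex) (auto simp: inj_on_def)
  also have "\<dots> \<le> dir_energy (cube (N * N)) \<phi>" unfolding dir_energy_def by (intro sum_mono2 finite_bnd) auto
  finally have 2: "(\<Sum>v\<in>?S. (gd \<phi> (x - v, i))\<^sup>2) \<le> dir_energy (cube (N * N)) \<phi>" .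
  have "(\<Sum>v\<in>Av N. (gd \<phi> (x - v, i))\<^sup>2) = (\<Sum>v\<in>Av N - ?S. (gd \<phi> (x - v, i))\<^sup>2) + (\<Sum>v\<in>?S. (gd \<phi> (x - v, i))\<^sup>2)"
    by (rule sum.subset_diff) auto
  then show ?thesis using 1 2 by linarith
qed

lemma sum_second_moment:
  "\<exists>c\<ge>0. \<forall>N x i. (\<Sum>v\<in>Av N. \<integral>\<^sup>+\<phi>. ennreal ((gd \<phi> (x - v, i))\<^sup>2) \<partial>BN N) \<le> ennreal (c * real (card (Av N)))"
proof -
  obtain c where c: "c \<ge> 0" and energy: "\<And>N. (\<integral>\<^sup>+\<phi>. ennreal (dir_energy (cube (N * N)) \<phi>) \<partial>BN N) \<le> ennreal (c * real (card (cube (N * N) :: 'd site set)))"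
    using energy_BN by blast
  have "(\<Sum>v\<in>Av N. \<integral>\<^sup>+\<phi>. ennreal ((gd \<phi> (x - v, i))\<^sup>2) \<partial>BN N) \<le> ennreal ((c + tilt_sq) * real (card (Av N)))" for N x i
  proof -
    have "(\<Sum>v\<in>Av N. \<integral>\<^sup>+\<phi>. ennreal ((gd \<phi> (x - v, i))\<^sup>2) \<partial>BN N) = (\<integral>\<^sup>+\<phi>. (\<Sum>v\<in>Av N. ennreal ((gd \<phi> (x - v, i))\<^sup>2)) \<partial>BN N)"
      by (rule nn_integral_sum[symmetric]) measurable
    also have "\<dots> \<le> (\<integral>\<^sup>+\<phi>. ennreal (dir_energy (cube (N * N)) \<phi>) + ennreal (real (card (Av N)) * tilt_sq) \<partial>BN N)"
    proof (rule nn_integral_mono_AE)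
      show "AE \<phi> in BN N. (\<Sum>v\<in>Av N. ennreal ((gd \<phi> (x - v, i))\<^sup>2)) \<le> ennreal (dir_energy (cube (N * N)) \<phi>) + ennreal (real (card (Av N)) * tilt_sq)"
        using AE_BN_boundary[of N]
      proof eventually_elim
        fix \<phi> :: "'d site \<Rightarrow> real" assume "\<forall>x. x \<notin> cube (N * N) \<longrightarrow> \<phi> x = plane x"
        then have "(\<Sum>v\<in>Av N. (gd \<phi> (x - v, i))\<^sup>2) \<le> dir_energy (cube (N * N)) \<phi> + real (card (Av N)) * tilt_sq"
          by (intro sum_shift_gd_le) auto
        then have "ennreal (\<Sum>v\<in>Av N. (gd \<phi> (x - v, i))\<^sup>2) \<le> ennreal (dir_energy (cube (N * N)) \<phi> + real (card (Av N)) * tilt_sq)"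
          by (rule ennreal_leI)
        then show "(\<Sum>v\<in>Av N. ennreal ((gd \<phi> (x - v, i))\<^sup>2)) \<le> ennreal (dir_energy (cube (N * N)) \<phi>) + ennreal (real (card (Av N)) * tilt_sq)"
          using tilt_sq_nonneg by (simp add: sum_ennreal dir_energy_def sum_nonneg)
      qed
    qed
    also have "\<dots> = (\<integral>\<^sup>+\<phi>. ennreal (dir_energy (cube (N * N)) \<phi>) \<partial>BN N) + ennreal (real (card (Av N)) * tilt_sq)"
      using prob_space.emeasure_space_1[OF BN_prob[of N]] by (subst nn_integral_add) auto
    also have "\<dots> \<le> ennreal (c * real (card (Av N))) + ennreal (real (card (Av N)) * tilt_sq)"
    proof (intro add_mono order.trans[OF energy] ennreal_leI mult_left_mono c)
      show "real (card (cube (N * N) :: 'd site set)) \<le> real (card (Av N))"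
        unfolding Av_def by (simp add: card_mono cube_mono)
    qed auto
    also have "\<dots> = ennreal ((c + tilt_sq) * real (card (Av N)))"
      using c tilt_sq_nonneg by (simp add: ennreal_plus[symmetric] algebra_simps del: ennreal_plus)
    finally show ?thesis .
  qed
  then show ?thesis using c tilt_sq_nonneg by (intro exI[of _ "c + tilt_sq"]) auto
qed

text \<open>\<open>SOME\<close> only gives a constant, known to exist, a name that later lemmas
  share.\<close>

definition CB :: real where
  "CB = (SOME c. c \<ge> 0 \<and> (\<forall>N x i. (\<Sum>v\<in>Av N. \<integral>\<^sup>+\<phi>. ennreal ((gd \<phi> (x - v, i))\<^sup>2) \<partial>BN N) \<le> ennreal (c * real (card (Av N)))))"

lemma CB: "CB \<ge> 0" "(\<Sum>v\<in>Av N. \<integral>\<^sup>+\<phi>. ennreal ((gd \<phi> (x - v, i))\<^sup>2) \<partial>BN N) \<le> ennreal (CB * real (card (Av N)))"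
  using someI_ex[OF sum_second_moment] unfolding CB_def[symmetric] by auto

lemma second_moment: "(\<integral>\<^sup>+z. \<integral>\<^sup>+\<phi>. ennreal ((gd \<phi> (x, i))\<^sup>2) \<partial>K N z \<partial>Q) \<le> ennreal CB"
proof -
  have c: "card (Av N) > 0" by simp
  have "(\<integral>\<^sup>+z. \<integral>\<^sup>+\<phi>. ennreal ((gd \<phi> (x, i))\<^sup>2) \<partial>K N z \<partial>Q) = (\<Sum>v\<in>Av N. \<integral>\<^sup>+\<phi>. ennreal ((gd \<phi> (x - v, i))\<^sup>2) \<partial>BN N) / of_nat (card (Av N))"
    by (subst annealed_nn) (simp_all add: gd_shift)
  also have "\<dots> \<le> ennreal (CB * real (card (Av N))) / of_nat (card (Av N))"
    by (intro divide_right_mono_ennreal CB)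
  also have "\<dots> = ennreal CB" using CB(1) c
    by (simp add: ennreal_of_nat_eq_real_of_nat divide_ennreal)
  finally show ?thesis .
qed

lemma K_sub [measurable]: "K N \<in> measurable Q (subprob_algebra HS)"
  by (rule measurable_prob_algebraD[OF K_kernel])

text \<open>Induction along a path from the origin with
  \<open>(a + b)\<^sup>2 \<le> 2 * a\<^sup>2 + 2 * b\<^sup>2\<close>: the constant grows along the
  path but does not depend on \<open>N\<close>.\<close>

lemma height_moment: "\<exists>c. \<forall>N. (\<integral>\<^sup>+z. \<integral>\<^sup>+\<phi>. ennreal ((\<phi> x - \<phi> 0)\<^sup>2) \<partial>K N z \<partial>Q) \<le> ennreal c"
proof -
  define AK where "AK N = Q \<bind> K N" for N
  have nn: "(\<integral>\<^sup>+\<phi>. G \<phi> \<partial>AK N) = (\<integral>\<^sup>+z. \<integral>\<^sup>+\<phi>. G \<phi> \<partial>K N z \<partial>Q)" if "G \<in> borel_measurable HS" for G N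
    unfolding AK_def by (rule nn_integral_bind[OF that K_sub])
  have [simp, measurable_cong]: "sets (AK N) = sets HS" for N unfolding AK_def by (rule sets_bind) auto
  have g: "(\<integral>\<^sup>+\<phi>. ennreal ((gd \<phi> (x, i))\<^sup>2) \<partial>AK N) \<le> ennreal CB" for x i N
    using second_moment by (simp add: nn)
  have step: "(\<integral>\<^sup>+\<phi>. ennreal ((f \<phi>)\<^sup>2) \<partial>AK N) \<le> ennreal (2 * c + 2 * CB)"
    if f: "\<And>\<phi>. (f \<phi>)\<^sup>2 \<le> 2 * (g' \<phi>)\<^sup>2 + 2 * (gd \<phi> (x, i))\<^sup>2" and [measurable]: "g' \<in> borel_measurable HS"
      and c: "c \<ge> 0" "(\<integral>\<^sup>+\<phi>. ennreal ((g' \<phi>)\<^sup>2) \<partial>AK N) \<le> ennreal c" for f g' c x i N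
  proof -
    have "(\<integral>\<^sup>+\<phi>. ennreal ((f \<phi>)\<^sup>2) \<partial>AK N) \<le> (\<integral>\<^sup>+\<phi>. 2 * ennreal ((g' \<phi>)\<^sup>2) + 2 * ennreal ((gd \<phi> (x, i))\<^sup>2) \<partial>AK N)"
    proof (rule nn_integral_mono)
      fix \<phi>
      have "ennreal ((f \<phi>)\<^sup>2) \<le> ennreal (2 * (g' \<phi>)\<^sup>2 + 2 * (gd \<phi> (x, i))\<^sup>2)" by (intro ennreal_leI f)
      then show "ennreal ((f \<phi>)\<^sup>2) \<le> 2 * ennreal ((g' \<phi>)\<^sup>2) + 2 * ennreal ((gd \<phi> (x, i))\<^sup>2)" by (simp add: ennreal_mult)
    qed
    also have "\<dots> = 2 * (\<integral>\<^sup>+\<phi>. ennreal ((g' \<phi>)\<^sup>2) \<partial>AK N) + 2 * (\<integral>\<^sup>+\<phi>. ennreal ((gd \<phi> (x, i))\<^sup>2) \<partial>AK N)"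
      by (subst nn_integral_add) (auto simp: nn_integral_cmult)
    also have "\<dots> \<le> 2 * ennreal c + 2 * ennreal CB" by (intro add_mono mult_left_mono c g) auto
    also have "\<dots> = ennreal (2 * c + 2 * CB)" using c CB(1) by (simp add: ennreal_mult)
    finally show ?thesis .
  qed
  have "\<exists>c\<ge>0. \<forall>N. (\<integral>\<^sup>+\<phi>. ennreal ((\<phi> x - \<phi> 0)\<^sup>2) \<partial>AK N) \<le> ennreal c"
  proof (induction x rule: site_induct)
    case zero then show ?case by (intro exI[of _ 0]) auto
  next
    case (plus x i)
    then obtain c where c: "c \<ge> 0" "\<And>N. (\<integral>\<^sup>+\<phi>. ennreal ((\<phi> x - \<phi> 0)\<^sup>2) \<partial>AK N) \<le> ennreal c" by blast
    have le: "(\<phi> (x + unitv i) - \<phi> 0)\<^sup>2 \<le> 2 * (\<phi> x - \<phi> 0)\<^sup>2 + 2 * (gd \<phi> (x, i))\<^sup>2" for \<phi> :: "'d site \<Rightarrow> real"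
      using zero_le_power2[of "(\<phi> x - \<phi> 0) - gd \<phi> (x, i)"] by (simp add: gd_def power2_eq_square algebra_simps)
    have "(\<integral>\<^sup>+\<phi>. ennreal ((\<phi> (x + unitv i) - \<phi> 0)\<^sup>2) \<partial>AK N) \<le> ennreal (2 * c + 2 * CB)" for N
      by (intro step[OF le _ c]) measurable
    then show ?case using c CB(1) by (intro exI[of _ "2 * c + 2 * CB"]) auto
  next
    case (minus x i)
    then obtain c where c: "c \<ge> 0" "\<And>N. (\<integral>\<^sup>+\<phi>. ennreal ((\<phi> x - \<phi> 0)\<^sup>2) \<partial>AK N) \<le> ennreal c" by blast
    have le: "(\<phi> (x - unitv i) - \<phi> 0)\<^sup>2 \<le> 2 * (\<phi> x - \<phi> 0)\<^sup>2 + 2 * (gd \<phi> (x - unitv i, i))\<^sup>2" for \<phi> :: "'d site \<Rightarrow> real"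
      using zero_le_power2[of "(\<phi> x - \<phi> 0) + gd \<phi> (x - unitv i, i)"] by (simp add: gd_def power2_eq_square algebra_simps)
    have "(\<integral>\<^sup>+\<phi>. ennreal ((\<phi> (x - unitv i) - \<phi> 0)\<^sup>2) \<partial>AK N) \<le> ennreal (2 * c + 2 * CB)" for N
      by (intro step[OF le _ c]) measurable
    then show ?case using c CB(1) by (intro exI[of _ "2 * c + 2 * CB"]) auto
  qed
  then show ?thesis by (auto simp: nn)
qed

text \<open>The reflected window, the set of all \<open>x - v\<close>, contains the box for every
  \<open>x\<close> in \<open>cube N\<close>. The sum is thus the same for two neighbouring
  \<open>x\<close>, and their difference cancels exactly.\<close>

lemma sum_Av_reflect:
  assumes x: "x \<in> cube N" and f: "\<And>y. y \<notin> cube (N * N) \<Longrightarrow> f y = (0::real)"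
  shows "(\<Sum>v\<in>Av N. f (x - v)) = (\<Sum>y\<in>cube (N * N). f y)"
proof -
  have "(\<Sum>v\<in>Av N. f (x - v)) = (\<Sum>y\<in>(\<lambda>v. x - v) ` Av N. f y)" by (subst sum.reindex) (auto simp: inj_on_def)
  also have "\<dots> = (\<Sum>y\<in>cube (N * N). f y)"
  proof (rule sum.mono_neutral_right)
    show "cube (N * N) \<subseteq> (\<lambda>v. x - v) ` Av N"
    proof
      fix y :: "'d site" assume "y \<in> cube (N * N)"
      then have "x - y \<in> cube (N + N * N)" using x by (intro cube_diff) auto
      then show "y \<in> (\<lambda>v. x - v) ` Av N" by (intro image_eqI[of _ _ "x - y"]) (auto simp: Av_def add.commute)
    qed
  qed (auto simp: f)
  finally show ?thesis .
qed

text \<open>The Dirichlet boundary condition fixes the tilt: differences along a line telescope.\<close>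

lemma sum_tilt:
  assumes x: "x \<in> cube N" "x + unitv i \<in> cube N" and out: "\<And>y. y \<notin> cube (N * N) \<Longrightarrow> \<phi> y = plane y"
  shows "(\<Sum>v\<in>Av N. gd \<phi> (x - v, i)) = real (card (Av N)) * u $ i"
proof -
  define f where "f y = \<phi> y - plane y" for y
  have f0: "f y = 0" if "y \<notin> cube (N * N)" for y using out[OF that] by (simp add: f_def)
  have "gd \<phi> (x - v, i) = u $ i + (f ((x + unitv i) - v) - f (x - v))" for v
    using gd_plane[of "(x - v, i)"] by (simp add: gd_def f_def algebra_simps)
  then have "(\<Sum>v\<in>Av N. gd \<phi> (x - v, i)) = real (card (Av N)) * u $ i + ((\<Sum>v\<in>Av N. f ((x + unitv i) - v)) - (\<Sum>v\<in>Av N. f (x - v)))"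
    by (simp add: sum.distrib sum_subtractf)
  then show ?thesis using sum_Av_reflect[where f=f, OF x(1) f0] sum_Av_reflect[where f=f, OF x(2) f0] by simp
qed

definition clip :: "real \<Rightarrow> real \<Rightarrow> real" where "clip M t = max (- M) (min M t)"

lemma clip_bound: "M \<ge> 0 \<Longrightarrow> \<bar>clip M t\<bar> \<le> M" by (auto simp: clip_def)

text \<open>Where clipping acts, \<open>\<bar>t\<bar> > M\<close>, and the error is at most
  \<open>\<bar>t\<bar> \<le> t\<^sup>2 / M\<close>. With a second moment bound this is the uniform
  integrability behind the tilt.\<close>

lemma clip_diff: "M > 0 \<Longrightarrow> \<bar>clip M t - t\<bar> \<le> t\<^sup>2 / M"
proof -
  assume M: "M > 0"
  have "\<bar>clip M t - t\<bar> \<le> (if \<bar>t\<bar> \<le> M then 0 else \<bar>t\<bar>)" using M by (auto simp: clip_def abs_if split: if_splits)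
  also have "\<dots> \<le> t\<^sup>2 / M"
  proof (cases "\<bar>t\<bar> \<le> M")
    case False
    then have "\<bar>t\<bar> * M \<le> \<bar>t\<bar> * \<bar>t\<bar>" by (intro mult_left_mono) auto
    then show ?thesis using False M by (simp add: field_simps power2_eq_square)
  qed (use M in simp)
  finally show ?thesis .
qed

text \<open>By \<open>sum_tilt\<close> the sum of the unclipped gradients over all shifts is almost
  surely deterministic. Clipping, needed to have a bounded test function, costs
  \<open>CB / M\<close> uniformly in \<open>N\<close>.\<close>

lemma tilt_K:
  assumes M: "M > 0" and x: "x \<in> cube N" "x + unitv i \<in> cube N"
  shows "\<bar>(\<integral>z. (\<integral>\<phi>. clip M (gd \<phi> (x, i)) \<partial>K N z) \<partial>Q) - u $ i\<bar> \<le> CB / M"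
proof -
  interpret B: prob_space "BN N" by (rule BN_prob)
  have [measurable]: "(\<lambda>t. clip M t) \<in> borel_measurable borel" unfolding clip_def by measurable
  define X where "X v \<phi> = gd \<phi> (x - v, i)" for v \<phi>
  have Xm [measurable]: "X v \<in> borel_measurable HS" for v unfolding X_def by measurable
  have fin: "(\<integral>\<^sup>+\<phi>. ennreal ((X v \<phi>)\<^sup>2) \<partial>BN N) < \<infinity>" if "v \<in> Av N" for v
  proof -
    have "(\<integral>\<^sup>+\<phi>. ennreal ((X v \<phi>)\<^sup>2) \<partial>BN N) \<le> (\<Sum>v\<in>Av N. \<integral>\<^sup>+\<phi>. ennreal ((X v \<phi>)\<^sup>2) \<partial>BN N)" using that by (intro member_le_sum) auto
    also have "\<dots> \<le> ennreal (CB * real (card (Av N)))" unfolding X_def by (rule CB)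
    finally show ?thesis by (rule le_less_trans) simp
  qed
  then have i2: "integrable (BN N) (\<lambda>\<phi>. (X v \<phi>)\<^sup>2)" if "v \<in> Av N" for v
    using that by (intro integrableI_nonneg) auto
  have i1: "integrable (BN N) (X v)" if "v \<in> Av N" for v
    by (rule B.square_integrable_imp_integrable[OF _ i2[OF that]]) measurable
  have ic: "integrable (BN N) (\<lambda>\<phi>. clip M (X v \<phi>))" for v
    using M by (intro B.integrable_const_bound[of _ M]) (auto simp: clip_bound)
  have "(\<Sum>v\<in>Av N. \<integral>\<phi>. (X v \<phi>)\<^sup>2 \<partial>BN N) \<le> CB * real (card (Av N))"
  proof -
    have "ennreal (\<Sum>v\<in>Av N. \<integral>\<phi>. (X v \<phi>)\<^sup>2 \<partial>BN N) = (\<Sum>v\<in>Av N. \<integral>\<^sup>+\<phi>. ennreal ((X v \<phi>)\<^sup>2) \<partial>BN N)"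
      using i2 by (subst sum_ennreal[symmetric]) (auto simp: nn_integral_eq_integral intro!: sum.cong)
    also have "\<dots> \<le> ennreal (CB * real (card (Av N)))" unfolding X_def by (rule CB)
    finally show ?thesis using CB(1) by (simp add: ennreal_le_iff)
  qed
  note S2 = this
  have tot: "(\<Sum>v\<in>Av N. \<integral>\<phi>. X v \<phi> \<partial>BN N) = real (card (Av N)) * u $ i"
  proof -
    have "(\<Sum>v\<in>Av N. \<integral>\<phi>. X v \<phi> \<partial>BN N) = (\<integral>\<phi>. (\<Sum>v\<in>Av N. X v \<phi>) \<partial>BN N)"
      using i1 by (intro Bochner_Integration.integral_sum[symmetric]) auto
    also have "\<dots> = (\<integral>\<phi>. real (card (Av N)) * u $ i \<partial>BN N)"
    proof (rule integral_cong_AE)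
      show "AE \<phi> in BN N. (\<Sum>v\<in>Av N. X v \<phi>) = real (card (Av N)) * u $ i"
        using AE_BN_boundary[of N] by eventually_elim (auto simp: X_def intro!: sum_tilt x)
    qed measurable
    finally show ?thesis using B.prob_space by simp
  qed
  have "\<bar>(\<Sum>v\<in>Av N. \<integral>\<phi>. clip M (X v \<phi>) \<partial>BN N) - (\<Sum>v\<in>Av N. \<integral>\<phi>. X v \<phi> \<partial>BN N)\<bar> = \<bar>\<Sum>v\<in>Av N. \<integral>\<phi>. clip M (X v \<phi>) - X v \<phi> \<partial>BN N\<bar>"
    using i1 ic by (simp add: sum_subtractf[symmetric])
  also have "\<dots> \<le> (\<Sum>v\<in>Av N. \<integral>\<phi>. (X v \<phi>)\<^sup>2 / M \<partial>BN N)"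
  proof (rule order.trans[OF sum_abs sum_mono])
    fix v assume v: "v \<in> Av N"
    have "\<bar>\<integral>\<phi>. clip M (X v \<phi>) - X v \<phi> \<partial>BN N\<bar> \<le> (\<integral>\<phi>. \<bar>clip M (X v \<phi>) - X v \<phi>\<bar> \<partial>BN N)" by (rule integral_abs_bound)
    also have "\<dots> \<le> (\<integral>\<phi>. (X v \<phi>)\<^sup>2 / M \<partial>BN N)"
      using i1[OF v] i2[OF v] ic M by (intro integral_mono) (auto simp: clip_diff)
    finally show "\<bar>\<integral>\<phi>. clip M (X v \<phi>) - X v \<phi> \<partial>BN N\<bar> \<le> (\<integral>\<phi>. (X v \<phi>)\<^sup>2 / M \<partial>BN N)" .
  qed
  also have "\<dots> = (\<Sum>v\<in>Av N. \<integral>\<phi>. (X v \<phi>)\<^sup>2 \<partial>BN N) / M" by (simp add: sum_divide_distrib)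
  also have "\<dots> \<le> CB * real (card (Av N)) / M" using S2 M by (intro divide_right_mono) auto
  finally have d: "\<bar>(\<Sum>v\<in>Av N. \<integral>\<phi>. clip M (X v \<phi>) \<partial>BN N) - real (card (Av N)) * u $ i\<bar> \<le> CB * real (card (Av N)) / M"
    unfolding tot .
  have c: "real (card (Av N)) > 0" by simp
  have "(\<integral>z. (\<integral>\<phi>. clip M (gd \<phi> (x, i)) \<partial>K N z) \<partial>Q) - u $ i = ((\<Sum>v\<in>Av N. \<integral>\<phi>. clip M (X v \<phi>) \<partial>BN N) - real (card (Av N)) * u $ i) / real (card (Av N))"
    using M c by (subst annealed[where B=M]) (simp_all add: clip_bound gd_shift X_def diff_divide_distrib)
  then have "\<bar>(\<integral>z. (\<integral>\<phi>. clip M (gd \<phi> (x, i)) \<partial>K N z) \<partial>Q) - u $ i\<bar> = \<bar>(\<Sum>v\<in>Av N. \<integral>\<phi>. clip M (X v \<phi>) \<partial>BN N) - real (card (Av N)) * u $ i\<bar> / real (card (Av N))"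
    by (simp add: abs_divide)
  also have "\<dots> \<le> (CB * real (card (Av N)) / M) / real (card (Av N))" by (intro divide_right_mono d) simp
  also have "\<dots> = CB / M" using c by simp
  finally show ?thesis .
qed

end

section \<open>Existence of the random gradient Gibbs measure\<close>

text \<open>\<open>c n\<close> charges only indices from \<open>n\<close> on, where the sequence is
  already small.\<close>

lemma pmf_tail_tendsto:
  fixes d :: "nat \<Rightarrow> real" and c :: "nat \<Rightarrow> nat pmf"
  assumes bd: "\<And>k. \<bar>d k\<bar> \<le> B" and d: "d \<longlonglongrightarrow> 0" and c: "\<And>n. set_pmf (c n) \<subseteq> {n..}"
  shows "(\<lambda>n. \<integral>k. d k \<partial>measure_pmf (c n)) \<longlonglongrightarrow> 0"
proof (rule LIMSEQ_I)
  fix r :: real assume r: "0 < r"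
  then obtain N where N: "\<And>k. k \<ge> N \<Longrightarrow> \<bar>d k\<bar> < r/2" using LIMSEQ_D[OF d, of "r/2"] by auto
  have "norm ((\<integral>k. d k \<partial>measure_pmf (c n)) - 0) < r" if n: "n \<ge> N" for n
  proof -
    have i: "integrable (measure_pmf (c n)) d" by (rule measure_pmf.integrable_const_bound[of _ B]) (auto simp: bd)
    have "\<bar>\<integral>k. d k \<partial>measure_pmf (c n)\<bar> \<le> (\<integral>k. \<bar>d k\<bar> \<partial>measure_pmf (c n))" by (rule integral_abs_bound)
    also have "\<dots> \<le> r/2"
      using i N n c[of n] by (intro measure_pmf.integral_le_const) (auto simp: AE_measure_pmf_iff intro!: less_imp_le)
    finally show ?thesis using r by simp
  qed
  then show "\<exists>no. \<forall>n\<ge>no. norm ((\<integral>k. d k \<partial>measure_pmf (c n)) - 0) < r" by blast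
qed

lemma Cb_test_fun:
  assumes F: "F \<in> Cb" obtains B where "test_fun B (\<lambda>\<phi>. F (grad \<phi>))"
proof -
  obtain B where B: "\<And>\<phi>. \<bar>F (grad \<phi>)\<bar> \<le> B" using Cb_bound[OF F] by blast
  have [measurable]: "F \<in> borel_measurable GS" using F by (simp add: Cb_def)
  have "test_fun B (\<lambda>\<phi>. F (grad \<phi>))"
    unfolding test_fun_def using Cb_pointwise_continuous[OF F] B by (auto simp: grad_minus_const)
  then show ?thesis by (rule that)
qed

lemma nested_integral_nn:
  fixes G :: "'a \<Rightarrow> real"
  assumes Q: "prob_space Q" and \<kappa>: "\<kappa> \<in> measurable Q (prob_algebra N)"
    and G [measurable]: "G \<in> borel_measurable N" and bd: "\<And>x. 0 \<le> G x" "\<And>x. G x \<le> B"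
  shows "(\<integral>\<^sup>+z. \<integral>\<^sup>+x. ennreal (G x) \<partial>\<kappa> z \<partial>Q) = ennreal (\<integral>z. (\<integral>x. G x \<partial>\<kappa> z) \<partial>Q)"
proof -
  interpret prob_space Q by fact
  have k: "prob_space (\<kappa> z)" "sets (\<kappa> z) = sets N" if "z \<in> space Q" for z
    using measurable_space[OF \<kappa> that] by (auto simp: space_prob_algebra)
  have 1: "(\<integral>\<^sup>+x. ennreal (G x) \<partial>\<kappa> z) = ennreal (\<integral>x. G x \<partial>\<kappa> z)" and 2: "(\<integral>x. G x \<partial>\<kappa> z) \<le> B" if z: "z \<in> space Q" for z
  proof -
    interpret kz: prob_space "\<kappa> z" by (rule k[OF z])
    have "G \<in> borel_measurable (\<kappa> z)" using G by (simp add: measurable_cong_sets[OF k(2)[OF z] refl])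
    then have i: "integrable (\<kappa> z) G" using bd by (intro kz.integrable_const_bound[of _ B]) auto
    then show "(\<integral>\<^sup>+x. ennreal (G x) \<partial>\<kappa> z) = ennreal (\<integral>x. G x \<partial>\<kappa> z)" using bd by (intro nn_integral_eq_integral) auto
    show "(\<integral>x. G x \<partial>\<kappa> z) \<le> B" using i bd by (intro kz.integral_le_const) auto
  qed
  have m: "(\<lambda>z. \<integral>x. G x \<partial>\<kappa> z) \<in> borel_measurable Q"
    by (rule measurable_compose[OF measurable_prob_algebraD[OF \<kappa>] integral_measurable_subprob_algebra[OF G]])
  have nn: "0 \<le> (\<integral>x. G x \<partial>\<kappa> z)" for z using bd by (intro integral_nonneg_AE) auto
  have "(\<integral>\<^sup>+z. \<integral>\<^sup>+x. ennreal (G x) \<partial>\<kappa> z \<partial>Q) = (\<integral>\<^sup>+z. ennreal (\<integral>x. G x \<partial>\<kappa> z) \<partial>Q)"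
    by (rule nn_integral_cong) (rule 1)
  also have "\<dots> = ennreal (\<integral>z. (\<integral>x. G x \<partial>\<kappa> z) \<partial>Q)"
    using m nn 2 by (intro nn_integral_eq_integral integrable_const_bound[of _ B]) (auto intro!: AE_I2)
  finally show ?thesis .
qed

section \<open>Gibbs kernels acting on gradient fields\<close>

context potential begin

lemma gib_const:
  assumes fin: "finite \<Lambda>"
  shows "gib U h \<Lambda> (\<lambda>x. \<phi> x + c) = distr (gib U h \<Lambda> \<phi>) HS (\<lambda>\<phi>' x. \<phi>' x + c)"
  using gib_shift[OF potential_axioms potential_axioms fin, of 0 \<phi> c] by simp

lemma integral_gib_const:
  fixes G :: "_ \<Rightarrow> real"
  assumes fin: "finite \<Lambda>" and [measurable]: "G \<in> borel_measurable HS" and inv: "\<And>\<phi>. G (\<lambda>x. \<phi> x - \<phi> 0) = G \<phi>"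
  shows "(\<integral>\<phi>'. G \<phi>' \<partial>gib U h \<Lambda> (\<lambda>x. \<phi> x + c)) = (\<integral>\<phi>'. G \<phi>' \<partial>gib U h \<Lambda> \<phi>)"
proof -
  have m: "(\<lambda>\<phi>' x. \<phi>' x + c) \<in> measurable (gib U h \<Lambda> \<phi>) HS" by (rule measurable_HS_I) measurable
  have "G (\<lambda>x. \<phi>' x + c) = G \<phi>'" for \<phi>' using inv[of "\<lambda>x. \<phi>' x + c"] inv[of \<phi>'] by simp
  then show ?thesis unfolding gib_const[OF fin] by (subst integral_distr[OF m]) auto
qed

text \<open>Feller continuity and blindness to vertical translations. Both sides of the DLR equation
  are thus integrals of test functions, to which the limit theorem applies.\<close>

lemma gib_test_fun:
  assumes fin: "finite \<Lambda>" and G: "test_fun B G"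
  shows "test_fun B (\<lambda>\<phi>. \<integral>\<phi>'. G \<phi>' \<partial>gib U h \<Lambda> \<phi>)"
proof -
  have g [measurable]: "G \<in> borel_measurable HS" and bd: "\<And>\<phi>. \<bar>G \<phi>\<bar> \<le> B" and inv: "\<And>\<phi>. G (\<lambda>x. \<phi> x - \<phi> 0) = G \<phi>"
    using G by (auto simp: test_fun_def)
  show ?thesis unfolding test_fun_def
  proof (intro conjI allI impI)
    show "(\<lambda>\<phi>. \<integral>\<phi>'. G \<phi>' \<partial>gib U h \<Lambda> \<phi>) \<in> borel_measurable HS"
      by (rule measurable_compose[OF measurable_prob_algebraD[OF gib_kernel[OF fin]] integral_measurable_subprob_algebra]) measurable
    show "\<bar>\<integral>\<phi>'. G \<phi>' \<partial>gib U h \<Lambda> \<phi>\<bar> \<le> B" for \<phi>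
      by (rule prob_integral_abs_le[OF prob_space_gib[OF fin]]) (auto simp: bd)
    show "(\<integral>\<phi>'. G \<phi>' \<partial>gib U h \<Lambda> (\<lambda>x. \<phi> x - \<phi> 0)) = (\<integral>\<phi>'. G \<phi>' \<partial>gib U h \<Lambda> \<phi>)" for \<phi>
      using integral_gib_const[where G=G and \<phi>=\<phi> and c="- \<phi> 0", OF fin g] inv by simp
    fix \<phi> :: "nat \<Rightarrow> 'd site \<Rightarrow> real" and \<phi>' assume lim: "\<forall>x. (\<lambda>n. \<phi> n x) \<longlonglongrightarrow> \<phi>' x"
    show "(\<lambda>n. \<integral>\<phi>'. G \<phi>' \<partial>gib U h \<Lambda> (\<phi> n)) \<longlonglongrightarrow> (\<integral>\<phi>. G \<phi> \<partial>gib U h \<Lambda> \<phi>')"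
    proof (rule integral_gib_tendsto[where G=G and K=B])
      show "(\<lambda>n. G (\<phi> n)) \<longlonglongrightarrow> G \<phi>'" if "\<And>x. (\<lambda>n. \<phi> n x) \<longlonglongrightarrow> \<phi>' x" for \<phi>' and \<phi> :: "nat \<Rightarrow> _"
        using G that by (simp add: test_fun_def)
      show "(\<lambda>n. \<phi> n x) \<longlonglongrightarrow> \<phi>' x" for x using lim by blast
    qed (fact fin g bd)+
  qed
qed

text \<open>The heights picked by \<open>SOME\<close> differ from \<phi> by a constant, to which the
  gradient law is blind.\<close>

lemma integral_gspec_grad:
  assumes fin: "finite \<Lambda>" and F: "F \<in> Cb"
  shows "(\<integral>\<eta>. F \<eta> \<partial>gspec (hamf U h) \<Lambda> (grad \<phi>)) = (\<integral>\<phi>'. F (grad \<phi>') \<partial>gib U h \<Lambda> \<phi>)"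
proof -
  have [measurable]: "F \<in> borel_measurable GS" using F by (simp add: Cb_def)
  define \<psi> where "\<psi> = (SOME \<psi>. grad \<psi> = grad \<phi>)"
  have "grad \<psi> = grad \<phi>" unfolding \<psi>_def by (rule someI[of _ \<phi>]) simp
  then have "\<psi> x - \<psi> 0 = \<phi> x - \<phi> 0" for x by (rule grad_eq_imp)
  then have e: "\<psi> = (\<lambda>x. \<phi> x + (\<psi> 0 - \<phi> 0))" by (auto simp: fun_eq_iff algebra_simps)
  have "(\<integral>\<eta>. F \<eta> \<partial>gspec (hamf U h) \<Lambda> (grad \<phi>)) = (\<integral>\<phi>'. F (grad \<phi>') \<partial>gib U h \<Lambda> \<psi>)"
    unfolding gspec_def \<psi>_def[symmetric] by (subst integral_distr) auto
  also have "\<dots> = (\<integral>\<phi>'. F (grad \<phi>') \<partial>gib U h \<Lambda> \<phi>)"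
    by (subst e, rule integral_gib_const[OF fin]) (auto simp: grad_minus_const)
  finally show ?thesis .
qed

text \<open>On gradient fields the measurable left inverse \<open>H\<close> of \<open>grad\<close>
  replaces the chosen heights. On other bond fields no heights exist, the predicate under
  \<open>SOME\<close> is constantly false, and the integral is the constant
  \<open>c0\<close>.\<close>

lemma gspec_integral_measurable:
  assumes fin: "finite \<Lambda>" and F: "F \<in> Cb"
  shows "(\<lambda>\<rho>. \<integral>\<eta>. F \<eta> \<partial>gspec (hamf U h) \<Lambda> \<rho>) \<in> borel_measurable GS"
proof -
  have [measurable]: "F \<in> borel_measurable GS" using F by (simp add: Cb_def)
  obtain H :: "('d bond \<Rightarrow> real) \<Rightarrow> 'd site \<Rightarrow> real" where H [measurable]: "H \<in> measurable GS HS" and Hg: "\<And>\<phi> x. H (grad \<phi>) x = \<phi> x - \<phi> 0"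
    using grad_left_inverse by metis
  obtain B where "test_fun B (\<lambda>\<phi>. F (grad \<phi>))" using Cb_test_fun[OF F] .
  from gib_test_fun[OF fin this] have G [measurable]: "(\<lambda>\<phi>. \<integral>\<phi>'. F (grad \<phi>') \<partial>gib U h \<Lambda> \<phi>) \<in> borel_measurable HS"
    by (simp add: test_fun_def)
  define c0 where "c0 = (\<integral>\<eta>. F \<eta> \<partial>distr (gib U h \<Lambda> (SOME \<psi>. False)) GS grad)"
  have gH: "grad (H (grad \<phi>)) = grad \<phi>" for \<phi>
  proof -
    have "H (grad \<phi>) = (\<lambda>x. \<phi> x - \<phi> 0)" using Hg by auto
    then show ?thesis by (simp add: grad_minus_const)
  qed
  have P: "Measurable.pred GS (\<lambda>\<rho>. \<forall>b. \<rho> b = grad (H \<rho>) b)"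
  proof (intro pred_intros_countable(1) borel_measurable_pred_eq)
    fix b :: "'d bond"
    have "(\<lambda>\<rho>. grad (H \<rho>)) \<in> measurable GS GS" by measurable
    from measurable_compose[OF this GS_component] show "(\<lambda>\<rho>. grad (H \<rho>) b) \<in> borel_measurable GS" .
  qed measurable
  have "(\<lambda>\<rho>. \<integral>\<eta>. F \<eta> \<partial>gspec (hamf U h) \<Lambda> \<rho>) = (\<lambda>\<rho>. if \<forall>b. \<rho> b = grad (H \<rho>) b then \<integral>\<phi>'. F (grad \<phi>') \<partial>gib U h \<Lambda> (H \<rho>) else c0)"
  proof
    fix \<rho> :: "'d bond \<Rightarrow> real"
    show "(\<integral>\<eta>. F \<eta> \<partial>gspec (hamf U h) \<Lambda> \<rho>) = (if \<forall>b. \<rho> b = grad (H \<rho>) b then \<integral>\<phi>'. F (grad \<phi>') \<partial>gib U h \<Lambda> (H \<rho>) else c0)"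
    proof (cases "\<forall>b. \<rho> b = grad (H \<rho>) b")
      case True
      then have "\<rho> = grad (H \<rho>)" by auto
      then show ?thesis using True integral_gspec_grad[OF fin F, of "H \<rho>"] by simp
    next
      case False
      have "\<nexists>\<psi>. grad \<psi> = \<rho>" using gH False by metis
      then have "gspec (hamf U h) \<Lambda> \<rho> = distr (gib U h \<Lambda> (SOME \<psi>. False)) GS grad" unfolding gspec_def by simp
      then show ?thesis using False by (auto simp: c0_def)
    qed
  qed
  also have "\<dots> \<in> borel_measurable GS" using P measurable_compose[OF H G] by measurable
  finally show ?thesis .
qed

lemma is_ggm_distr_grad:
  assumes m: "prob_space m" and s: "sets m = sets HS"
    and dlr: "\<And>\<Lambda> F. finite \<Lambda> \<Longrightarrow> F \<in> Cb \<Longrightarrow> (\<integral>\<phi>. (\<integral>\<phi>'. F (grad \<phi>') \<partial>gib U h \<Lambda> \<phi>) \<partial>m) = (\<integral>\<phi>. F (grad \<phi>) \<partial>m)"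
  shows "is_ggm (hamf U h) (distr m GS grad)"
proof -
  have g: "grad \<in> measurable m GS" using grad_measurable by (simp add: measurable_cong_sets[OF s refl])
  have "AE \<eta> in distr m GS grad. \<eta> \<in> chi"
    using chi_sets by (subst AE_distr_iff[OF g]) (auto simp: grad_in_chi)
  moreover have "(\<integral>\<rho>. (\<integral>\<eta>. F \<eta> \<partial>gspec (hamf U h) \<Lambda> \<rho>) \<partial>distr m GS grad) = (\<integral>\<eta>. F \<eta> \<partial>distr m GS grad)"
    if "finite \<Lambda>" "F \<in> Cb" for \<Lambda> F
  proof -
    have F: "F \<in> borel_measurable GS" using that by (simp add: Cb_def)
    have "(\<integral>\<rho>. (\<integral>\<eta>. F \<eta> \<partial>gspec (hamf U h) \<Lambda> \<rho>) \<partial>distr m GS grad) = (\<integral>\<phi>. (\<integral>\<phi>'. F (grad \<phi>') \<partial>gib U h \<Lambda> \<phi>) \<partial>m)"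
      unfolding integral_distr[OF g gspec_integral_measurable[OF that]] integral_gspec_grad[OF that] ..
    also have "\<dots> = (\<integral>\<eta>. F \<eta> \<partial>distr m GS grad)" unfolding dlr[OF that] by (rule integral_distr[OF g F, symmetric])
    finally show ?thesis .
  qed
  ultimately show ?thesis unfolding is_ggm_def using prob_space.prob_space_distr[OF m g] by auto
qed

end

context grad_model begin

lemma gd_tendsto: "(\<And>x. (\<lambda>n. \<phi> n x) \<longlonglongrightarrow> \<phi>' x) \<Longrightarrow> (\<lambda>n. gd (\<phi> n) b) \<longlonglongrightarrow> gd \<phi>' b"
  unfolding gd_def by (intro tendsto_diff)

lemma gd_inv: "gd (\<lambda>x. \<phi> x - c) b = gd \<phi> b" by (simp add: gd_def)

lemma test_fun_clip:
  assumes "M \<ge> 0" shows "test_fun M (\<lambda>\<phi>. clip M (gd \<phi> b))"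
proof -
  have "(\<lambda>\<phi>. clip M (gd \<phi> b)) \<in> borel_measurable HS" unfolding clip_def by measurable
  moreover have "(\<lambda>n. clip M (gd (\<phi> n) b)) \<longlonglongrightarrow> clip M (gd \<phi>' b)" if "\<forall>x. (\<lambda>n. \<phi> n x) \<longlonglongrightarrow> \<phi>' x" for \<phi>' and \<phi> :: "nat \<Rightarrow> _"
    using that unfolding clip_def by (intro tendsto_intros gd_tendsto) auto
  ultimately show ?thesis unfolding test_fun_def using clip_bound[OF assms] by (simp add: gd_inv)
qed

lemma test_fun_uminus: "test_fun B G \<Longrightarrow> test_fun B (\<lambda>\<phi>. - G \<phi>)"
  unfolding test_fun_def by (auto intro: tendsto_minus)

lemma test_fun_min_sq:
  assumes "M \<ge> 0" shows "test_fun M (\<lambda>\<phi>. min M ((gd \<phi> b)\<^sup>2))"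
proof -
  have "(\<lambda>\<phi>. min M ((gd \<phi> b)\<^sup>2)) \<in> borel_measurable HS" by measurable
  moreover have "(\<lambda>n. min M ((gd (\<phi> n) b)\<^sup>2)) \<longlonglongrightarrow> min M ((gd \<phi>' b)\<^sup>2)" if "\<forall>x. (\<lambda>n. \<phi> n x) \<longlonglongrightarrow> \<phi>' x" for \<phi>' and \<phi> :: "nat \<Rightarrow> _"
    using that by (intro tendsto_intros gd_tendsto) auto
  ultimately show ?thesis unfolding test_fun_def using assms by (auto simp: gd_inv)
qed

lemma test_fun_shift:
  fixes w :: "'d site"
  assumes "test_fun B (\<lambda>\<phi>. F (grad \<phi>))" and [measurable]: "F \<in> borel_measurable GS"
  shows "test_fun B (\<lambda>\<phi>. F (grad (shift_site w \<phi>)))"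
proof -
  have "(\<lambda>\<phi>. F (grad (shift_site w \<phi>))) \<in> borel_measurable HS" by measurable
  moreover have "grad (shift_site w (\<lambda>x. \<phi> x - \<phi> 0)) = grad (shift_site w \<phi>)" for \<phi> :: "'d site \<Rightarrow> real"
    unfolding shift_site_def by (rule grad_minus_const)
  moreover have "(\<lambda>n. F (grad (shift_site w (\<phi> n)))) \<longlonglongrightarrow> F (grad (shift_site w \<phi>'))" if "\<forall>x. (\<lambda>n. \<phi> n x) \<longlonglongrightarrow> \<phi>' x" for \<phi>' and \<phi> :: "nat \<Rightarrow> _"
    using assms(1) that unfolding test_fun_def shift_site_def by auto
  ultimately show ?thesis using assms(1) by (auto simp: test_fun_def)
qed

lemma boundary_error_tendsto:
  "(\<lambda>N. 2 * B * (1 - real (card (cube (N * N - r) :: 'd site set)) / real (card (Av N)))) \<longlonglongrightarrow> 0"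
proof -
  have "(\<lambda>N. 2 * B * (1 - real (card (cube (N * N - r) :: 'd site set)) / real (card (Av N)))) \<longlonglongrightarrow> 2 * B * (1 - 1)"
    unfolding Av_def by (intro tendsto_intros cube_ratio)
  then show ?thesis by simp
qed

lemma tendsto_zero_boundary:
  assumes "\<And>N. r \<le> N * N \<Longrightarrow> \<bar>d N\<bar> \<le> 2 * B * (1 - real (card (cube (N * N - r) :: 'd site set)) / real (card (Av N)))"
  shows "d \<longlonglongrightarrow> (0::real)"
proof (rule Lim_null_comparison[OF _ boundary_error_tendsto])
  show "\<forall>\<^sub>F N in sequentially. norm (d N) \<le> 2 * B * (1 - real (card (cube (N * N - r) :: 'd site set)) / real (card (Av N)))"
  proof (rule eventually_sequentiallyI[of r])
    fix N assume "r \<le> N"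
    then have "r \<le> N * N" by (meson le_square le_trans)
    then show "norm (d N) \<le> 2 * B * (1 - real (card (cube (N * N - r) :: 'd site set)) / real (card (Av N)))"
      using assms by simp
  qed
qed

lemma annealed_min_sq_le:
  assumes "M \<ge> 0" shows "(\<integral>z. (\<integral>\<phi>. min M ((gd \<phi> (x, i))\<^sup>2) \<partial>K N z) \<partial>Q) \<le> CB"
proof -
  have "ennreal (\<integral>z. (\<integral>\<phi>. min M ((gd \<phi> (x, i))\<^sup>2) \<partial>K N z) \<partial>Q) = (\<integral>\<^sup>+z. \<integral>\<^sup>+\<phi>. ennreal (min M ((gd \<phi> (x, i))\<^sup>2)) \<partial>K N z \<partial>Q)"
    by (rule nested_integral_nn[OF prob_space_axioms K_kernel, symmetric, of _ M]) (use assms in auto)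
  also have "\<dots> \<le> (\<integral>\<^sup>+z. \<integral>\<^sup>+\<phi>. ennreal ((gd \<phi> (x, i))\<^sup>2) \<partial>K N z \<partial>Q)" by (intro nn_integral_mono ennreal_leI) auto
  also have "\<dots> \<le> ennreal CB" by (rule second_moment)
  finally show ?thesis using CB(1) by (simp add: ennreal_le_iff)
qed

theorem shift_covariant_ggm_exists:
  "\<exists>mu. mu \<in> measurable Q (prob_algebra GS)
   \<and> (AE z in Q. is_ggm (hamf (U z) (h z)) (mu z))
   \<and> (\<forall>v z F. F \<in> Cb \<longrightarrow> (\<integral>\<eta>. F \<eta> \<partial>(mu (sh v z))) = (\<integral>\<eta>. F (shift_grad v \<eta>) \<partial>(mu z)))
   \<and> (\<forall>x y. nn x y \<longrightarrow> (\<integral>z. (\<integral>\<eta>. \<eta> (x, y) \<partial>(mu z)) \<partial>Q) = tilt u x y)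
   \<and> (\<forall>x y. nn x y \<longrightarrow> (\<integral>\<^sup>+z. (\<integral>\<^sup>+\<eta>. ennreal ((\<eta> (x, y))\<^sup>2) \<partial>(mu z)) \<partial>Q) < \<infinity>)"
proof -
  obtain c :: "nat \<Rightarrow> nat pmf" and good :: "'z set" and m :: "'z \<Rightarrow> ('d site \<Rightarrow> real) measure"
    where c: "\<And>n. set_pmf (c n) \<subseteq> {n..}" and good [measurable]: "good \<in> sets Q" and AEg: "AE z in Q. z \<in> good"
    and mk: "m \<in> measurable Q (prob_algebra HS)"
    and conv: "\<And>z G B. z \<in> good \<Longrightarrow> test_fun B G \<Longrightarrow>
      (\<lambda>n. \<integral>k. (\<integral>\<phi>. G \<phi> \<partial>K k z) \<partial>measure_pmf (c n)) \<longlonglongrightarrow> (\<integral>\<phi>. G \<phi> \<partial>m z)"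
    and ann: "\<And>G B N b. test_fun B G \<Longrightarrow> (\<And>k. k \<ge> N \<Longrightarrow> (\<integral>z. (\<integral>\<phi>. G \<phi> \<partial>K k z) \<partial>Q) \<le> b) \<Longrightarrow>
      (\<integral>z. (\<integral>\<phi>. G \<phi> \<partial>m z) \<partial>Q) \<le> b"
    using random_weak_limit[OF prob_space_axioms K_kernel height_moment] by metis
  have ms [simp, measurable_cong]: "sets (m z) = sets HS" and mp: "prob_space (m z)" for z
    using measurable_space[OF mk, of z] by (auto simp: space_prob_algebra)
  have msub [measurable]: "m \<in> measurable Q (subprob_algebra HS)" by (rule measurable_prob_algebraD[OF mk])
  have Kb: "\<bar>\<integral>\<phi>. G \<phi> \<partial>K k z\<bar> \<le> B" if "test_fun B G" for G B k z
    using that by (intro prob_integral_abs_le[OF K_prob]) (auto simp: test_fun_def)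

  \<comment> \<open>An equality that holds for \<open>K k\<close> up to a vanishing error becomes
    exact, because mixtures over later and later tails average the error away. The DLR equation and
    covariance are both instances.\<close>
  have limit_eq: "(\<integral>\<phi>. G1 \<phi> \<partial>m z1) = (\<integral>\<phi>. G2 \<phi> \<partial>m z2)"
    if z: "z1 \<in> good" "z2 \<in> good" and t: "test_fun B1 G1" "test_fun B2 G2"
      and d: "(\<lambda>k. (\<integral>\<phi>. G1 \<phi> \<partial>K k z1) - (\<integral>\<phi>. G2 \<phi> \<partial>K k z2)) \<longlonglongrightarrow> 0" for z1 z2 G1 G2 B1 B2
  proof -
    have i: "integrable (measure_pmf (c n)) (\<lambda>k. \<integral>\<phi>. G1 \<phi> \<partial>K k z1)" "integrable (measure_pmf (c n)) (\<lambda>k. \<integral>\<phi>. G2 \<phi> \<partial>K k z2)" for n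
      by (rule measure_pmf.integrable_const_bound[of _ B1], simp add: Kb[OF t(1)], simp)
        (rule measure_pmf.integrable_const_bound[of _ B2], simp add: Kb[OF t(2)], simp)
    have "\<bar>(\<integral>\<phi>. G1 \<phi> \<partial>K k z1) - (\<integral>\<phi>. G2 \<phi> \<partial>K k z2)\<bar> \<le> B1 + B2" for k
      using Kb[OF t(1), of k z1] Kb[OF t(2), of k z2] by linarith
    from pmf_tail_tendsto[OF this d c]
    have "(\<lambda>n. (\<integral>k. (\<integral>\<phi>. G1 \<phi> \<partial>K k z1) \<partial>measure_pmf (c n)) - (\<integral>k. (\<integral>\<phi>. G2 \<phi> \<partial>K k z2) \<partial>measure_pmf (c n))) \<longlonglongrightarrow> 0"
      using i by simp
    moreover have "(\<lambda>n. (\<integral>k. (\<integral>\<phi>. G1 \<phi> \<partial>K k z1) \<partial>measure_pmf (c n)) - (\<integral>k. (\<integral>\<phi>. G2 \<phi> \<partial>K k z2) \<partial>measure_pmf (c n)))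
      \<longlonglongrightarrow> (\<integral>\<phi>. G1 \<phi> \<partial>m z1) - (\<integral>\<phi>. G2 \<phi> \<partial>m z2)"
      by (intro tendsto_diff conv[OF z(1) t(1)] conv[OF z(2) t(2)])
    ultimately have "(\<integral>\<phi>. G1 \<phi> \<partial>m z1) - (\<integral>\<phi>. G2 \<phi> \<partial>m z2) = 0" using LIMSEQ_unique by blast
    then show ?thesis by simp
  qed

  have dlr: "(\<integral>\<phi>. (\<integral>\<phi>'. F (grad \<phi>') \<partial>gib (U z) (h z) \<Lambda> \<phi>) \<partial>m z) = (\<integral>\<phi>. F (grad \<phi>) \<partial>m z)"
    if z: "z \<in> good" and fin: "finite \<Lambda>" and F: "F \<in> Cb" for z \<Lambda> F
  proof -
    interpret p: potential "U z" "h z" A "Bf z" "j z" by (rule pot)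
    obtain B where t: "test_fun B (\<lambda>\<phi>. F (grad \<phi>))" using Cb_test_fun[OF F] .
    obtain r where r: "\<Lambda> \<subseteq> cube r" using finite_subset_cube[OF fin] .
    show ?thesis
    proof (rule limit_eq[OF z z p.gib_test_fun[OF fin t] t], rule tendsto_zero_boundary[where r=r and B=B])
      fix N assume "r \<le> N * N"
      then show "\<bar>(\<integral>\<phi>. (\<integral>\<phi>'. F (grad \<phi>') \<partial>gib (U z) (h z) \<Lambda> \<phi>) \<partial>K N z) - (\<integral>\<phi>. F (grad \<phi>) \<partial>K N z)\<bar>
          \<le> 2 * B * (1 - real (card (cube (N * N - r) :: 'd site set)) / real (card (Av N)))"
        using t by (intro K_dlr[OF fin r]) (auto simp: test_fun_def)
    qed
  qed

  have cov: "(\<integral>\<phi>. F (grad \<phi>) \<partial>m (sh w z)) = (\<integral>\<phi>. F (grad (shift_site w \<phi>)) \<partial>m z)"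
    if z: "sh w z \<in> good" "z \<in> good" and F: "F \<in> Cb" for w z F
  proof -
    have [measurable]: "F \<in> borel_measurable GS" using F by (simp add: Cb_def)
    obtain B where t: "test_fun B (\<lambda>\<phi>. F (grad \<phi>))" using Cb_test_fun[OF F] .
    obtain r where r: "w \<in> cube r" using finite_subset_cube[of "{w}"] by auto
    show ?thesis
    proof (rule limit_eq[OF z t test_fun_shift[OF t]], measurable, rule tendsto_zero_boundary[where r=r and B=B])
      fix N assume "r \<le> N * N"
      then show "\<bar>(\<integral>\<phi>. F (grad \<phi>) \<partial>K N (sh w z)) - (\<integral>\<phi>. F (grad (shift_site w \<phi>)) \<partial>K N z)\<bar>
          \<le> 2 * B * (1 - real (card (cube (N * N - r) :: 'd site set)) / real (card (Av N)))"
        using t by (intro K_covariant[OF r]) (auto simp: test_fun_def)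
    qed
  qed

  \<comment> \<open>The shift-invariant part of \<open>good\<close>, still of full measure because
    the law is stationary and there are countably many shifts. It is needed because covariance is
    required at every \<open>z\<close>.\<close>
  define good' where "good' = {z. \<forall>v. sh v z \<in> good}"
  have good's [measurable]: "good' \<in> sets Q"
  proof -
    have "{z \<in> space Q. \<forall>v. sh v z \<in> good} \<in> sets Q" by measurable
    then show ?thesis by (simp add: good'_def)
  qed
  have AEg': "AE z in Q. z \<in> good'"
  proof -
    have "AE z in Q. sh v z \<in> good" for v
    proof (rule AE_distrD[OF sh_measurable[of v]])
      show "AE z in distr Q Q (sh v). z \<in> good" unfolding sh_distr by (rule AEg)
    qed
    then show ?thesis unfolding good'_def by (simp add: AE_all_countable)
  qed
  have g'sh: "sh w z \<in> good' \<longleftrightarrow> z \<in> good'" for w z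
  proof -
    have "z \<in> good' \<Longrightarrow> sh w z \<in> good'" for w z by (auto simp: good'_def sh_sh)
    from this[of z w] this[of "sh w z" "- w"] show ?thesis by (auto simp: sh_sh sh_zero)
  qed
  have g'g: "z \<in> good" if "z \<in> good'" for z using that sh_zero[of z] by (auto simp: good'_def dest: spec[of _ 0])

  \<comment> \<open>The default is deterministic with a shift-invariant gradient, so covariance also
    holds off \<open>good'\<close>; the Gibbs property is only claimed almost everywhere.\<close>
  define mu where "mu z = (if z \<in> good' then distr (m z) GS grad else return GS (grad plane))" for z
  have mum: "mu \<in> measurable Q (prob_algebra GS)"
  proof -
    have 1: "(\<lambda>z. distr (m z) GS grad) \<in> measurable Q (prob_algebra GS)"
      by (rule measurable_compose[OF mk measurable_distr_prob_space]) measurable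
    have 2: "(\<lambda>z. return GS (grad plane)) \<in> measurable Q (prob_algebra GS)"
      by (rule measurable_const) (auto simp: space_prob_algebra intro: prob_space_return)
    show ?thesis unfolding mu_def using 1 2 by measurable
  qed
  have gm [measurable]: "grad \<in> measurable (m z) GS" for z by measurable
  have ggm: "is_ggm (hamf (U z) (h z)) (mu z)" if z: "z \<in> good'" for z
  proof -
    have "is_ggm (hamf (U z) (h z)) (distr (m z) GS grad)"
      using dlr[OF g'g[OF z]] by (intro potential.is_ggm_distr_grad[OF pot mp ms])
    then show ?thesis using z by (simp add: mu_def)
  qed
  have covm: "(\<integral>\<eta>. F \<eta> \<partial>(mu (sh v z))) = (\<integral>\<eta>. F (shift_grad v \<eta>) \<partial>(mu z))" if F: "F \<in> Cb" for v z F
  proof -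
    have Fm [measurable]: "F \<in> borel_measurable GS" using F by (simp add: Cb_def)
    have Fm' [measurable]: "(\<lambda>\<eta>. F (shift_grad v \<eta>)) \<in> borel_measurable GS" by measurable
    show ?thesis
    proof (cases "z \<in> good'")
      case True
      have "(\<integral>\<phi>. F (grad \<phi>) \<partial>m (sh v z)) = (\<integral>\<phi>. F (grad (shift_site v \<phi>)) \<partial>m z)"
        using True g'sh g'g F by (intro cov) auto
      then show ?thesis using True by (simp add: mu_def g'sh integral_distr shift_grad_grad)
    next
      case False
      have "shift_site v plane = (\<lambda>x. plane x - plane v)"
        unfolding shift_site_def using plane_add by (auto simp: fun_eq_iff) (metis add_diff_cancel_right' diff_add_cancel)
      then have "shift_grad v (grad plane) = grad plane" by (simp add: shift_grad_grad grad_minus_const)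
      then show ?thesis using False by (simp add: mu_def g'sh integral_return)
    qed
  qed

  define X where "X x i \<phi> = gd \<phi> (x, i)" for x i and \<phi> :: "'d site \<Rightarrow> real"
  have Xm [measurable]: "X x i \<in> borel_measurable HS" for x i unfolding X_def by measurable
  have sec: "(\<integral>\<^sup>+z. \<integral>\<^sup>+\<phi>. ennreal ((X x i \<phi>)\<^sup>2) \<partial>m z \<partial>Q) \<le> ennreal CB" for x i
  proof -
    define Am where "Am = Q \<bind> m"
    have nn: "(\<integral>\<^sup>+\<phi>. G \<phi> \<partial>Am) = (\<integral>\<^sup>+z. \<integral>\<^sup>+\<phi>. G \<phi> \<partial>m z \<partial>Q)" if "G \<in> borel_measurable HS" for G
      unfolding Am_def by (rule nn_integral_bind[OF that msub])
    have [simp, measurable_cong]: "sets Am = sets HS" unfolding Am_def by (rule sets_bind) auto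
    \<comment> \<open>The truncated square is a test function, so its annealed bound survives the
      limit; monotone convergence then removes the truncation.\<close>
    have b: "(\<integral>\<^sup>+\<phi>. ennreal (min (real k) ((X x i \<phi>)\<^sup>2)) \<partial>Am) \<le> ennreal CB" for k :: nat
    proof -
      have "(\<integral>\<^sup>+\<phi>. ennreal (min (real k) ((X x i \<phi>)\<^sup>2)) \<partial>Am) = ennreal (\<integral>z. (\<integral>\<phi>. min (real k) ((X x i \<phi>)\<^sup>2) \<partial>m z) \<partial>Q)"
        by (subst nn, measurable, rule nested_integral_nn[OF prob_space_axioms mk, of _ "real k"]) auto
      also have "\<dots> \<le> ennreal CB"
        unfolding X_def by (intro ennreal_leI ann[OF test_fun_min_sq] annealed_min_sq_le) auto
      finally show ?thesis .
    qed
    have sup: "ennreal (t\<^sup>2) = (SUP k. ennreal (min (real k) (t\<^sup>2)))" for t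
    proof (rule antisym)
      obtain k :: nat where "t\<^sup>2 \<le> real k" using real_arch_simple by blast
      then have "ennreal (t\<^sup>2) = ennreal (min (real k) (t\<^sup>2))" by simp
      also have "\<dots> \<le> (SUP k. ennreal (min (real k) (t\<^sup>2)))" by (rule SUP_upper) simp
      finally show "ennreal (t\<^sup>2) \<le> (SUP k. ennreal (min (real k) (t\<^sup>2)))" .
    qed (auto intro!: SUP_least ennreal_leI)
    have "(\<integral>\<^sup>+z. \<integral>\<^sup>+\<phi>. ennreal ((X x i \<phi>)\<^sup>2) \<partial>m z \<partial>Q) = (\<integral>\<^sup>+\<phi>. ennreal ((X x i \<phi>)\<^sup>2) \<partial>Am)" by (subst nn) auto
    also have "\<dots> = (\<integral>\<^sup>+\<phi>. (SUP k. ennreal (min (real k) ((X x i \<phi>)\<^sup>2))) \<partial>Am)" by (simp add: sup)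
    also have "\<dots> = (SUP k. \<integral>\<^sup>+\<phi>. ennreal (min (real k) ((X x i \<phi>)\<^sup>2)) \<partial>Am)"
      by (rule nn_integral_monotone_convergence_SUP) (auto simp: incseq_def le_fun_def intro!: ennreal_leI min.mono)
    also have "\<dots> \<le> ennreal CB" by (intro SUP_least b)
    finally show ?thesis .
  qed

  have tilt: "(\<integral>z. (\<integral>\<phi>. X x i \<phi> \<partial>m z) \<partial>Q) = u $ i" for x i
  proof -
    obtain r where r: "x \<in> cube r" "x + unitv i \<in> cube r" using finite_subset_cube[of "{x, x + unitv i}"] by auto
    define s where "s z = (\<integral>\<^sup>+\<phi>. ennreal ((X x i \<phi>)\<^sup>2) \<partial>m z)" for z
    have sm [measurable]: "s \<in> borel_measurable Q" unfolding s_def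
      by (rule measurable_compose[OF msub nn_integral_measurable_subprob_algebra]) measurable
    have s1: "(\<integral>\<^sup>+z. s z \<partial>Q) \<le> ennreal CB" unfolding s_def by (rule sec)
    have sfin: "AE z in Q. s z \<noteq> \<infinity>"
    proof (rule nn_integral_PInf_AE[OF sm])
      show "(\<integral>\<^sup>+z. s z \<partial>Q) \<noteq> \<infinity>" using s1 by (auto simp: top_unique)
    qed
    define s' where "s' z = enn2real (s z)" for z
    have s'm [measurable]: "s' \<in> borel_measurable Q" unfolding s'_def by measurable
    have ss': "AE z in Q. s z = ennreal (s' z)" using sfin by eventually_elim (auto simp: s'_def less_top)
    have s'1: "(\<integral>\<^sup>+z. ennreal (s' z) \<partial>Q) \<le> ennreal CB"
    proof -
      have "(\<integral>\<^sup>+z. ennreal (s' z) \<partial>Q) = (\<integral>\<^sup>+z. s z \<partial>Q)" using ss' by (intro nn_integral_cong_AE) auto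
      then show ?thesis using s1 by simp
    qed
    have s'0: "0 \<le> s' z" for z by (simp add: s'_def)
    have s'i: "integrable Q s'" using s'1 s'0 by (intro integrableI_nonneg) (auto simp: le_less_trans[OF _ ennreal_less_top])
    have s'e: "(\<integral>z. s' z \<partial>Q) \<le> CB"
      using s'1 nn_integral_eq_integral[OF s'i] s'0 CB(1) by (simp add: ennreal_le_iff)
    have close: "AE z in Q. \<bar>(\<integral>\<phi>. X x i \<phi> \<partial>m z) - (\<integral>\<phi>. clip M (X x i \<phi>) \<partial>m z)\<bar> \<le> s' z / M" if M: "M > 0" for M
      using ss'
    proof eventually_elim
      fix z assume sz: "s z = ennreal (s' z)"
      interpret mz: prob_space "m z" by (rule mp)
      have [measurable]: "(\<lambda>t. clip M t) \<in> borel_measurable borel" unfolding clip_def by measurable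
      have i2: "integrable (m z) (\<lambda>\<phi>. (X x i \<phi>)\<^sup>2)" using sz by (intro integrableI_nonneg) (auto simp: s_def)
      have i1: "integrable (m z) (X x i)" by (rule mz.square_integrable_imp_integrable[OF _ i2]) measurable
      have ic: "integrable (m z) (\<lambda>\<phi>. clip M (X x i \<phi>))"
        using M by (intro mz.integrable_const_bound[of _ M]) (auto simp: clip_bound)
      have e2: "(\<integral>\<phi>. (X x i \<phi>)\<^sup>2 \<partial>m z) = s' z"
        using sz s'0[of z] i2 unfolding s_def by (simp add: nn_integral_eq_integral)
      have "\<bar>(\<integral>\<phi>. X x i \<phi> \<partial>m z) - (\<integral>\<phi>. clip M (X x i \<phi>) \<partial>m z)\<bar> = \<bar>\<integral>\<phi>. X x i \<phi> - clip M (X x i \<phi>) \<partial>m z\<bar>"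
        using i1 ic by simp
      also have "\<dots> \<le> (\<integral>\<phi>. \<bar>X x i \<phi> - clip M (X x i \<phi>)\<bar> \<partial>m z)" by (rule integral_abs_bound)
      also have "\<dots> \<le> (\<integral>\<phi>. (X x i \<phi>)\<^sup>2 / M \<partial>m z)"
        using i1 i2 ic M clip_diff by (intro integral_mono) (auto simp: abs_minus_commute)
      also have "\<dots> = s' z / M" using e2 by simp
      finally show "\<bar>(\<integral>\<phi>. X x i \<phi> \<partial>m z) - (\<integral>\<phi>. clip M (X x i \<phi>) \<partial>m z)\<bar> \<le> s' z / M" .
    qed
    \<comment> \<open>One \<open>CB / M\<close> is the price of clipping under the limit law, the
      other that of clipping in finite volume.\<close>
    have near: "\<bar>(\<integral>z. (\<integral>\<phi>. X x i \<phi> \<partial>m z) \<partial>Q) - u $ i\<bar> \<le> 2 * CB / M" if M: "M > 0" for M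
    proof -
      have M0: "M \<ge> 0" using M by simp
      define a where "a z = (\<integral>\<phi>. X x i \<phi> \<partial>m z)" for z
      define b where "b z = (\<integral>\<phi>. clip M (X x i \<phi>) \<partial>m z)" for z
      have am [measurable]: "a \<in> borel_measurable Q" unfolding a_def
        by (rule measurable_compose[OF msub integral_measurable_subprob_algebra]) measurable
      have bm [measurable]: "b \<in> borel_measurable Q" unfolding b_def
        by (rule measurable_compose[OF msub integral_measurable_subprob_algebra]) (simp add: clip_def)
      have bi: "integrable Q b"
      proof (rule integrable_const_bound[of _ M])
        have [measurable]: "(\<lambda>t. clip M t) \<in> borel_measurable borel" unfolding clip_def by measurable
        have "\<bar>b z\<bar> \<le> M" for z unfolding b_def
          by (rule prob_integral_abs_le[OF mp]) (measurable, rule clip_bound[OF M0])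
        then show "AE z in Q. norm (b z) \<le> M" by simp
      qed measurable
      have ab: "AE z in Q. norm (a z - b z) \<le> s' z / M" using close[OF M] by (simp add: a_def b_def)
      have abi: "integrable Q (\<lambda>z. a z - b z)"
        by (rule Bochner_Integration.integrable_bound[of _ "\<lambda>z. s' z / M"]) (use s'i ab s'0 M in auto)
      have ai: "integrable Q a" using Bochner_Integration.integrable_add[OF abi bi] by simp
      have "\<bar>(\<integral>z. a z \<partial>Q) - (\<integral>z. b z \<partial>Q)\<bar> = \<bar>\<integral>z. a z - b z \<partial>Q\<bar>" using ai bi by simp
      also have "\<dots> \<le> (\<integral>z. \<bar>a z - b z\<bar> \<partial>Q)" by (rule integral_abs_bound)
      also have "\<dots> \<le> (\<integral>z. s' z / M \<partial>Q)" using ab abi s'i by (intro integral_mono_AE) auto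
      also have "\<dots> \<le> CB / M" using s'e M by (simp add: divide_right_mono)
      finally have 1: "\<bar>(\<integral>z. a z \<partial>Q) - (\<integral>z. b z \<partial>Q)\<bar> \<le> CB / M" .
      have tk: "\<bar>(\<integral>z. (\<integral>\<phi>. clip M (gd \<phi> (x, i)) \<partial>K k z) \<partial>Q) - u $ i\<bar> \<le> CB / M" if "k \<ge> r" for k
        using r cube_mono[OF that] by (intro tilt_K[OF M]) auto
      have "(\<integral>z. b z \<partial>Q) \<le> u $ i + CB / M" unfolding b_def X_def
      proof (rule ann[OF test_fun_clip[OF M0], of r])
        fix k assume "r \<le> k"
        from tk[OF this] show "(\<integral>z. (\<integral>\<phi>. clip M (gd \<phi> (x, i)) \<partial>K k z) \<partial>Q) \<le> u $ i + CB / M" by linarith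
      qed
      \<comment> \<open>Annealed bounds reach the limit as upper bounds only, so the lower bound
        comes from the negated functional.\<close>
      moreover have "(\<integral>z. (\<integral>\<phi>. - clip M (gd \<phi> (x, i)) \<partial>m z) \<partial>Q) \<le> - (u $ i) + CB / M"
      proof (rule ann[OF test_fun_uminus[OF test_fun_clip[OF M0]], of r])
        fix k assume "r \<le> k"
        from tk[OF this] show "(\<integral>z. (\<integral>\<phi>. - clip M (gd \<phi> (x, i)) \<partial>K k z) \<partial>Q) \<le> - (u $ i) + CB / M" by simp
      qed
      then have "- (\<integral>z. b z \<partial>Q) \<le> - (u $ i) + CB / M" by (simp add: b_def X_def)
      ultimately show ?thesis using 1 unfolding a_def[symmetric] by (simp add: abs_le_iff)
    qed
    show ?thesis
    proof (rule ccontr)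
      assume ne: "(\<integral>z. (\<integral>\<phi>. X x i \<phi> \<partial>m z) \<partial>Q) \<noteq> u $ i"
      define e where "e = \<bar>(\<integral>z. (\<integral>\<phi>. X x i \<phi> \<partial>m z) \<partial>Q) - u $ i\<bar>"
      have e: "e > 0" using ne by (simp add: e_def)
      \<comment> \<open>The extra 1 in \<open>M\<close> makes the bound strictly smaller than
        \<open>e\<close> and keeps \<open>M\<close> positive when \<open>CB = 0\<close>.\<close>
      have "e \<le> 2 * CB / ((2 * CB + 1) / e)" unfolding e_def[symmetric] using near[of "(2 * CB + 1) / e"] e CB(1) by (simp add: e_def)
      also have "\<dots> = 2 * CB * e / (2 * CB + 1)" by simp
      also have "\<dots> < e" using e CB(1) by (simp add: divide_less_eq algebra_simps)
      finally show False by simp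
    qed
  qed

  have emu: "AE z in Q. mu z = distr (m z) GS grad" using AEg' by eventually_elim (simp add: mu_def)
  have first: "(\<integral>z. (\<integral>\<eta>. \<eta> b \<partial>(mu z)) \<partial>Q) = (\<integral>z. (\<integral>\<phi>. grad \<phi> b \<partial>m z) \<partial>Q)" for b
  proof (rule integral_cong_AE)
    show "(\<lambda>z. \<integral>\<eta>. \<eta> b \<partial>(mu z)) \<in> borel_measurable Q"
      by (rule measurable_compose[OF measurable_prob_algebraD[OF mum] integral_measurable_subprob_algebra]) measurable
    show "(\<lambda>z. \<integral>\<phi>. grad \<phi> b \<partial>m z) \<in> borel_measurable Q"
      by (rule measurable_compose[OF msub integral_measurable_subprob_algebra]) measurable
    show "AE z in Q. (\<integral>\<eta>. \<eta> b \<partial>(mu z)) = (\<integral>\<phi>. grad \<phi> b \<partial>m z)"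
      using emu by eventually_elim (simp add: integral_distr)
  qed
  have second: "(\<integral>\<^sup>+z. (\<integral>\<^sup>+\<eta>. ennreal ((\<eta> b)\<^sup>2) \<partial>(mu z)) \<partial>Q) = (\<integral>\<^sup>+z. (\<integral>\<^sup>+\<phi>. ennreal ((grad \<phi> b)\<^sup>2) \<partial>m z) \<partial>Q)" for b
  proof (rule nn_integral_cong_AE)
    show "AE z in Q. (\<integral>\<^sup>+\<eta>. ennreal ((\<eta> b)\<^sup>2) \<partial>(mu z)) = (\<integral>\<^sup>+\<phi>. ennreal ((grad \<phi> b)\<^sup>2) \<partial>m z)"
      using emu by eventually_elim (simp add: nn_integral_distr)
  qed
  have bond: "(\<exists>i. y = x + unitv i \<and> (\<forall>\<phi>. grad \<phi> (x, y) = X x i \<phi>) \<and> tilt u x y = u $ i)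
      \<or> (\<exists>i. x = y + unitv i \<and> (\<forall>\<phi>. grad \<phi> (x, y) = - X y i \<phi>) \<and> tilt u x y = - (u $ i))" if "nn x y" for x y :: "'d site"
  proof -
    have tl: "tilt u x y = plane y - plane x" for x y :: "'d site"
      by (simp add: tilt_def plane_def sum_subtractf[symmetric] algebra_simps)
    obtain i where "y = x + unitv i \<or> x = y + unitv i" using \<open>nn x y\<close> by (auto simp: nn_iff)
    then show ?thesis
    proof
      assume y: "y = x + unitv i"
      have "tilt u x y = u $ i" using gd_plane[of "(x, i)"] by (simp add: tl y gd_def)
      then show ?thesis using y by (auto simp: grad_def X_def gd_def)
    next
      assume x: "x = y + unitv i"
      have "tilt u x y = - (u $ i)" using gd_plane[of "(y, i)"] by (simp add: tl x gd_def)
      then show ?thesis using x by (auto simp: grad_def X_def gd_def)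
    qed
  qed
  have "(\<integral>z. (\<integral>\<eta>. \<eta> (x, y) \<partial>(mu z)) \<partial>Q) = tilt u x y" if "nn x y" for x y
    using bond[OF that] tilt by (auto simp: first)
  moreover have "(\<integral>\<^sup>+z. (\<integral>\<^sup>+\<eta>. ennreal ((\<eta> (x, y))\<^sup>2) \<partial>(mu z)) \<partial>Q) < \<infinity>" if "nn x y" for x y
    using bond[OF that] le_less_trans[OF sec ennreal_less_top] by (auto simp: second)
  moreover have "AE z in Q. is_ggm (hamf (U z) (h z)) (mu z)" using AEg' by eventually_elim (rule ggm)
  ultimately show ?thesis using mum covm by (intro exI[of _ mu]) auto
qed

end

section \<open>Finite-energy flows in dimension three and higher\<close>

text \<open>The unit flow of Polya's urn started from three balls of different colours: the current from \<open>x\<close>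
  to \<open>x + unitv i\<close> is the probability that the urn is in state \<open>x\<close> and then draws colour \<open>i\<close>.
  Uniformity of the urn on each level makes the energy finite.\<close>

definition orth :: "'d::finite set \<Rightarrow> 'd site set" where
  "orth S = {x. (\<forall>i. 0 \<le> x $ i) \<and> (\<forall>i. i \<notin> S \<longrightarrow> x $ i = 0)}"

text \<open>The number of draws made so far: coordinates count drawn balls, the three initial ones
  not included.\<close>

definition level :: "'d::finite set \<Rightarrow> 'd site \<Rightarrow> nat" where
  "level S x = nat (\<Sum>i\<in>S. x $ i)"

definition flow :: "'d::finite set \<Rightarrow> 'd site \<Rightarrow> 'd \<Rightarrow> real" where
  "flow S x i = (if x \<in> orth S \<and> i \<in> S then 2 * (real_of_int (x $ i) + 1) /
     ((real (level S x) + 1) * (real (level S x) + 2) * (real (level S x) + 3)) else 0)"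

lemma level_eq: "x \<in> orth S \<Longrightarrow> real (level S x) = (\<Sum>i\<in>S. real_of_int (x $ i))"
  by (simp add: level_def orth_def sum_nonneg)

lemma level_unitv:
  assumes "x \<in> orth S" "i \<in> S" shows "level S (x + unitv i) = Suc (level S x)"
proof -
  have "(\<Sum>k\<in>S. (x + unitv i) $ k) = (\<Sum>k\<in>S. x $ k) + (\<Sum>k\<in>S. if k = i then 1 else 0)"
    by (simp add: unitv_nth sum.distrib)
  also have "(\<Sum>k\<in>S. if k = i then 1 else (0::int)) = 1" using assms(2) by simp
  finally show ?thesis using assms(1) by (simp add: level_def orth_def sum_nonneg nat_add_distrib)
qed

text \<open>The \<open>(n + 1) * (n + 2) / 2\<close> states of level \<open>n\<close> are equally
  likely, and colour \<open>i\<close> is drawn with probability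
  \<open>(x $ i + 1) / (n + 3)\<close>. These add up to 1, since the three coordinates sum to
  \<open>n\<close>.\<close>

lemma outflow:
  assumes S: "card S = 3" and x: "x \<in> orth S"
  shows "(\<Sum>i\<in>UNIV. flow S x i) = 2 / ((real (level S x) + 1) * (real (level S x) + 2))"
proof -
  define n where "n = real (level S x)"
  have n: "n \<ge> 0" by (simp add: n_def)
  have "(\<Sum>i\<in>UNIV. flow S x i) = (\<Sum>i\<in>S. 2 * (real_of_int (x $ i) + 1) / ((n + 1) * (n + 2) * (n + 3)))"
    using x by (intro sum.mono_neutral_cong_right) (auto simp: flow_def n_def)
  also have "\<dots> = 2 * (\<Sum>i\<in>S. real_of_int (x $ i) + 1) / ((n + 1) * (n + 2) * (n + 3))"
    unfolding sum_divide_distrib[symmetric] sum_distrib_left[symmetric] ..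
  also have "(\<Sum>i\<in>S. real_of_int (x $ i) + 1) = n + 3" using S by (simp add: sum.distrib level_eq[OF x] n_def)
  also have "2 * (n + 3) / ((n + 1) * (n + 2) * (n + 3)) = 2 / ((n + 1) * (n + 2))"
    using n by (intro nonzero_mult_divide_mult_cancel_right) simp
  finally show ?thesis by (simp add: n_def)
qed

lemma orth_minus_unitv:
  assumes "x \<in> orth S" "i \<in> S" shows "x - unitv i \<in> orth S \<longleftrightarrow> 1 \<le> x $ i"
proof
  assume "x - unitv i \<in> orth S"
  then have "0 \<le> (x - unitv i) $ i" unfolding orth_def by blast
  then show "1 \<le> x $ i" by (simp add: unitv_nth)
qed (use assms in \<open>auto simp: orth_def unitv_nth\<close>)

lemma orth_minus_unitv_imp: "x - unitv i \<in> orth S \<Longrightarrow> i \<in> S \<Longrightarrow> x \<in> orth S"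
proof -
  assume h: "x - unitv i \<in> orth S" "i \<in> S"
  have "0 \<le> x $ k" for k
  proof -
    have "0 \<le> (x - unitv i) $ k" using h(1) unfolding orth_def by blast
    then show ?thesis by (simp add: unitv_nth split: if_splits)
  qed
  moreover have "x $ k = 0" if "k \<notin> S" for k
  proof -
    have "(x - unitv i) $ k = 0" using h(1) that unfolding orth_def by blast
    then show ?thesis using that h(2) by (auto simp: unitv_nth)
  qed
  ultimately show ?thesis by (simp add: orth_def)
qed

text \<open>The predecessor \<open>x - unitv i\<close> has level \<open>n - 1\<close> and has seen
  colour \<open>i\<close> one time less, so its current is proportional to \<open>x $ i\<close>, and
  the coordinates sum to \<open>n\<close>. At \<open>x $ i = 0\<close> the predecessor leaves the
  orthant and the formula gives 0 as well.\<close>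

lemma inflow:
  assumes x: "x \<in> orth S" "x \<noteq> 0"
  shows "(\<Sum>i\<in>UNIV. flow S (x - unitv i) i) = 2 / ((real (level S x) + 1) * (real (level S x) + 2))"
proof -
  define n where "n = real (level S x)"
  obtain k where k: "x $ k \<noteq> 0" using x(2) by (auto simp: vec_eq_iff)
  then have kS: "k \<in> S" "1 \<le> x $ k" using x(1) unfolding orth_def by (auto simp: order.order_iff_strict dest: spec[of _ k])
  have "x $ k \<le> (\<Sum>i\<in>S. x $ i)" using x(1) kS by (intro member_le_sum) (auto simp: orth_def)
  then have "1 \<le> level S x" using kS unfolding level_def by linarith
  then have n: "n \<ge> 1" by (simp add: n_def)
  have f: "flow S (x - unitv i) i = 2 * real_of_int (x $ i) / (n * (n + 1) * (n + 2))" if i: "i \<in> S" for i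
  proof (cases "1 \<le> x $ i")
    case True
    then have o: "x - unitv i \<in> orth S" using orth_minus_unitv[OF x(1) i] by simp
    have "level S x = Suc (level S (x - unitv i))" using level_unitv[OF o i] by simp
    then have l: "real (level S (x - unitv i)) = n - 1" by (simp add: n_def)
    show ?thesis using o i unfolding flow_def l by (simp add: unitv_nth algebra_simps)
  next
    case False
    then have "x $ i = 0" using x(1) unfolding orth_def by (auto simp: order.order_iff_strict dest: spec[of _ i])
    then show ?thesis using False orth_minus_unitv[OF x(1) i] by (simp add: flow_def)
  qed
  have "(\<Sum>i\<in>UNIV. flow S (x - unitv i) i) = (\<Sum>i\<in>S. 2 * real_of_int (x $ i) / (n * (n + 1) * (n + 2)))"
    using f by (intro sum.mono_neutral_cong_right) (auto simp: flow_def)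
  also have "\<dots> = 2 * n / (n * (n + 1) * (n + 2))"
    unfolding sum_divide_distrib[symmetric] sum_distrib_left[symmetric] n_def level_eq[OF x(1)] ..
  also have "\<dots> = 2 / ((n + 1) * (n + 2))" using n by (simp add: mult.assoc)
  finally show ?thesis by (simp add: n_def)
qed

text \<open>The urn leaves each state as often as it enters it, except for its start, which it
  leaves with probability 1.\<close>

lemma flow_divergence:
  assumes S: "card S = 3"
  shows "(\<Sum>i\<in>UNIV. flow S x i) - (\<Sum>i\<in>UNIV. flow S (x - unitv i) i) = (if x = 0 then 1 else 0)"
proof (cases "x \<in> orth S")
  case True
  show ?thesis
  proof (cases "x = 0")
    case x0: True
    have "flow S (0 - unitv i) i = 0" for i
    proof -
      have "(0 - unitv i) $ i < 0" by (simp add: unitv_nth)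
      then have "0 - unitv i \<notin> orth S" unfolding orth_def by (auto simp: not_le intro: exI[of _ i])
      then show ?thesis by (simp add: flow_def)
    qed
    moreover have "(\<Sum>i\<in>UNIV. flow S 0 i) = 1" using outflow[OF S True] x0 by (simp add: level_def)
    ultimately show ?thesis using x0 by simp
  qed (use outflow[OF S True] inflow[OF True] in simp)
next
  case False
  have "flow S (x - unitv i) i = 0" for i using orth_minus_unitv_imp[of x i S] False by (auto simp: flow_def)
  moreover have "x \<noteq> 0" using False by (auto simp: orth_def)
  ultimately show ?thesis using False by (simp add: flow_def)
qed

text \<open>Summation by parts against the unit flow out of \<open>a\<close>; the sign is negative
  because \<open>gd\<close> points along the flow. The flow may leave \<Lambda> freely, since ends
  off \<Lambda> are weighted by \<open>f = 0\<close>.\<close>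

lemma flow_represents:
  fixes f :: "'d::finite site \<Rightarrow> real"
  assumes S: "card S = 3" and fin: "finite \<Lambda>" and f: "\<And>x. x \<notin> \<Lambda> \<Longrightarrow> f x = 0"
  shows "f a = - (\<Sum>b\<in>bnd \<Lambda>. flow S (fst b - a) (snd b) * gd f b)"
proof -
  let ?t = "\<lambda>b. flow S (fst b - a) (snd b)"
  have "(\<Sum>b\<in>bnd \<Lambda>. ?t b * gd f b) = (\<Sum>b\<in>bnd \<Lambda>. ?t b * f (fst b + unitv (snd b))) - (\<Sum>b\<in>bnd \<Lambda>. ?t b * f (fst b))"
    by (simp add: gd_def right_diff_distrib sum_subtractf)
  also have "(\<Sum>b\<in>bnd \<Lambda>. ?t b * f (fst b)) = (\<Sum>b\<in>\<Lambda> \<times> UNIV. ?t b * f (fst b))"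
  proof (intro sum.mono_neutral_right finite_bnd fin ballI)
    fix b :: "'d site \<times> 'd" assume "b \<in> bnd \<Lambda> - \<Lambda> \<times> UNIV"
    then have "fst b \<notin> \<Lambda>" by (cases b) auto
    then show "?t b * f (fst b) = 0" by (simp add: f)
  qed (auto simp: bnd_def)
  also have "\<dots> = (\<Sum>y\<in>\<Lambda>. (\<Sum>i\<in>UNIV. flow S (y - a) i) * f y)"
    by (simp add: sum_distrib_right sum.cartesian_product case_prod_beta')
  also have "(\<Sum>b\<in>bnd \<Lambda>. ?t b * f (fst b + unitv (snd b))) = (\<Sum>b\<in>(\<lambda>(y, i). (y - unitv i, i)) ` (\<Lambda> \<times> UNIV). ?t b * f (fst b + unitv (snd b)))"
  proof (intro sum.mono_neutral_right ballI)
    show "(\<lambda>(y, i). (y - unitv i, i)) ` (\<Lambda> \<times> UNIV) \<subseteq> bnd \<Lambda>" by (auto simp: bnd_def)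
    fix b assume b: "b \<in> bnd \<Lambda> - (\<lambda>(y, i). (y - unitv i, i)) ` (\<Lambda> \<times> UNIV)"
    have "fst b + unitv (snd b) \<notin> \<Lambda>"
    proof
      assume "fst b + unitv (snd b) \<in> \<Lambda>"
      then have "b \<in> (\<lambda>(y, i). (y - unitv i, i)) ` (\<Lambda> \<times> UNIV)"
        by (intro image_eqI[of _ _ "(fst b + unitv (snd b), snd b)"]) auto
      then show False using b by blast
    qed
    then show "?t b * f (fst b + unitv (snd b)) = 0" by (simp add: f)
  qed (use fin in auto)
  also have "\<dots> = (\<Sum>(y, i)\<in>\<Lambda> \<times> UNIV. flow S (y - a - unitv i) i * f y)"
    by (subst sum.reindex) (auto simp: inj_on_def algebra_simps intro!: sum.cong)
  also have "\<dots> = (\<Sum>y\<in>\<Lambda>. (\<Sum>i\<in>UNIV. flow S (y - a - unitv i) i) * f y)"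
    by (simp add: sum.cartesian_product[symmetric] sum_distrib_right)
  finally have "(\<Sum>b\<in>bnd \<Lambda>. ?t b * gd f b) = - (\<Sum>y\<in>\<Lambda>. ((\<Sum>i\<in>UNIV. flow S (y - a) i) - (\<Sum>i\<in>UNIV. flow S (y - a - unitv i) i)) * f y)"
    by (simp add: left_diff_distrib sum_subtractf)
  also have "\<dots> = - (\<Sum>y\<in>\<Lambda>. if y = a then f y else 0)"
    unfolding flow_divergence[OF S] by (intro arg_cong[of _ _ uminus] sum.cong) auto
  also have "\<dots> = - f a" using fin f[of a] by auto
  finally show ?thesis by simp
qed

text \<open>Two coordinates determine the third, and each lies between 0 and
  \<open>n\<close>.\<close>

lemma card_orth_level:
  assumes S: "card S = 3" and W: "finite W"
  shows "card {x \<in> W. x \<in> orth S \<and> level S x = n} \<le> (n + 1)\<^sup>2"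
proof -
  obtain a b c where abc: "S = {a, b, c}" "a \<noteq> b" "a \<noteq> c" "b \<noteq> c"
    using S by (auto simp: card_3_iff)
  let ?X = "{x \<in> W. x \<in> orth S \<and> level S x = n}"
  have s: "x $ a + x $ b + x $ c = int n \<and> 0 \<le> x $ a \<and> 0 \<le> x $ b \<and> 0 \<le> x $ c \<and> (\<forall>i. i \<notin> S \<longrightarrow> x $ i = 0)" if "x \<in> ?X" for x
    using that abc by (auto simp: orth_def level_def)
  have "inj_on (\<lambda>x. (x $ a, x $ b)) ?X"
  proof (rule inj_onI)
    fix x y assume x: "x \<in> ?X" and y: "y \<in> ?X" and e: "(x $ a, x $ b) = (y $ a, y $ b)"
    have "x $ i = y $ i" for i
      using s[OF x] s[OF y] e abc(1) by (cases "i \<in> S") auto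
    then show "x = y" by (simp add: vec_eq_iff)
  qed
  then have "card ?X = card ((\<lambda>x. (x $ a, x $ b)) ` ?X)" by (simp add: card_image)
  also have "\<dots> \<le> card ({0..int n} \<times> {0..int n})"
  proof (rule card_mono)
    show "(\<lambda>x. (x $ a, x $ b)) ` ?X \<subseteq> {0..int n} \<times> {0..int n}"
    proof
      fix p assume "p \<in> (\<lambda>x. (x $ a, x $ b)) ` ?X"
      then obtain x where x: "x \<in> ?X" "p = (x $ a, x $ b)" by blast
      show "p \<in> {0..int n} \<times> {0..int n}" using s[OF x(1)] x(2) by auto
    qed
  qed simp
  also have "\<dots> = (n + 1)\<^sup>2" by (simp add: card_cartesian_product power2_eq_square nat_add_distrib)
  finally show ?thesis .
qed

text \<open>Level \<open>n\<close> has at most \<open>(n + 1)\<^sup>2\<close> points with current at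
  most \<open>2 / ((n + 1) * (n + 2))\<close>, hence energy at most
  \<open>4 / (n + 2)\<^sup>2\<close>; comparison with a telescoping sum gives 4. With two colours
  the levels would contribute of order 1 / n, which is why three dimensions are required.\<close>

lemma flow_energy:
  assumes S: "card S = 3" and W: "finite W"
  shows "(\<Sum>x\<in>W. (flow S x i)\<^sup>2) \<le> 4"
proof -
  let ?X = "\<lambda>n. {x \<in> W. x \<in> orth S \<and> level S x = n}"
  let ?W = "{x \<in> W. x \<in> orth S}"
  define g where "g n = (2 / ((real n + 1) * (real n + 2)))\<^sup>2" for n
  have fb: "(flow S x i)\<^sup>2 \<le> g (level S x)" if x: "x \<in> orth S" for x
  proof (cases "i \<in> S")
    case True
    define n where "n = real (level S x)"
    have x0: "0 \<le> real_of_int (x $ i)" using x by (simp add: orth_def)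
    have "real_of_int (x $ i) \<le> n" unfolding n_def level_eq[OF x]
      using x True by (intro member_le_sum) (auto simp: orth_def)
    then have "2 * (real_of_int (x $ i) + 1) / ((n + 1) * (n + 2) * (n + 3)) \<le> 2 * (n + 3) / ((n + 1) * (n + 2) * (n + 3))"
      using x0 by (intro divide_right_mono) auto
    also have "\<dots> = 2 / ((n + 1) * (n + 2))"
      by (rule nonzero_mult_divide_mult_cancel_right) (simp add: n_def add_nonneg_eq_0_iff)
    finally have "flow S x i \<le> 2 / ((n + 1) * (n + 2))" using x True by (simp add: flow_def n_def)
    moreover have "0 \<le> flow S x i" using x0 x True by (simp add: flow_def)
    ultimately show ?thesis unfolding g_def n_def by (intro power_mono) auto
  qed (simp add: flow_def g_def)
  define N where "N = Suc (Max (insert 0 (level S ` ?W)))"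
  have lN: "level S ` ?W \<subseteq> {..<N}"
  proof
    fix k assume "k \<in> level S ` ?W"
    then have "k \<le> Max (insert 0 (level S ` ?W))" using W by (intro Max_ge) auto
    then show "k \<in> {..<N}" by (simp add: N_def)
  qed
  have "(\<Sum>x\<in>W. (flow S x i)\<^sup>2) = (\<Sum>x\<in>?W. (flow S x i)\<^sup>2)"
    using W by (intro sum.mono_neutral_right) (auto simp: flow_def)
  also have "\<dots> \<le> (\<Sum>x\<in>?W. g (level S x))" by (intro sum_mono fb) auto
  also have "\<dots> = (\<Sum>n<N. \<Sum>x\<in>{x \<in> ?W. level S x = n}. g (level S x))"
    using W lN by (intro sum.group[symmetric]) auto
  also have "\<dots> = (\<Sum>n<N. real (card (?X n)) * g n)"
    by (intro sum.cong refl) (auto simp: conj_assoc intro!: arg_cong[of _ _ card])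
  also have "\<dots> \<le> (\<Sum>n<N. 4 * (1 / (real n + 1) - 1 / (real n + 2)))"
  proof (intro sum_mono)
    fix n
    have "real (card (?X n)) * g n \<le> (real n + 1)\<^sup>2 * g n"
    proof (rule mult_right_mono)
      have "real (card (?X n)) \<le> real ((n + 1)\<^sup>2)" using card_orth_level[OF S W, of n] by (simp only: of_nat_le_iff)
      then show "real (card (?X n)) \<le> (real n + 1)\<^sup>2" by (simp add: add.commute)
    qed (simp add: g_def)
    also have "\<dots> = 4 / (real n + 2)\<^sup>2" by (simp add: g_def power_divide power_mult_distrib)
    also have "\<dots> \<le> 4 / ((real n + 1) * (real n + 2))"
      by (intro divide_left_mono) (auto simp: power2_eq_square intro!: mult_right_mono)
    also have "\<dots> = 4 * (1 / (real n + 1) - 1 / (real n + 2))" by (simp add: field_simps)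
    finally show "real (card (?X n)) * g n \<le> 4 * (1 / (real n + 1) - 1 / (real n + 2))" .
  qed
  also have "\<dots> = (\<Sum>n<N. 4 * (1 / (real n + 1)) - 4 * (1 / (real (Suc n) + 1)))"
    by (intro sum.cong refl) (simp add: right_diff_distrib add.commute)
  also have "\<dots> = 4 * (1 - 1 / (real N + 1))"
    using sum_lessThan_telescope'[of "\<lambda>n. 4 * (1 / (real n + 1))" N] by simp
  also have "\<dots> \<le> 4" by simp
  finally show ?thesis .
qed

text \<open>Independence factors the off-diagonal terms and centring makes them vanish.\<close>

lemma (in prob_space) expectation_square_sum:
  fixes X :: "'i \<Rightarrow> 'a \<Rightarrow> real"
  assumes ind: "indep_vars (\<lambda>_. borel) X UNIV" and W: "finite W"
    and sq: "\<And>x. integrable M (\<lambda>\<omega>. (X x \<omega>)\<^sup>2)" and mean: "\<And>x. expectation (X x) = 0"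
  shows "integrable M (\<lambda>\<omega>. (\<Sum>x\<in>W. a x * X x \<omega>)\<^sup>2)"
    and "expectation (\<lambda>\<omega>. (\<Sum>x\<in>W. a x * X x \<omega>)\<^sup>2) = (\<Sum>x\<in>W. (a x)\<^sup>2 * expectation (\<lambda>\<omega>. (X x \<omega>)\<^sup>2))"
proof -
  have rv [measurable]: "X x \<in> borel_measurable M" for x using ind by (simp add: indep_vars_def2)
  have i1: "integrable M (X x)" for x by (rule square_integrable_imp_integrable[OF rv sq])
  have prod: "integrable M (\<lambda>\<omega>. X x \<omega> * X y \<omega>) \<and> expectation (\<lambda>\<omega>. X x \<omega> * X y \<omega>) = (if x = y then expectation (\<lambda>\<omega>. (X x \<omega>)\<^sup>2) else 0)" for x y
  proof (cases "x = y")
    case True then show ?thesis using sq[of x] by (simp add: power2_eq_square)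
  next
    case False
    have iv: "indep_vars (\<lambda>_. borel) X {x, y}" by (rule indep_vars_subset[OF ind]) simp
    have "integrable M (\<lambda>\<omega>. \<Prod>i\<in>{x, y}. X i \<omega>)" by (rule indep_vars_integrable[OF _ iv]) (auto intro: i1)
    moreover have "expectation (\<lambda>\<omega>. \<Prod>i\<in>{x, y}. X i \<omega>) = (\<Prod>i\<in>{x, y}. expectation (X i))"
      by (rule indep_vars_lebesgue_integral[OF _ iv]) (auto intro: i1)
    ultimately show ?thesis using False mean by simp
  qed
  have e: "(\<Sum>x\<in>W. a x * X x \<omega>)\<^sup>2 = (\<Sum>x\<in>W. \<Sum>y\<in>W. (a x * a y) * (X x \<omega> * X y \<omega>))" for \<omega>
    by (simp add: power2_eq_square sum_product mult_ac)
  show "integrable M (\<lambda>\<omega>. (\<Sum>x\<in>W. a x * X x \<omega>)\<^sup>2)" unfolding e using prod by auto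
  have "expectation (\<lambda>\<omega>. (\<Sum>x\<in>W. a x * X x \<omega>)\<^sup>2) = (\<Sum>x\<in>W. \<Sum>y\<in>W. (a x * a y) * (if x = y then expectation (\<lambda>\<omega>. (X x \<omega>)\<^sup>2) else 0))"
    unfolding e using prod by simp
  also have "\<dots> = (\<Sum>x\<in>W. (a x)\<^sup>2 * expectation (\<lambda>\<omega>. (X x \<omega>)\<^sup>2))"
    using W by (intro sum.cong refl) (simp add: if_distrib[of "times _"] power2_eq_square cong: if_cong)
  finally show "expectation (\<lambda>\<omega>. (\<Sum>x\<in>W. a x * X x \<omega>)\<^sup>2) = (\<Sum>x\<in>W. (a x)\<^sup>2 * expectation (\<lambda>\<omega>. (X x \<omega>)\<^sup>2))" .
qed

section \<open>Model A\<close>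

text \<open>The construction lives on the canonical space of disorder fields, and \<open>X\<close>
  brings it back. The Hamiltonians have to agree only almost surely, which leaves room for the
  regularised potentials of model B.\<close>

lemma transfer_rggm:
  assumes X [measurable]: "X \<in> measurable P DS" and mu: "mu \<in> measurable (distr P DS X) (prob_algebra GS)"
    and ggm: "AE z in distr P DS X. is_ggm (H z) (mu z)"
    and H: "AE \<omega> in P. Ham (X \<omega>) = H (X \<omega>)"
    and cov: "\<forall>v z F. F \<in> Cb \<longrightarrow> (\<integral>\<eta>. F \<eta> \<partial>(mu (sh v z))) = (\<integral>\<eta>. F (shift_grad v \<eta>) \<partial>(mu z))"
    and tilt: "\<forall>x y. nn x y \<longrightarrow> (\<integral>z. (\<integral>\<eta>. \<eta> (x, y) \<partial>(mu z)) \<partial>distr P DS X) = tilt u x y"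
    and sec: "\<forall>x y. nn x y \<longrightarrow> (\<integral>\<^sup>+z. (\<integral>\<^sup>+\<eta>. ennreal ((\<eta> (x, y))\<^sup>2) \<partial>(mu z)) \<partial>distr P DS X) < \<infinity>"
  shows "shift_cov_rggm_tilt P X DS sh Ham u mu"
proof -
  have m: "mu \<in> measurable DS (prob_algebra GS)" using mu by simp
  have ms: "mu \<in> measurable DS (subprob_algebra GS)" by (rule measurable_prob_algebraD[OF m])
  have 1: "(\<lambda>z. \<integral>\<eta>. \<eta> b \<partial>(mu z)) \<in> borel_measurable DS" for b
    by (rule measurable_compose[OF ms integral_measurable_subprob_algebra]) measurable
  have "(\<lambda>z. \<integral>\<^sup>+\<eta>. ennreal ((\<eta> b)\<^sup>2) \<partial>(mu z)) \<in> borel_measurable DS" for b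
    by (rule measurable_compose[OF ms nn_integral_measurable_subprob_algebra]) measurable
  then have 2: "(\<lambda>z. \<integral>\<^sup>+\<eta>. ennreal ((\<eta> b)\<^sup>2) \<partial>(mu z)) \<in> borel_measurable (distr P DS X)" for b
    by simp
  have "AE \<omega> in P. is_ggm (Ham (X \<omega>)) (mu (X \<omega>))"
    using AE_distrD[OF X ggm] H by eventually_elim simp
  then show ?thesis unfolding shift_cov_rggm_tilt_def
    using m cov tilt sec by (simp add: integral_distr[OF X 1] nn_integral_distr[OF X 2])
qed

lemma hamA_eq: "hamA V (\<xi> :: 'd::finite site \<Rightarrow> real) = hamf (\<lambda>_ _. V) \<xi>"
proof -
  have "bondpot (\<lambda>_ _. V) x y = V" for x y :: "'d site" by (simp add: bondpot_def)
  then show ?thesis by (intro ext) (simp add: hamA_def hamf_def hamB_def)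
qed

lemma hamB_eq: "hamB W = hamf W (\<lambda>_. 0)"
  by (intro ext) (simp add: hamf_def)

lemma C2_fun_DERIV:
  assumes "C2_fun V" shows "(V has_real_derivative deriv V s) (at s)" "(deriv V has_real_derivative deriv (deriv V) s) (at s)"
  using assms by (auto simp: C2_fun_def field_differentiable_def real_differentiable_def DERIV_deriv_iff_real_differentiable)

lemma C2_fun_continuous: "C2_fun V \<Longrightarrow> continuous_on UNIV V"
  by (auto simp: continuous_on_eq_continuous_at intro: DERIV_isCont[OF C2_fun_DERIV(1)])

text \<open>Evenness gives \<open>deriv V 0 = 0\<close>; integrating the bound on the second
  derivative twice from 0 gives quadratic growth, then weakened to the form shared by both
  models.\<close>

lemma quadratic_upper_bound:
  assumes V: "C2_fun V" and even: "\<And>s. V (- s) = V s" and up: "\<And>s. deriv (deriv V) s \<le> C2" and C2: "C2 > 0"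
  shows "V s \<le> (\<bar>V 0\<bar> + C2) * (1 + s\<^sup>2)"
proof -
  have "((\<lambda>s. V (- s)) has_real_derivative - deriv V 0) (at 0)"
    using C2_fun_DERIV(1)[OF V, of 0] DERIV_mirror[of V "deriv V 0" 0] by simp
  then have "(V has_real_derivative - deriv V 0) (at 0)" by (simp add: even)
  from DERIV_unique[OF C2_fun_DERIV(1)[OF V, of 0] this] have d0: "deriv V 0 = 0" by simp
  have d1: "deriv V t \<le> C2 * t" if "0 \<le> t" for t
  proof -
    have "(\<lambda>t. C2 * t - deriv V t) 0 \<le> (\<lambda>t. C2 * t - deriv V t) t"
    proof (rule DERIV_nonneg_imp_nondecreasing[OF that])
      fix x
      have "((\<lambda>t. C2 * t - deriv V t) has_real_derivative C2 - deriv (deriv V) x) (at x)"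
        using C2_fun_DERIV(2)[OF V, of x] by (auto intro!: derivative_eq_intros)
      then show "\<exists>y. ((\<lambda>t. C2 * t - deriv V t) has_real_derivative y) (at x) \<and> 0 \<le> y" using up[of x] by force
    qed
    then show ?thesis using d0 by simp
  qed
  have v: "V t \<le> V 0 + C2 * t\<^sup>2 / 2" if "0 \<le> t" for t
  proof -
    have "(\<lambda>t. C2 * t\<^sup>2 / 2 - V t) 0 \<le> (\<lambda>t. C2 * t\<^sup>2 / 2 - V t) t"
    proof (rule DERIV_nonneg_imp_nondecreasing[OF that])
      fix x :: real assume "0 \<le> x"
      have "((\<lambda>t. C2 * t\<^sup>2 / 2 - V t) has_real_derivative C2 * x - deriv V x) (at x)"
        using C2_fun_DERIV(1)[OF V, of x] by (auto intro!: derivative_eq_intros)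
      then show "\<exists>y. ((\<lambda>t. C2 * t\<^sup>2 / 2 - V t) has_real_derivative y) (at x) \<and> 0 \<le> y"
        using d1[OF \<open>0 \<le> x\<close>] by force
    qed
    then show ?thesis by simp
  qed
  have "V s = V \<bar>s\<bar>" using even[of s] by (auto simp: abs_if)
  also have "\<dots> \<le> V 0 + C2 * s\<^sup>2 / 2" using v[of "\<bar>s\<bar>"] by simp
  also have "\<dots> \<le> \<bar>V 0\<bar> + C2 * s\<^sup>2 + C2 + \<bar>V 0\<bar> * s\<^sup>2"
  proof -
    have "0 \<le> C2 * s\<^sup>2" "0 \<le> \<bar>V 0\<bar> * s\<^sup>2" using C2 by auto
    then show ?thesis using C2 by linarith
  qed
  also have "\<dots> = (\<bar>V 0\<bar> + C2) * (1 + s\<^sup>2)" by (simp add: algebra_simps)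
  finally show ?thesis .
qed

text \<open>Relabelling i.i.d. coordinates injectively does not change their joint law; for lattice
  shifts this is stationarity of the disorder.\<close>

lemma PiM_iid_reindex:
  assumes D: "prob_space D" and s: "sets D = sets N" and f: "inj f"
  shows "distr (PiM UNIV (\<lambda>_. D)) (PiM UNIV (\<lambda>_. N)) (\<lambda>\<omega> x. \<omega> (f x)) = PiM UNIV (\<lambda>_. D)"
proof -
  have "distr (PiM UNIV (\<lambda>_. D)) (PiM UNIV (\<lambda>_. D)) (\<lambda>\<omega>. \<lambda>n\<in>UNIV. \<omega> (f n)) = PiM UNIV (\<lambda>_. D)"
    using distr_PiM_reindex[of UNIV "\<lambda>_. D" f UNIV] D f by auto
  moreover have "sets (PiM UNIV (\<lambda>_. D)) = sets (PiM UNIV (\<lambda>_. N))" by (intro sets_PiM_cong) (auto simp: s)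
  then have "distr (PiM UNIV (\<lambda>_. D)) (PiM UNIV (\<lambda>_. N)) (\<lambda>\<omega> x. \<omega> (f x)) = distr (PiM UNIV (\<lambda>_. D)) (PiM UNIV (\<lambda>_. D)) (\<lambda>\<omega> x. \<omega> (f x))"
    by (intro distr_cong) auto
  ultimately show ?thesis by (simp add: restrict_UNIV)
qed

lemma (in prob_space) iid_distr_PiM:
  assumes ind: "indep_vars (\<lambda>_. N) Y UNIV" and id: "\<And>i k. distr M N (Y i) = distr M N (Y k)"
  shows "distr M (PiM UNIV (\<lambda>_. N)) (\<lambda>\<omega> i. Y i \<omega>) = PiM UNIV (\<lambda>_. distr M N (Y k))"
proof -
  have rv: "random_variable N (Y i)" for i using ind by (simp add: indep_vars_def2)
  have "distr M (PiM UNIV (\<lambda>_. N)) (\<lambda>\<omega>. \<lambda>i\<in>UNIV. Y i \<omega>) = PiM UNIV (\<lambda>i. distr M N (Y i))"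
    using indep_vars_iff_distr_eq_PiM[where I=UNIV and M'="\<lambda>_. N" and X=Y] rv ind by auto
  also have "\<dots> = PiM UNIV (\<lambda>_. distr M N (Y k))" using id by (intro PiM_cong) auto
  finally show ?thesis by (simp add: restrict_UNIV)
qed

lemma model_A:
  fixes u :: "real ^ 'd::finite" and P :: "'o measure" and \<xi> :: "'o \<Rightarrow> 'd site \<Rightarrow> real"
  assumes d: "CARD('d) \<ge> 3" and V: "C2_fun V" "\<And>s. V (- s) = V s" and A: "A > 0" and C2: "C2 > 0"
    and lo: "\<And>s. V s \<ge> A * s\<^sup>2 - B" and up: "\<And>s. deriv (deriv V) s \<le> C2" and P: "prob_space P"
    and ind: "prob_space.indep_vars P (\<lambda>_. borel) (\<lambda>x \<omega>. \<xi> \<omega> x) UNIV"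
    and id: "\<And>x. distr P borel (\<lambda>\<omega>. \<xi> \<omega> x) = distr P borel (\<lambda>\<omega>. \<xi> \<omega> 0)"
    and sq: "integrable P (\<lambda>\<omega>. (\<xi> \<omega> 0)\<^sup>2)" and mean: "(\<integral>\<omega>. \<xi> \<omega> 0 \<partial>P) = 0"
  shows "\<exists>mu. shift_cov_rggm_tilt P \<xi> HS shift_site (hamA V) u mu"
proof -
  interpret P: prob_space P by fact
  have rv [measurable]: "(\<lambda>\<omega>. \<xi> \<omega> x) \<in> borel_measurable P" for x using ind by (simp add: P.indep_vars_def2)
  have X [measurable]: "\<xi> \<in> measurable P HS" by (rule measurable_HS_I) measurable
  have int_eq: "integrable P (\<lambda>\<omega>. g (\<xi> \<omega> x)) \<longleftrightarrow> integrable P (\<lambda>\<omega>. g (\<xi> \<omega> 0))"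
    and ex_eq: "(\<integral>\<omega>. g (\<xi> \<omega> x) \<partial>P) = (\<integral>\<omega>. g (\<xi> \<omega> 0) \<partial>P)" if [measurable]: "g \<in> borel_measurable borel" for g :: "real \<Rightarrow> real" and x
  proof -
    show "integrable P (\<lambda>\<omega>. g (\<xi> \<omega> x)) \<longleftrightarrow> integrable P (\<lambda>\<omega>. g (\<xi> \<omega> 0))"
      using integrable_distr_eq[OF rv[of x] that] integrable_distr_eq[OF rv[of 0] that] id[of x] by simp
    show "(\<integral>\<omega>. g (\<xi> \<omega> x) \<partial>P) = (\<integral>\<omega>. g (\<xi> \<omega> 0) \<partial>P)"
      using integral_distr[OF rv[of x] that] integral_distr[OF rv[of 0] that] id[of x] by simp
  qed
  have sqx: "integrable P (\<lambda>\<omega>. (\<xi> \<omega> x)\<^sup>2)" for x using int_eq[of "\<lambda>t. t\<^sup>2" x] sq by simp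
  have ix: "integrable P (\<lambda>\<omega>. \<xi> \<omega> x)" for x by (rule P.square_integrable_imp_integrable[OF rv sqx])
  define s2 where "s2 = (\<integral>\<omega>. (\<xi> \<omega> 0)\<^sup>2 \<partial>P)"
  define s1 where "s1 = (\<integral>\<omega>. \<bar>\<xi> \<omega> 0\<bar> \<partial>P)"
  have s0: "0 \<le> s2" "0 \<le> s1" by (auto simp: s1_def s2_def)
  \<comment> \<open>One constant for all moments: \<open>4 * s2\<close> for the currents, with the 4
    of \<open>flow_energy\<close>, then \<open>s1\<close> for the field and the rest for the lower
    bound of \<open>V\<close>.\<close>
  define E0 where "E0 = 4 * s2 + s1 + \<bar>B\<bar>"
  obtain S :: "'d set" where S: "card S = 3" using obtain_subset_with_card_n[OF d] by auto
  \<comment> \<open>The superposition of the flows out of all sites of \<Lambda>, each weighted by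
    its charge; the sign is that of \<open>flow_represents\<close>.\<close>
  define j where "j z \<Lambda> b = - (\<Sum>a\<in>\<Lambda>. z a * flow S (fst b - a) (snd b))" for z :: "'d site \<Rightarrow> real" and \<Lambda> b
  define Q where "Q = distr P HS \<xi>"
  have Qs [simp, measurable_cong]: "sets Q = sets HS" by (simp add: Q_def)
  have Qi: "integrable Q g \<longleftrightarrow> integrable P (\<lambda>\<omega>. g (\<xi> \<omega>))" and Qe: "(\<integral>z. g z \<partial>Q) = (\<integral>\<omega>. g (\<xi> \<omega>) \<partial>P)"
    if "g \<in> borel_measurable HS" for g :: "_ \<Rightarrow> real"
    unfolding Q_def using integrable_distr_eq[OF X that] integral_distr[OF X that] by auto
  have jm [measurable]: "(\<lambda>z. j z \<Lambda> b) \<in> borel_measurable HS" for \<Lambda> b unfolding j_def by measurable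
  \<comment> \<open>The current through a bond is a weighted sum of independent centred charges.
    Reflecting \<open>a\<close> to \<open>fst b - a\<close> turns the sum of the squared weights
    into a flow energy, bounded independently of \<Lambda>.\<close>
  have jP: "integrable P (\<lambda>\<omega>. (j (\<xi> \<omega>) \<Lambda> b)\<^sup>2) \<and> (\<integral>\<omega>. (j (\<xi> \<omega>) \<Lambda> b)\<^sup>2 \<partial>P) \<le> 4 * s2" if fin: "finite \<Lambda>" for \<Lambda> b
  proof -
    have jj: "(j (\<xi> \<omega>) \<Lambda> b)\<^sup>2 = (\<Sum>a\<in>\<Lambda>. flow S (fst b - a) (snd b) * \<xi> \<omega> a)\<^sup>2" for \<omega>
      by (simp add: j_def mult.commute)
    have m0: "(\<integral>\<omega>. \<xi> \<omega> x \<partial>P) = 0" for x using ex_eq[of "\<lambda>t. t" x] mean by simp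
    note es = P.expectation_square_sum[OF ind fin sqx m0, of "\<lambda>a. flow S (fst b - a) (snd b)"]
    have "(\<integral>\<omega>. (j (\<xi> \<omega>) \<Lambda> b)\<^sup>2 \<partial>P) = (\<Sum>a\<in>\<Lambda>. (flow S (fst b - a) (snd b))\<^sup>2 * s2)"
    proof -
      have "(\<integral>\<omega>. (\<xi> \<omega> a)\<^sup>2 \<partial>P) = s2" for a unfolding s2_def using ex_eq[of "\<lambda>t. t\<^sup>2" a] by simp
      then show ?thesis unfolding jj es(2) by simp
    qed
    also have "\<dots> = (\<Sum>y\<in>(\<lambda>a. fst b - a) ` \<Lambda>. (flow S y (snd b))\<^sup>2) * s2"
      by (subst sum.reindex) (auto simp: inj_on_def sum_distrib_right)
    also have "\<dots> \<le> 4 * s2" using fin s0 by (intro mult_right_mono flow_energy[OF S]) auto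
    finally show ?thesis using es(1) unfolding jj by simp
  qed
  have Qdist: "Q = PiM UNIV (\<lambda>_. distr P borel (\<lambda>\<omega>. \<xi> \<omega> 0))"
  proof -
    have "distr P borel (\<lambda>\<omega>. \<xi> \<omega> x) = distr P borel (\<lambda>\<omega>. \<xi> \<omega> y)" for x y using id[of x] id[of y] by simp
    from P.iid_distr_PiM[OF ind this, of 0] show ?thesis unfolding Q_def HS_def .
  qed
  interpret G: grad_model Q shift_site "\<lambda>_ _ _. V" "\<lambda>z. z" A "\<bar>V 0\<bar> + C2" E0 "\<lambda>_ _ _. B" j u
  proof (intro grad_model.intro grad_model_axioms.intro)
    show "prob_space Q" unfolding Q_def by (rule P.prob_space_distr) measurable
    show "space Q = UNIV" by (simp add: Q_def)
    show "potential (\<lambda>_ _. V) z A (\<lambda>_ _. B) (j z)" for z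
    proof
      fix \<Lambda> and f :: "'d site \<Rightarrow> real" assume fin: "finite \<Lambda>" and f: "\<And>x. x \<notin> \<Lambda> \<Longrightarrow> f x = 0"
      have "(\<Sum>a\<in>\<Lambda>. z a * f a) = (\<Sum>a\<in>\<Lambda>. z a * - (\<Sum>b\<in>bnd \<Lambda>. flow S (fst b - a) (snd b) * gd f b))"
        by (intro sum.cong refl arg_cong2[where f=times] flow_represents[OF S fin f])
      also have "\<dots> = (\<Sum>b\<in>bnd \<Lambda>. \<Sum>a\<in>\<Lambda>. - (z a * flow S (fst b - a) (snd b) * gd f b))"
        by (subst sum.swap) (simp add: sum_distrib_left sum_negf mult.assoc)
      also have "\<dots> = (\<Sum>b\<in>bnd \<Lambda>. j z \<Lambda> b * gd f b)"
        by (simp add: j_def sum_negf sum_distrib_right)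
      finally show "(\<Sum>a\<in>\<Lambda>. z a * f a) = (\<Sum>b\<in>bnd \<Lambda>. j z \<Lambda> b * gd f b)" .
    qed (use V A lo C2_fun_continuous in auto)
    show "V s \<le> (\<bar>V 0\<bar> + C2) * (1 + s\<^sup>2)" for s by (rule quadratic_upper_bound[OF V up C2])
    show "distr Q Q (shift_site v) = Q" for v :: "'d site"
    proof -
      have "distr Q Q (shift_site v) = distr Q HS (shift_site v)" by (rule distr_cong) auto
      also have "\<dots> = Q" unfolding Qdist HS_def shift_site_def[abs_def]
        by (rule PiM_iid_reindex) (auto intro!: P.prob_space_distr injI)
      finally show ?thesis .
    qed
    show "shift_site v (shift_site w z) = shift_site (v + w) z" for v w and z :: "'d site \<Rightarrow> real"
      by (auto simp: shift_site_def algebra_simps)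
    show "(\<lambda>(z, s). V s) \<in> borel_measurable (Q \<Otimes>\<^sub>M borel)"
      using borel_measurable_continuous_onI[OF C2_fun_continuous[OF V(1)]] by measurable
    show "integrable Q (\<lambda>z. z x)" "(\<integral>z. \<bar>z x\<bar> \<partial>Q) \<le> E0" for x
      using ix[of x] ex_eq[of abs x] s0 by (auto simp: Qi Qe E0_def s1_def)
    show "integrable Q (\<lambda>z. (j z \<Lambda> b)\<^sup>2)" "(\<integral>z. (j z \<Lambda> b)\<^sup>2 \<partial>Q) \<le> E0" if "finite \<Lambda>" for \<Lambda> b
      using jP[OF that, of b] s0 by (auto simp: Qi Qe E0_def)
    interpret Q: prob_space Q by fact
    show "(\<integral>z. \<bar>B\<bar> \<partial>Q) \<le> E0" "integrable Q (\<lambda>z. B)" using s0 Q.prob_space by (auto simp: E0_def)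
  qed (use C2 in \<open>auto simp: shift_site_def\<close>)
  from G.shift_covariant_ggm_exists obtain mu where mu: "mu \<in> measurable Q (prob_algebra GS)"
    "AE z in Q. is_ggm (hamf (\<lambda>_ _. V) z) (mu z)"
    "\<forall>v z F. F \<in> Cb \<longrightarrow> (\<integral>\<eta>. F \<eta> \<partial>(mu (shift_site v z))) = (\<integral>\<eta>. F (shift_grad v \<eta>) \<partial>(mu z))"
    "\<forall>x y. nn x y \<longrightarrow> (\<integral>z. (\<integral>\<eta>. \<eta> (x, y) \<partial>(mu z)) \<partial>Q) = tilt u x y"
    "\<forall>x y. nn x y \<longrightarrow> (\<integral>\<^sup>+z. (\<integral>\<^sup>+\<eta>. ennreal ((\<eta> (x, y))\<^sup>2) \<partial>(mu z)) \<partial>Q) < \<infinity>"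
    by blast
  show ?thesis
    by (rule exI[of _ mu], rule transfer_rggm[OF X mu(1,2)[unfolded Q_def] _ mu(3-5)[unfolded Q_def]])
      (simp add: hamA_eq)
qed

section \<open>Model B\<close>

abbreviation RS :: "(real \<Rightarrow> real) measure" where "RS \<equiv> PiM UNIV (\<lambda>_. borel)"

abbreviation DSB :: "('d::finite site \<Rightarrow> 'd \<Rightarrow> real \<Rightarrow> real) measure" where
  "DSB \<equiv> PiM UNIV (\<lambda>_. PiM UNIV (\<lambda>_. RS))"

text \<open>Rounding down to a dyadic grid: at each level only countably many points occur, so
  evaluating a potential there is jointly measurable in potential and argument.\<close>

definition dyad :: "real \<Rightarrow> nat \<Rightarrow> rat" where
  "dyad s n = of_int \<lfloor>2 ^ n * s\<rfloor> / 2 ^ n"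

lemma of_rat_dyad: "real_of_rat (dyad s n) = of_int \<lfloor>2 ^ n * s\<rfloor> / 2 ^ n"
  by (simp add: dyad_def of_rat_divide of_rat_power)

lemma dyad_tendsto: "(\<lambda>n. real_of_rat (dyad s n)) \<longlonglongrightarrow> s"
proof (rule tendsto_sandwich[of "\<lambda>n. s - (1/2) ^ n" _ _ "\<lambda>n. s"])
  have "s - (1/2) ^ n \<le> real_of_rat (dyad s n)" for n
  proof -
    have "2 ^ n * s - 1 \<le> of_int \<lfloor>2 ^ n * s\<rfloor>" by linarith
    then have "(2 ^ n * s - 1) / 2 ^ n \<le> of_int \<lfloor>2 ^ n * s\<rfloor> / 2 ^ n" by (intro divide_right_mono) auto
    then show ?thesis by (simp add: of_rat_dyad diff_divide_distrib power_one_over)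
  qed
  then show "\<forall>\<^sub>F n in sequentially. s - (1/2) ^ n \<le> real_of_rat (dyad s n)" by simp
  show "\<forall>\<^sub>F n in sequentially. real_of_rat (dyad s n) \<le> s" by (simp add: of_rat_dyad field_simps)
  have "(\<lambda>n. s - (1/2) ^ n) \<longlonglongrightarrow> s - 0" by (intro tendsto_diff tendsto_const LIMSEQ_power_zero) auto
  then show "(\<lambda>n. s - (1/2) ^ n) \<longlonglongrightarrow> s" by simp
qed simp

text \<open>The product \<open>\<sigma>\<close>-algebra on \<open>real \<Rightarrow> real\<close> only sees countably many values, so a potential is
  replaced by the continuous extension of its restriction to the rationals.\<close>

definition rat_unif_cont :: "(real \<Rightarrow> real) \<Rightarrow> bool" where
  "rat_unif_cont f \<longleftrightarrow> (\<forall>M k :: nat. \<exists>m :: nat. \<forall>p q :: rat. \<bar>p\<bar> \<le> of_nat M \<and> \<bar>q\<bar> \<le> of_nat M \<and> \<bar>p - q\<bar> < 1 / (of_nat m + 1)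
     \<longrightarrow> \<bar>f (of_rat p) - f (of_rat q)\<bar> \<le> 1 / (real k + 1))"

definition rat_ext :: "(real \<Rightarrow> real) \<Rightarrow> real \<Rightarrow> real" where
  "rat_ext f s = lim (\<lambda>n. f (of_rat (dyad s n)))"

lemma real_of_rat_less_inverse: "\<bar>p - q\<bar> < 1 / (of_nat m + 1) \<longleftrightarrow> \<bar>real_of_rat p - real_of_rat q\<bar> < 1 / (real m + 1)"
proof -
  have "\<bar>p - q\<bar> < 1 / (of_nat m + 1) \<longleftrightarrow> real_of_rat \<bar>p - q\<bar> < real_of_rat (1 / (of_nat m + 1))" by (simp only: of_rat_less)
  then show ?thesis by (simp add: of_rat_divide of_rat_add of_rat_diff[symmetric])
qed

lemma real_of_rat_abs_le_nat: "\<bar>p\<bar> \<le> of_nat M \<longleftrightarrow> \<bar>real_of_rat p\<bar> \<le> real M"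
proof -
  have "\<bar>p\<bar> \<le> of_nat M \<longleftrightarrow> real_of_rat \<bar>p\<bar> \<le> real_of_rat (of_nat M)" by (simp only: of_rat_less_eq)
  then show ?thesis by simp
qed

lemma rat_unif_contD:
  assumes "rat_unif_cont f" "e > 0"
  obtains d where "d > 0" "\<And>p q :: rat. \<bar>real_of_rat p\<bar> \<le> real M \<Longrightarrow> \<bar>real_of_rat q\<bar> \<le> real M \<Longrightarrow> \<bar>real_of_rat p - real_of_rat q\<bar> < d \<Longrightarrow>
     \<bar>f (of_rat p) - f (of_rat q)\<bar> \<le> e"
proof -
  obtain k :: nat where k: "1 / (real k + 1) < e" using assms(2) reals_Archimedean[of e] by (auto simp: inverse_eq_divide add.commute)
  obtain m :: nat where m: "\<And>p q :: rat. \<bar>p\<bar> \<le> of_nat M \<and> \<bar>q\<bar> \<le> of_nat M \<and> \<bar>p - q\<bar> < 1 / (of_nat m + 1)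
     \<Longrightarrow> \<bar>f (of_rat p) - f (of_rat q)\<bar> \<le> 1 / (real k + 1)" using assms(1) unfolding rat_unif_cont_def by meson
  show ?thesis
  proof (rule that[of "1 / (real m + 1)"])
    fix p q :: rat assume "\<bar>real_of_rat p\<bar> \<le> real M" "\<bar>real_of_rat q\<bar> \<le> real M" "\<bar>real_of_rat p - real_of_rat q\<bar> < 1 / (real m + 1)"
    then have "\<bar>f (of_rat p) - f (of_rat q)\<bar> \<le> 1 / (real k + 1)"
      by (intro m) (simp add: real_of_rat_abs_le_nat real_of_rat_less_inverse)
    then show "\<bar>f (of_rat p) - f (of_rat q)\<bar> \<le> e" using k by linarith
  qed (simp add: add_nonneg_pos)
qed

lemma continuous_rat_unif_cont:
  assumes "continuous_on UNIV f" shows "rat_unif_cont f"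
  unfolding rat_unif_cont_def
proof (intro allI)
  fix M k :: nat
  have "uniformly_continuous_on {- real M..real M} f"
    using assms by (intro compact_uniformly_continuous) (auto intro: continuous_on_subset)
  then obtain d where d: "d > 0" "\<And>x y. x \<in> {- real M..real M} \<Longrightarrow> y \<in> {- real M..real M} \<Longrightarrow> dist y x < d \<Longrightarrow> dist (f y) (f x) < 1 / (real k + 1)"
    unfolding uniformly_continuous_on_def by (metis add_nonneg_pos of_nat_0_le_iff zero_less_divide_1_iff zero_less_one)
  obtain m :: nat where m: "1 / (real m + 1) < d" using d(1) reals_Archimedean[of d] by (auto simp: inverse_eq_divide add.commute)
  show "\<exists>m :: nat. \<forall>p q :: rat. \<bar>p\<bar> \<le> of_nat M \<and> \<bar>q\<bar> \<le> of_nat M \<and> \<bar>p - q\<bar> < 1 / (of_nat m + 1)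
     \<longrightarrow> \<bar>f (of_rat p) - f (of_rat q)\<bar> \<le> 1 / (real k + 1)"
  proof (intro exI[of _ m] allI impI)
    fix p q :: rat assume h: "\<bar>p\<bar> \<le> of_nat M \<and> \<bar>q\<bar> \<le> of_nat M \<and> \<bar>p - q\<bar> < 1 / (of_nat m + 1)"
    then have "\<bar>real_of_rat p\<bar> \<le> real M" "\<bar>real_of_rat q\<bar> \<le> real M" "\<bar>real_of_rat p - real_of_rat q\<bar> < 1 / (real m + 1)"
      unfolding real_of_rat_abs_le_nat real_of_rat_less_inverse by blast+
    then have "dist (f (of_rat p)) (f (of_rat q)) < 1 / (real k + 1)"
      using m by (intro d(2)) (auto simp del: abs_of_rat simp: dist_real_def abs_le_iff)
    then show "\<bar>f (of_rat p) - f (of_rat q)\<bar> \<le> 1 / (real k + 1)" by (simp add: dist_real_def)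
  qed
qed

text \<open>Two rational sequences with the same limit eventually lie close together in one bounded
  interval, so uniform continuity there makes their values merge. Applied to the dyadic sequence
  twice, this is the Cauchy property.\<close>

lemma rat_ext_tendsto:
  assumes u: "rat_unif_cont f" and p: "(\<lambda>n. real_of_rat (p n)) \<longlonglongrightarrow> s"
  shows "(\<lambda>n. f (of_rat (p n))) \<longlonglongrightarrow> rat_ext f s"
proof -
  have cl: "\<exists>N. \<forall>n\<ge>N. \<forall>k\<ge>N. \<bar>f (of_rat (p n)) - f (of_rat (r k))\<bar> \<le> e"
    if e: "e > 0" and p: "(\<lambda>n. real_of_rat (p n)) \<longlonglongrightarrow> s" and r: "(\<lambda>n. real_of_rat (r n)) \<longlonglongrightarrow> s" for e p r
  proof -
    obtain M :: nat where M: "\<bar>s\<bar> + 1 \<le> real M" using real_arch_simple by blast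
    obtain d where d: "d > 0" "\<And>p q :: rat. \<bar>real_of_rat p\<bar> \<le> real M \<Longrightarrow> \<bar>real_of_rat q\<bar> \<le> real M \<Longrightarrow> \<bar>real_of_rat p - real_of_rat q\<bar> < d \<Longrightarrow>
     \<bar>f (of_rat p) - f (of_rat q)\<bar> \<le> e" using rat_unif_contD[OF u e, of M] by metis
    define d' where "d' = min 1 (d/2)"
    have d': "d' > 0" using d(1) by (simp add: d'_def)
    obtain N1 where N1: "\<And>n. n \<ge> N1 \<Longrightarrow> \<bar>real_of_rat (p n) - s\<bar> < d'" using LIMSEQ_D[OF p d'] by auto
    obtain N2 where N2: "\<And>n. n \<ge> N2 \<Longrightarrow> \<bar>real_of_rat (r n) - s\<bar> < d'" using LIMSEQ_D[OF r d'] by auto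
    have "\<bar>f (of_rat (p n)) - f (of_rat (r k))\<bar> \<le> e" if "n \<ge> max N1 N2" "k \<ge> max N1 N2" for n k
    proof (rule d(2))
      have a: "\<bar>real_of_rat (p n) - s\<bar> < d'" "\<bar>real_of_rat (r k) - s\<bar> < d'" using N1[of n] N2[of k] that by auto
      have b: "d' \<le> 1" "d' \<le> d/2" by (auto simp: d'_def)
      show "\<bar>real_of_rat (p n)\<bar> \<le> real M" "\<bar>real_of_rat (r k)\<bar> \<le> real M" using a b M by linarith+
      show "\<bar>real_of_rat (p n) - real_of_rat (r k)\<bar> < d" using a b by linarith
    qed
    then show ?thesis by blast
  qed
  have "Cauchy (\<lambda>n. f (of_rat (dyad s n)))"
  proof (rule CauchyI)
    fix e :: real assume "e > 0"
    then obtain N where "\<forall>n\<ge>N. \<forall>k\<ge>N. \<bar>f (of_rat (dyad s n)) - f (of_rat (dyad s k))\<bar> \<le> e/2"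
      using cl[OF _ dyad_tendsto dyad_tendsto, of "e/2"] by auto
    then show "\<exists>M. \<forall>m\<ge>M. \<forall>n\<ge>M. norm (f (of_rat (dyad s m)) - f (of_rat (dyad s n))) < e"
      using \<open>e > 0\<close> by (intro exI[of _ N]) fastforce
  qed
  then have c: "(\<lambda>n. f (of_rat (dyad s n))) \<longlonglongrightarrow> rat_ext f s"
    unfolding rat_ext_def using Cauchy_convergent convergent_LIMSEQ_iff by blast
  have "(\<lambda>n. f (of_rat (p n)) - f (of_rat (dyad s n))) \<longlonglongrightarrow> 0"
  proof (rule LIMSEQ_I)
    fix e :: real assume "e > 0"
    then obtain N where "\<forall>n\<ge>N. \<forall>k\<ge>N. \<bar>f (of_rat (p n)) - f (of_rat (dyad s k))\<bar> \<le> e/2"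
      using cl[OF _ p dyad_tendsto, of "e/2"] by auto
    then show "\<exists>no. \<forall>n\<ge>no. norm (f (of_rat (p n)) - f (of_rat (dyad s n)) - 0) < e"
      using \<open>e > 0\<close> by (intro exI[of _ N]) fastforce
  qed
  from tendsto_add[OF this c] show ?thesis by simp
qed

lemma rat_ext_continuous:
  assumes u: "rat_unif_cont f" shows "continuous_on UNIV (rat_ext f)"
  unfolding continuous_on_eq_continuous_at[OF open_UNIV]
proof
  fix s :: real
  show "isCont (rat_ext f) s" unfolding continuous_at_eps_delta
  proof (intro allI impI)
    fix e :: real assume e: "e > 0"
    obtain M :: nat where M: "\<bar>s\<bar> + 2 \<le> real M" using real_arch_simple by blast
    obtain d where d: "d > 0" "\<And>p q :: rat. \<bar>real_of_rat p\<bar> \<le> real M \<Longrightarrow> \<bar>real_of_rat q\<bar> \<le> real M \<Longrightarrow> \<bar>real_of_rat p - real_of_rat q\<bar> < d \<Longrightarrow>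
     \<bar>f (of_rat p) - f (of_rat q)\<bar> \<le> e/2" using rat_unif_contD[OF u, of "e/2" M] e by auto
    have "dist (rat_ext f t) (rat_ext f s) < e" if t: "dist t s < min 1 d" for t
    proof -
      have ts: "\<bar>t - s\<bar> < 1" "\<bar>t - s\<bar> < d" using t by (auto simp: dist_real_def)
      have l1: "(\<lambda>n. \<bar>f (of_rat (dyad t n)) - f (of_rat (dyad s n))\<bar>) \<longlonglongrightarrow> \<bar>rat_ext f t - rat_ext f s\<bar>"
        by (intro tendsto_intros rat_ext_tendsto u dyad_tendsto)
      have "(\<lambda>n. \<bar>real_of_rat (dyad t n) - real_of_rat (dyad s n)\<bar>) \<longlonglongrightarrow> \<bar>t - s\<bar>"
        by (intro tendsto_intros dyad_tendsto)
      then have e1: "\<forall>\<^sub>F n in sequentially. \<bar>real_of_rat (dyad t n) - real_of_rat (dyad s n)\<bar> < d" using ts by (intro order_tendstoD) auto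
      have e2: "\<forall>\<^sub>F n in sequentially. \<bar>real_of_rat (dyad t n)\<bar> < real M"
        using ts M by (intro order_tendstoD(2)[OF tendsto_rabs[OF dyad_tendsto]]) linarith
      have e3: "\<forall>\<^sub>F n in sequentially. \<bar>real_of_rat (dyad s n)\<bar> < real M"
        using M by (intro order_tendstoD(2)[OF tendsto_rabs[OF dyad_tendsto]]) linarith
      have "\<forall>\<^sub>F n in sequentially. \<bar>f (of_rat (dyad t n)) - f (of_rat (dyad s n))\<bar> \<le> e/2"
        using e1 e2 e3 by eventually_elim (intro d(2), auto)
      then have "\<bar>rat_ext f t - rat_ext f s\<bar> \<le> e/2" using l1 by (intro tendsto_upperbound[OF l1]) auto
      then show ?thesis using e by (simp add: dist_real_def)
    qed
    then show "\<exists>d>0. \<forall>t. dist t s < d \<longrightarrow> dist (rat_ext f t) (rat_ext f s) < e"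
      using d(1) by (intro exI[of _ "min 1 d"]) auto
  qed
qed

lemma rat_ext_eq: "continuous_on UNIV f \<Longrightarrow> rat_ext f = f"
proof
  fix s assume c: "continuous_on UNIV f"
  have "(\<lambda>n. f (of_rat (dyad s n))) \<longlonglongrightarrow> f s"
    using c dyad_tendsto[of s] by (intro isCont_tendsto_compose[of s f]) (auto simp: continuous_on_eq_continuous_at)
  then show "rat_ext f s = f s" using rat_ext_tendsto[OF continuous_rat_unif_cont[OF c] dyad_tendsto] LIMSEQ_unique by blast
qed

text \<open>Quantifiers range over rationals and natural numbers, which keeps the condition
  measurable. The lower bound is some integer, because the random bound \<open>Bb\<close> of model B
  need not be a function of the potential.\<close>

definition admissible :: "real \<Rightarrow> real \<Rightarrow> (real \<Rightarrow> real) \<Rightarrow> bool" where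
  "admissible A C2 f \<longleftrightarrow> rat_unif_cont f \<and> (\<forall>q::rat. f (of_rat (- q)) = f (of_rat q))
    \<and> (\<exists>k::nat. \<forall>q::rat. A * (of_rat q)\<^sup>2 - real k \<le> f (of_rat q)) \<and> (\<forall>q::rat. f (of_rat q) \<le> C2 * (of_rat q)\<^sup>2)"

text \<open>The default \<open>A * s\<^sup>2\<close> makes the assumptions of
  \<open>potential\<close> true for every disorder, not merely for almost every one.\<close>

definition regularise :: "real \<Rightarrow> real \<Rightarrow> (real \<Rightarrow> real) \<Rightarrow> real \<Rightarrow> real" where
  "regularise A C2 f s = (if admissible A C2 f then rat_ext f s else A * s\<^sup>2)"

text \<open>The least integer that works is a function of the potential alone, hence measurable and
  stationary with it, and it is dominated by the integrable bound of the model.\<close>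

definition lower_shift :: "real \<Rightarrow> real \<Rightarrow> (real \<Rightarrow> real) \<Rightarrow> nat" where
  "lower_shift A C2 f = (if admissible A C2 f then LEAST k. \<forall>q::rat. A * (of_rat q)\<^sup>2 - real k \<le> f (of_rat q) else 0)"

lemma regularise_continuous: "continuous_on UNIV (regularise A C2 f)"
proof (cases "admissible A C2 f")
  case True
  then have "regularise A C2 f = rat_ext f" by (auto simp: regularise_def)
  then show ?thesis using rat_ext_continuous True by (simp add: admissible_def)
qed (auto simp: regularise_def[abs_def] intro!: continuous_intros)

lemma regularise_even: "regularise A C2 f (- s) = regularise A C2 f s"
proof (cases "admissible A C2 f")
  case True
  then have u: "rat_unif_cont f" and ev: "\<And>q::rat. f (of_rat (- q)) = f (of_rat q)" by (auto simp: admissible_def)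
  have "(\<lambda>n. real_of_rat (- dyad (- s) n)) \<longlonglongrightarrow> s"
    using tendsto_minus[OF dyad_tendsto[of "- s"]] by (simp add: of_rat_minus)
  from rat_ext_tendsto[OF u this] have "(\<lambda>n. f (of_rat (dyad (- s) n))) \<longlonglongrightarrow> rat_ext f s" unfolding ev .
  then have "rat_ext f s = rat_ext f (- s)" using rat_ext_tendsto[OF u dyad_tendsto] LIMSEQ_unique by blast
  then show ?thesis using True by (simp add: regularise_def)
qed (simp add: regularise_def)

lemma regularise_lower: "A * s\<^sup>2 - real (lower_shift A C2 f) \<le> regularise A C2 f s"
proof (cases "admissible A C2 f")
  case True
  then have u: "rat_unif_cont f" and ex: "\<exists>k::nat. \<forall>q::rat. A * (of_rat q)\<^sup>2 - real k \<le> f (of_rat q)" by (auto simp: admissible_def)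
  have lo: "A * (of_rat q)\<^sup>2 - real (lower_shift A C2 f) \<le> f (of_rat q)" for q :: rat
    using LeastI_ex[OF ex] True by (auto simp: lower_shift_def)
  have "(\<lambda>n. A * (real_of_rat (dyad s n))\<^sup>2 - real (lower_shift A C2 f)) \<longlonglongrightarrow> A * s\<^sup>2 - real (lower_shift A C2 f)"
    by (intro tendsto_intros dyad_tendsto)
  then have "A * s\<^sup>2 - real (lower_shift A C2 f) \<le> rat_ext f s" using rat_ext_tendsto[OF u dyad_tendsto[of s]] lo by (intro LIMSEQ_le) auto
  then show ?thesis using True by (simp add: regularise_def)
qed (simp add: regularise_def lower_shift_def)

text \<open>\<open>C2\<close> serves the admissible potentials and \<open>A\<close> the default one;
  the sum covers both.\<close>

lemma regularise_upper: assumes "A > 0" "C2 > 0" shows "regularise A C2 f s \<le> (A + C2) * (1 + s\<^sup>2)"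
proof -
  have "regularise A C2 f s \<le> (A + C2) * s\<^sup>2"
  proof (cases "admissible A C2 f")
    case True
    then have u: "rat_unif_cont f" and up: "\<And>q::rat. f (of_rat q) \<le> C2 * (of_rat q)\<^sup>2" by (auto simp: admissible_def)
    have "(\<lambda>n. C2 * (real_of_rat (dyad s n))\<^sup>2) \<longlonglongrightarrow> C2 * s\<^sup>2" by (intro tendsto_intros dyad_tendsto)
    then have "rat_ext f s \<le> C2 * s\<^sup>2" using rat_ext_tendsto[OF u dyad_tendsto[of s]] up by (intro LIMSEQ_le) auto
    also have "\<dots> \<le> (A + C2) * s\<^sup>2" using assms by (intro mult_right_mono) auto
    finally show ?thesis using True by (simp add: regularise_def)
  qed (use assms in \<open>auto simp: regularise_def intro!: mult_right_mono\<close>)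
  then show ?thesis using assms by (simp add: algebra_simps)
qed

text \<open>The additive 1 is lost in rounding \<open>\<bar>B\<bar>\<close> up to a natural
  number.\<close>

lemma admissible_intro:
  assumes c: "continuous_on UNIV f" and ev: "\<And>s. f (- s) = f s" and b: "\<And>s. A * s\<^sup>2 - B \<le> f s" "\<And>s. f s \<le> C2 * s\<^sup>2"
  shows "admissible A C2 f" "regularise A C2 f = f" "real (lower_shift A C2 f) \<le> \<bar>B\<bar> + 1"
proof -
  define k where "k = nat \<lceil>\<bar>B\<bar>\<rceil>"
  have k: "\<bar>B\<bar> \<le> real k" "real k \<le> \<bar>B\<bar> + 1" unfolding k_def by linarith+
  have kk: "\<forall>q::rat. A * (of_rat q)\<^sup>2 - real k \<le> f (of_rat q)"
  proof
    fix q :: rat show "A * (of_rat q)\<^sup>2 - real k \<le> f (of_rat q)" using b(1)[of "of_rat q"] k by linarith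
  qed
  show n: "admissible A C2 f" unfolding admissible_def using continuous_rat_unif_cont[OF c] ev b(2) kk by (auto simp: of_rat_minus)
  show "regularise A C2 f = f" using n rat_ext_eq[OF c] by (auto simp: regularise_def)
  have "lower_shift A C2 f \<le> k" using n kk by (auto simp: lower_shift_def intro: Least_le)
  then show "real (lower_shift A C2 f) \<le> \<bar>B\<bar> + 1" using k by linarith
qed

lemma RS_component [measurable]: "(\<lambda>f. f s) \<in> borel_measurable RS"
  by (rule measurable_component_singleton) simp

lemma admissible_measurable [measurable]: "Measurable.pred RS (admissible A C2)"
proof -
  have "Measurable.pred RS (\<lambda>f. rat_unif_cont f \<and> (\<forall>q::rat. f (of_rat (- q)) = f (of_rat q))
    \<and> (\<exists>k::nat. \<forall>q::rat. A * (of_rat q)\<^sup>2 - real k \<le> f (of_rat q)) \<and> (\<forall>q::rat. f (of_rat q) \<le> C2 * (of_rat q)\<^sup>2))"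
  proof (intro pred_intros_logic(3))
    show "Measurable.pred RS rat_unif_cont" unfolding rat_unif_cont_def[abs_def] by measurable
    show "Measurable.pred RS (\<lambda>f. \<forall>q::rat. f (of_rat (- q)) = f (of_rat q))"
      by (intro pred_intros_countable(1) borel_measurable_pred_eq) measurable
  qed measurable
  then show ?thesis by (simp add: admissible_def[abs_def])
qed

lemma lower_shift_measurable: "(\<lambda>f. real (lower_shift A C2 f)) \<in> borel_measurable RS"
proof -
  have "(\<lambda>f. LEAST k::nat. \<forall>q::rat. A * (of_rat q)\<^sup>2 - real k \<le> f (of_rat q)) \<in> measurable RS (count_space UNIV)"
    by (intro measurable_Least) measurable
  then have "lower_shift A C2 \<in> measurable RS (count_space UNIV)"
    unfolding lower_shift_def[abs_def] by measurable
  then show ?thesis by measurable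
qed

text \<open>At each dyadic level the evaluation point is one of countably many rationals, where
  evaluation is a coordinate map; limits keep joint measurability.\<close>

lemma regularise_measurable: "(\<lambda>(f, s). regularise A C2 f s) \<in> borel_measurable (RS \<Otimes>\<^sub>M borel)"
proof -
  have "(\<lambda>p. fst p (of_rat (dyad (snd p) n))) \<in> borel_measurable (RS \<Otimes>\<^sub>M borel)" for n
    unfolding dyad_def
    by (rule measurable_compose_countable[where f="\<lambda>k p. fst p (real_of_rat (of_int k / 2 ^ n))" and g="\<lambda>p. \<lfloor>2 ^ n * snd p\<rfloor>"])
      (rule measurable_compose[OF measurable_fst RS_component], measurable)
  then have [measurable]: "(\<lambda>p. rat_ext (fst p) (snd p)) \<in> borel_measurable (RS \<Otimes>\<^sub>M borel)"
    unfolding rat_ext_def by (intro borel_measurable_lim_metric)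
  have [measurable]: "Measurable.pred (RS \<Otimes>\<^sub>M borel) (\<lambda>p. admissible A C2 (fst p))"
    by (rule measurable_compose[OF measurable_fst admissible_measurable])
  show ?thesis unfolding regularise_def case_prod_beta' by measurable
qed

lemma DSB_component [measurable]: "(\<lambda>z. z x i) \<in> measurable (DSB :: ('d::finite site \<Rightarrow> 'd \<Rightarrow> real \<Rightarrow> real) measure) RS"
proof -
  have "(\<lambda>z. z x) \<in> measurable (DSB :: ('d site \<Rightarrow> 'd \<Rightarrow> real \<Rightarrow> real) measure) (PiM UNIV (\<lambda>_. RS))"
    by (rule measurable_component_singleton) simp
  moreover have "(\<lambda>g. g i) \<in> measurable (PiM UNIV (\<lambda>_::'d. RS)) RS" by (rule measurable_component_singleton) simp
  ultimately show ?thesis by (rule measurable_compose)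
qed

lemma measurable_DSB_I:
  assumes "\<And>x i. (\<lambda>a. f a x i) \<in> measurable M RS"
  shows "f \<in> measurable M (DSB :: ('d::finite site \<Rightarrow> 'd \<Rightarrow> real \<Rightarrow> real) measure)"
  by (intro measurable_PiM_single' assms) (auto simp: space_PiM)

lemma model_B:
  fixes u :: "real ^ 'd::finite" and P :: "'p measure" and W :: "'p \<Rightarrow> 'd site \<Rightarrow> 'd \<Rightarrow> real \<Rightarrow> real"
  assumes P: "prob_space P"
    and ind: "prob_space.indep_vars P (\<lambda>_. RS) (\<lambda>(x, i) \<omega>. W \<omega> x i) UNIV"
    and id: "\<And>x i y j. distr P RS (\<lambda>\<omega>. W \<omega> x i) = distr P RS (\<lambda>\<omega>. W \<omega> y j)"
    and W: "\<And>\<omega> x i. C2_fun (W \<omega> x i)" "\<And>\<omega> x i s. W \<omega> x i (- s) = W \<omega> x i s"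
    and Bid: "\<And>x i y j. distr P borel (\<lambda>\<omega>. Bb \<omega> x i) = distr P borel (\<lambda>\<omega>. Bb \<omega> y j)"
    and Bi: "\<And>x i. integrable P (\<lambda>\<omega>. Bb \<omega> x i)" and A: "A > 0" and C2: "C2 > 0"
    and bd: "AE \<omega> in P. \<forall>x i s. A * s\<^sup>2 - Bb \<omega> x i \<le> W \<omega> x i s \<and> W \<omega> x i s \<le> C2 * s\<^sup>2"
  shows "\<exists>mu. shift_cov_rggm_tilt P W DSB shift_site hamB u mu"
proof -
  interpret P: prob_space P by fact
  have rv [measurable]: "(\<lambda>\<omega>. W \<omega> x i) \<in> measurable P RS" for x i
    using ind unfolding P.indep_vars_def2 by (auto dest: bspec[of _ _ "(x, i)"])
  have X [measurable]: "W \<in> measurable P DSB" by (rule measurable_DSB_I) (rule rv)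
  define Q where "Q = distr P DSB W"
  have Qs [simp, measurable_cong]: "sets Q = sets (DSB :: ('d site \<Rightarrow> 'd \<Rightarrow> real \<Rightarrow> real) measure)" by (simp add: Q_def)
  have Qi: "integrable Q g \<longleftrightarrow> integrable P (\<lambda>\<omega>. g (W \<omega>))" and Qe: "(\<integral>z. g z \<partial>Q) = (\<integral>\<omega>. g (W \<omega>) \<partial>P)"
    if "g \<in> borel_measurable DSB" for g :: "_ \<Rightarrow> real"
    unfolding Q_def using integrable_distr_eq[OF X that] integral_distr[OF X that] by auto
  fix i0 :: 'd
  \<comment> \<open>The 1 pays for the rounding in \<open>lower_shift\<close>.\<close>
  define E0 where "E0 = (\<integral>\<omega>. \<bar>Bb \<omega> 0 i0\<bar> \<partial>P) + 1"
  have E0: "0 \<le> E0" by (simp add: E0_def)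
  have EB: "(\<integral>\<omega>. \<bar>Bb \<omega> x i\<bar> \<partial>P) + 1 = E0" for x i
    using integral_distr[of "\<lambda>\<omega>. Bb \<omega> x i" P borel abs] integral_distr[of "\<lambda>\<omega>. Bb \<omega> 0 i0" P borel abs] Bid[of x i 0 i0] Bi
    by (simp add: E0_def borel_measurable_integrable)
  \<comment> \<open>Almost surely the regularisation changes nothing, so the regularised model has
    the original Hamiltonian.\<close>
  have low: "AE \<omega> in P. \<forall>x i. regularise A C2 (W \<omega> x i) = W \<omega> x i \<and> real (lower_shift A C2 (W \<omega> x i)) \<le> \<bar>Bb \<omega> x i\<bar> + 1"
    using bd
  proof eventually_elim
    fix \<omega> assume "\<forall>x i s. A * s\<^sup>2 - Bb \<omega> x i \<le> W \<omega> x i s \<and> W \<omega> x i s \<le> C2 * s\<^sup>2"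
    then show "\<forall>x i. regularise A C2 (W \<omega> x i) = W \<omega> x i \<and> real (lower_shift A C2 (W \<omega> x i)) \<le> \<bar>Bb \<omega> x i\<bar> + 1"
      using admissible_intro(2,3)[OF C2_fun_continuous[OF W(1)] W(2)] by blast
  qed
  have lm [measurable]: "(\<lambda>z. real (lower_shift A C2 (z x i))) \<in> borel_measurable (DSB :: ('d site \<Rightarrow> 'd \<Rightarrow> real \<Rightarrow> real) measure)" for x i
    by (rule measurable_compose[OF DSB_component lower_shift_measurable])
  have li: "integrable P (\<lambda>\<omega>. real (lower_shift A C2 (W \<omega> x i)))" for x i
  proof (rule Bochner_Integration.integrable_bound[of _ "\<lambda>\<omega>. \<bar>Bb \<omega> x i\<bar> + 1"])
    show "(\<lambda>\<omega>. real (lower_shift A C2 (W \<omega> x i))) \<in> borel_measurable P" using measurable_compose[OF X lm] .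
    show "AE \<omega> in P. norm (real (lower_shift A C2 (W \<omega> x i))) \<le> norm (\<bar>Bb \<omega> x i\<bar> + 1)"
      using low by eventually_elim simp
  qed (use Bi in auto)
  have le: "(\<integral>\<omega>. real (lower_shift A C2 (W \<omega> x i)) \<partial>P) \<le> E0" for x i
  proof -
    have "(\<integral>\<omega>. real (lower_shift A C2 (W \<omega> x i)) \<partial>P) \<le> (\<integral>\<omega>. \<bar>Bb \<omega> x i\<bar> + 1 \<partial>P)"
      using low li Bi by (intro integral_mono_AE) auto
    also have "\<dots> = E0" using Bi[of x i] EB[of x i] by (simp add: P.prob_space)
    finally show ?thesis .
  qed
  have stat: "distr Q DSB (shift_site v) = Q" for v :: "'d site"
  proof -
    \<comment> \<open>Bonds become a single index set of pairs: there the field is i.i.d. and a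
      lattice shift is an injective relabelling. The map \<open>cu\<close> carries this to the
      curried field.\<close>
    define L where "L = distr P (PiM UNIV (\<lambda>_::'d site \<times> 'd. RS)) (\<lambda>\<omega> p. (case p of (x, i) \<Rightarrow> \<lambda>\<omega>. W \<omega> x i) \<omega>)"
    define Dd where "Dd = distr P RS (\<lambda>\<omega>. W \<omega> 0 i0)"
    have "distr P RS (case p of (x, i) \<Rightarrow> \<lambda>\<omega>. W \<omega> x i) = distr P RS (case q of (x, i) \<Rightarrow> \<lambda>\<omega>. W \<omega> x i)" for p q :: "'d site \<times> 'd"
      using id by (simp add: case_prod_beta')
    from P.iid_distr_PiM[OF ind this, of "(0, i0)"] have L: "L = PiM UNIV (\<lambda>_. Dd)" by (simp add: L_def Dd_def)
    define cu where "cu g x i = g (x, i)" for g :: "'d site \<times> 'd \<Rightarrow> real \<Rightarrow> real" and x i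
    have cum [measurable]: "cu \<in> measurable (PiM UNIV (\<lambda>_. RS)) DSB"
      unfolding cu_def by (intro measurable_DSB_I measurable_component_singleton) simp
    have Lm [measurable]: "(\<lambda>\<omega> p. (case p of (x, i) \<Rightarrow> \<lambda>\<omega>. W \<omega> x i) \<omega>) \<in> measurable P (PiM UNIV (\<lambda>_::'d site \<times> 'd. RS))"
      by (rule measurable_PiM_single') (auto simp: space_PiM case_prod_beta')
    have "cu \<circ> (\<lambda>\<omega> p. (case p of (x, i) \<Rightarrow> \<lambda>\<omega>. W \<omega> x i) \<omega>) = W" by (auto simp: fun_eq_iff cu_def)
    then have QL: "Q = distr L DSB cu" unfolding L_def Q_def distr_distr[OF cum Lm] by simp
    define s where "s g p = g (fst p - v, snd p)" for g :: "'d site \<times> 'd \<Rightarrow> real \<Rightarrow> real" and p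
    have sm [measurable]: "s \<in> measurable (PiM UNIV (\<lambda>_. RS)) (PiM UNIV (\<lambda>_. RS))"
      unfolding s_def by (rule measurable_PiM_single') (auto simp: space_PiM intro!: measurable_component_singleton)
    have sL: "distr L (PiM UNIV (\<lambda>_. RS)) s = L"
      unfolding L s_def[abs_def]
      by (rule PiM_iid_reindex) (auto simp: Dd_def inj_on_def intro!: P.prob_space_distr)
    have Ls [measurable_cong]: "sets L = sets (PiM UNIV (\<lambda>_. RS))" by (simp add: L_def)
    have shm: "shift_site v \<in> measurable (DSB :: ('d site \<Rightarrow> 'd \<Rightarrow> real \<Rightarrow> real) measure) DSB"
      unfolding shift_site_def by (rule measurable_DSB_I) measurable
    have "distr Q DSB (shift_site v) = distr L DSB (shift_site v \<circ> cu)"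
      unfolding QL by (rule distr_distr[OF shm]) measurable
    also have "shift_site v \<circ> cu = cu \<circ> s" by (auto simp: shift_site_def cu_def s_def fun_eq_iff)
    also have "distr L DSB (cu \<circ> s) = distr (distr L (PiM UNIV (\<lambda>_. RS)) s) DSB cu"
      by (rule distr_distr[symmetric]) measurable
    finally show ?thesis unfolding sL QL .
  qed
  have shm: "shift_site v \<in> measurable (DSB :: ('d site \<Rightarrow> 'd \<Rightarrow> real \<Rightarrow> real) measure) DSB" for v
    unfolding shift_site_def by (rule measurable_DSB_I) measurable
  interpret Q: prob_space Q unfolding Q_def by (rule P.prob_space_distr) measurable
  interpret G: grad_model Q shift_site "\<lambda>z x i. regularise A C2 (z x i)" "\<lambda>_ _. 0" A "A + C2" E0 "\<lambda>z x i. real (lower_shift A C2 (z x i))" "\<lambda>_ _ _. 0" u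
  proof (intro grad_model.intro grad_model_axioms.intro)
    show "prob_space Q" by (rule Q.prob_space_axioms)
    show "space Q = UNIV" by (simp add: Q_def space_PiM)
    show "potential (\<lambda>x i. regularise A C2 (z x i)) (\<lambda>_. 0) A (\<lambda>x i. real (lower_shift A C2 (z x i))) (\<lambda>_ _. 0)" for z
      by standard (auto simp: regularise_continuous regularise_even regularise_lower A)
    show "regularise A C2 (z x i) s \<le> (A + C2) * (1 + s\<^sup>2)" for z x i s by (rule regularise_upper[OF A C2])
    show "distr Q Q (shift_site v) = Q" for v :: "'d site"
      using stat[of v] by (metis distr_cong Qs)
    show "shift_site v (shift_site w z) = shift_site (v + w) z" for v w and z :: "'d site \<Rightarrow> 'd \<Rightarrow> real \<Rightarrow> real"
      by (auto simp: shift_site_def algebra_simps)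
    show "(\<lambda>(z, s). regularise A C2 (z x i) s) \<in> borel_measurable (Q \<Otimes>\<^sub>M borel)" for x i
    proof -
      have "(\<lambda>p. (fst p x i, snd p)) \<in> measurable (Q \<Otimes>\<^sub>M borel) (RS \<Otimes>\<^sub>M borel)"
        by (rule measurable_Pair) measurable
      from measurable_compose[OF this regularise_measurable] show ?thesis by (simp add: case_prod_beta')
    qed
    show "integrable Q (\<lambda>z. real (lower_shift A C2 (z x i)))" "(\<integral>z. \<bar>real (lower_shift A C2 (z x i))\<bar> \<partial>Q) \<le> E0" for x i
      using li[of x i] le[of x i] by (simp_all add: Qi Qe)
    show "shift_site v \<in> measurable Q Q" for v :: "'d site"
      using shm[of v] by (simp add: measurable_cong_sets[OF Qs Qs])
  qed (use A C2 E0 in \<open>auto simp: shift_site_def\<close>)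
  from G.shift_covariant_ggm_exists obtain mu where mu: "mu \<in> measurable Q (prob_algebra GS)"
    "AE z in Q. is_ggm (hamf (\<lambda>x i. regularise A C2 (z x i)) (\<lambda>_. 0)) (mu z)"
    "\<forall>v z F. F \<in> Cb \<longrightarrow> (\<integral>\<eta>. F \<eta> \<partial>(mu (shift_site v z))) = (\<integral>\<eta>. F (shift_grad v \<eta>) \<partial>(mu z))"
    "\<forall>x y. nn x y \<longrightarrow> (\<integral>z. (\<integral>\<eta>. \<eta> (x, y) \<partial>(mu z)) \<partial>Q) = tilt u x y"
    "\<forall>x y. nn x y \<longrightarrow> (\<integral>\<^sup>+z. (\<integral>\<^sup>+\<eta>. ennreal ((\<eta> (x, y))\<^sup>2) \<partial>(mu z)) \<partial>Q) < \<infinity>"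
    by blast
  have H: "AE \<omega> in P. hamB (W \<omega>) = hamf (\<lambda>x i. regularise A C2 (W \<omega> x i)) (\<lambda>_. 0)"
    using low by eventually_elim (simp add: hamB_eq)
  show ?thesis
    by (rule exI[of _ mu], rule transfer_rggm[OF X mu(1,2)[unfolded Q_def] H mu(3-5)[unfolded Q_def]])
qed

theorem theorem1p1:
  fixes u :: "real ^ 'd::finite"
  shows
  "(\<forall>(P :: 'o measure) (\<xi> :: 'o \<Rightarrow> 'd site \<Rightarrow> real) (V :: real \<Rightarrow> real) (A :: real) (B :: real) (C2 :: real).
      CARD('d) \<ge> 3
    \<and> C2_fun V \<and> (\<forall>s. V (- s) = V s) \<and> A > 0 \<and> C2 > 0
    \<and> (\<forall>s. V s \<ge> A * s\<^sup>2 - B) \<and> (\<forall>s. deriv (deriv V) s \<le> C2)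
    \<and> prob_space P
    \<and> prob_space.indep_vars P (\<lambda>_. borel) (\<lambda>x \<omega>. \<xi> \<omega> x) UNIV
    \<and> (\<forall>x. distr P borel (\<lambda>\<omega>. \<xi> \<omega> x) = distr P borel (\<lambda>\<omega>. \<xi> \<omega> 0))
    \<and> integrable P (\<lambda>\<omega>. (\<xi> \<omega> 0)\<^sup>2)
    \<and> (\<integral>\<omega>. (\<xi> \<omega> 0)\<^sup>2 \<partial>P) \<noteq> 0
    \<and> (\<integral>\<omega>. \<xi> \<omega> 0 \<partial>P) = 0
    \<longrightarrow> (\<exists>mu. shift_cov_rggm_tilt P \<xi> HS shift_site (hamA V) u mu))
 \<and> (\<forall>(P :: 'p measure) (W :: 'p \<Rightarrow> 'd site \<Rightarrow> 'd \<Rightarrow> real \<Rightarrow> real) (Bb :: 'p \<Rightarrow> 'd site \<Rightarrow> 'd \<Rightarrow> real)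
       (A :: real) (C2 :: real).
      prob_space P
    \<and> (\<forall>x i. (\<lambda>(\<omega>, s). W \<omega> x i s) \<in> borel_measurable (P \<Otimes>\<^sub>M borel))
    \<and> prob_space.indep_vars P (\<lambda>_. PiM UNIV (\<lambda>_::real. borel)) (\<lambda>(x, i) \<omega>. W \<omega> x i) UNIV
    \<and> (\<forall>x i y j. distr P (PiM UNIV (\<lambda>_::real. borel)) (\<lambda>\<omega>. W \<omega> x i)
                = distr P (PiM UNIV (\<lambda>_::real. borel)) (\<lambda>\<omega>. W \<omega> y j))
    \<and> (\<forall>\<omega> x i. C2_fun (W \<omega> x i) \<and> (\<forall>s. W \<omega> x i (- s) = W \<omega> x i s))
    \<and> prob_space.indep_vars P (\<lambda>_. borel) (\<lambda>(x, i) \<omega>. Bb \<omega> x i) UNIV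
    \<and> (\<forall>x i y j. distr P borel (\<lambda>\<omega>. Bb \<omega> x i) = distr P borel (\<lambda>\<omega>. Bb \<omega> y j))
    \<and> (\<forall>x i. integrable P (\<lambda>\<omega>. Bb \<omega> x i))
    \<and> A > 0 \<and> C2 > 0
    \<and> (AE \<omega> in P. \<forall>x i s. A * s\<^sup>2 - Bb \<omega> x i \<le> W \<omega> x i s \<and> W \<omega> x i s \<le> C2 * s\<^sup>2)
    \<longrightarrow> (\<exists>mu. shift_cov_rggm_tilt P W
               (PiM UNIV (\<lambda>_::'d site. PiM UNIV (\<lambda>_::'d. PiM UNIV (\<lambda>_::real. borel))))
               shift_site hamB u mu))"
proof (intro conjI allI impI; elim conjE)
  fix P :: "'o measure" and \<xi> :: "'o \<Rightarrow> 'd site \<Rightarrow> real" and V :: "real \<Rightarrow> real" and A B C2 :: real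
  assume a: "3 \<le> CARD('d)" "C2_fun V" "\<forall>s. V (- s) = V s" "0 < A" "0 < C2" "\<forall>s. A * s\<^sup>2 - B \<le> V s"
    "\<forall>s. deriv (deriv V) s \<le> C2" "prob_space P" "prob_space.indep_vars P (\<lambda>_. borel) (\<lambda>x \<omega>. \<xi> \<omega> x) UNIV"
    "\<forall>x. distr P borel (\<lambda>\<omega>. \<xi> \<omega> x) = distr P borel (\<lambda>\<omega>. \<xi> \<omega> 0)" "integrable P (\<lambda>\<omega>. (\<xi> \<omega> 0)\<^sup>2)"
    "(\<integral>\<omega>. \<xi> \<omega> 0 \<partial>P) = 0"
  show "\<exists>mu. shift_cov_rggm_tilt P \<xi> HS shift_site (hamA V) u mu"
    by (rule model_A[of V A C2 B]) (use a in auto)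
next
  fix P :: "'p measure" and W :: "'p \<Rightarrow> 'd site \<Rightarrow> 'd \<Rightarrow> real \<Rightarrow> real" and Bb :: "'p \<Rightarrow> 'd site \<Rightarrow> 'd \<Rightarrow> real" and A C2 :: real
  assume a: "prob_space P" "prob_space.indep_vars P (\<lambda>_. PiM UNIV (\<lambda>_::real. borel)) (\<lambda>(x, i) \<omega>. W \<omega> x i) UNIV"
    "\<forall>x i y j. distr P (PiM UNIV (\<lambda>_::real. borel)) (\<lambda>\<omega>. W \<omega> x i) = distr P (PiM UNIV (\<lambda>_::real. borel)) (\<lambda>\<omega>. W \<omega> y j)"
    "\<forall>\<omega> x i. C2_fun (W \<omega> x i) \<and> (\<forall>s. W \<omega> x i (- s) = W \<omega> x i s)"
    "\<forall>x i y j. distr P borel (\<lambda>\<omega>. Bb \<omega> x i) = distr P borel (\<lambda>\<omega>. Bb \<omega> y j)"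
    "\<forall>x i. integrable P (\<lambda>\<omega>. Bb \<omega> x i)" "0 < A" "0 < C2"
    "AE \<omega> in P. \<forall>x i s. A * s\<^sup>2 - Bb \<omega> x i \<le> W \<omega> x i s \<and> W \<omega> x i s \<le> C2 * s\<^sup>2"
  show "\<exists>mu. shift_cov_rggm_tilt P W (PiM UNIV (\<lambda>_::'d site. PiM UNIV (\<lambda>_::'d. PiM UNIV (\<lambda>_::real. borel)))) shift_site hamB u mu"
    by (rule model_B[of P W Bb A C2]) (use a in blast)+
qed

end
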